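(* Let $X$ be a normal toric variety with torus $T$, associated to a fan $\Sigma$ in $N\otimes_{\mathbb Z}\mathbb R$. Let $\Delta\subseteq\Sigma(1)$ and $D=\sum_{\rho\in\Delta}D_\rho$. The family of filtrations $\left(E,\{E^\rho(j)\}_{\rho\in\Sigma(1),\,j\in\mathbb Z}\right)$ of the logarithmic tangent sheaf $\mathcal T_X(-\log D)$ (so $E=N\otimes_{\mathbb Z}\mathbb C$) is given by $$E^{\rho}(j)=\begin{cases}0 & \text{if } j\le -1\\ N\otimes_{\mathbb Z}\mathbb C & \text{if } j\ge 0\end{cases}\qquad\text{if }\rho\in\Delta,$$ and by $$E^{\rho}(j)=\begin{cases}0 & \text{if } j\le -2\\ \mathrm{Span}(u_\rho) & \text{if } j=-1\\ N\otimes_{\mathbb Z}\mathbb C & \text{if } j\ge 0\end{cases}\qquad\text{if }\rho\notin\Delta,$$ where $u_\rho\in N$ is the minimal generator of the ray $\rho$.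
   Context: $N$ is a lattice of rank $n$, $M=\mathrm{Hom}_{\mathbb Z}(N,\mathbb Z)$, $T=N\otimes_{\mathbb Z}\mathbb C^*$, $\chi^m$ is the character of $m\in M$. $\Sigma(1)$ is the set of rays of $\Sigma$; $D_\rho$ is the torus-invariant prime divisor (closure of the orbit) of $\rho\in\Sigma(1)$; $U_\sigma=\mathrm{Spec}\,\mathbb C[\sigma^\vee\cap M]$ is the affine chart of $\sigma\in\Sigma$; $\sigma(1)$ is the set of rays of $\sigma$. Logarithmic tangent sheaf: for a normal variety $X$ and a reduced Weil divisor $D$, let $X_0\subseteq X$ be the open locus of points near which $X$ is smooth and $D$ is simple normal crossing, with inclusion $j:X_0\to X$. On $X_0$, $T_{X_0}(-\log D|_{X_0})$ is the dual of $\Omega^1_{X_0}(\log D|_{X_0})$; where $D$ is $(z_1\cdots z_k=0)$ in local coordinates it is the locally free subsheaf of the tangent sheaf generated by $z_1\partial_{z_1},\dots,z_k\partial_{z_k},\partial_{z_{k+1}},\dots,\partial_{z_n}$. Put $\mathcal T_X(-\log D)=j_*T_{X_0}(-\log D|_{X_0})$, a reflexive sheaf. When $D$ is torus invariant it carries the natural $T$-equivariant structure induced by the differential of the torus action. Family of filtrations: a finite-dimensional complex vector space $E$ with, for each $\rho\in\Sigma(1)$, an increasing filtration $(E^\rho(j))_{j\in\mathbb Z}$ of $E$ with $E^\rho(j)=0$ for $j\ll0$ and $E^\rho(j)=E$ for some $j$. It defines an equivariant reflexive sheaf $\mathcal E$ by $\Gamma(U_\sigma,\mathcal E)=\bigoplus_{m\in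 M}\bigcap_{\rho\in\sigma(1)}E^\rho(\langle m,u_\rho\rangle)\otimes\chi^m$ for $\sigma\in\Sigma$ of positive dimension, and $\Gamma(U_{\{0\}},\mathcal E)=E\otimes\mathbb C[M]$. This is an equivalence of categories (Klyachko, Perling) between families of filtrations (morphisms: linear maps preserving filtrations) and equivariant reflexive sheaves on $X$. "The family of filtrations of $\mathcal E$" is the one corresponding to $\mathcal E$ up to isomorphism. Convention: $t\in T$ acts on functions by $t\cdot\chi^m=\chi^{-m}(t)\chi^m$, and the degree $m$ part of sections is the part on which $t$ acts by $\chi^{-m}(t)$. *)

theory Defs
  imports "HOL-Analysis.Analysis" "HOL-Library.Poly_Mapping"
begin

section \<open>Lattices, cones and fans\<close>

text \<open>A basis of the lattice \<open>N\<close> is fixed, so that \<open>N\<close> is \<open>int^'n\<close> with \<open>n = CARD('n)\<close>, and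
  \<open>M = Hom(N, \<int>)\<close> is \<open>int^'n\<close> as well, paired with \<open>N\<close> by the dot product.
  Then \<open>N \<otimes> \<real>\<close> is \<open>real^'n\<close>, \<open>N \<otimes> \<complex>\<close> is \<open>complex^'n\<close>, and \<open>T = N \<otimes> \<complex>\<^sup>*\<close> is the set of all
  vectors of \<open>complex^'n\<close> with nonzero coordinates.\<close>

definition pairing :: "int^'n \<Rightarrow> int^'n \<Rightarrow> int" where
  "pairing m u = (\<Sum>i\<in>UNIV. m $ i * u $ i)"

definition real_vec :: "int^'n \<Rightarrow> real^'n" where
  "real_vec u = (\<chi> i. of_int (u $ i))"

definition complex_vec :: "int^'n \<Rightarrow> complex^'n" where
  "complex_vec u = (\<chi> i. of_int (u $ i))"

definition rational_polyhedral_cone :: "(real^'n) set \<Rightarrow> bool" where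
  "rational_polyhedral_cone \<sigma> \<longleftrightarrow> (\<exists>S. finite S \<and> \<sigma> = convex_cone hull (real_vec ` S))"

definition strongly_convex :: "(real^'n) set \<Rightarrow> bool" where
  "strongly_convex \<sigma> \<longleftrightarrow> (\<forall>v\<in>\<sigma>. - v \<in> \<sigma> \<longrightarrow> v = 0)"

text \<open>The library counts the empty set as a face of every convex set; it is not a face of a cone.\<close>

definition fan :: "(real^'n) set set \<Rightarrow> bool" where
  "fan \<Sigma> \<longleftrightarrow>
     finite \<Sigma> \<and> \<Sigma> \<noteq> {} \<and>
     (\<forall>\<sigma>\<in>\<Sigma>. rational_polyhedral_cone \<sigma> \<and> strongly_convex \<sigma>) \<and>
     (\<forall>\<sigma>\<in>\<Sigma>. \<forall>\<tau>. \<tau> face_of \<sigma> \<and> \<tau> \<noteq> {} \<longrightarrow> \<tau> \<in> \<Sigma>) \<and>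
     (\<forall>\<sigma>\<in>\<Sigma>. \<forall>\<tau>\<in>\<Sigma>. (\<sigma> \<inter> \<tau>) face_of \<sigma> \<and> (\<sigma> \<inter> \<tau>) face_of \<tau>)"

definition rays :: "(real^'n) set set \<Rightarrow> (real^'n) set set" where
  "rays \<Sigma> = {\<rho>\<in>\<Sigma>. dim \<rho> = 1}"

definition rays_of_cone :: "(real^'n) set set \<Rightarrow> (real^'n) set \<Rightarrow> (real^'n) set set" where
  "rays_of_cone \<Sigma> \<sigma> = {\<rho>\<in>rays \<Sigma>. \<rho> face_of \<sigma>}"

text \<open>The minimal generator of a ray \<open>\<rho>\<close> is the generator of the monoid \<open>\<rho> \<inter> N\<close>.\<close>

definition ray_generator :: "(real^'n) set \<Rightarrow> int^'n" where
  "ray_generator \<rho> = (THE u. {v. real_vec v \<in> \<rho>} = range (\<lambda>k::nat. int k *s u))"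

definition dual_monoid :: "(real^'n) set \<Rightarrow> (int^'n) set" where
  "dual_monoid \<sigma> = {m. \<forall>v\<in>\<sigma>. real_vec m \<bullet> v \<ge> 0}"

definition perp_lattice :: "(real^'n) set \<Rightarrow> (int^'n) set" where
  "perp_lattice \<sigma> = {m. \<forall>v\<in>\<sigma>. real_vec m \<bullet> v = 0}"


section \<open>The toric variety of a fan\<close>

text \<open>The toric variety \<open>X\<close> is given by its closed points, its Zariski topology and its sheaf of
  regular functions.  A closed point of \<open>U\<^sub>\<sigma> = Spec \<complex>[\<sigma>\<^sup>\<or> \<inter> M]\<close> is a monoid homomorphism
  \<open>\<gamma> : \<sigma>\<^sup>\<or> \<inter> M \<rightarrow> (\<complex>, \<cdot>)\<close>, and \<open>\<chi>\<^sup>m\<close> has the value \<open>\<gamma> m\<close> there.  The chart of a face \<open>\<tau>\<close> of \<open>\<sigma>\<close>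
  is glued to that of \<open>\<sigma>\<close> by restricting \<open>\<gamma>\<close> from \<open>\<tau>\<^sup>\<or> \<inter> M\<close> to \<open>\<sigma>\<^sup>\<or> \<inter> M\<close>.  Among the charts
  containing a given point there is a smallest one, \<open>U\<^sub>\<tau>\<close>, where \<open>\<tau>\<close> is the cone whose orbit
  contains the point; the homomorphism \<open>\<gamma>\<close> on \<open>\<tau>\<^sup>\<or> \<inter> M\<close> is then nonzero exactly on
  \<open>\<tau>\<^sup>\<bottom> \<inter> M\<close>.  The pair \<open>(\<tau>, \<gamma>)\<close>, with \<open>\<gamma>\<close> extended by \<open>0\<close> to \<open>M\<close>, is used as the normal form of
  the point, so that no quotient by the gluing is needed: in any chart \<open>U\<^sub>\<sigma>\<close> that contains it
  (that is, with \<open>\<tau>\<close> a face of \<open>\<sigma>\<close>) the point is the restriction of \<open>\<gamma>\<close> to \<open>\<sigma>\<^sup>\<or> \<inter> M\<close>.\<close>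

type_synonym 'n point = "(real^'n) set \<times> (int^'n \<Rightarrow> complex)"

definition toric_variety :: "(real^'n) set set \<Rightarrow> 'n point set" where
  "toric_variety \<Sigma> = {(\<tau>, \<gamma>). \<tau> \<in> \<Sigma> \<and> \<gamma> 0 = 1 \<and>
     (\<forall>m\<in>dual_monoid \<tau>. \<forall>m'\<in>dual_monoid \<tau>. \<gamma> (m + m') = \<gamma> m * \<gamma> m') \<and>
     {m. \<gamma> m \<noteq> 0} = perp_lattice \<tau>}"

definition orbit :: "(real^'n) set set \<Rightarrow> (real^'n) set \<Rightarrow> 'n point set" where
  "orbit \<Sigma> \<tau> = {p \<in> toric_variety \<Sigma>. fst p = \<tau>}"

definition chart :: "(real^'n) set set \<Rightarrow> (real^'n) set \<Rightarrow> 'n point set" where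
  "chart \<Sigma> \<sigma> = {p \<in> toric_variety \<Sigma>. fst p face_of \<sigma>}"

text \<open>The points of the torus, as an open subset of \<open>X\<close>, are those of \<open>orbit \<Sigma> {0} = chart \<Sigma> {0}\<close>.\<close>

abbreviation open_torus :: "(real^'n) set set \<Rightarrow> 'n point set" where
  "open_torus \<Sigma> \<equiv> orbit \<Sigma> {0}"

text \<open>Elements of \<open>\<complex>[M]\<close> and of \<open>E \<otimes> \<complex>[M]\<close>, for \<open>E = complex^'e\<close>, are finitely supported families
  of coefficients indexed by \<open>M\<close>.\<close>

definition coordinate_ring :: "(real^'n) set \<Rightarrow> (int^'n \<Rightarrow>\<^sub>0 complex) set" where
  "coordinate_ring \<sigma> = {f. Poly_Mapping.keys f \<subseteq> dual_monoid \<sigma>}"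

definition eval_at :: "(int^'n \<Rightarrow>\<^sub>0 complex) \<Rightarrow> 'n point \<Rightarrow> complex" where
  "eval_at f p = (\<Sum>m\<in>Poly_Mapping.keys f. Poly_Mapping.lookup f m * snd p m)"

definition eval_vec_at :: "(int^'n \<Rightarrow>\<^sub>0 complex^'e) \<Rightarrow> 'n point \<Rightarrow> complex^'e" where
  "eval_vec_at s p = (\<Sum>m\<in>Poly_Mapping.keys s. snd p m *s Poly_Mapping.lookup s m)"

text \<open>The principal open subsets of all charts form a basis of the Zariski topology.\<close>

definition zariski :: "(real^'n) set set \<Rightarrow> 'n point topology" where
  "zariski \<Sigma> = topology_generated_by
     {{p \<in> chart \<Sigma> \<sigma>. eval_at f p \<noteq> 0} | \<sigma> f. \<sigma> \<in> \<Sigma> \<and> f \<in> coordinate_ring \<sigma>}"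

definition opens :: "(real^'n) set set \<Rightarrow> 'n point set \<Rightarrow> 'n point set set" where
  "opens \<Sigma> U = {V. openin (zariski \<Sigma>) V \<and> V \<subseteq> U}"

text \<open>Functions on \<open>U\<close> are represented by functions that are undefined outside \<open>U\<close>.\<close>

definition regular :: "(real^'n) set set \<Rightarrow> 'n point set \<Rightarrow> ('n point \<Rightarrow> complex) set" where
  "regular \<Sigma> U = {f \<in> extensional U. \<forall>p\<in>U. \<exists>\<sigma>\<in>\<Sigma>.
     \<exists>W \<in> opens \<Sigma> (U \<inter> chart \<Sigma> \<sigma>). \<exists>a\<in>coordinate_ring \<sigma>. \<exists>b\<in>coordinate_ring \<sigma>.
       p \<in> W \<and> (\<forall>q\<in>W. eval_at b q \<noteq> 0 \<and> f q = eval_at a q / eval_at b q)}"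

definition toric_divisor :: "(real^'n) set set \<Rightarrow> (real^'n) set \<Rightarrow> 'n point set" where
  "toric_divisor \<Sigma> \<rho> = zariski \<Sigma> closure_of orbit \<Sigma> \<rho>"


section \<open>The torus action\<close>

definition torus :: "(complex^'n) set" where
  "torus = {t. \<forall>i. t $ i \<noteq> 0}"

definition torus_inv :: "complex^'n \<Rightarrow> complex^'n" where
  "torus_inv t = (\<chi> i. inverse (t $ i))"

definition character :: "int^'n \<Rightarrow> complex^'n \<Rightarrow> complex" where
  "character m t = (\<Prod>i\<in>UNIV. (t $ i) powi (m $ i))"

definition act :: "complex^'n \<Rightarrow> 'n point \<Rightarrow> 'n point" where
  "act t p = (fst p, \<lambda>m. character m t * snd p m)"

text \<open>The action on functions is \<open>(t \<cdot> f) p = f (t\<^sup>-\<^sup>1 \<cdot> p)\<close>, so that \<open>t \<cdot> \<chi>\<^sup>m = \<chi>\<^sup>-\<^sup>m(t) \<chi>\<^sup>m\<close>; it takes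
  functions on \<open>U\<close> to functions on \<open>t \<cdot> U\<close>.\<close>

definition translate :: "complex^'n \<Rightarrow> 'n point set \<Rightarrow> ('n point \<Rightarrow> 'a) \<Rightarrow> ('n point \<Rightarrow> 'a)" where
  "translate t U f = (\<lambda>p \<in> act t ` U. f (act (torus_inv t) p))"


section \<open>Equivariant sheaves of modules\<close>

text \<open>\<open>restr \<F> U V\<close> is the restriction from \<open>U\<close> to \<open>V \<subseteq> U\<close>, and \<open>shift \<F> t U\<close> is the action of
  \<open>t \<in> T\<close>, from the sections over \<open>U\<close> to the sections over \<open>t \<cdot> U\<close>.\<close>

record ('n, 's) equivariant_sheaf =
  sections :: "'n point set \<Rightarrow> 's set"
  restr :: "'n point set \<Rightarrow> 'n point set \<Rightarrow> 's \<Rightarrow> 's"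
  plus_sec :: "'n point set \<Rightarrow> 's \<Rightarrow> 's \<Rightarrow> 's"
  smult_sec :: "'n point set \<Rightarrow> ('n point \<Rightarrow> complex) \<Rightarrow> 's \<Rightarrow> 's"
  shift :: "complex^'n \<Rightarrow> 'n point set \<Rightarrow> 's \<Rightarrow> 's"

definition equivariant_isomorphism ::
  "(real^'n) set set \<Rightarrow> ('n, 'a) equivariant_sheaf \<Rightarrow> ('n, 'b) equivariant_sheaf
    \<Rightarrow> ('n point set \<Rightarrow> 'a \<Rightarrow> 'b) \<Rightarrow> bool" where
  "equivariant_isomorphism \<Sigma> \<E> \<F> \<phi> \<longleftrightarrow>
     (\<forall>U. openin (zariski \<Sigma>) U \<longrightarrow>
        bij_betw (\<phi> U) (sections \<E> U) (sections \<F> U) \<and>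
        (\<forall>s\<in>sections \<E> U. \<forall>s'\<in>sections \<E> U.
           \<phi> U (plus_sec \<E> U s s') = plus_sec \<F> U (\<phi> U s) (\<phi> U s')) \<and>
        (\<forall>f\<in>regular \<Sigma> U. \<forall>s\<in>sections \<E> U.
           \<phi> U (smult_sec \<E> U f s) = smult_sec \<F> U f (\<phi> U s)) \<and>
        (\<forall>V\<in>opens \<Sigma> U. \<forall>s\<in>sections \<E> U.
           \<phi> V (restr \<E> U V s) = restr \<F> U V (\<phi> U s)) \<and>
        (\<forall>t\<in>torus. \<forall>s\<in>sections \<E> U.
           \<phi> (act t ` U) (shift \<E> t U s) = shift \<F> t U (\<phi> U s)))"


section \<open>Families of filtrations\<close>

definition family_of_filtrations ::
  "(real^'n) set set \<Rightarrow> ((real^'n) set \<Rightarrow> int \<Rightarrow> (complex^'e) set) \<Rightarrow> bool" where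
  "family_of_filtrations \<Sigma> F \<longleftrightarrow> (\<forall>\<rho>\<in>rays \<Sigma>.
     (\<forall>j. vec.subspace (F \<rho> j)) \<and>
     (\<forall>i j. i \<le> j \<longrightarrow> F \<rho> i \<subseteq> F \<rho> j) \<and>
     (\<exists>i. \<forall>j\<le>i. F \<rho> j = {0}) \<and>
     (\<exists>j. F \<rho> j = UNIV))"

text \<open>The module \<open>\<Oplus>\<^sub>m \<Inter>\<^sub>\<rho> E\<^sup>\<rho>(\<langle>m, u\<^sub>\<rho>\<rangle>) \<otimes> \<chi>\<^sup>m\<close>, \<open>\<rho> \<in> \<sigma>(1)\<close>, as a submodule of \<open>E \<otimes> \<complex>[M]\<close>.  For
  \<open>\<sigma> = {0}\<close> the intersection is empty and the module is \<open>E \<otimes> \<complex>[M]\<close>.\<close>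

definition filtration_module ::
  "(real^'n) set set \<Rightarrow> ((real^'n) set \<Rightarrow> int \<Rightarrow> (complex^'e) set) \<Rightarrow> (real^'n) set
    \<Rightarrow> (int^'n \<Rightarrow>\<^sub>0 complex^'e) set" where
  "filtration_module \<Sigma> F \<sigma> =
     {s. \<forall>m. Poly_Mapping.lookup s m \<in> (\<Inter>\<rho>\<in>rays_of_cone \<Sigma> \<sigma>. F \<rho> (pairing m (ray_generator \<rho>)))}"

text \<open>The quasi-coherent sheaf \<open>\<E>\<close> on \<open>X\<close> with \<open>\<Gamma>(U\<^sub>\<sigma>, \<E>) = filtration_module \<Sigma> F \<sigma>\<close>.  These modules
  are torsion free and all become \<open>E \<otimes> \<complex>[M]\<close> on the torus, so a section over \<open>U\<close> is identified
  with its restriction to the torus, an \<open>E\<close>-valued function; the sections over \<open>U\<close> are the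
  functions that near every point of \<open>U\<close>, boundary points included, are a fraction with numerator
  in the module of a chart and a denominator in the coordinate ring of that chart which has no
  zero there.\<close>

definition filtration_sections ::
  "(real^'n) set set \<Rightarrow> ((real^'n) set \<Rightarrow> int \<Rightarrow> (complex^'e) set) \<Rightarrow> 'n point set
    \<Rightarrow> ('n point \<Rightarrow> complex^'e) set" where
  "filtration_sections \<Sigma> F U = {s \<in> extensional (U \<inter> open_torus \<Sigma>). \<forall>p\<in>U. \<exists>\<sigma>\<in>\<Sigma>.
     \<exists>W \<in> opens \<Sigma> (U \<inter> chart \<Sigma> \<sigma>). \<exists>e\<in>filtration_module \<Sigma> F \<sigma>. \<exists>b\<in>coordinate_ring \<sigma>.
       p \<in> W \<and> (\<forall>q\<in>W. eval_at b q \<noteq> 0) \<and>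
       (\<forall>q\<in>W \<inter> open_torus \<Sigma>. s q = inverse (eval_at b q) *s eval_vec_at e q)}"

definition filtration_sheaf ::
  "(real^'n) set set \<Rightarrow> ((real^'n) set \<Rightarrow> int \<Rightarrow> (complex^'e) set)
    \<Rightarrow> ('n, 'n point \<Rightarrow> complex^'e) equivariant_sheaf" where
  "filtration_sheaf \<Sigma> F = \<lparr>
     sections = filtration_sections \<Sigma> F,
     restr = (\<lambda>U V s. restrict s (V \<inter> open_torus \<Sigma>)),
     plus_sec = (\<lambda>U s s'. \<lambda>p \<in> U \<inter> open_torus \<Sigma>. s p + s' p),
     smult_sec = (\<lambda>U f s. \<lambda>p \<in> U \<inter> open_torus \<Sigma>. f p *s s p),
     shift = (\<lambda>t U. translate t (U \<inter> open_torus \<Sigma>)) \<rparr>"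

definition is_family_of_filtrations_of ::
  "(real^'n) set set \<Rightarrow> ((real^'n) set \<Rightarrow> int \<Rightarrow> (complex^'e) set)
    \<Rightarrow> ('n, 's) equivariant_sheaf \<Rightarrow> bool" where
  "is_family_of_filtrations_of \<Sigma> F \<E> \<longleftrightarrow>
     family_of_filtrations \<Sigma> F \<and> (\<exists>\<phi>. equivariant_isomorphism \<Sigma> (filtration_sheaf \<Sigma> F) \<E> \<phi>)"


section \<open>The logarithmic tangent sheaf\<close>

text \<open>The tangent sheaf is the sheaf of \<open>\<complex>\<close>-linear derivations of the structure sheaf: a section
  over \<open>U\<close> is a derivation of \<open>\<O>(V)\<close> for each open \<open>V \<subseteq> U\<close>, compatible with restriction.\<close>

type_synonym 'n vector_field = "'n point set \<Rightarrow> ('n point \<Rightarrow> complex) \<Rightarrow> ('n point \<Rightarrow> complex)"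

definition tangent_sections ::
  "(real^'n) set set \<Rightarrow> 'n point set \<Rightarrow> 'n vector_field set" where
  "tangent_sections \<Sigma> U = {\<delta> \<in> (\<Pi>\<^sub>E V \<in> opens \<Sigma> U. regular \<Sigma> V \<rightarrow>\<^sub>E regular \<Sigma> V).
     (\<forall>V\<in>opens \<Sigma> U. \<forall>f\<in>regular \<Sigma> V. \<forall>g\<in>regular \<Sigma> V. \<forall>c. \<forall>p\<in>V.
        \<delta> V (\<lambda>q\<in>V. f q + g q) p = \<delta> V f p + \<delta> V g p \<and>
        \<delta> V (\<lambda>q\<in>V. c * f q) p = c * \<delta> V f p \<and>
        \<delta> V (\<lambda>q\<in>V. f q * g q) p = f p * \<delta> V g p + g p * \<delta> V f p) \<and>
     (\<forall>V\<in>opens \<Sigma> U. \<forall>V'\<in>opens \<Sigma> V. \<forall>f\<in>regular \<Sigma> V.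
        \<delta> V' (restrict f V') = restrict (\<delta> V f) V')}"

text \<open>\<open>z\<close> is a system of local coordinates at \<open>p\<close>, that is, \<open>n = dim X\<close> functions that generate the
  maximal ideal of the local ring at \<open>p\<close>.  Such functions exist iff this local ring is regular,
  that is, iff \<open>X\<close> is smooth at \<open>p\<close>.\<close>

definition local_coordinates ::
  "(real^'n) set set \<Rightarrow> 'n point \<Rightarrow> 'n point set \<Rightarrow> ('n \<Rightarrow> 'n point \<Rightarrow> complex) \<Rightarrow> bool" where
  "local_coordinates \<Sigma> p W z \<longleftrightarrow>
     openin (zariski \<Sigma>) W \<and> p \<in> W \<and> (\<forall>i. z i \<in> regular \<Sigma> W \<and> z i p = 0) \<and>
     (\<forall>V\<in>opens \<Sigma> W. \<forall>g\<in>regular \<Sigma> V. p \<in> V \<and> g p = 0 \<longrightarrow>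
        (\<exists>V'\<in>opens \<Sigma> V. \<exists>h. p \<in> V' \<and> (\<forall>i. h i \<in> regular \<Sigma> V') \<and>
           (\<forall>q\<in>V'. g q = (\<Sum>i\<in>UNIV. h i q * z i q))))"

text \<open>\<open>D\<close> is reduced, so it is enough to say which set is cut out by \<open>\<Prod>\<^sub>i\<^sub>\<in>\<^sub>K z\<^sub>i = 0\<close>.  As the coordinates
  are Zariski local, each component of \<open>D\<close> through \<open>p\<close> is smooth there, and the crossings
  are simple.\<close>

definition snc_coordinates ::
  "(real^'n) set set \<Rightarrow> 'n point set \<Rightarrow> 'n point \<Rightarrow> 'n point set
    \<Rightarrow> ('n \<Rightarrow> 'n point \<Rightarrow> complex) \<Rightarrow> 'n set \<Rightarrow> bool" where
  "snc_coordinates \<Sigma> D p W z K \<longleftrightarrow>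
     local_coordinates \<Sigma> p W z \<and> D \<inter> W = {q\<in>W. (\<Prod>i\<in>K. z i q) = 0}"

definition snc_locus :: "(real^'n) set set \<Rightarrow> 'n point set \<Rightarrow> 'n point set" where
  "snc_locus \<Sigma> D = {p \<in> toric_variety \<Sigma>. \<exists>W z K. snc_coordinates \<Sigma> D p W z K}"

definition coordinate_fields ::
  "(real^'n) set set \<Rightarrow> 'n point set \<Rightarrow> ('n \<Rightarrow> 'n point \<Rightarrow> complex)
    \<Rightarrow> ('n \<Rightarrow> 'n vector_field) \<Rightarrow> bool" where
  "coordinate_fields \<Sigma> W z d \<longleftrightarrow> (\<forall>i. d i \<in> tangent_sections \<Sigma> W \<and>
     (\<forall>j. \<forall>q\<in>W. d i W (z j) q = (if i = j then 1 else 0)))"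

text \<open>The sections over \<open>U \<subseteq> X\<^sub>0\<close> of the subsheaf of the tangent sheaf that is locally generated by
  \<open>z\<^sub>i \<partial>\<^sub>i\<close> for \<open>i \<in> K\<close> and \<open>\<partial>\<^sub>i\<close> for \<open>i \<notin> K\<close>, where \<open>D = (\<Prod>\<^sub>i\<^sub>\<in>\<^sub>K z\<^sub>i = 0)\<close>.\<close>

definition log_tangent_sections ::
  "(real^'n) set set \<Rightarrow> 'n point set \<Rightarrow> 'n point set \<Rightarrow> 'n vector_field set" where
  "log_tangent_sections \<Sigma> D U = {\<delta> \<in> tangent_sections \<Sigma> U. \<forall>p\<in>U.
     \<exists>W\<in>opens \<Sigma> U. \<exists>z K d a. snc_coordinates \<Sigma> D p W z K \<and> coordinate_fields \<Sigma> W z d \<and>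
       (\<forall>i. a i \<in> regular \<Sigma> W) \<and>
       (\<forall>V\<in>opens \<Sigma> W. \<forall>f\<in>regular \<Sigma> V. \<forall>q\<in>V.
          \<delta> V f q = (\<Sum>i\<in>UNIV. a i q * ((if i \<in> K then z i q else 1) * d i V f q)))}"

text \<open>The sheaf \<open>j\<^sub>* T(-log D)\<close>, for the inclusion \<open>j\<close> of the open set \<open>X\<^sub>0 = snc_locus \<Sigma> D\<close>, with
  the equivariant structure \<open>(t \<cdot> \<delta>) f = t \<cdot> \<delta> (t\<^sup>-\<^sup>1 \<cdot> f)\<close> given by the differential of the action.
  It is meant for a torus-invariant \<open>D\<close>, so that \<open>X\<^sub>0\<close> is torus invariant.\<close>

definition log_tangent_sheaf ::
  "(real^'n) set set \<Rightarrow> 'n point set \<Rightarrow> ('n, 'n vector_field) equivariant_sheaf" where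
  "log_tangent_sheaf \<Sigma> D = \<lparr>
     sections = (\<lambda>U. log_tangent_sections \<Sigma> D (U \<inter> snc_locus \<Sigma> D)),
     restr = (\<lambda>U V \<delta>. restrict \<delta> (opens \<Sigma> (V \<inter> snc_locus \<Sigma> D))),
     plus_sec = (\<lambda>U \<delta> \<delta>'. \<lambda>V \<in> opens \<Sigma> (U \<inter> snc_locus \<Sigma> D). \<lambda>f \<in> regular \<Sigma> V. \<lambda>p \<in> V.
       \<delta> V f p + \<delta>' V f p),
     smult_sec = (\<lambda>U g \<delta>. \<lambda>V \<in> opens \<Sigma> (U \<inter> snc_locus \<Sigma> D). \<lambda>f \<in> regular \<Sigma> V. \<lambda>p \<in> V.
       g p * \<delta> V f p),
     shift = (\<lambda>t U \<delta>. \<lambda>V \<in> opens \<Sigma> (act t ` U \<inter> snc_locus \<Sigma> D). \<lambda>f \<in> regular \<Sigma> V.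
       let V' = act (torus_inv t) ` V
       in translate t V' (\<delta> V' (translate (torus_inv t) V f))) \<rparr>"

end

theory Submission
  imports Defs "HOL-Complex_Analysis.Conformal_Mappings"
    "HOL-Computational_Algebra.Fundamental_Theorem_Algebra"
begin

text \<open>An element \<open>v\<close> of \<open>N \<otimes> \<complex>\<close> acts on \<open>\<complex>[M]\<close> by the invariant derivation \<open>\<chi>\<^sup>m \<mapsto> \<langle>m, v\<rangle> \<chi>\<^sup>m\<close>, so that the
  vector fields on the torus are the functions \<open>s\<close> with values in \<open>N \<otimes> \<complex>\<close>.  Near the generic points of
  \<open>D\<^sub>\<rho> = (x = 0)\<close> the field of \<open>s\<close> is regular iff all components of \<open>s\<close> are regular except for a simple
  pole of the component along \<open>u\<^sub>\<rho>\<close>, since \<open>\<partial>\<^sub>x = x\<^sup>-\<^sup>1 u\<^sub>\<rho>\<close>, and it is tangent to \<open>D\<^sub>\<rho>\<close> iff there is no pole.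
  This is the filtration at \<open>\<rho>\<close>.  A cone whose orbit consists of regular points of \<open>X\<close> is generated by part of
  a basis of \<open>N\<close>, and there the monomial coordinates turn sections of the filtration sheaf into logarithmic
  fields.  Conversely, the module of a cone is the intersection of the modules of its rays, so that
  a section known in codimension one extends by the Nullstellensatz.\<close>

text \<open>Sections on both sides are determined by their restriction to the open torus
  \<open>T\<close>, so identities are checked there: \<open>vfield\<close> turns \<open>s\<close>
  into the derivation given by \<open>logder (s q)\<close> on \<open>T\<close>, and
  \<open>log_vector\<close> recovers \<open>s\<close> from the values of a field on the coordinate
  characters. The index -1 in the filtration is a degree: if \<open>g\<close> pairs to 1 with the
  ray generator u, then \<partial>_x for x = \<chi>^g is u \<otimes> \<chi>^(-g), and <-g, u> = -1.
  Two features of the definitions shape the work. The locus X_0 and the logarithmic condition refer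
  to arbitrary local coordinates, so lattice information must be won from their mere existence
  (\<open>local_coordinates_imp_smooth\<close>), and divisibility by the equation of a divisor must
  be derived in unknown coordinates (\<open>log_field_divisible\<close>). Moreover, fields over
  \<open>U\<close> live only on the smooth part of \<open>U\<close>, while a section of the
  filtration sheaf needs a fraction at singular points as well. The Nullstellensatz that supplies
  its denominator rests on the countable dimension of a monoid algebra over the uncountable field
  \<complex>, in place of finite generation of the dual monoid.\<close>

abbreviation "keys \<equiv> Poly_Mapping.keys"
abbreviation "lookup \<equiv> Poly_Mapping.lookup"
abbreviation "single \<equiv> Poly_Mapping.single"

section \<open>Evaluation of monoid algebras\<close>

text \<open>The linear extension of an arbitrary function on exponents. Multiplicativity is not
  built in, because \<psi> will be the homomorphism of a point, a point derivation, or the weight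
  \<open>snd q m * cpair m v\<close> of an invariant vector field.\<close>

definition lev :: "('m \<Rightarrow> complex) \<Rightarrow> ('m \<Rightarrow>\<^sub>0 complex) \<Rightarrow> complex" where
  "lev \<psi> f = (\<Sum>m\<in>keys f. lookup f m * \<psi> m)"

lemma eval_at_lev: "eval_at f p = lev (snd p) f"
  by (simp add: eval_at_def lev_def)

lemma lev_superset: "finite A \<Longrightarrow> keys f \<subseteq> A \<Longrightarrow> lev \<psi> f = (\<Sum>m\<in>A. lookup f m * \<psi> m)"
  unfolding lev_def by (rule sum.mono_neutral_left) (auto simp: in_keys_iff)

lemma lev_zero [simp]: "lev \<psi> 0 = 0"
  by (simp add: lev_def)

lemma lev_add: "lev \<psi> (f + g) = lev \<psi> f + lev \<psi> g"
proof -
  have "keys (f + g) \<subseteq> keys f \<union> keys g" by (rule Poly_Mapping.keys_add)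
  then show ?thesis
    by (simp add: lev_superset[of "keys f \<union> keys g"] lookup_add distrib_right sum.distrib)
qed

lemma lev_single [simp]: "lev \<psi> (single m c) = c * \<psi> m"
  by (simp add: lev_def)

lemma lev_one [simp]: "lev \<psi> (1 :: ('m::zero) \<Rightarrow>\<^sub>0 complex) = \<psi> 0"
  by (simp add: lev_def)

lemma lev_uminus: "lev \<psi> (- f) = - lev \<psi> f"
  using lev_add[of \<psi> f "-f"] by (simp add: eq_neg_iff_add_eq_0 add.commute)

lemma lev_diff: "lev \<psi> (f - g) = lev \<psi> f - lev \<psi> g"
  using lev_add[of \<psi> f "-g"] by (simp add: lev_uminus)

lemma lev_sum: "lev \<psi> (\<Sum>i\<in>A. f i) = (\<Sum>i\<in>A. lev \<psi> (f i))"
  by (induction A rule: infinite_finite_induct) (auto simp: lev_add)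

lemma poly_mapping_expand: "f = (\<Sum>m\<in>keys f. single m (lookup f m))"
proof (rule poly_mapping_eqI)
  fix k
  have "(\<Sum>m\<in>keys f. lookup (single m (lookup f m)) k) = (\<Sum>m\<in>keys f. if m = k then lookup f m else 0)"
    by (intro sum.cong) (auto simp: lookup_single when_def)
  then show "lookup f k = lookup (\<Sum>m\<in>keys f. single m (lookup f m)) k"
    by (auto simp: lookup_sum in_keys_iff)
qed

text \<open>The bound \<open>S\<close> on the support is carried along, so that rules for \<psi>
  valid only on a submonoid \<open>S\<close> remain usable in every step.\<close>

lemma poly_mapping_keys_induct [consumes 1, case_names zero add]:
  fixes f :: "'m \<Rightarrow>\<^sub>0 'c::comm_monoid_add"
  assumes "keys f \<subseteq> S" and "P 0"
    and "\<And>m c g. m \<in> S \<Longrightarrow> keys g \<subseteq> S \<Longrightarrow> P g \<Longrightarrow> P (single m c + g)"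
  shows "P f"
proof -
  have "keys (\<Sum>m\<in>A. single m (lookup f m)) \<subseteq> S \<and> P (\<Sum>m\<in>A. single m (lookup f m))"
    if "finite A" "A \<subseteq> keys f" for A
    using that
  proof (induction A)
    case empty
    then show ?case using assms(2) by simp
  next
    case (insert a A)
    have a: "a \<in> S" using insert assms(1) by auto
    have "keys (single a (lookup f a) + (\<Sum>m\<in>A. single m (lookup f m)))
        \<subseteq> keys (single a (lookup f a)) \<union> keys (\<Sum>m\<in>A. single m (lookup f m))"
      by (rule Poly_Mapping.keys_add)
    also have "\<dots> \<subseteq> S" using insert a by (auto split: if_splits)
    finally show ?case using insert a assms(3)[OF a] by simp
  qed
  from this[of "keys f"] show ?thesis
    using poly_mapping_expand[of f] by simp
qed

lemma lev_single_mult: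
  fixes g :: "'m::cancel_comm_monoid_add \<Rightarrow>\<^sub>0 complex"
  assumes "keys g \<subseteq> S"
  shows "lev \<psi> (single m c * g) = c * lev (\<lambda>k. \<psi> (m + k)) g"
  using assms
  by (induction g rule: poly_mapping_keys_induct)
    (auto simp: distrib_left lev_add mult_single algebra_simps)

lemma lev_cong: "(\<And>m. m \<in> keys f \<Longrightarrow> \<psi> m = \<psi>' m) \<Longrightarrow> lev \<psi> f = lev \<psi>' f"
  by (auto simp: lev_def intro!: sum.cong)

lemma lev_lin: "lev (\<lambda>m. a * \<psi> m + b * \<psi>' m) f = a * lev \<psi> f + b * lev \<psi>' f"
  by (simp add: lev_def sum.distrib sum_distrib_left algebra_simps)

text \<open>By bilinearity the Leibniz rule is a statement about monomials. It is used with
  \<open>S\<close> a dual monoid for tangent functionals at boundary points, and with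
  \<open>S = UNIV\<close> for invariant fields on the torus.\<close>

lemma lev_derivation:
  fixes f g :: "'m::cancel_comm_monoid_add \<Rightarrow>\<^sub>0 complex"
  assumes "keys f \<subseteq> S" "keys g \<subseteq> S"
    and "\<And>m m'. m \<in> S \<Longrightarrow> m' \<in> S \<Longrightarrow> \<psi> (m + m') = \<gamma> m * \<psi> m' + \<psi> m * \<gamma> m'"
  shows "lev \<psi> (f * g) = lev \<gamma> f * lev \<psi> g + lev \<psi> f * lev \<gamma> g"
  using assms(1)
proof (induction f rule: poly_mapping_keys_induct)
  case (add m c f)
  have "lev \<psi> (single m c * g) = c * lev (\<lambda>k. \<psi> (m + k)) g"
    by (rule lev_single_mult[OF order_refl])
  also have "lev (\<lambda>k. \<psi> (m + k)) g = lev (\<lambda>k. \<gamma> m * \<psi> k + \<psi> m * \<gamma> k) g"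
    by (rule lev_cong) (use assms add in auto)
  finally have "lev \<psi> (single m c * g) = c * (\<gamma> m * lev \<psi> g + \<psi> m * lev \<gamma> g)"
    by (simp add: lev_lin)
  then show ?case using add by (simp add: distrib_right lev_add algebra_simps)
qed auto

lemma lev_mult:
  fixes f g :: "'m::cancel_comm_monoid_add \<Rightarrow>\<^sub>0 complex"
  assumes "keys f \<subseteq> S" "keys g \<subseteq> S"
    and "\<And>m m'. m \<in> S \<Longrightarrow> m' \<in> S \<Longrightarrow> \<gamma> (m + m') = \<gamma> m * \<gamma> m'"
  shows "lev \<gamma> (f * g) = lev \<gamma> f * lev \<gamma> g"
  using assms(1)
proof (induction f rule: poly_mapping_keys_induct)
  case (add m c f)
  have "lev \<gamma> (single m c * g) = c * lev (\<lambda>k. \<gamma> (m + k)) g"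
    by (rule lev_single_mult[OF order_refl])
  \<comment> \<open>The zero summand only brings the function into the form of
    \<open>lev_lin\<close>.\<close>
  also have "lev (\<lambda>k. \<gamma> (m + k)) g = lev (\<lambda>k. \<gamma> m * \<gamma> k + 0 * \<gamma> k) g"
    by (rule lev_cong) (use assms add in auto)
  finally have "lev \<gamma> (single m c * g) = c * (\<gamma> m * lev \<gamma> g)"
    by (simp only: lev_lin) simp
  then show ?case using add by (simp add: distrib_right lev_add algebra_simps)
qed auto

subsection \<open>Laurent polynomials on the torus\<close>

lemma character_0 [simp]: "character 0 t = 1"
  by (simp add: character_def)

lemma character_add: "t \<in> torus \<Longrightarrow> character (m + m') t = character m t * character m' t"
  by (simp add: character_def torus_def power_int_add prod.distrib)

lemma character_nonzero: "t \<in> torus \<Longrightarrow> character m t \<noteq> 0"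
  by (simp add: character_def torus_def)

lemma torus_inv_torus: "t \<in> torus \<Longrightarrow> torus_inv t \<in> torus"
  by (simp add: torus_def torus_inv_def)

lemma character_torus_inv: "character m (torus_inv t) = inverse (character m t)"
  by (simp add: character_def torus_inv_def power_int_inverse flip: prod_inversef)

lemma torus_inv_torus_inv [simp]: "torus_inv (torus_inv t) = t"
  by (simp add: torus_inv_def vec_eq_iff)

text \<open>Scaling a single coordinate tells apart characters whose exponents differ there.\<close>

lemma character_scale:
  "character m (\<chi> j. (if j = i then a else 1) * t $ j) = a powi (m $ i) * character m t"
proof -
  have "(\<Prod>j\<in>UNIV. (if j = i then a else 1) powi m $ j) = (\<Prod>j\<in>UNIV. if j = i then a powi m $ j else 1)"
    by (intro prod.cong) auto
  then show ?thesis
    by (simp add: character_def power_int_mult_distrib prod.distrib)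
qed

text \<open>Artin's argument: choose a coordinate \<open>i\<close> where \<open>a\<close> and
  \<open>b\<close> differ, scale it by 2 and subtract 2^(a_i) times the original relation. The term
  of \<open>a\<close> disappears and the coefficient of \<open>b\<close> is multiplied by a nonzero
  number. Once all others vanish, the coefficient of \<open>a\<close> is read off at the unit
  element.\<close>

lemma characters_independent:
  fixes c :: "int^'n \<Rightarrow> complex"
  assumes "finite A" and "\<And>t. t \<in> torus \<Longrightarrow> (\<Sum>m\<in>A. c m * character m t) = 0"
  shows "\<forall>m\<in>A. c m = 0"
  using assms
proof (induction A arbitrary: c)
  case (insert a A)
  have "c b = 0" if "b \<in> A" for b
  proof -
    from insert that have "a \<noteq> b" by auto
    then obtain i where i: "a $ i \<noteq> b $ i" by (auto simp: vec_eq_iff)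
    have "(\<Sum>m\<in>A. (c m * (2 powi (m$i) - 2 powi (a$i))) * character m t) = 0"
      if t: "t \<in> torus" for t
    proof -
      define t' where "t' = (\<chi> j. (if j = i then 2 else 1) * t $ j)"
      have t': "t' \<in> torus" using t by (auto simp: t'_def torus_def)
      let ?X = "c a * (2 powi (a$i) * character a t)"
      have 1: "?X + (\<Sum>m\<in>A. c m * (2 powi (m$i) * character m t)) = 0"
        using insert.prems[OF t'] insert.hyps unfolding t'_def character_scale by simp
      have "?X + 2 powi (a$i) * (\<Sum>m\<in>A. c m * character m t)
          = 2 powi (a$i) * (c a * character a t + (\<Sum>m\<in>A. c m * character m t))"
        by (simp add: algebra_simps)
      also have "c a * character a t + (\<Sum>m\<in>A. c m * character m t) = 0"
        using insert.prems[OF t] insert.hyps by simp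
      finally have 2: "?X + 2 powi (a$i) * (\<Sum>m\<in>A. c m * character m t) = 0"
        by simp
      have eq: "(\<Sum>m\<in>A. c m * (2 powi (m$i) * character m t))
          = 2 powi (a$i) * (\<Sum>m\<in>A. c m * character m t)"
        by (rule add_left_imp_eq[of ?X, OF trans[OF 1 2[symmetric]]])
      have "(\<Sum>m\<in>A. (c m * (2 powi (m$i) - 2 powi (a$i))) * character m t)
          = (\<Sum>m\<in>A. c m * (2 powi (m$i) * character m t) - 2 powi (a$i) * (c m * character m t))"
        by (intro sum.cong refl) (simp add: algebra_simps)
      also have "\<dots> = 0" by (simp add: sum_subtractf eq sum_distrib_left)
      finally show ?thesis .
    qed
    from insert.IH[OF this] that have "c b * (2 powi (b$i) - 2 powi (a$i)) = 0" by blast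
    moreover have "(2::complex) powi (b$i) \<noteq> 2 powi (a$i)"
    proof
      assume "(2::complex) powi (b$i) = 2 powi (a$i)"
      then have "(of_real (2 powi (b$i)) :: complex) = of_real (2 powi (a$i))" by simp
      then have "(2::real) powi (b$i) = 2 powi (a$i)" by (simp only: of_real_eq_iff)
      with i show False
        using power_int_strict_increasing[of "a$i" "b$i" "2::real"]
          power_int_strict_increasing[of "b$i" "a$i" "2::real"] by linarith
    qed
    ultimately show ?thesis by simp
  qed
  moreover from this insert.prems[of "\<chi> i. 1"] insert.hyps have "c a = 0"
    by (simp add: torus_def character_nonzero[unfolded torus_def])
  ultimately show ?case by auto
qed auto

lemma character_exp:
  "character m (\<chi> i. exp (a i)) = exp (\<Sum>i\<in>UNIV. of_int (m $ i) * a i)"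
  by (simp add: character_def exp_sum exp_power_int)

text \<open>The torus is irreducible: two points are joined by a curve \<open>z \<mapsto> exp (\<alpha> + z \<beta>)\<close>, along which
  a Laurent polynomial is an entire function, with countably many zeros unless it vanishes.\<close>

lemma torus_irreducible:
  fixes c d :: "int^'n \<Rightarrow> complex"
  assumes fin: "finite A" "finite B"
    and prod0: "\<And>t. t \<in> torus \<Longrightarrow>
      (\<Sum>m\<in>A. c m * character m t) * (\<Sum>m\<in>B. d m * character m t) = 0"
  shows "(\<forall>t\<in>torus. (\<Sum>m\<in>A. c m * character m t) = 0) \<or> (\<forall>t\<in>torus. (\<Sum>m\<in>B. d m * character m t) = 0)"
proof (rule ccontr)
  assume "\<not> ?thesis"
  then obtain t1 t2 where t: "t1 \<in> torus" "t2 \<in> torus"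
    "(\<Sum>m\<in>A. c m * character m t1) \<noteq> 0" "(\<Sum>m\<in>B. d m * character m t2) \<noteq> 0" by blast
  define \<alpha> \<beta> where "\<alpha> i = Ln (t1 $ i)" and "\<beta> i = Ln (t2 $ i) - Ln (t1 $ i)" for i
  define T where "T z = (\<chi> i. exp (\<alpha> i + z * \<beta> i))" for z
  have T: "T z \<in> torus" "T 0 = t1" "T 1 = t2" for z
    using t by (auto simp: T_def torus_def \<alpha>_def \<beta>_def vec_eq_iff)
  have hol: "(\<lambda>z. \<Sum>m\<in>A. c m * character m (T z)) holomorphic_on UNIV" for A :: "(int^'n) set" and c
    unfolding T_def character_exp by (intro holomorphic_intros)
  have cnt: "countable {z. (\<Sum>m\<in>A. c m * character m (T z)) = 0}"
    if "(\<Sum>m\<in>A. c m * character m (T w)) \<noteq> 0" for A :: "(int^'n) set" and c w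
  \<comment> \<open>Countability of zeros needs a nonconstant entire function; a constant one is
    nonzero at \<open>w\<close> and has no zeros at all.\<close>
  proof (cases "(\<lambda>z. \<Sum>m\<in>A. c m * character m (T z)) constant_on UNIV")
    case True
    then have "{z. (\<Sum>m\<in>A. c m * character m (T z)) = 0} = {}"
      using that by (auto simp: constant_on_def)
    then show ?thesis by simp
  next
    case False
    have "countable ({z \<in> UNIV. (\<Sum>m\<in>A. c m * character m (T z)) = 0})"
      using holomorphic_countable_zeros[OF hol open_UNIV connected_UNIV fsigma_UNIV False] by auto
    then show ?thesis by simp
  qed
  have "countable ({z. (\<Sum>m\<in>A. c m * character m (T z)) = 0} \<union> {z. (\<Sum>m\<in>B. d m * character m (T z)) = 0})"
    by (intro countable_Un cnt[of c 0 A] cnt[of d 1 B]) (simp_all add: T(2,3) t(3,4))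
  moreover have "{z. (\<Sum>m\<in>A. c m * character m (T z)) = 0} \<union> {z. (\<Sum>m\<in>B. d m * character m (T z)) = 0} = UNIV"
    using prod0[OF T(1)] by auto
  ultimately show False using uncountable_UNIV_complex by metis
qed

subsection \<open>The Nullstellensatz for semigroup algebras\<close>

text \<open>Gaussian elimination of the coordinate \<open>f\<close> with pivot \<open>a0\<close>:
  more vectors \<open>h a\<close> than coordinates in \<open>F\<close> are linearly
  dependent.\<close>

lemma linear_dependence:
  fixes h :: "'a \<Rightarrow> 'b \<Rightarrow> complex"
  assumes "finite F" "finite A" "card F < card A"
  shows "\<exists>c. (\<exists>a\<in>A. c a \<noteq> 0) \<and> (\<forall>f\<in>F. (\<Sum>a\<in>A. c a * h a f) = 0)"
  using assms
proof (induction F arbitrary: A h)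
  case empty
  then have "A \<noteq> {}" by auto
  then show ?case by (intro exI[of _ "\<lambda>_. 1"]) auto
next
  case (insert f F)
  show ?case
  proof (cases "\<forall>a\<in>A. h a f = 0")
    case True
    from insert have "card F < card A" by simp
    from insert.IH[OF \<open>finite A\<close> this, of h] True show ?thesis by auto
  next
    case False
    then obtain a0 where a0: "a0 \<in> A" "h a0 f \<noteq> 0" by auto
    define h' where "h' a g = h a g - (h a f / h a0 f) * h a0 g" for a g
    have "card F < card (A - {a0})" using insert a0 by simp
    with insert have "\<exists>c. (\<exists>a\<in>A-{a0}. c a \<noteq> 0) \<and> (\<forall>g\<in>F. (\<Sum>a\<in>A-{a0}. c a * h' a g) = 0)"
      by simp
    then obtain c a1 where
      c: "a1 \<in> A - {a0}" "c a1 \<noteq> 0" "\<And>g. g \<in> F \<Longrightarrow> (\<Sum>a\<in>A-{a0}. c a * h' a g) = 0" by blast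
    \<comment> \<open>The coefficient of the pivot is determined by the relation at
      \<open>f\<close>; in the remaining coordinates it turns a relation between the
      \<open>h'\<close> into one between the \<open>h\<close>.\<close>
    define c0 where "c0 = - (\<Sum>a\<in>A-{a0}. c a * h a f) / h a0 f"
    define c' where "c' = c(a0 := c0)"
    have sum: "(\<Sum>a\<in>A. c' a * h a g) = c0 * h a0 g + (\<Sum>a\<in>A-{a0}. c a * h a g)" for g
      using insert a0 by (subst sum.remove[of A a0]) (auto simp: c'_def intro!: sum.cong)
    have "(\<Sum>a\<in>A. c' a * h a g) = 0" if "g \<in> insert f F" for g
    proof (cases "g = f")
      case True
      then show ?thesis using a0 by (simp add: sum c0_def)
    next
      case False
      with that have g: "g \<in> F" by simp
      have "(\<Sum>a\<in>A-{a0}. c a * h' a g) =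
          (\<Sum>a\<in>A-{a0}. c a * h a g) - (\<Sum>a\<in>A-{a0}. c a * h a f) / h a0 f * h a0 g"
        by (simp add: h'_def sum_subtractf algebra_simps sum_divide_distrib sum_distrib_left)
      then show ?thesis using c(3)[OF g] by (simp add: sum c0_def)
    qed
    moreover have "c' a1 \<noteq> 0" "a1 \<in> A" using c by (auto simp: c'_def)
    ultimately show ?thesis by blast
  qed
qed

text \<open>A subset of one ambient ring rather than a ring of its own, so that the rings of
  different cones are compared by inclusion. The ring of a chart is the case of a dual
  monoid.\<close>

definition semigroup_algebra :: "'m set \<Rightarrow> ('m \<Rightarrow>\<^sub>0 complex) set" where
  "semigroup_algebra S = {f. keys f \<subseteq> S}"

lemma semigroup_algebra_simps [simp]:
  "0 \<in> semigroup_algebra S"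
  "single m c \<in> semigroup_algebra S \<longleftrightarrow> c = 0 \<or> m \<in> S"
  by (auto simp: semigroup_algebra_def)

lemma semigroup_algebra_add:
  "f \<in> semigroup_algebra S \<Longrightarrow> g \<in> semigroup_algebra S \<Longrightarrow> f + g \<in> semigroup_algebra S"
  using Poly_Mapping.keys_add[of f g] by (auto simp: semigroup_algebra_def)

lemma semigroup_algebra_uminus: "f \<in> semigroup_algebra S \<Longrightarrow> - f \<in> semigroup_algebra S"
  by (auto simp: semigroup_algebra_def in_keys_iff)

lemma semigroup_algebra_diff:
  "f \<in> semigroup_algebra S \<Longrightarrow> g \<in> semigroup_algebra S \<Longrightarrow> f - g \<in> semigroup_algebra S"
  using semigroup_algebra_add[of f S "-g"] semigroup_algebra_uminus[of g S] by simp

lemma semigroup_algebra_sum: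
  "(\<And>i. i \<in> A \<Longrightarrow> f i \<in> semigroup_algebra S) \<Longrightarrow> (\<Sum>i\<in>A. f i) \<in> semigroup_algebra S"
  by (induction A rule: infinite_finite_induct) (auto intro: semigroup_algebra_add)

locale submonoid =
  fixes S :: "'m::cancel_comm_monoid_add set"
  assumes zero_mem: "0 \<in> S" and add_mem: "m \<in> S \<Longrightarrow> m' \<in> S \<Longrightarrow> m + m' \<in> S"
begin

lemma algebra_mult:
  "f \<in> semigroup_algebra S \<Longrightarrow> g \<in> semigroup_algebra S \<Longrightarrow> f * g \<in> semigroup_algebra S"
  using keys_mult[of f g] add_mem by (fastforce simp: semigroup_algebra_def)

lemma algebra_one: "1 \<in> semigroup_algebra S"
  using zero_mem by (simp add: semigroup_algebra_def)

lemma algebra_power: "f \<in> semigroup_algebra S \<Longrightarrow> f ^ k \<in> semigroup_algebra S"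
  by (induction k) (auto intro: algebra_mult algebra_one)

lemma algebra_prod:
  "(\<And>i. i \<in> A \<Longrightarrow> f i \<in> semigroup_algebra S) \<Longrightarrow> (\<Prod>i\<in>A. f i) \<in> semigroup_algebra S"
  by (induction A rule: infinite_finite_induct) (auto intro: algebra_mult algebra_one)

definition ideal :: "('m \<Rightarrow>\<^sub>0 complex) set \<Rightarrow> bool" where
  "ideal J \<longleftrightarrow> J \<subseteq> semigroup_algebra S \<and> 0 \<in> J \<and> (\<forall>f\<in>J. \<forall>g\<in>J. f + g \<in> J) \<and>
     (\<forall>f\<in>J. \<forall>g\<in>semigroup_algebra S. g * f \<in> J)"

lemma idealD:
  assumes "ideal J"
  shows "J \<subseteq> semigroup_algebra S" "0 \<in> J" "f \<in> J \<Longrightarrow> g \<in> J \<Longrightarrow> f + g \<in> J"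
    "f \<in> J \<Longrightarrow> g \<in> semigroup_algebra S \<Longrightarrow> g * f \<in> J" "f \<in> J \<Longrightarrow> g \<in> J \<Longrightarrow> f - g \<in> J"
    "(\<And>i. i \<in> A \<Longrightarrow> h i \<in> J) \<Longrightarrow> sum h A \<in> J"
proof -
  show *: "J \<subseteq> semigroup_algebra S" "0 \<in> J" "f \<in> J \<Longrightarrow> g \<in> J \<Longrightarrow> f + g \<in> J"
    "f \<in> J \<Longrightarrow> g \<in> semigroup_algebra S \<Longrightarrow> g * f \<in> J" for f g
    using assms by (auto simp: ideal_def)
  show "f - g \<in> J" if "f \<in> J" "g \<in> J"
    using *(3)[OF that(1) *(4)[OF that(2) semigroup_algebra_uminus[OF algebra_one]]] by simp
  show "(\<And>i. i \<in> A \<Longrightarrow> h i \<in> J) \<Longrightarrow> sum h A \<in> J"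
    by (induction A rule: infinite_finite_induct) (auto intro: * )
qed

text \<open>An ideal maximal among those that contain no power of \<open>b\<close> is prime.  It has a complex root
  for every element \<open>x\<close>: otherwise the elements \<open>x - a\<close> would have inverses up to powers of \<open>b\<close> for
  uncountably many \<open>a\<close>, and a linear relation between these yields a polynomial equation for \<open>x\<close>.\<close>

lemma nullstellensatz:
  fixes I :: "('m \<Rightarrow>\<^sub>0 complex) set"
  assumes countable: "countable S"
    and I: "ideal I" and b: "b \<in> semigroup_algebra S" and pow: "\<And>k. b ^ k \<notin> I"
  shows "\<exists>\<gamma>. \<gamma> 0 = 1 \<and> (\<forall>m\<in>S. \<forall>m'\<in>S. \<gamma> (m + m') = \<gamma> m * \<gamma> m') \<and>
    (\<forall>f\<in>I. lev \<gamma> f = 0) \<and> lev \<gamma> b \<noteq> 0"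
proof -
  let ?R = "semigroup_algebra S"
  let ?A = "{J. ideal J \<and> I \<subseteq> J \<and> (\<forall>k. b ^ k \<notin> J)}"
  have "\<exists>M\<in>?A. \<forall>X\<in>?A. M \<subseteq> X \<longrightarrow> X = M"
  proof (rule subset_Zorn_nonempty)
    show "?A \<noteq> {}" using I pow by auto
    fix \<C> assume ne: "\<C> \<noteq> {}" and ch: "subset.chain ?A \<C>"
    then have sub: "\<C> \<subseteq> ?A" by (auto simp: subset.chain_def)
    have add: "f + g \<in> \<Union>\<C>" if "f \<in> \<Union>\<C>" "g \<in> \<Union>\<C>" for f g
    proof -
      from that obtain X Y where XY: "X \<in> \<C>" "Y \<in> \<C>" "f \<in> X" "g \<in> Y" by auto
      then have "X \<subseteq> Y \<or> Y \<subseteq> X" using ch by (auto simp: subset.chain_def)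
      moreover have "ideal X" "ideal Y" using XY sub by auto
      ultimately show ?thesis using XY idealD(3)[of X f g] idealD(3)[of Y f g] by blast
    qed
    have id: "ideal X" if "X \<in> \<C>" for X using that sub by auto
    have "ideal (\<Union>\<C>)"
      unfolding ideal_def
    proof (intro conjI ballI)
      show "\<Union>\<C> \<subseteq> ?R" using idealD(1)[OF id] by blast
      show "0 \<in> \<Union>\<C>" using idealD(2)[OF id] ne by blast
      show "g * f \<in> \<Union>\<C>" if "f \<in> \<Union>\<C>" "g \<in> ?R" for f g
        using idealD(4)[OF id] that by blast
    qed (rule add)
    then show "\<Union>\<C> \<in> ?A" using sub ne by auto
  qed
  then obtain J where J': "J \<in> ?A" and max': "\<forall>X\<in>?A. J \<subseteq> X \<longrightarrow> X = J" by blast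
  from J' have J: "ideal J" "I \<subseteq> J" "\<And>k. b ^ k \<notin> J" by auto
  have max: "X = J" if "ideal X" "J \<subseteq> X" "\<And>k. b ^ k \<notin> X" for X
    using max' that J(2) by auto
  note JD = idealD[OF J(1)]
  \<comment> \<open>By maximality J + R f contains a power of \<open>b\<close>, so modulo
    \<open>J\<close> every \<open>f\<close> outside \<open>J\<close> divides a power of
    \<open>b\<close>.\<close>
  have inv: "\<exists>k h. h \<in> ?R \<and> b ^ k - h * f \<in> J" if f: "f \<in> ?R" "f \<notin> J" for f
  proof -
    define X where "X = {j + h * f | j h. j \<in> J \<and> h \<in> ?R}"
    have X: "j + h * f \<in> X" if "j \<in> J" "h \<in> ?R" for j h using that by (auto simp: X_def)
    have "ideal X"
      unfolding ideal_def
    proof (intro conjI ballI)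
      show "X \<subseteq> ?R" using JD(1) f by (auto simp: X_def intro: semigroup_algebra_add algebra_mult)
      show "0 \<in> X" using X[OF JD(2), of 0] by simp
      fix x assume "x \<in> X"
      then obtain j h where x: "x = j + h * f" "j \<in> J" "h \<in> ?R" by (auto simp: X_def)
      show "x + y \<in> X" if "y \<in> X" for y
      proof -
        from that obtain j' h' where y: "y = j' + h' * f" "j' \<in> J" "h' \<in> ?R" by (auto simp: X_def)
        have "x + y = (j + j') + (h + h') * f" by (simp add: x y algebra_simps)
        then show ?thesis using X[OF JD(3)[OF x(2) y(2)] semigroup_algebra_add[OF x(3) y(3)]] by simp
      qed
      show "g * x \<in> X" if "g \<in> ?R" for g
      proof -
        have "g * x = g * j + (g * h) * f" by (simp add: x algebra_simps)
        then show ?thesis using X[OF JD(4)[OF x(2) that] algebra_mult[OF that x(3)]] by simp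
      qed
    qed
    moreover have "J \<subseteq> X" using X[of _ 0] by auto
    moreover have "f \<in> X" using X[OF JD(2) algebra_one] by simp
    ultimately have "\<exists>k. b ^ k \<in> X" using max f by blast
    then obtain k j h where "b ^ k = j + h * f" "j \<in> J" "h \<in> ?R" by (auto simp: X_def)
    then show ?thesis by (metis add_diff_cancel_right')
  qed
  have prime: "f \<in> J \<or> g \<in> J" if fg: "f \<in> ?R" "g \<in> ?R" "f * g \<in> J" for f g
  proof (rule ccontr)
    assume "\<not> ?thesis"
    then obtain k h l h' where *: "h \<in> ?R" "b ^ k - h * f \<in> J" "h' \<in> ?R" "b ^ l - h' * g \<in> J"
      using inv[of f] inv[of g] fg by blast
    \<comment> \<open>Modulo \<open>J\<close> the powers are b^k = h f and b^l = h' g, and their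
      product is a multiple of f g.\<close>
    have "b ^ (k + l) = b ^ l * (b ^ k - h * f) + (h * f) * (b ^ l - h' * g) + (h * h') * (f * g)"
      by (simp add: algebra_simps power_add)
    moreover have "\<dots> \<in> J"
      using * fg JD(3,4) b by (simp add: algebra_mult algebra_power)
    ultimately show False using J(3) by metis
  qed
  define C where "C = (single 0 :: complex \<Rightarrow> ('m \<Rightarrow>\<^sub>0 complex))"
  have C: "C a \<in> ?R" "C (a * a') = C a * C a'" "C (a + a') = C a + C a'" "C 0 = 0" "C 1 = 1" for a a'
    by (auto simp: C_def zero_mem mult_single single_add)
  have Cnot: "C a \<notin> J" if "a \<noteq> 0" for a
  proof
    assume "C a \<in> J"
    then have "C (inverse a) * C a \<in> J" using JD(4) C(1) by blast
    then have "1 \<in> J" using C(2)[of "inverse a" a] C(5) that by simp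
    then show False using J(3)[of 0] by simp
  qed
  have root: "\<exists>a. x - C a \<in> J" if x: "x \<in> ?R" for x
  proof (rule ccontr)
    assume no: "\<nexists>a. x - C a \<in> J"
    have "\<forall>a. \<exists>k h. h \<in> ?R \<and> b ^ k - h * (x - C a) \<in> J"
      using inv no x C(1) semigroup_algebra_diff by blast
    then obtain k h where kh: "\<And>a. h a \<in> ?R" "\<And>a. b ^ k a - h a * (x - C a) \<in> J" by metis
    \<comment> \<open>There are uncountably many \<open>a\<close>, but only countably many pairs of
      an exponent and a finite support. Hence infinitely many \<open>a\<close> share both, and one
      more of them than the common support has elements can be chosen.\<close>
    define cls where "cls a = (k a, keys (h a))" for a
    have "cls ` UNIV \<subseteq> UNIV \<times> {F. finite F \<and> F \<subseteq> S}"
      using kh(1) by (auto simp: cls_def semigroup_algebra_def)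
    moreover have "countable ((UNIV :: nat set) \<times> {F. finite F \<and> F \<subseteq> S})"
      using countable by (simp add: countable_Collect_finite_subset)
    ultimately have "countable (range cls)" using countable_subset by blast
    moreover have "UNIV = (\<Union>c\<in>range cls. {a. cls a = c})" by auto
    ultimately obtain c where "uncountable {a. cls a = c}"
      using uncountable_UNIV_complex countable_UN[of "range cls" "\<lambda>c. {a. cls a = c}"] by force
    then have "infinite {a. cls a = c}" using countable_finite by blast
    then obtain A where A: "A \<subseteq> {a. cls a = c}" "finite A" "card A = Suc (card (snd c))"
      using infinite_arbitrarily_large by blast
    define k0 F where "k0 = fst c" and "F = snd c"
    have A': "k a = k0" "keys (h a) = F" if "a \<in> A" for a
      using that A(1) by (auto simp: cls_def k0_def F_def)
    obtain a1 where "a1 \<in> A" using A by fastforce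
    then have "finite F" using A'(2) finite_keys by metis
    from linear_dependence[OF this A(2), of "\<lambda>a. lookup (h a)"] A(3) obtain d a0 where
      d: "a0 \<in> A" "d a0 \<noteq> 0" "\<And>f. f \<in> F \<Longrightarrow> (\<Sum>a\<in>A. d a * lookup (h a) f) = 0"
      unfolding F_def by auto
    have dh: "(\<Sum>a\<in>A. C (d a) * h a) = 0"
    proof (rule poly_mapping_eqI)
      fix f
      have lk: "lookup (C (d a) * h a) f = d a * lookup (h a) f" for a
        unfolding C_def by (simp add: mult_map_scale_conv_mult[symmetric] Poly_Mapping.map.rep_eq when_def)
      show "lookup (\<Sum>a\<in>A. C (d a) * h a) f = lookup 0 f"
      proof (cases "f \<in> F")
        case False
        then have "lookup (h a) f = 0" if "a \<in> A" for a
          using A'(2)[OF that] by (auto simp: in_keys_iff)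
        then show ?thesis by (simp add: lookup_sum lk)
      qed (use d in \<open>simp add: lookup_sum lk\<close>)
    qed
    \<comment> \<open>The ring homomorphism \<complex>[X] \<rightarrow> \<complex>[S] that
      substitutes \<open>x\<close>.\<close>
    define ev where "ev p = poly (map_poly C p) x" for p
    have ev_pCons: "ev (pCons a p) = C a + x * ev p" for a p
      by (simp add: ev_def C(4) map_poly_pCons)
    have ev0: "ev 0 = 0" by (simp add: ev_def)
    have ev_add: "ev (p + q) = ev p + ev q" for p q
      by (induction p q rule: poly_induct2) (auto simp: ev0 ev_pCons C algebra_simps)
    have ev_smult: "ev (smult a p) = C a * ev p" for a p
      by (induction p) (auto simp: ev0 ev_pCons C algebra_simps)
    have ev_lin: "ev ([:-a, 1:] * p) = (x - C a) * ev p" for a p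
    proof -
      have "[:-a, 1:] * p = pCons 0 p + smult (- a) p" by simp
      moreover have "C (- a) = - C a" by (simp add: C_def single_uminus)
      ultimately show ?thesis by (simp only: ev_add ev_smult ev_pCons) (simp add: C algebra_simps)
    qed
    have ev1: "ev 1 = 1" by (simp add: ev_pCons ev0 C one_pCons)
    have ev_prod: "ev (\<Prod>a\<in>B. [:-a, 1:]) = (\<Prod>a\<in>B. x - C a)" if "finite B" for B
      using that by (induction B) (simp_all only: prod.insert prod.empty ev_lin ev1 not_False_eq_True)
    have ev_sum: "ev (\<Sum>a\<in>B. p a) = (\<Sum>a\<in>B. ev (p a))" if "finite B" for B p
      using that by (induction B) (auto simp: ev0 ev_add)
    \<comment> \<open>Modulo \<open>J\<close> one has b^k0 = h_a (x - a) for all \<open>a\<close> in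
      \<open>A\<close>. Multiplying by d_a and the product of the other factors and summing over
      \<open>a\<close> gives b^k0 Q(x) = 0, because the d_a h_a sum to 0. At \<open>a0\<close> only
      one summand of \<open>Q\<close> survives, so \<open>Q\<close> is not the zero
      polynomial.\<close>
    define Q where "Q = (\<Sum>a\<in>A. smult (d a) (\<Prod>a'\<in>A-{a}. [:-a', 1:]))"
    have "poly Q a0 = (\<Sum>a\<in>A. if a = a0 then d a * (\<Prod>a'\<in>A-{a}. a0 - a') else 0)"
      unfolding Q_def poly_sum
    proof (intro sum.cong refl)
      fix a assume a: "a \<in> A"
      show "poly (smult (d a) (\<Prod>a'\<in>A-{a}. [:-a', 1:])) a0
          = (if a = a0 then d a * (\<Prod>a'\<in>A-{a}. a0 - a') else 0)"
        using A(2) d(1) by (auto simp: poly_prod)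
    qed
    also have "\<dots> = d a0 * (\<Prod>a'\<in>A-{a0}. a0 - a')" using A(2) d(1) by simp
    finally have "poly Q a0 \<noteq> 0" using d A(2) by simp
    then have "Q \<noteq> 0" by auto
    have xC: "(\<Prod>a\<in>B. x - C a) \<in> ?R" for B
      by (intro algebra_prod semigroup_algebra_diff x C)
    have bk: "b ^ k0 * ev Q \<in> J"
    proof -
      have "(\<Sum>a\<in>A. (C (d a) * (\<Prod>a'\<in>A-{a}. x - C a')) * (b ^ k a - h a * (x - C a))) \<in> J"
        by (intro JD(6) JD(4) kh algebra_mult C xC)
      moreover have "(C (d a) * (\<Prod>a'\<in>A-{a}. x - C a')) * (b ^ k a - h a * (x - C a))
          = b ^ k0 * (C (d a) * (\<Prod>a'\<in>A-{a}. x - C a')) - (C (d a) * h a) * (\<Prod>a'\<in>A. x - C a')"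
        if "a \<in> A" for a
        by (simp only: prod.remove[OF A(2) that, of "\<lambda>a'. x - C a'"] A'(1)[OF that])
          (simp add: algebra_simps)
      ultimately have "b ^ k0 * (\<Sum>a\<in>A. C (d a) * (\<Prod>a'\<in>A-{a}. x - C a'))
          - (\<Sum>a\<in>A. C (d a) * h a) * (\<Prod>a'\<in>A. x - C a') \<in> J"
        by (simp add: sum_subtractf sum_distrib_left sum_distrib_right)
      then show ?thesis
        using A(2) by (simp add: dh Q_def ev_sum ev_smult ev_prod)
    qed
    have evR: "ev p \<in> ?R" for p
      by (induction p) (auto simp: ev0 ev_pCons intro: semigroup_algebra_add algebra_mult C x)
    have "ev Q \<in> J" using prime[OF algebra_power[OF b] evR bk] J(3) by blast
    \<comment> \<open>A nonzero complex polynomial is a product of a constant and linear factors; no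
      value of these at \<open>x\<close> lies in \<open>J\<close>, and \<open>J\<close> is
      prime.\<close>
    moreover have "ev p \<notin> J" if "p \<noteq> 0" for p
      using that
    proof (induction "degree p" arbitrary: p)
      case 0
      then obtain a where "p = [:a:]" "a \<noteq> 0" by (metis degree_eq_zeroE pCons_0_0)
      then show ?case using Cnot by (simp add: ev_pCons ev0)
    next
      case (Suc n)
      then obtain a where "poly p a = 0" using alg_closed_imp_poly_has_root[of p] by auto
      then obtain q where q: "p = [:-a, 1:] * q" by (auto simp: poly_eq_0_iff_dvd)
      then have "q \<noteq> 0" using Suc by auto
      then have "degree p = Suc (degree q)" unfolding q by (subst degree_mult_eq) auto
      then have "ev q \<notin> J" using Suc \<open>q \<noteq> 0\<close> by simp
      then show ?case using no prime[of "x - C a" "ev q"] x C(1) semigroup_algebra_diff evR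
        unfolding q ev_lin by blast
    qed
    ultimately show False using \<open>Q \<noteq> 0\<close> by blast
  qed
  \<comment> \<open>Every residue class modulo \<open>J\<close> is that of a constant; \<gamma>
    records the constant of each monomial.\<close>
  define \<gamma> where "\<gamma> m = (SOME a. single m 1 - C a \<in> J)" for m
  have \<gamma>: "single m 1 - C (\<gamma> m) \<in> J" if "m \<in> S" for m
    unfolding \<gamma>_def by (rule someI_ex, rule root) (use that in simp)
  have uniq: "a = a'" if "f - C a \<in> J" "f - C a' \<in> J" for f a a'
  proof (rule ccontr)
    assume "a \<noteq> a'"
    have "C (a' - a) = (f - C a) - (f - C a')" by (simp add: C_def single_diff)
    then show False using Cnot[of "a' - a"] JD(5)[OF that] \<open>a \<noteq> a'\<close> by simp
  qed
  have lev: "f - C (lev \<gamma> f) \<in> J" if "f \<in> ?R" for f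
    using that unfolding semigroup_algebra_def mem_Collect_eq
  proof (induction f rule: poly_mapping_keys_induct)
    case zero
    then show ?case using JD(2) C by simp
  next
    case (add m c f)
    have "single m c = C c * single m 1" by (simp add: C_def mult_single)
    moreover have "lev \<gamma> (single m c + f) = c * \<gamma> m + lev \<gamma> f" by (simp add: lev_add)
    ultimately have "single m c + f - C (lev \<gamma> (single m c + f))
        = C c * (single m 1 - C (\<gamma> m)) + (f - C (lev \<gamma> f))"
      by (simp only: C) (simp add: algebra_simps)
    then show ?case using JD(3)[OF JD(4)[OF \<gamma>[OF add(1)] C(1)] add(3)] by (simp only:)
  qed
  show ?thesis
  proof (intro exI[of _ \<gamma>] conjI ballI)
    show "\<gamma> 0 = 1" using uniq[OF \<gamma>[OF zero_mem], of 1] JD(2) C by simp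
    show "\<gamma> (m + m') = \<gamma> m * \<gamma> m'" if m: "m \<in> S" "m' \<in> S" for m m'
    proof (rule uniq[OF \<gamma>[OF add_mem[OF m]]])
      have "single (m + m') 1 - C (\<gamma> m * \<gamma> m')
          = single m' 1 * (single m 1 - C (\<gamma> m)) + C (\<gamma> m) * (single m' 1 - C (\<gamma> m'))"
        by (simp add: C algebra_simps mult_single)
      then show "single (m + m') 1 - C (\<gamma> m * \<gamma> m') \<in> J"
        using m by (simp add: JD \<gamma> C)
    qed
    show "lev \<gamma> f = 0" if "f \<in> I" for f
    proof (rule ccontr)
      assume *: "lev \<gamma> f \<noteq> 0"
      have f: "f \<in> J" using that J by auto
      then have "f - C (lev \<gamma> f) \<in> J" using JD(1) lev by auto
      then have "f - (f - C (lev \<gamma> f)) \<in> J" using JD(5) f by blast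
      then show False using Cnot[OF *] by simp
    qed
    show "lev \<gamma> b \<noteq> 0" using lev[OF b] J(3)[of 1] C by auto
  qed
qed

end

subsection \<open>Lattices\<close>

lemma pairing_simps:
  "pairing (m + m') u = pairing m u + pairing m' u"
  "pairing m (u + u') = pairing m u + pairing m u'"
  "pairing (m - m') u = pairing m u - pairing m' u"
  "pairing (- m) u = - pairing m u"
  "pairing (c *s m) u = c * pairing m u"
  "pairing m (c *s u) = c * pairing m u"
  "pairing 0 u = 0"
  "pairing m 0 = 0"
  by (simp_all add: pairing_def algebra_simps sum.distrib sum_subtractf sum_negf sum_distrib_left)

lemma pairing_sum: "pairing (\<Sum>i\<in>A. m i) u = (\<Sum>i\<in>A. pairing (m i) u)"
  by (induction A rule: infinite_finite_induct) (auto simp: pairing_simps)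

lemma pairing_sum_right: "pairing m (\<Sum>i\<in>A. u i) = (\<Sum>i\<in>A. pairing m (u i))"
  by (induction A rule: infinite_finite_induct) (auto simp: pairing_simps)

lemma real_vec_inner: "real_vec m \<bullet> real_vec u = of_int (pairing m u)"
  by (simp add: real_vec_def pairing_def inner_vec_def)

lemma real_vec_simps:
  "real_vec (m + m') = real_vec m + real_vec m'"
  "real_vec (m - m') = real_vec m - real_vec m'"
  "real_vec (- m) = - real_vec m"
  "real_vec (c *s m) = of_int c *\<^sub>R real_vec m"
  "real_vec 0 = 0"
  "real_vec m = real_vec m' \<longleftrightarrow> m = m'"
  "real_vec m = 0 \<longleftrightarrow> m = 0"
  by (auto simp: real_vec_def vec_eq_iff)

text \<open>The complex-linear extension of \<open>pairing\<close> to N \<otimes> \<complex>: the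
  eigenvalue of the invariant field \<open>v\<close> on the character of \<open>m\<close>.\<close>

definition cpair :: "int^'n \<Rightarrow> complex^'n \<Rightarrow> complex" where
  "cpair m v = (\<Sum>i\<in>UNIV. of_int (m $ i) * v $ i)"

lemma cpair_simps:
  "cpair (m + m') v = cpair m v + cpair m' v"
  "cpair m (v + v') = cpair m v + cpair m v'"
  "cpair m (v - v') = cpair m v - cpair m v'"
  "cpair (- m) v = - cpair m v"
  "cpair (m - m') v = cpair m v - cpair m' v"
  "cpair m (c *s v) = c * cpair m v"
  "cpair 0 v = 0"
  "cpair m 0 = 0"
  "cpair m (complex_vec u) = of_int (pairing m u)"
  "cpair (c' *s m) v = of_int c' * cpair m v"
  by (simp_all add: cpair_def complex_vec_def pairing_def algebra_simps sum.distrib sum_subtractf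
    sum_negf sum_distrib_left)

lemma cpair_sum: "cpair m (\<Sum>i\<in>A. v i) = (\<Sum>i\<in>A. cpair m (v i))"
  by (induction A rule: infinite_finite_induct) (auto simp: cpair_simps)

text \<open>The subgroup generated by \<open>B\<close> when \<open>B\<close> is finite; for infinite
  \<open>B\<close> the sums are 0 by default, so finiteness of \<open>B\<close> accompanies its
  uses.\<close>

definition zspan :: "(int^'n) set \<Rightarrow> (int^'n) set" where
  "zspan B = {\<Sum>b\<in>B. c b *s b | c. True}"

lemma zspanI: "m = (\<Sum>b\<in>B. c b *s b) \<Longrightarrow> m \<in> zspan B"
  by (auto simp: zspan_def)

lemma zspan_add: "m \<in> zspan B \<Longrightarrow> m' \<in> zspan B \<Longrightarrow> m + m' \<in> zspan B"
  unfolding zspan_def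
  by (clarsimp, rule_tac x="\<lambda>b. c b + ca b" in exI)
    (simp add: vec_eq_iff sum.distrib algebra_simps)

lemma zspan_smult: "m \<in> zspan B \<Longrightarrow> k *s m \<in> zspan B"
  unfolding zspan_def
  by (clarsimp, rule_tac x="\<lambda>b. k * c b" in exI) (simp add: vec_eq_iff sum_distrib_left algebra_simps)

lemma zspan_diff: "m \<in> zspan B \<Longrightarrow> m' \<in> zspan B \<Longrightarrow> m - m' \<in> zspan B"
  using zspan_add[of m B "(-1) *s m'"] zspan_smult[of m' B "-1"]
  by (simp add: vector_smult_lneg)

lemma zspan_0: "0 \<in> zspan B"
  by (rule zspanI[of _ "\<lambda>_. 0"]) simp

lemma zspan_sum: "(\<And>i. i \<in> A \<Longrightarrow> m i \<in> zspan B) \<Longrightarrow> (\<Sum>i\<in>A. m i) \<in> zspan B"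
  by (induction A rule: infinite_finite_induct) (auto intro: zspan_add zspan_0)

lemma zspan_base: "finite B \<Longrightarrow> b \<in> B \<Longrightarrow> b \<in> zspan B"
proof (rule zspanI[of _ "\<lambda>x. if x = b then 1 else 0"])
  assume "finite B" "b \<in> B"
  moreover have "(\<Sum>x\<in>B. (if x = b then 1 else 0) *s x) = (\<Sum>x\<in>B. if x = b then x else 0)"
    by (intro sum.cong) auto
  ultimately show "b = (\<Sum>x\<in>B. (if x = b then 1 else 0) *s x)" by simp
qed

lemma zspan_mono: "finite B' \<Longrightarrow> B \<subseteq> B' \<Longrightarrow> zspan B \<subseteq> zspan B'"
  by (auto simp: zspan_def[of B] intro!: zspan_sum zspan_smult intro: zspan_base)

lemma subgroup_smult:
  fixes m :: "int^'n"
  assumes "0 \<in> H" and diff: "\<And>a b. a \<in> H \<Longrightarrow> b \<in> H \<Longrightarrow> a - b \<in> H" and m: "m \<in> H"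
  shows "k *s m \<in> H"
proof -
  have neg: "- a \<in> H" if "a \<in> H" for a using diff[OF assms(1) that] by simp
  have add: "a + b \<in> H" if "a \<in> H" "b \<in> H" for a b using diff[OF that(1) neg[OF that(2)]] by simp
  have nat: "int j *s a \<in> H" if "a \<in> H" for a j
    using that assms(1) by (induction j) (auto simp: vector_sadd_rdistrib intro: add)
  show ?thesis
  proof (cases "k \<ge> 0")
    case True
    then show ?thesis using nat[OF m, of "nat k"] by simp
  next
    case False
    then show ?thesis using nat[OF neg[OF m], of "nat (-k)"] by (simp add: vector_smult_lneg)
  qed
qed

lemma subgroup_sum:
  fixes f :: "'a \<Rightarrow> int^'n"
  assumes "0 \<in> H" and diff: "\<And>a b. a \<in> H \<Longrightarrow> b \<in> H \<Longrightarrow> a - b \<in> H" and "\<And>i. i \<in> A \<Longrightarrow> f i \<in> H"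
  shows "(\<Sum>i\<in>A. f i) \<in> H"
  using assms(3)
proof (induction A rule: infinite_finite_induct)
  case (insert x A)
  have "f x - (0 - (\<Sum>i\<in>A. f i)) \<in> H" using insert by (intro diff assms(1)) auto
  then show ?case using insert by simp
qed (use assms(1) in auto)

text \<open>Division with remainder by the least positive element of \<open>G\<close>.\<close>

lemma int_subgroup:
  fixes G :: "int set"
  assumes "0 \<in> G" and diff: "\<And>a b. a \<in> G \<Longrightarrow> b \<in> G \<Longrightarrow> a - b \<in> G"
  shows "\<exists>d\<in>G. G = range ((*) d)"
proof (cases "G = {0}")
  case False
  have neg: "- a \<in> G" if "a \<in> G" for a using diff[OF assms(1) that] by simp
  have add: "a + b \<in> G" if "a \<in> G" "b \<in> G" for a b using diff[OF that(1) neg[OF that(2)]] by simp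
  have natmul: "int k * a \<in> G" if "a \<in> G" for a k
    using that assms(1) by (induction k) (auto simp: algebra_simps intro: add)
  have mul: "k * a \<in> G" if "a \<in> G" for a k
  proof (cases "k \<ge> 0")
    case True
    then show ?thesis using natmul[OF that, of "nat k"] by simp
  next
    case False
    then show ?thesis using natmul[OF neg[OF that], of "nat (-k)"] by simp
  qed
  from False assms obtain a where "a \<in> G" "a \<noteq> 0" by auto
  then have "\<exists>k. k > 0 \<and> int k \<in> G"
    using neg[of a] by (intro exI[of _ "nat \<bar>a\<bar>"]) (auto simp: abs_if)
  then obtain k where k: "k > 0" "int k \<in> G" "\<And>l. l > 0 \<and> int l \<in> G \<Longrightarrow> k \<le> l"
    using exists_least_iff[of "\<lambda>k. k > 0 \<and> int k \<in> G"] by (meson not_le)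
  have "g \<in> range ((*) (int k))" if g: "g \<in> G" for g
  proof -
    have "g mod int k = g - (g div int k) * int k" by (simp add: minus_div_mult_eq_mod)
    then have m: "g mod int k \<in> G" using diff[OF g mul[OF k(2)]] by simp
    have bd: "0 \<le> g mod int k" "g mod int k < int k" using k(1) by auto
    have "g mod int k = 0"
    proof (rule ccontr)
      assume "g mod int k \<noteq> 0"
      then have "nat (g mod int k) > 0" "int (nat (g mod int k)) \<in> G" using m bd by auto
      then show False using k(3)[of "nat (g mod int k)"] bd by auto
    qed
    then have "g = int k * (g div int k)" by auto
    then show ?thesis by blast
  qed
  then show ?thesis using k(2) mul[OF k(2)] by (intro bexI[of _ "int k"]) (auto simp: mult.commute)
qed (auto intro: bexI[of _ 0])

text \<open>Linear independence of the basis is expressed by a dual system of complex vectors.\<close>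

lemma lattice_basis:
  fixes H :: "(int^'n) set"
  assumes "0 \<in> H" and "\<And>a b. a \<in> H \<Longrightarrow> b \<in> H \<Longrightarrow> a - b \<in> H"
  shows "\<exists>B v. finite B \<and> B \<subseteq> H \<and> H \<subseteq> zspan B \<and>
    (\<forall>b\<in>B. \<forall>b'\<in>B. cpair b' (v b) = (if b = b' then 1 else 0))"
proof -
  have "\<exists>B v. finite B \<and> B \<subseteq> H \<and> H \<subseteq> zspan B \<and>
      (\<forall>b\<in>B. \<forall>b'\<in>B. cpair b' (v b) = (if b = b' then 1 else 0))"
    if "finite I" "H \<subseteq> {m. \<forall>i. i \<notin> I \<longrightarrow> m $ i = 0}" "0 \<in> H"
      "\<And>a b. a \<in> H \<Longrightarrow> b \<in> H \<Longrightarrow> a - b \<in> H" for I and H :: "(int^'n) set"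
    using that
  proof (induction I arbitrary: H)
    case empty
    then have "H \<subseteq> {0}" by (auto simp: vec_eq_iff)
    then show ?case by (intro exI[of _ "{}"]) (auto intro: zspan_0)
  next
    case (insert k I)
    note diff = insert.prems(3)
    note mul = subgroup_smult[OF insert.prems(2) diff]
    have "\<exists>d\<in>(\<lambda>m. m $ k) ` H. (\<lambda>m. m $ k) ` H = range ((*) d)"
    proof (rule int_subgroup)
      show "0 \<in> (\<lambda>m. m $ k) ` H" using insert.prems(2) by force
      fix a b assume "a \<in> (\<lambda>m. m $ k) ` H" "b \<in> (\<lambda>m. m $ k) ` H"
      then obtain x y where "x \<in> H" "y \<in> H" "a = x $ k" "b = y $ k" by auto
      then show "a - b \<in> (\<lambda>m. m $ k) ` H" using diff[of x y] by (intro image_eqI[of _ _ "x - y"]) auto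
    qed
    then obtain h where h: "h \<in> H" "(\<lambda>m. m $ k) ` H = range ((*) (h $ k))" by auto
    \<comment> \<open>Coordinate \<open>k\<close> maps \<open>H\<close> onto the multiples of
      \<open>h $ k\<close>, with kernel \<open>H'\<close>; so a basis of \<open>H'\<close> together
      with \<open>h\<close> is a basis of \<open>H\<close>, unless \<open>h $ k = 0\<close>.\<close>
    define H' where "H' = {m\<in>H. m $ k = 0}"
    have "H' \<subseteq> {m. \<forall>i. i \<notin> I \<longrightarrow> m $ i = 0}" using insert.prems(1) by (auto simp: H'_def)
    moreover have "0 \<in> H'" "\<And>a b. a \<in> H' \<Longrightarrow> b \<in> H' \<Longrightarrow> a - b \<in> H'"
      using insert.prems by (auto simp: H'_def)
    ultimately obtain B v where B: "finite B" "B \<subseteq> H'" "H' \<subseteq> zspan B"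
      and B4: "\<forall>b\<in>B. \<forall>b'\<in>B. cpair b' (v b) = (if b = b' then 1 else 0)"
      using insert.IH[of H'] by blast
    show ?case
    proof (cases "h $ k = 0")
      case True
      then have "H = H'" using h(2) by (auto simp: H'_def image_iff)
      then show ?thesis using B B4 by (intro exI[of _ B] exI[of _ v] conjI) simp_all
    next
      case False
      have hB: "h \<notin> B" using B(2) False by (auto simp: H'_def)
      define e where "e = (axis k 1 :: complex^'n)"
      have e: "cpair m e = of_int (m $ k)" for m
        by (simp add: cpair_def e_def axis_def if_distrib[of "\<lambda>x. _ * x"] cong: if_cong)
      \<comment> \<open>The vector \<open>e\<close> reads off coordinate \<open>k\<close>, which is
        0 on \<open>B\<close>. Adding multiples of \<open>e\<close> therefore keeps the duality on
        \<open>B\<close> and can be used to make the old dual vectors vanish at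
        \<open>h\<close>.\<close>
      define v' where "v' b = (if b = h then (1 / of_int (h $ k)) *s e
        else v b - (cpair h (v b) / of_int (h $ k)) *s e)" for b
      have "H \<subseteq> zspan (insert h B)"
      proof
        fix m assume m: "m \<in> H"
        then obtain j where j: "m $ k = h $ k * j" using h(2) by blast
        have "m - j *s h \<in> H'" using m h(1) j diff mul by (auto simp: H'_def)
        then have "m - j *s h \<in> zspan (insert h B)" using B(1,3) zspan_mono[of "insert h B" B] by auto
        moreover have "j *s h \<in> zspan (insert h B)" using B(1) by (intro zspan_smult zspan_base) auto
        ultimately show "m \<in> zspan (insert h B)" using zspan_add by fastforce
      qed
      moreover have "cpair b' (v' b) = (if b = b' then 1 else 0)"
        if "b \<in> insert h B" "b' \<in> insert h B" for b b'
        using that B(2) B4 False hB by (auto simp: v'_def cpair_simps e H'_def)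
      moreover have "finite (insert h B)" "insert h B \<subseteq> H" using B h by (auto simp: H'_def)
      ultimately show ?thesis by (intro exI[of _ "insert h B"] exI[of _ v'] conjI) simp_all
    qed
  qed
  from this[of UNIV H] assms show ?thesis by simp
qed

lemma card_le_of_dual:
  fixes h e :: "'a \<Rightarrow> 'n::finite \<Rightarrow> complex"
  assumes "finite K" and "\<And>l. l \<in> K \<Longrightarrow> d l \<noteq> 0"
    and "\<And>k l. k \<in> K \<Longrightarrow> l \<in> K \<Longrightarrow> (\<Sum>i\<in>UNIV. h k i * e l i) = (if k = l then d l else 0)"
  shows "card K \<le> CARD('n)"
proof (rule ccontr)
  assume "\<not> ?thesis"
  then obtain c l where c: "l \<in> K" "c l \<noteq> 0" "\<And>i. (\<Sum>k\<in>K. c k * h k i) = 0"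
    using linear_dependence[of "UNIV :: 'n set" K h] assms(1) by auto
  have "0 = (\<Sum>i\<in>UNIV. (\<Sum>k\<in>K. c k * h k i) * e l i)" by (simp add: c(3))
  also have "\<dots> = (\<Sum>k\<in>K. \<Sum>i\<in>UNIV. c k * h k i * e l i)"
    by (subst sum.swap) (simp add: sum_distrib_right)
  also have "\<dots> = (\<Sum>k\<in>K. c k * (\<Sum>i\<in>UNIV. h k i * e l i))"
    by (simp add: sum_distrib_left mult.assoc)
  also have "\<dots> = (\<Sum>k\<in>K. if k = l then c k * d l else 0)"
    by (intro sum.cong) (auto simp: assms(3) c(1))
  also have "\<dots> = c l * d l" using assms(1) c(1) by simp
  finally show False using c(1,2) assms(2) by auto
qed

definition dual_bases :: "('n \<Rightarrow> int^'n) \<Rightarrow> ('n \<Rightarrow> int^'n) \<Rightarrow> bool" where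
  "dual_bases g w \<longleftrightarrow> (\<forall>i j. pairing (g i) (w j) = (if i = j then 1 else 0))"

text \<open>Writing the unit vectors in terms of the generators gives a left inverse of the matrix
  of generators. This matrix is square, so the inverse is two-sided, and the columns of the inverse
  form the dual basis.\<close>

lemma dual_bases_of_generators:
  fixes K :: "(int^'n) set"
  assumes "finite K" "card K \<le> CARD('n)" "zspan K = UNIV"
  shows "\<exists>g w. range g = K \<and> dual_bases g (w :: 'n \<Rightarrow> int^'n)"
proof -
  obtain f :: "int^'n \<Rightarrow> 'n" where f: "inj_on f K"
    using card_le_inj[of K "UNIV :: 'n set"] assms by auto
  have "K \<noteq> {}"
  proof
    assume "K = {}"
    then have "zspan K = {0}" by (auto simp: zspan_def)
    moreover have "axis undefined (1::int) \<in> zspan K" unfolding assms(3) by (rule UNIV_I)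
    ultimately have "axis undefined (1::int) = (0 :: int^'n)" by blast
    then show False by (auto simp: vec_eq_iff axis_def split: if_splits)
  qed
  then obtain k0 where k0: "k0 \<in> K" by auto
  \<comment> \<open>Padding with \<open>k0\<close> makes the family square before it is known that
    \<open>K\<close> has exactly n elements; the padded indices get coefficient 0 below.\<close>
  define g where "g i = (if i \<in> f ` K then inv_into K f i else k0)" for i
  have gf: "g (f k) = k" if "k \<in> K" for k using that f by (simp add: g_def)
  have rg: "range g = K"
  proof
    show "range g \<subseteq> K" using k0 by (auto simp: g_def inv_into_into)
    show "K \<subseteq> range g" using gf by (metis rangeI subsetI)
  qed
  have "\<exists>C. m = (\<Sum>i\<in>UNIV. C i *s g i)" for m
  proof -
    obtain c where c: "m = (\<Sum>k\<in>K. c k *s k)" using assms(3) by (auto simp: zspan_def)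
    have "(\<Sum>i\<in>UNIV. (if i \<in> f ` K then c (g i) else 0) *s g i) = (\<Sum>i\<in>f ` K. c (g i) *s g i)"
      by (rule sum.mono_neutral_cong_right) auto
    also have "\<dots> = (\<Sum>k\<in>K. c k *s k)" by (simp add: sum.reindex[OF f] gf cong: sum.cong)
    finally show ?thesis 
      by (intro exI[of _ "\<lambda>i. if i \<in> f ` K then c (g i) else 0"]) (simp only: c)
  qed
  then have "\<forall>k. \<exists>C. axis k 1 = (\<Sum>i\<in>UNIV. C i *s g i)" by blast
  from choice[OF this] obtain C where C: "\<And>k. axis k 1 = (\<Sum>i\<in>UNIV. C k i *s g i)" by blast
  define A G where "A = (\<chi> k i. real_of_int (C k i))" and "G = (\<chi> i k. real_of_int (g i $ k))"
  have "A ** G = mat 1"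
  proof -
    have "(\<Sum>i\<in>UNIV. C k i * g i $ l) = (if k = l then 1 else 0)" for k l
    proof -
      have "(\<Sum>i\<in>UNIV. C k i * g i $ l) = axis k 1 $ l" by (subst C) simp
      then show ?thesis by (auto simp: axis_def)
    qed
    then have "real_of_int (\<Sum>i\<in>UNIV. C k i * g i $ l) = (if k = l then 1 else 0)" for k l by simp
    then show ?thesis by (simp add: A_def G_def matrix_matrix_mult_def mat_def vec_eq_iff)
  qed
  then have GA: "G ** A = mat 1" by (simp add: matrix_left_right_inverse)
  have "dual_bases g (\<lambda>j. \<chi> k. C k j)"
    unfolding dual_bases_def
  proof (intro allI)
    fix i j
    have "real_of_int (pairing (g i) (\<chi> k. C k j)) = (G ** A) $ i $ j"
      by (simp add: A_def G_def matrix_matrix_mult_def pairing_def)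
    also have "\<dots> = real_of_int (if i = j then 1 else 0)" by (simp add: GA mat_def)
    finally show "pairing (g i) (\<chi> k. C k j) = (if i = j then 1 else 0)"
      by (simp only: of_int_eq_iff)
  qed
  then show ?thesis using rg by blast
qed

text \<open>The other order of the matrix product: biorthogonality of a square system implies
  completeness, from which the three expansions that follow are obtained.\<close>

lemma dual_bases_transpose:
  fixes g w :: "'n \<Rightarrow> int^'n"
  assumes "dual_bases g w"
  shows "(\<Sum>i\<in>UNIV. g i $ k * w i $ l) = (if k = l then 1 else 0)"
proof -
  define A G where "A = (\<chi> k j. real_of_int (w j $ k))" and "G = (\<chi> i k. real_of_int (g i $ k))"
  have "(G ** A) $ i $ j = real_of_int (pairing (g i) (w j))" for i j
    by (simp add: A_def G_def matrix_matrix_mult_def pairing_def)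
  then have "G ** A = mat 1" using assms by (simp add: vec_eq_iff mat_def dual_bases_def)
  then have AG: "A ** G = mat 1" by (simp add: matrix_left_right_inverse)
  have "real_of_int (\<Sum>i\<in>UNIV. g i $ k * w i $ l) = (A ** G) $ l $ k"
    by (simp add: A_def G_def matrix_matrix_mult_def mult.commute)
  also have "\<dots> = real_of_int (if k = l then 1 else 0)" by (simp add: AG mat_def)
  finally show ?thesis by (simp only: of_int_eq_iff)
qed

lemma dual_bases_expand:
  fixes g w :: "'n \<Rightarrow> int^'n"
  assumes "dual_bases g w"
  shows "m = (\<Sum>i\<in>UNIV. pairing m (w i) *s g i)"
    and "v = (\<Sum>i\<in>UNIV. (real_vec (g i) \<bullet> v) *\<^sub>R real_vec (w i))"
    and "z = (\<Sum>i\<in>UNIV. cpair (g i) z *s complex_vec (w i))"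
proof -
  note t = dual_bases_transpose[OF assms]
  have tc: "(\<Sum>i\<in>UNIV. of_int (g i $ k) * of_int (w i $ l)) = (if k = l then 1 else 0 :: 'a::comm_ring_1)" for k l
    using arg_cong[OF t[of k l], of "of_int :: int \<Rightarrow> 'a"] by (auto split: if_splits)
  show "m = (\<Sum>i\<in>UNIV. pairing m (w i) *s g i)"
  proof (subst vec_eq_iff, rule allI)
    fix k
    have "(\<Sum>i\<in>UNIV. pairing m (w i) *s g i) $ k = (\<Sum>i\<in>UNIV. \<Sum>l\<in>UNIV. m $ l * (g i $ k * w i $ l))"
      by (simp add: pairing_def sum_distrib_left sum_distrib_right algebra_simps)
    also have "\<dots> = (\<Sum>l\<in>UNIV. m $ l * (if k = l then 1 else 0))"
      by (subst sum.swap) (simp add: sum_distrib_left[symmetric] t)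
    also have "\<dots> = m $ k" by (simp add: if_distrib cong: if_cong)
    finally show "m $ k = (\<Sum>i\<in>UNIV. pairing m (w i) *s g i) $ k" by (rule sym)
  qed
  show "v = (\<Sum>i\<in>UNIV. (real_vec (g i) \<bullet> v) *\<^sub>R real_vec (w i))"
  proof (subst vec_eq_iff, rule allI)
    fix k
    have "(\<Sum>i\<in>UNIV. (real_vec (g i) \<bullet> v) *\<^sub>R real_vec (w i)) $ k
        = (\<Sum>i\<in>UNIV. \<Sum>l\<in>UNIV. v $ l * (of_int (g i $ l) * of_int (w i $ k)))"
      by (simp add: inner_vec_def real_vec_def sum_distrib_left sum_distrib_right algebra_simps)
    also have "\<dots> = (\<Sum>l\<in>UNIV. v $ l * (if l = k then 1 else 0))"
      by (subst sum.swap) (simp add: sum_distrib_left[symmetric] tc)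
    also have "\<dots> = v $ k" by (simp add: if_distrib cong: if_cong)
    finally show "v $ k = (\<Sum>i\<in>UNIV. (real_vec (g i) \<bullet> v) *\<^sub>R real_vec (w i)) $ k" by (rule sym)
  qed
  show "z = (\<Sum>i\<in>UNIV. cpair (g i) z *s complex_vec (w i))"
  proof (subst vec_eq_iff, rule allI)
    fix k
    have "(\<Sum>i\<in>UNIV. cpair (g i) z *s complex_vec (w i)) $ k
        = (\<Sum>i\<in>UNIV. \<Sum>l\<in>UNIV. z $ l * (of_int (g i $ l) * of_int (w i $ k)))"
      by (simp add: cpair_def complex_vec_def sum_distrib_left sum_distrib_right algebra_simps)
    also have "\<dots> = (\<Sum>l\<in>UNIV. z $ l * (if l = k then 1 else 0))"
      by (subst sum.swap) (simp add: sum_distrib_left[symmetric] tc)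
    also have "\<dots> = z $ k" by (simp add: if_distrib cong: if_cong)
    finally show "z $ k = (\<Sum>i\<in>UNIV. cpair (g i) z *s complex_vec (w i)) $ k" by (rule sym)
  qed
qed

subsection \<open>Rational cones\<close>

lemma dual_monoid_hull:
  "m \<in> dual_monoid (convex_cone hull (real_vec ` S)) \<longleftrightarrow> (\<forall>s\<in>S. pairing m s \<ge> 0)"
proof
  assume "m \<in> dual_monoid (convex_cone hull (real_vec ` S))"
  then show "\<forall>s\<in>S. pairing m s \<ge> 0"
    using hull_inc[of "real_vec _" "real_vec ` S" convex_cone]
    by (fastforce simp: dual_monoid_def real_vec_inner)
next
  assume "\<forall>s\<in>S. pairing m s \<ge> 0"
  then have "convex_cone hull (real_vec ` S) \<subseteq> {v. real_vec m \<bullet> v \<ge> 0}"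
    by (intro hull_minimal convex_cone_halfspace_ge) (auto simp: real_vec_inner)
  then show "m \<in> dual_monoid (convex_cone hull (real_vec ` S))" by (auto simp: dual_monoid_def)
qed

lemma perp_lattice_dual: "m \<in> perp_lattice \<tau> \<longleftrightarrow> m \<in> dual_monoid \<tau> \<and> - m \<in> dual_monoid \<tau>"
  by (force simp: perp_lattice_def dual_monoid_def real_vec_simps)

lemma perp_lattice_hull:
  "m \<in> perp_lattice (convex_cone hull (real_vec ` S)) \<longleftrightarrow> (\<forall>s\<in>S. pairing m s = 0)"
  by (fastforce simp: perp_lattice_dual dual_monoid_hull pairing_simps)

text \<open>Finitely many strict inequalities survive rounding of a large multiple of
  \<open>a\<close>: rounding changes the pairing with \<open>z\<close> by at most the l1-norm
  \<open>K z\<close>, whereas the value at \<open>z\<close> grows with the multiple.\<close>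

lemma integer_approximation:
  fixes a :: "real^'n"
  assumes "finite Z" and pos: "\<And>z. z \<in> Z \<Longrightarrow> a \<bullet> real_vec z > 0"
  shows "\<exists>m. \<forall>z\<in>Z. pairing m z > 0"
proof -
  define K where "K z = (\<Sum>i\<in>UNIV. \<bar>real_of_int (z $ i)\<bar>)" for z :: "int^'n"
  have "\<exists>n::nat. K z < real n * (a \<bullet> real_vec z)" if "z \<in> Z" for z
    using reals_Archimedean3[OF pos[OF that]] by auto
  then obtain n where n: "\<And>z. z \<in> Z \<Longrightarrow> K z < real (n z) * (a \<bullet> real_vec z)" by metis
  define N where "N = (\<Sum>z\<in>Z. n z)"
  define m where "m = (\<chi> i. \<lfloor>real N * a $ i\<rfloor>)"
  have "pairing m z > 0" if z: "z \<in> Z" for z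
  proof -
    have "n z \<le> N" unfolding N_def using assms(1) z by (intro member_le_sum) auto
    then have "K z < real N * (a \<bullet> real_vec z)"
      using n[OF z] pos[OF z] by (meson less_le_trans less_imp_le mult_right_mono of_nat_le_iff)
    also have "\<dots> = (\<Sum>i\<in>UNIV. (real N * a $ i) * real_of_int (z $ i))"
      by (simp add: inner_vec_def real_vec_def sum_distrib_left mult.assoc)
    also have "\<dots> \<le> (\<Sum>i\<in>UNIV. real_of_int (m $ i) * real_of_int (z $ i) + \<bar>real_of_int (z $ i)\<bar>)"
    proof (rule sum_mono)
      fix i
      define x where "x = real N * a $ i"
      have "(x - real_of_int \<lfloor>x\<rfloor>) * real_of_int (z $ i) \<le> \<bar>(x - real_of_int \<lfloor>x\<rfloor>) * real_of_int (z $ i)\<bar>"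
        by simp
      also have "\<dots> \<le> 1 * \<bar>real_of_int (z $ i)\<bar>"
        unfolding abs_mult by (intro mult_right_mono) (auto simp: abs_le_iff; linarith)+
      finally show "real N * a $ i * real_of_int (z $ i)
          \<le> real_of_int (m $ i) * real_of_int (z $ i) + \<bar>real_of_int (z $ i)\<bar>"
        by (simp add: m_def x_def algebra_simps)
    qed
    finally have "0 < real_of_int (pairing m z)"
      by (simp add: K_def pairing_def sum.distrib)
    then show ?thesis by simp
  qed
  then show ?thesis by blast
qed

lemma convex_cone_sum:
  assumes "convex_cone C" "\<And>i. i \<in> A \<Longrightarrow> x i \<in> C"
  shows "(\<Sum>i\<in>A. x i) \<in> C"
  using assms(2)
proof (induction A rule: infinite_finite_induct)
  case (insert a A)
  then show ?case using convex_cone_add[OF assms(1), of "x a" "\<Sum>i\<in>A. x i"] by simp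
qed (simp_all add: convex_cone_contains_0[OF assms(1)])

text \<open>If 0 were a convex combination of nonzero generators, the cone would contain a nonzero
  vector with its negative. So 0 can be separated from their compact convex hull, and the separating
  functional can be rounded to the lattice.\<close>

lemma strict_functional:
  fixes S :: "(int^'n) set"
  assumes "finite S" "strongly_convex (convex_cone hull (real_vec ` S))"
  shows "\<exists>m. \<forall>s\<in>S. s \<noteq> 0 \<longrightarrow> pairing m s > 0"
proof -
  let ?\<tau> = "convex_cone hull (real_vec ` S)" and ?Z = "real_vec ` (S - {0})"
  note cc = convex_cone_convex_cone_hull[of "real_vec ` S"]
  have in\<tau>: "x \<in> ?\<tau>" if "x \<in> ?Z" for x using that by (auto intro: hull_inc)
  have fin: "finite ?Z" using assms by auto
  have "0 \<notin> convex hull ?Z"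
  proof
    assume "0 \<in> convex hull ?Z"
    then obtain u where u: "\<And>x. x \<in> ?Z \<Longrightarrow> 0 \<le> u x" "sum u ?Z = 1" "(\<Sum>x\<in>?Z. u x *\<^sub>R x) = 0"
      using fin by (auto simp: convex_hull_finite)
    then obtain x where x: "x \<in> ?Z" "u x \<noteq> 0" using sum.neutral[of ?Z u] by fastforce
    have "0 = u x *\<^sub>R x + (\<Sum>y\<in>?Z - {x}. u y *\<^sub>R y)"
      using sum.remove[OF fin x(1), of "\<lambda>y. u y *\<^sub>R y"] u(3) by simp
    then have "- (u x *\<^sub>R x) = (\<Sum>y\<in>?Z - {x}. u y *\<^sub>R y)" by (simp add: eq_neg_iff_add_eq_0 minus_unique)
    moreover have "(\<Sum>y\<in>?Z - {x}. u y *\<^sub>R y) \<in> ?\<tau>"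
      using u(1) in\<tau> by (intro convex_cone_sum[OF cc] convex_cone_scaleR[OF cc]) auto
    moreover have "u x *\<^sub>R x \<in> ?\<tau>" using u(1) in\<tau> x by (intro convex_cone_scaleR[OF cc]) auto
    ultimately have "u x *\<^sub>R x = 0" using assms(2) by (auto simp: strongly_convex_def)
    then show False using x by (auto simp: real_vec_simps)
  qed
  moreover have "closed (convex hull ?Z)"
    by (intro compact_imp_closed compact_convex_hull finite_imp_compact fin)
  ultimately obtain a b where "0 < b" "\<And>x. x \<in> convex hull ?Z \<Longrightarrow> a \<bullet> x > b"
    using separating_hyperplane_closed_0[of "convex hull ?Z"] by auto
  then have "a \<bullet> real_vec s > 0" if "s \<in> S - {0}" for s
    using that hull_inc[of "real_vec s" ?Z convex] by (fastforce intro: order_less_trans)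
  then show ?thesis using integer_approximation[of "S - {0}" a] assms(1) by auto
qed

text \<open>The bipolar theorem over the lattice. A real functional separating \<open>w\<close> from
  the cone may vanish on generators, and rounding could then spoil its sign; a small multiple of a
  strictly positive functional is added beforehand.\<close>

lemma dual_separation:
  fixes S :: "(int^'n) set"
  assumes "finite S" "strongly_convex (convex_cone hull (real_vec ` S))"
    and w: "real_vec w \<notin> convex_cone hull (real_vec ` S)"
  shows "\<exists>m. (\<forall>s\<in>S. pairing m s \<ge> 0) \<and> pairing m w < 0"
proof -
  let ?\<tau> = "convex_cone hull (real_vec ` S)"
  note cc = convex_cone_convex_cone_hull[of "real_vec ` S"]
  have "closed ?\<tau>" using assms(1) by (intro closed_convex_cone_hull) auto
  then obtain a b where ab: "a \<bullet> real_vec w < b" "\<And>x. x \<in> ?\<tau> \<Longrightarrow> a \<bullet> x > b"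
    using separating_hyperplane_closed_point[OF convex_convex_cone_hull _ w] by auto
  have b0: "b < 0" using ab(2)[of 0] convex_cone_contains_0[OF cc] by simp
  have nn: "a \<bullet> x \<ge> 0" if x: "x \<in> ?\<tau>" for x
  proof (rule ccontr)
    assume "\<not> ?thesis"
    then have neg: "a \<bullet> x < 0" by simp
    have "(b / (a \<bullet> x)) *\<^sub>R x \<in> ?\<tau>"
      using b0 neg x by (intro convex_cone_scaleR[OF cc]) (auto simp: divide_nonpos_neg)
    from ab(2)[OF this] neg show False by simp
  qed
  obtain m0 where m0: "\<And>s. s \<in> S \<Longrightarrow> s \<noteq> 0 \<Longrightarrow> pairing m0 s > 0"
    using strict_functional[OF assms(1,2)] by auto
  \<comment> \<open>Small enough that the perturbation uses up at most half of the negative value at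
    \<open>w\<close>; the summand 1 keeps the denominator nonzero.\<close>
  define \<epsilon> where "\<epsilon> = - (a \<bullet> real_vec w) / (2 * (\<bar>real_of_int (pairing m0 w)\<bar> + 1))"
  have aw: "a \<bullet> real_vec w < 0" using ab(1) b0 by simp
  have \<epsilon>: "\<epsilon> > 0" unfolding \<epsilon>_def using aw by (intro divide_pos_pos) auto
  have "\<epsilon> * real_of_int (pairing m0 w) \<le> \<epsilon> * (\<bar>real_of_int (pairing m0 w)\<bar> + 1)"
    using \<epsilon> by (intro mult_left_mono) auto
  also have "\<dots> = - (a \<bullet> real_vec w) / 2" by (simp add: \<epsilon>_def field_simps)
  also have "\<dots> < - (a \<bullet> real_vec w)" using aw by simp
  finally have w': "\<epsilon> * real_of_int (pairing m0 w) < - (a \<bullet> real_vec w)" .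
  \<comment> \<open>Negativity at \<open>w\<close> is positivity at \<open>- w\<close>, so a single
    rounding serves all conditions. The generator 0 is left out, as no functional is positive
    there.\<close>
  have "\<exists>m. \<forall>z\<in>insert (- w) (S - {0}). pairing m z > 0"
  proof (rule integer_approximation[where a = "a + \<epsilon> *\<^sub>R real_vec m0"])
    fix z assume "z \<in> insert (- w) (S - {0})"
    then consider "z = - w" | "z \<in> S" "z \<noteq> 0" by auto
    then show "(a + \<epsilon> *\<^sub>R real_vec m0) \<bullet> real_vec z > 0"
    proof cases
      case 1
      then show ?thesis using w' by (simp add: inner_add_left real_vec_simps real_vec_inner)
    next
      case 2
      then have "a \<bullet> real_vec z \<ge> 0" by (intro nn hull_inc) auto
      moreover have "\<epsilon> * real_of_int (pairing m0 z) > 0" using \<epsilon> m0 2 by simp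
      ultimately show ?thesis by (simp add: inner_add_left real_vec_inner)
    qed
  qed (use assms in auto)
  then obtain m where m: "pairing m (- w) > 0" "\<And>s. s \<in> S - {0} \<Longrightarrow> pairing m s > 0" by auto
  have "pairing m s \<ge> 0" if "s \<in> S" for s
    using m(2)[of s] that by (cases "s = 0") (auto simp: pairing_simps)
  moreover have "pairing m w < 0" using m(1) by (simp add: pairing_def sum_negf)
  ultimately show ?thesis by blast
qed

lemma dual_monoid_submonoid: "submonoid (dual_monoid \<tau>)"
  by unfold_locales (auto simp: dual_monoid_def real_vec_simps inner_add_left)

lemma perp_lattice_closed:
  "0 \<in> perp_lattice \<tau>"
  "m \<in> perp_lattice \<tau> \<Longrightarrow> m' \<in> perp_lattice \<tau> \<Longrightarrow> m + m' \<in> perp_lattice \<tau>"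
  "m \<in> perp_lattice \<tau> \<Longrightarrow> m' \<in> perp_lattice \<tau> \<Longrightarrow> m - m' \<in> perp_lattice \<tau>"
  "m \<in> perp_lattice \<tau> \<Longrightarrow> - m \<in> perp_lattice \<tau>"
  by (auto simp: perp_lattice_def real_vec_simps inner_add_left inner_diff_left)

lemma perp_dual: "m \<in> perp_lattice \<tau> \<Longrightarrow> m \<in> dual_monoid \<tau>"
  by (simp add: perp_lattice_dual)

lemma dual_zero: "0 \<in> dual_monoid \<tau>"
  using perp_dual perp_lattice_closed(1) .

lemma dual_add: "m \<in> dual_monoid \<tau> \<Longrightarrow> m' \<in> dual_monoid \<tau> \<Longrightarrow> m + m' \<in> dual_monoid \<tau>"
  using submonoid.add_mem[OF dual_monoid_submonoid] .

text \<open>Nonnegative values add up to 0 only if both are 0: the units form a face of the dual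
  monoid. This is what makes extension of a homomorphism by 0 multiplicative.\<close>

lemma perp_sum_iff:
  assumes "m \<in> dual_monoid \<tau>" "m' \<in> dual_monoid \<tau>"
  shows "m + m' \<in> perp_lattice \<tau> \<longleftrightarrow> m \<in> perp_lattice \<tau> \<and> m' \<in> perp_lattice \<tau>"
proof
  assume *: "m + m' \<in> perp_lattice \<tau>"
  have "real_vec m \<bullet> v = 0 \<and> real_vec m' \<bullet> v = 0" if v: "v \<in> \<tau>" for v
  proof -
    have "real_vec m \<bullet> v \<ge> 0" "real_vec m' \<bullet> v \<ge> 0" using assms v by (auto simp: dual_monoid_def)
    moreover have "real_vec m \<bullet> v + real_vec m' \<bullet> v = 0"
      using * v by (auto simp: perp_lattice_def real_vec_simps inner_add_left)
    ultimately show ?thesis by linarith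
  qed
  then show "m \<in> perp_lattice \<tau> \<and> m' \<in> perp_lattice \<tau>" by (auto simp: perp_lattice_def)
qed (auto intro: perp_lattice_closed)

lemma dual_monoid_antimono: "\<tau> \<subseteq> \<sigma> \<Longrightarrow> dual_monoid \<sigma> \<subseteq> dual_monoid \<tau>"
  by (auto simp: dual_monoid_def)

lemma perp_lattice_antimono: "\<tau> \<subseteq> \<sigma> \<Longrightarrow> perp_lattice \<sigma> \<subseteq> perp_lattice \<tau>"
  by (auto simp: perp_lattice_def)

lemma dual_monoid_zero [simp]: "dual_monoid {0} = UNIV"
  by (auto simp: dual_monoid_def)

lemma perp_lattice_zero [simp]: "perp_lattice {0} = UNIV"
  by (auto simp: perp_lattice_def)

lemma coordinate_ring_eq: "coordinate_ring \<sigma> = semigroup_algebra (dual_monoid \<sigma>)"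
  by (simp add: coordinate_ring_def semigroup_algebra_def)

lemmas coordinate_ring_mult = submonoid.algebra_mult[OF dual_monoid_submonoid, folded coordinate_ring_eq]
lemmas coordinate_ring_one = submonoid.algebra_one[OF dual_monoid_submonoid, folded coordinate_ring_eq]
lemmas coordinate_ring_power = submonoid.algebra_power[OF dual_monoid_submonoid, folded coordinate_ring_eq]
lemmas coordinate_ring_add = semigroup_algebra_add[of _ "dual_monoid \<sigma>" for \<sigma>, folded coordinate_ring_eq]
lemmas coordinate_ring_diff = semigroup_algebra_diff[of _ "dual_monoid \<sigma>" for \<sigma>, folded coordinate_ring_eq]
lemmas coordinate_ring_sum = semigroup_algebra_sum[of _ _ "dual_monoid \<sigma>" for \<sigma>, folded coordinate_ring_eq]

lemma coordinate_ring_simps [simp]: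
  "0 \<in> coordinate_ring \<sigma>" "single m c \<in> coordinate_ring \<sigma> \<longleftrightarrow> c = 0 \<or> m \<in> dual_monoid \<sigma>"
  "coordinate_ring {0} = UNIV"
  by (auto simp: coordinate_ring_def)

lemma coordinate_ring_mono: "\<tau> \<subseteq> \<sigma> \<Longrightarrow> coordinate_ring \<sigma> \<subseteq> coordinate_ring \<tau>"
  using dual_monoid_antimono[of \<tau> \<sigma>] by (auto simp: coordinate_ring_def)

definition ray_cone :: "int^'n \<Rightarrow> (real^'n) set" where
  "ray_cone u = {c *\<^sub>R real_vec u | c. c \<ge> 0}"

lemma dim_ray_cone:
  assumes "u \<noteq> 0"
  shows "dim (ray_cone u) = 1"
proof -
  have "ray_cone u \<subseteq> span {real_vec u}" by (auto simp: ray_cone_def span_singleton)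
  then have "dim (ray_cone u) \<le> dim {real_vec u}" using dim_subset dim_span by metis
  moreover have "{real_vec u} \<subseteq> ray_cone u" by (auto simp: ray_cone_def intro: exI[of _ 1])
  then have "dim {real_vec u} \<le> dim (ray_cone u)" by (rule dim_subset)
  moreover have "dim {real_vec u} = 1" using assms by (simp add: dim_singleton real_vec_simps)
  ultimately show ?thesis by simp
qed

text \<open>The functional \<open>m\<close> certifies primitivity of \<open>u\<close>: a lattice
  point c u has the integral coefficient c = <m, c u>.\<close>

lemma ray_generator_ray_cone:
  assumes "pairing m u = 1"
  shows "ray_generator (ray_cone u) = u"
proof -
  have eq: "{v. real_vec v \<in> ray_cone u} = range (\<lambda>k::nat. int k *s u)"
  proof (intro equalityI subsetI)
    fix v assume "v \<in> {v. real_vec v \<in> ray_cone u}"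
    then obtain c where c: "c \<ge> 0" "real_vec v = c *\<^sub>R real_vec u" by (auto simp: ray_cone_def)
    then have "real_vec m \<bullet> real_vec v = c * (real_vec m \<bullet> real_vec u)" by simp
    then have c': "c = of_int (pairing m v)" using assms by (simp add: real_vec_inner)
    then have "real_vec v = real_vec (pairing m v *s u)" using c(2) by (simp add: real_vec_simps)
    then have "v = pairing m v *s u" by (simp add: real_vec_simps(6))
    moreover have "pairing m v \<ge> 0" using c(1) c' by simp
    ultimately have "v = int (nat (pairing m v)) *s u" by simp
    then show "v \<in> range (\<lambda>k::nat. int k *s u)" by (rule range_eqI)
  qed (auto simp: ray_cone_def real_vec_simps)
  show ?thesis
    unfolding ray_generator_def
  proof (rule the_equality)
    show "{v. real_vec v \<in> ray_cone u} = range (\<lambda>k::nat. int k *s u)" by (rule eq)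
    fix u' assume "{v. real_vec v \<in> ray_cone u} = range (\<lambda>k::nat. int k *s u')"
    then have r: "range (\<lambda>k::nat. int k *s u') = range (\<lambda>k::nat. int k *s u)" using eq by simp
    have "u' \<in> range (\<lambda>k::nat. int k *s u)" unfolding r[symmetric] by (rule range_eqI[of _ _ 1]) simp
    then obtain k where k: "u' = int k *s u" by auto
    have "u \<in> range (\<lambda>k::nat. int k *s u')" unfolding r by (rule range_eqI[of _ _ 1]) simp
    then obtain l where l: "u = int l *s u'" by auto
    have "1 = int l * int k" using arg_cong[OF l, of "pairing m"] unfolding k by (simp only: pairing_simps assms mult_1_right)
    then have "int k = 1" using zmult_eq_1_iff[of "int l" "int k"] by linarith
    then have "k = 1" by linarith
    then show "u' = u" using k by simp
  qed
qed

text \<open>The cone \<open>\<tau>\<close> is generated by the \<open>w i\<close> with \<open>i \<in> I\<close>, which are part of the lattice basis \<open>w\<close>;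
  the conditions below describe it in terms of the dual basis \<open>g\<close>.\<close>

definition smooth_frame :: "(real^'n) set \<Rightarrow> 'n set \<Rightarrow> ('n \<Rightarrow> int^'n) \<Rightarrow> ('n \<Rightarrow> int^'n) \<Rightarrow> bool" where
  "smooth_frame \<tau> I g w \<longleftrightarrow> dual_bases g w \<and>
     \<tau> = {v. (\<forall>i\<in>I. real_vec (g i) \<bullet> v \<ge> 0) \<and> (\<forall>i. i \<notin> I \<longrightarrow> real_vec (g i) \<bullet> v = 0)}"

lemma smooth_frame_pairing: "smooth_frame \<tau> I g w \<Longrightarrow> pairing (g i) (w j) = (if i = j then 1 else 0)"
  by (simp add: smooth_frame_def dual_bases_def)

lemma smooth_frame_mem: "smooth_frame \<tau> I g w \<Longrightarrow> i \<in> I \<Longrightarrow> real_vec (w i) \<in> \<tau>"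
  by (auto simp: smooth_frame_def dual_bases_def real_vec_inner)

lemma smooth_frame_dual:
  assumes "smooth_frame \<tau> I g w"
  shows "m \<in> dual_monoid \<tau> \<longleftrightarrow> (\<forall>i\<in>I. pairing m (w i) \<ge> 0)"
proof
  assume "m \<in> dual_monoid \<tau>"
  then have "real_vec m \<bullet> real_vec (w i) \<ge> 0" if "i \<in> I" for i
    using smooth_frame_mem[OF assms that] by (auto simp: dual_monoid_def)
  then show "\<forall>i\<in>I. pairing m (w i) \<ge> 0" by (simp add: real_vec_inner)
next
  assume nn: "\<forall>i\<in>I. pairing m (w i) \<ge> 0"
  have db: "dual_bases g w" using assms by (simp add: smooth_frame_def)
  have "real_vec m \<bullet> v \<ge> 0" if v: "v \<in> \<tau>" for v
  proof -
    have "real_vec m \<bullet> v = real_vec m \<bullet> (\<Sum>i\<in>UNIV. (real_vec (g i) \<bullet> v) *\<^sub>R real_vec (w i))"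
      using dual_bases_expand(2)[OF db, of v] by simp
    also have "\<dots> = (\<Sum>i\<in>UNIV. (real_vec (g i) \<bullet> v) * real_of_int (pairing m (w i)))"
      by (simp add: inner_sum_right real_vec_inner)
    also have "\<dots> \<ge> 0"
    proof (rule sum_nonneg)
      fix i
      show "(real_vec (g i) \<bullet> v) * real_of_int (pairing m (w i)) \<ge> 0"
        using v nn assms by (cases "i \<in> I") (auto simp: smooth_frame_def)
    qed
    finally show ?thesis .
  qed
  then show "m \<in> dual_monoid \<tau>" by (simp add: dual_monoid_def)
qed

lemma smooth_frame_perp:
  assumes "smooth_frame \<tau> I g w"
  shows "m \<in> perp_lattice \<tau> \<longleftrightarrow> (\<forall>i\<in>I. pairing m (w i) = 0)"
  unfolding perp_lattice_dual smooth_frame_dual[OF assms] by (fastforce simp: pairing_simps)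

section \<open>Points, charts and the Zariski topology\<close>

text \<open>The translate by \<open>t\<close> of the distinguished point of the orbit of \<tau>,
  whose homomorphism is 1 on the units and 0 elsewhere.\<close>

definition pt :: "(real^'n) set \<Rightarrow> complex^'n \<Rightarrow> 'n point" where
  "pt \<tau> t = (\<tau>, \<lambda>m. if m \<in> perp_lattice \<tau> then character m t else 0)"

definition basic_open :: "(real^'n) set set \<Rightarrow> (real^'n) set \<Rightarrow> (int^'n \<Rightarrow>\<^sub>0 complex) \<Rightarrow> 'n point set" where
  "basic_open \<Sigma> \<sigma> b = {p \<in> chart \<Sigma> \<sigma>. eval_at b p \<noteq> 0}"

lemma pt_in_variety:
  assumes "\<tau> \<in> \<Sigma>" "t \<in> torus"
  shows "pt \<tau> t \<in> toric_variety \<Sigma>"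
  using assms character_nonzero[OF assms(2)]
  by (auto simp: pt_def toric_variety_def perp_sum_iff character_add perp_lattice_closed)

lemma chart_iff: "p \<in> chart \<Sigma> \<sigma> \<longleftrightarrow> p \<in> toric_variety \<Sigma> \<and> fst p face_of \<sigma>"
  by (simp add: chart_def)

lemma point_value_add:
  assumes "p \<in> toric_variety \<Sigma>" "m \<in> dual_monoid (fst p)" "m' \<in> dual_monoid (fst p)"
  shows "snd p (m + m') = snd p m * snd p m'"
  using assms by (auto simp: toric_variety_def case_prod_beta)

lemma point_value_0: "p \<in> toric_variety \<Sigma> \<Longrightarrow> snd p 0 = 1"
  by (auto simp: toric_variety_def case_prod_beta)

lemma point_value_nonzero: "p \<in> toric_variety \<Sigma> \<Longrightarrow> snd p m \<noteq> 0 \<longleftrightarrow> m \<in> perp_lattice (fst p)"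
  by (auto simp: toric_variety_def case_prod_beta)

lemma point_value_eq_0: "p \<in> toric_variety \<Sigma> \<Longrightarrow> snd p m = 0 \<longleftrightarrow> m \<notin> perp_lattice (fst p)"
  using point_value_nonzero by blast

lemma variety_cone: "p \<in> toric_variety \<Sigma> \<Longrightarrow> fst p \<in> \<Sigma>"
  by (auto simp: toric_variety_def)

lemma eval_at_simps [simp]:
  "eval_at 0 p = 0" "eval_at (f + g) p = eval_at f p + eval_at g p"
  "eval_at (f - g) p = eval_at f p - eval_at g p" "eval_at (- f) p = - eval_at f p"
  "eval_at (single m c) p = c * snd p m"
  by (simp_all add: eval_at_lev lev_add lev_diff lev_uminus)

lemma eval_at_sum: "eval_at (\<Sum>i\<in>A. f i) p = (\<Sum>i\<in>A. eval_at (f i) p)"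
  by (simp add: eval_at_lev lev_sum)

lemma eval_at_one: "p \<in> toric_variety \<Sigma> \<Longrightarrow> eval_at 1 p = 1"
  by (simp add: eval_at_lev point_value_0)

lemma eval_at_mult:
  assumes "p \<in> toric_variety \<Sigma>" "f \<in> coordinate_ring (fst p)" "g \<in> coordinate_ring (fst p)"
  shows "eval_at (f * g) p = eval_at f p * eval_at g p"
  unfolding eval_at_lev
  using assms by (intro lev_mult[of _ "dual_monoid (fst p)"])
    (auto simp: coordinate_ring_def intro: point_value_add)

lemma eval_at_power:
  assumes "p \<in> toric_variety \<Sigma>" "f \<in> coordinate_ring (fst p)"
  shows "eval_at (f ^ k) p = eval_at f p ^ k"
  by (induction k) (use assms in \<open>auto simp: eval_at_one eval_at_mult coordinate_ring_power\<close>)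

lemma chart_coordinate_ring:
  assumes "p \<in> chart \<Sigma> \<sigma>"
  shows "coordinate_ring \<sigma> \<subseteq> coordinate_ring (fst p)"
  using assms by (intro coordinate_ring_mono) (auto simp: chart_iff face_of_imp_subset)

lemma chart_eval_at_mult:
  assumes "p \<in> chart \<Sigma> \<sigma>" "f \<in> coordinate_ring \<sigma>" "g \<in> coordinate_ring \<sigma>"
  shows "eval_at (f * g) p = eval_at f p * eval_at g p"
  using assms chart_coordinate_ring[OF assms(1)] by (intro eval_at_mult[of _ \<Sigma>]) (auto simp: chart_iff)

lemma chart_eval_at_power:
  assumes "p \<in> chart \<Sigma> \<sigma>" "f \<in> coordinate_ring \<sigma>"
  shows "eval_at (f ^ k) p = eval_at f p ^ k"
  using assms chart_coordinate_ring[OF assms(1)] by (intro eval_at_power[of _ \<Sigma>]) (auto simp: chart_iff)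

lemma basic_open_mult:
  assumes "f \<in> coordinate_ring \<sigma>" "g \<in> coordinate_ring \<sigma>"
  shows "basic_open \<Sigma> \<sigma> (f * g) = basic_open \<Sigma> \<sigma> f \<inter> basic_open \<Sigma> \<sigma> g"
  using assms by (auto simp: basic_open_def chart_eval_at_mult)

lemma basic_open_face_subset:
  assumes "p \<in> chart \<Sigma> \<sigma>"
  shows "basic_open \<Sigma> (fst p) b \<subseteq> basic_open \<Sigma> \<sigma> b"
  using assms face_of_trans by (auto simp: basic_open_def chart_iff)

lemma openin_basic_open:
  assumes "\<sigma> \<in> \<Sigma>" "b \<in> coordinate_ring \<sigma>"
  shows "openin (zariski \<Sigma>) (basic_open \<Sigma> \<sigma> b)"
  unfolding zariski_def basic_open_def using assms by (intro topology_generated_by_Basis) auto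

locale toric =
  fixes \<Sigma> :: "(real^'n) set set"
  assumes fan: "fan \<Sigma>"
begin

abbreviation "X \<equiv> toric_variety \<Sigma>"
abbreviation "T \<equiv> open_torus \<Sigma>"
abbreviation "R \<equiv> (coordinate_ring :: (real^'n) set \<Rightarrow> _)"
abbreviation "D \<equiv> basic_open \<Sigma>"

lemma cone_generators:
  assumes "\<tau> \<in> \<Sigma>"
  obtains S where "finite S" "\<tau> = convex_cone hull (real_vec ` S)"
proof -
  have "rational_polyhedral_cone \<tau>" using assms fan by (simp add: fan_def)
  then show thesis using that unfolding rational_polyhedral_cone_def by blast
qed

lemma cone_convex_cone: "\<tau> \<in> \<Sigma> \<Longrightarrow> convex_cone \<tau>"
  by (elim cone_generators) (simp add: convex_cone_convex_cone_hull)

lemma cone_strongly_convex: "\<tau> \<in> \<Sigma> \<Longrightarrow> strongly_convex \<tau>"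
  using fan by (auto simp: fan_def)

lemma cone_convex: "\<tau> \<in> \<Sigma> \<Longrightarrow> convex \<tau>"
  using cone_convex_cone by (auto simp: convex_cone_def)

lemma face_in_fan: "\<sigma> \<in> \<Sigma> \<Longrightarrow> \<tau> face_of \<sigma> \<Longrightarrow> \<tau> \<noteq> {} \<Longrightarrow> \<tau> \<in> \<Sigma>"
  using fan by (auto simp: fan_def)

lemma face_refl: "\<tau> \<in> \<Sigma> \<Longrightarrow> \<tau> face_of \<tau>"
  by (intro face_of_refl cone_convex)

lemma self_chart: "p \<in> X \<Longrightarrow> p \<in> chart \<Sigma> (fst p)"
  by (simp add: chart_iff face_refl variety_cone)

lemma zero_face:
  assumes "\<tau> \<in> \<Sigma>"
  shows "{0} face_of \<tau>"
  unfolding face_of_def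
proof (intro conjI ballI impI)
  note cc = cone_convex_cone[OF assms]
  show "{0} \<subseteq> \<tau>" using convex_cone_contains_0[OF cc] by simp
  fix a b x assume ab: "a \<in> \<tau>" "b \<in> \<tau>" and x: "x \<in> {0}" "x \<in> open_segment a b"
  then obtain u where u: "0 < u" "u < 1" "0 = (1 - u) *\<^sub>R a + u *\<^sub>R b" by (auto simp: in_segment)
  have 1: "(1 - u) *\<^sub>R a \<in> \<tau>" "u *\<^sub>R b \<in> \<tau>" using u ab by (auto intro!: convex_cone_scaleR[OF cc])
  have 2: "- ((1 - u) *\<^sub>R a) = u *\<^sub>R b" "- (u *\<^sub>R b) = (1 - u) *\<^sub>R a"
    using u(3) by (simp_all add: eq_neg_iff_add_eq_0 minus_unique add.commute)
  have "(1 - u) *\<^sub>R a = 0" "u *\<^sub>R b = 0"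
    using cone_strongly_convex[OF assms] 1 2 unfolding strongly_convex_def by metis+
  then show "a \<in> {0}" "b \<in> {0}" using u by auto
qed auto

lemma zero_in_fan: "{0} \<in> \<Sigma>"
proof -
  obtain \<sigma> where "\<sigma> \<in> \<Sigma>" using fan by (auto simp: fan_def)
  then show ?thesis using zero_face face_in_fan by blast
qed

text \<open>Half of the sum is the midpoint of \<open>a\<close> and \<open>b\<close>, which is
  interior to their segment unless they coincide. In this form the face condition applies directly
  to sums of generators.\<close>

lemma face_add:
  assumes \<tau>: "\<tau> \<in> \<Sigma>" and F: "F face_of \<tau>" and ab: "a \<in> \<tau>" "b \<in> \<tau>" "a + b \<in> F"
  shows "a \<in> F"
proof -
  have "F \<in> \<Sigma>" using face_in_fan[OF \<tau> F] ab(3) by auto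
  then have cc: "convex_cone F" by (rule cone_convex_cone)
  have mid: "midpoint a b \<in> F"
    using ab(3) unfolding midpoint_def by (intro convex_cone_scaleR[OF cc]) auto
  show ?thesis
  proof (cases "a = b")
    case True
    with mid show ?thesis by simp
  next
    case False
    then have "midpoint a b \<in> open_segment a b" by simp
    then show ?thesis using F ab(1,2) mid unfolding face_of_def by blast
  qed
qed

lemma T_iff: "q \<in> T \<longleftrightarrow> q \<in> X \<and> fst q = {0}"
  by (simp add: orbit_def)

lemma T_chart: "\<sigma> \<in> \<Sigma> \<Longrightarrow> q \<in> T \<Longrightarrow> q \<in> chart \<Sigma> \<sigma>"
  by (simp add: chart_iff T_iff zero_face)

lemma chart_zero: "chart \<Sigma> {0} = T"
proof (intro equalityI subsetI)
  fix q assume "q \<in> chart \<Sigma> {0}"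
  then have q: "q \<in> X" "fst q face_of {0}" by (auto simp: chart_iff)
  from face_of_imp_subset[OF q(2)] have "fst q \<subseteq> {0}" .
  moreover have "0 \<in> fst q" using convex_cone_contains_0[OF cone_convex_cone[OF variety_cone[OF q(1)]]] .
  ultimately have "fst q = {0}" by blast
  then show "q \<in> T" using q(1) by (simp add: T_iff)
next
  fix q assume "q \<in> T"
  then show "q \<in> chart \<Sigma> {0}" using T_chart[OF zero_in_fan] by blast
qed

lemma T_mult: "q \<in> T \<Longrightarrow> eval_at (f * g) q = eval_at f q * eval_at g q"
  by (rule eval_at_mult) (auto simp: T_iff)

lemma T_power: "q \<in> T \<Longrightarrow> eval_at (f ^ k) q = eval_at f q ^ k"
  by (rule eval_at_power) (auto simp: T_iff)

lemma T_value_nonzero: "q \<in> T \<Longrightarrow> snd q m \<noteq> 0"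
  by (simp add: point_value_nonzero[of q \<Sigma>] T_iff)

lemma T_value_add: "q \<in> T \<Longrightarrow> snd q (m + m') = snd q m * snd q m'"
  by (rule point_value_add) (auto simp: T_iff)

lemma pt_T: "t \<in> torus \<Longrightarrow> pt {0} t \<in> T"
  using pt_in_variety[OF zero_in_fan, of t] by (simp add: T_iff pt_def)

text \<open>The bridge from functions on \<open>T\<close> to the boundary: an equation valid on the
  torus becomes an identity in \<complex>[M] and can then be evaluated at boundary points.\<close>

lemma laurent_eq_0:
  assumes "\<And>q. q \<in> T \<Longrightarrow> eval_at f q = 0"
  shows "f = 0"
proof -
  have "\<forall>m\<in>keys f. lookup f m = 0"
  proof (rule characters_independent)
    fix t :: "complex^'n" assume "t \<in> torus"
    then show "(\<Sum>m\<in>keys f. lookup f m * character m t) = 0"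
      using assms[OF pt_T] by (simp add: eval_at_def pt_def)
  qed simp
  then show ?thesis by (auto simp: in_keys_iff intro!: poly_mapping_eqI)
qed

text \<open>A function on any chart through \<open>p\<close> is also one on the smallest chart, that
  of \<open>fst p\<close>, and shrinking the chart shrinks the basic open set. Neighbourhoods of
  \<open>p\<close> can thus always be taken of the form \<open>D (fst p) b\<close>.\<close>

lemma openin_zariski_iff:
  "openin (zariski \<Sigma>) V \<longleftrightarrow> V \<subseteq> X \<and> (\<forall>p\<in>V. \<exists>b\<in>R (fst p). eval_at b p \<noteq> 0 \<and> D (fst p) b \<subseteq> V)"
proof
  assume "openin (zariski \<Sigma>) V"
  then have "generate_topology_on {{p \<in> chart \<Sigma> \<sigma>. eval_at f p \<noteq> 0} | \<sigma> f. \<sigma> \<in> \<Sigma> \<and> f \<in> R \<sigma>} V"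
    unfolding zariski_def by (rule openin_topology_generated_by)
  then show "V \<subseteq> X \<and> (\<forall>p\<in>V. \<exists>b\<in>R (fst p). eval_at b p \<noteq> 0 \<and> D (fst p) b \<subseteq> V)"
  proof induction
    case (Int A B)
    have "\<exists>b\<in>R (fst p). eval_at b p \<noteq> 0 \<and> D (fst p) b \<subseteq> A \<inter> B" if p: "p \<in> A \<inter> B" for p
    proof -
      obtain a b where ab: "a \<in> R (fst p)" "eval_at a p \<noteq> 0" "D (fst p) a \<subseteq> A"
        "b \<in> R (fst p)" "eval_at b p \<noteq> 0" "D (fst p) b \<subseteq> B" using Int p by blast
      then have "D (fst p) (a * b) \<subseteq> A \<inter> B" by (auto simp: basic_open_mult)
      moreover have "eval_at (a * b) p \<noteq> 0" using ab Int p by (subst eval_at_mult[of _ \<Sigma>]) auto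
      ultimately show ?thesis using ab coordinate_ring_mult by blast
    qed
    then show ?case using Int by blast
  next
    case (UN K)
    show ?case
    proof (intro conjI ballI)
      show "\<Union>K \<subseteq> X" using UN by blast
      fix p assume "p \<in> \<Union>K"
      then obtain k where k: "k \<in> K" "p \<in> k" by blast
      with UN obtain b where "b \<in> R (fst p)" "eval_at b p \<noteq> 0" "D (fst p) b \<subseteq> k" by blast
      then show "\<exists>b\<in>R (fst p). eval_at b p \<noteq> 0 \<and> D (fst p) b \<subseteq> \<Union>K" using k(1) by blast
    qed
  next
    case (Basis s)
    then obtain \<sigma> f where s: "\<sigma> \<in> \<Sigma>" "f \<in> R \<sigma>" "s = D \<sigma> f" by (auto simp: basic_open_def)
    show ?case
    proof (intro conjI ballI)
      show "s \<subseteq> X" by (auto simp: s basic_open_def chart_iff)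
      fix p assume "p \<in> s"
      then have p: "p \<in> chart \<Sigma> \<sigma>" "eval_at f p \<noteq> 0" by (auto simp: s basic_open_def)
      then show "\<exists>b\<in>R (fst p). eval_at b p \<noteq> 0 \<and> D (fst p) b \<subseteq> s"
        using s chart_coordinate_ring[OF p(1)] basic_open_face_subset[OF p(1), of f]
        by (intro bexI[of _ f]) auto
    qed
  qed simp
next
  assume V: "V \<subseteq> X \<and> (\<forall>p\<in>V. \<exists>b\<in>R (fst p). eval_at b p \<noteq> 0 \<and> D (fst p) b \<subseteq> V)"
  show "openin (zariski \<Sigma>) V"
  proof (subst openin_subopen, intro ballI)
    fix p assume p: "p \<in> V"
    then obtain b where b: "b \<in> R (fst p)" "eval_at b p \<noteq> 0" "D (fst p) b \<subseteq> V" using V by blast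
    have pX: "p \<in> X" using p V by blast
    have "openin (zariski \<Sigma>) (D (fst p) b)" using b pX by (intro openin_basic_open variety_cone)
    moreover have "p \<in> D (fst p) b" using b self_chart[OF pX] by (simp add: basic_open_def)
    ultimately show "\<exists>T. openin (zariski \<Sigma>) T \<and> p \<in> T \<and> T \<subseteq> V" using b by blast
  qed
qed

lemma open_nbhd:
  assumes "openin (zariski \<Sigma>) V" "p \<in> V"
  obtains b where "b \<in> R (fst p)" "eval_at b p \<noteq> 0" "D (fst p) b \<subseteq> V"
  using assms openin_zariski_iff by blast

lemma openin_chart: "\<sigma> \<in> \<Sigma> \<Longrightarrow> openin (zariski \<Sigma>) (chart \<Sigma> \<sigma>)"
proof -
  assume "\<sigma> \<in> \<Sigma>"
  moreover have "D \<sigma> 1 = chart \<Sigma> \<sigma>" by (auto simp: basic_open_def chart_iff eval_at_one)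
  ultimately show ?thesis using openin_basic_open[of \<sigma> \<Sigma> 1] coordinate_ring_one by metis
qed

lemma openin_T: "openin (zariski \<Sigma>) T"
  using openin_chart[OF zero_in_fan] chart_zero by simp

lemma eval_pt:
  "eval_at f (pt \<tau> t) = (\<Sum>m\<in>keys f \<inter> perp_lattice \<tau>. lookup f m * character m t)"
  unfolding eval_at_def by (rule sum.mono_neutral_cong_right) (auto simp: pt_def)

text \<open>On the orbit of \<tau> only monomials with exponents in \<tau>^\<bottom> survive, and
  these restrict to independent characters.\<close>

lemma vanishing_on_orbit:
  assumes "\<And>t. t \<in> torus \<Longrightarrow> eval_at f (pt \<tau> t) = 0"
  shows "keys f \<inter> perp_lattice \<tau> = {}"
proof -
  have "\<forall>m\<in>keys f \<inter> perp_lattice \<tau>. lookup f m = 0"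
    by (rule characters_independent) (use assms in \<open>auto simp: eval_pt\<close>)
  then show ?thesis by (auto simp: in_keys_iff)
qed

text \<open>The chart of \<open>fst q\<close> is a neighbourhood of \<open>q\<close> that meets only
  orbits of faces of \<open>fst q\<close>. Conversely, if \<rho> is a face, a function
  \<open>b\<close> vanishing on the orbit of \<rho> has no exponents in \<rho>^\<bottom>, hence none
  in the smaller group (fst q)^\<bottom>, and so vanishes at \<open>q\<close>.\<close>

lemma toric_divisor_iff:
  assumes \<rho>: "\<rho> \<in> \<Sigma>"
  shows "q \<in> toric_divisor \<Sigma> \<rho> \<longleftrightarrow> q \<in> X \<and> \<rho> face_of fst q"
proof
  assume q: "q \<in> toric_divisor \<Sigma> \<rho>"
  have "q \<in> topspace (zariski \<Sigma>)" using q by (simp add: toric_divisor_def in_closure_of)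
  then have qX: "q \<in> X" using openin_topspace[of "zariski \<Sigma>"] unfolding openin_zariski_iff by blast
  have "openin (zariski \<Sigma>) (chart \<Sigma> (fst q))" using qX by (intro openin_chart variety_cone)
  then obtain r where "r \<in> orbit \<Sigma> \<rho>" "r \<in> chart \<Sigma> (fst q)"
    using q self_chart[OF qX] by (auto simp: toric_divisor_def in_closure_of)
  then show "q \<in> X \<and> \<rho> face_of fst q" using qX by (auto simp: orbit_def chart_iff)
next
  assume q: "q \<in> X \<and> \<rho> face_of fst q"
  have "\<exists>r. r \<in> orbit \<Sigma> \<rho> \<and> r \<in> V" if V: "openin (zariski \<Sigma>) V" "q \<in> V" for V
  proof -
    obtain b where b: "b \<in> R (fst q)" "eval_at b q \<noteq> 0" "D (fst q) b \<subseteq> V" using open_nbhd[OF V] .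
    have "\<exists>t\<in>torus. eval_at b (pt \<rho> t) \<noteq> 0"
    proof (rule ccontr)
      assume *: "\<not> ?thesis"
      then have "keys b \<inter> perp_lattice \<rho> = {}" by (intro vanishing_on_orbit) blast
      then have "m \<notin> perp_lattice (fst q)" if "m \<in> keys b" for m
        using that q perp_lattice_antimono[of \<rho> "fst q"] by (auto simp: in_keys_iff face_of_imp_subset)
      then have "eval_at b q = 0"
        unfolding eval_at_def using q by (intro sum.neutral) (auto simp: point_value_eq_0[of q \<Sigma>])
      then show False using b(2) by simp
    qed
    then obtain t where t: "t \<in> torus" "eval_at b (pt \<rho> t) \<noteq> 0" by blast
    have "pt \<rho> t \<in> orbit \<Sigma> \<rho>" using pt_in_variety[OF \<rho> t(1)] by (simp add: orbit_def pt_def)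
    moreover have "pt \<rho> t \<in> D (fst q) b"
      using pt_in_variety[OF \<rho> t(1)] q t(2) by (simp add: basic_open_def chart_iff) (simp add: pt_def)
    ultimately show ?thesis using b(3) by blast
  qed
  moreover have "q \<in> topspace (zariski \<Sigma>)"
    using q openin_subset[OF openin_chart[OF variety_cone]] self_chart by blast
  ultimately show "q \<in> toric_divisor \<Sigma> \<rho>" by (auto simp: toric_divisor_def in_closure_of)
qed

subsection \<open>Smooth cones\<close>

text \<open>Strong convexity makes the dual monoid generate \<open>M\<close>, so \<open>A\<close>
  and \<open>B\<close> together are at most n generators of \<open>M\<close>, hence a basis. Duality
  then shows that the dual vectors belonging to \<open>A\<close> generate \<tau>.\<close>

lemma smooth_frame_of_generators:
  assumes \<tau>: "\<tau> \<in> \<Sigma>" and fin: "finite A" "finite B" and card: "card (A \<union> B) \<le> CARD('n)"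
    and A: "A \<subseteq> dual_monoid \<tau> - perp_lattice \<tau>" and B: "B \<subseteq> perp_lattice \<tau>" "perp_lattice \<tau> \<subseteq> zspan B"
    and gen: "\<And>m. m \<in> dual_monoid \<tau> \<Longrightarrow> \<exists>c p. p \<in> perp_lattice \<tau> \<and> m = (\<Sum>a\<in>A. int (c a) *s a) + p"
  shows "\<exists>g w. smooth_frame \<tau> {i. g i \<in> A} g (w :: 'n \<Rightarrow> int^'n) \<and> range g = A \<union> B"
proof -
  obtain S where S: "finite S" "\<tau> = convex_cone hull (real_vec ` S)" using cone_generators[OF \<tau>] .
  have sc: "strongly_convex (convex_cone hull (real_vec ` S))" using cone_strongly_convex[OF \<tau>] S by simp
  have sub: "dual_monoid \<tau> \<subseteq> zspan (A \<union> B)"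
  proof
    fix m assume "m \<in> dual_monoid \<tau>"
    then obtain c p where cp: "p \<in> perp_lattice \<tau>" "m = (\<Sum>a\<in>A. int (c a) *s a) + p" using gen by blast
    have "(\<Sum>a\<in>A. int (c a) *s a) \<in> zspan (A \<union> B)"
      using fin by (intro zspan_sum zspan_smult zspan_base) auto
    moreover have "p \<in> zspan (A \<union> B)" using zspan_mono[of "A \<union> B" B] fin B cp by auto
    ultimately show "m \<in> zspan (A \<union> B)" unfolding cp(2) by (rule zspan_add)
  qed
  have "zspan (A \<union> B) = UNIV"
  proof (intro equalityI subsetI UNIV_I)
    fix m :: "int^'n"
    obtain m0 where m0: "\<And>s. s \<in> S \<Longrightarrow> s \<noteq> 0 \<Longrightarrow> pairing m0 s > 0"
      using strict_functional[OF S(1) sc] by blast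
    \<comment> \<open>Adding k times the strictly positive \<open>m0\<close> moves an arbitrary
      \<open>m\<close> into the dual monoid, which exhibits \<open>m\<close> as a difference of two
      of its elements.\<close>
    define k where "k = (\<Sum>s\<in>S. \<bar>pairing m s\<bar>)"
    have k: "\<bar>pairing m s\<bar> \<le> k" if "s \<in> S" for s
      unfolding k_def using S(1) that by (intro member_le_sum) auto
    have "pairing (m + k *s m0) s \<ge> 0" if s: "s \<in> S" for s
    proof (cases "s = 0")
      case False
      have k0: "k \<ge> 0" unfolding k_def by (intro sum_nonneg) auto
      have "k * 1 \<le> k * pairing m0 s" using m0[OF s False] k0 by (intro mult_left_mono) auto
      then show ?thesis using k[OF s] by (simp add: pairing_simps)
    qed (simp add: pairing_simps)
    then have "m + k *s m0 \<in> dual_monoid \<tau>" by (simp add: S(2) dual_monoid_hull)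
    moreover have "m0 \<in> dual_monoid \<tau>"
      unfolding S(2) dual_monoid_hull
    proof
      fix s assume "s \<in> S"
      then show "0 \<le> pairing m0 s" using m0[of s] by (cases "s = 0") (auto simp: pairing_simps)
    qed
    ultimately have "(m + k *s m0) - k *s m0 \<in> zspan (A \<union> B)"
      using sub by (intro zspan_diff zspan_smult) auto
    then show "m \<in> zspan (A \<union> B)" by simp
  qed
  then obtain g w where gw: "range g = A \<union> B" "dual_bases g (w :: 'n \<Rightarrow> int^'n)"
    using dual_bases_of_generators[of "A \<union> B"] fin card by auto
  note d = gw(2)[unfolded dual_bases_def, rule_format]
  define I where "I = {i. g i \<in> A}"
  have perp0: "pairing p (w i) = 0" if p: "p \<in> perp_lattice \<tau>" and "i \<in> I" for p i
  proof -
    obtain c where c: "p = (\<Sum>b\<in>B. c b *s b)" using subsetD[OF B(2) p] unfolding zspan_def by blast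
    have "pairing b (w i) = 0" if b: "b \<in> B" for b
    proof -
      obtain j where j: "b = g j" using gw(1) b by blast
      have "g j \<noteq> g i" using A B(1) b j \<open>i \<in> I\<close> by (auto simp: I_def)
      then show ?thesis using d j by auto
    qed
    then show ?thesis by (simp add: c pairing_sum pairing_simps)
  qed
  have wpos: "pairing m (w i) \<ge> 0" if m: "m \<in> dual_monoid \<tau>" and i: "i \<in> I" for m i
  proof -
    obtain c p where cp: "p \<in> perp_lattice \<tau>" "m = (\<Sum>a\<in>A. int (c a) *s a) + p" using gen[OF m] by blast
    have "pairing a (w i) \<ge> 0" if a: "a \<in> A" for a
    proof -
      have "a \<in> range g" using gw(1) a by simp
      then obtain j where "a = g j" by (rule rangeE)
      then show ?thesis by (simp add: d)
    qed
    then show ?thesis using perp0[OF cp(1) i]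
      by (auto simp: cp(2) pairing_simps pairing_sum intro!: sum_nonneg mult_nonneg_nonneg)
  qed
  \<comment> \<open>The vector \<open>w i\<close> is nonnegative on the whole dual monoid, so by
    biduality it lies in the cone.\<close>
  have wmem: "real_vec (w i) \<in> \<tau>" if "i \<in> I" for i
  proof (rule ccontr)
    assume "real_vec (w i) \<notin> \<tau>"
    then obtain m where "\<forall>s\<in>S. pairing m s \<ge> 0" "pairing m (w i) < 0"
      using dual_separation[OF S(1) sc] S(2) by blast
    moreover from this have "m \<in> dual_monoid \<tau>" by (simp add: S(2) dual_monoid_hull)
    ultimately show False using wpos[OF _ that] by force
  qed
  have "\<tau> = {v. (\<forall>i\<in>I. real_vec (g i) \<bullet> v \<ge> 0) \<and> (\<forall>i. i \<notin> I \<longrightarrow> real_vec (g i) \<bullet> v = 0)}"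
  proof (intro equalityI subsetI)
    fix v assume v: "v \<in> \<tau>"
    have "real_vec (g i) \<bullet> v \<ge> 0" if "i \<in> I" for i
    proof -
      have "g i \<in> dual_monoid \<tau>" using that A by (auto simp: I_def)
      then show ?thesis using v by (simp add: dual_monoid_def)
    qed
    moreover have "real_vec (g i) \<bullet> v = 0" if "i \<notin> I" for i
    proof -
      have "g i \<in> perp_lattice \<tau>" using that B(1) gw(1) by (auto simp: I_def)
      then show ?thesis using v by (simp add: perp_lattice_def)
    qed
    ultimately show "v \<in> {v. (\<forall>i\<in>I. real_vec (g i) \<bullet> v \<ge> 0) \<and> (\<forall>i. i \<notin> I \<longrightarrow> real_vec (g i) \<bullet> v = 0)}"
      by simp
  next
    fix v assume v: "v \<in> {v. (\<forall>i\<in>I. real_vec (g i) \<bullet> v \<ge> 0) \<and> (\<forall>i. i \<notin> I \<longrightarrow> real_vec (g i) \<bullet> v = 0)}"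
    note cc = cone_convex_cone[OF \<tau>]
    have "(\<Sum>i\<in>UNIV. (real_vec (g i) \<bullet> v) *\<^sub>R real_vec (w i)) \<in> \<tau>"
    proof (rule convex_cone_sum[OF cc])
      fix i
      show "(real_vec (g i) \<bullet> v) *\<^sub>R real_vec (w i) \<in> \<tau>"
        using v wmem by (cases "i \<in> I") (auto intro: convex_cone_scaleR[OF cc] convex_cone_contains_0[OF cc])
    qed
    then show "v \<in> \<tau>" using dual_bases_expand(2)[OF gw(2), of v] by simp
  qed
  then have "smooth_frame \<tau> I g w" using gw(2) by (simp add: smooth_frame_def)
  then show ?thesis using gw(1) by (auto simp: I_def)
qed

text \<open>The ray of \<open>w i\<close> is the face of \<tau> on which all other dual coordinates
  vanish.\<close>

lemma smooth_frame_ray: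
  assumes \<tau>: "\<tau> \<in> \<Sigma>" and sf: "smooth_frame \<tau> I g w" and i: "i \<in> I"
  shows "ray_cone (w i) \<in> rays_of_cone \<Sigma> \<tau>" "ray_generator (ray_cone (w i)) = w i"
proof -
  have db: "dual_bases g w" using sf by (simp add: smooth_frame_def)
  note d = db[unfolded dual_bases_def, rule_format]
  have gi: "pairing (g i) (w i) = 1" by (simp add: d)
  then show "ray_generator (ray_cone (w i)) = w i" by (rule ray_generator_ray_cone)
  have mem: "a \<in> ray_cone (w i)" if a: "a \<in> \<tau>" "\<And>j. j \<noteq> i \<Longrightarrow> real_vec (g j) \<bullet> a = 0" for a
  proof -
    have "a = (\<Sum>j\<in>UNIV. (real_vec (g j) \<bullet> a) *\<^sub>R real_vec (w j))" by (rule dual_bases_expand(2)[OF db])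
    also have "\<dots> = (\<Sum>j\<in>{i}. (real_vec (g j) \<bullet> a) *\<^sub>R real_vec (w j))"
      using a(2) by (intro sum.mono_neutral_right) auto
    finally have "a = (real_vec (g i) \<bullet> a) *\<^sub>R real_vec (w i)" by simp
    moreover have "real_vec (g i) \<bullet> a \<ge> 0" using a(1) sf i by (auto simp: smooth_frame_def)
    ultimately show ?thesis by (auto simp: ray_cone_def)
  qed
  have "ray_cone (w i) face_of \<tau>"
    unfolding face_of_def
  proof (intro conjI ballI impI)
    show "ray_cone (w i) \<subseteq> \<tau>"
      using smooth_frame_mem[OF sf i] by (auto simp: ray_cone_def intro!: convex_cone_scaleR[OF cone_convex_cone[OF \<tau>]])
    have "convex_cone (ray_cone (w i))"
      unfolding convex_cone_iff
    proof (intro conjI ballI allI impI)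
      show "0 \<in> ray_cone (w i)" by (auto simp: ray_cone_def)
      fix x assume "x \<in> ray_cone (w i)"
      then obtain c where c: "c \<ge> 0" "x = c *\<^sub>R real_vec (w i)" by (auto simp: ray_cone_def)
      show "x + y \<in> ray_cone (w i)" if "y \<in> ray_cone (w i)" for y
      proof -
        from that obtain b where "b \<ge> 0" "y = b *\<^sub>R real_vec (w i)" by (auto simp: ray_cone_def)
        then have "0 \<le> c + b \<and> x + y = (c + b) *\<^sub>R real_vec (w i)" using c by (simp add: scaleR_add_left)
        then show ?thesis unfolding ray_cone_def by blast
      qed
      show "b *\<^sub>R x \<in> ray_cone (w i)" if "0 \<le> b" for b
      proof -
        have "0 \<le> b * c \<and> b *\<^sub>R x = (b * c) *\<^sub>R real_vec (w i)" using c that by simp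
        then show ?thesis unfolding ray_cone_def by blast
      qed
    qed
    then show "convex (ray_cone (w i))" by (simp add: convex_cone_def)
    fix a b x assume ab: "a \<in> \<tau>" "b \<in> \<tau>" and x: "x \<in> ray_cone (w i)" "x \<in> open_segment a b"
    then obtain u where u: "0 < u" "u < 1" "x = (1 - u) *\<^sub>R a + u *\<^sub>R b" by (auto simp: in_segment)
    have "real_vec (g j) \<bullet> a = 0 \<and> real_vec (g j) \<bullet> b = 0" if j: "j \<noteq> i" for j
    proof -
      have nn: "real_vec (g j) \<bullet> a \<ge> 0" "real_vec (g j) \<bullet> b \<ge> 0"
        using ab sf by (cases "j \<in> I"; auto simp: smooth_frame_def)+
      have "real_vec (g j) \<bullet> x = 0" using x(1) j by (auto simp: ray_cone_def real_vec_inner d)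
      then have "(1 - u) * (real_vec (g j) \<bullet> a) + u * (real_vec (g j) \<bullet> b) = 0"
        using u(3) by (simp add: inner_add_right)
      then have "(1 - u) * (real_vec (g j) \<bullet> a) = 0 \<and> u * (real_vec (g j) \<bullet> b) = 0"
        using nn u by (smt (verit) mult_nonneg_nonneg)
      then show ?thesis using u by auto
    qed
    then show "a \<in> ray_cone (w i)" "b \<in> ray_cone (w i)" using mem ab by auto
  qed
  moreover have "w i \<noteq> 0" using gi by (auto simp: pairing_simps)
  then have "dim (ray_cone (w i)) = 1" by (rule dim_ray_cone)
  moreover from calculation have "ray_cone (w i) \<in> \<Sigma>"
    by (intro face_in_fan[OF \<tau>]) (auto simp: ray_cone_def)
  ultimately show "ray_cone (w i) \<in> rays_of_cone \<Sigma> \<tau>" by (simp add: rays_of_cone_def rays_def)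
qed

text \<open>A nonzero integral generator \<open>s\<close> is divided by the gcd d of its
  coordinates. Obtaining d as the generator of the group of all values <m, s> provides at once an
  \<open>m\<close> with <m, s> = d, that is, <m, u> = 1.\<close>

lemma ray_structure:
  assumes "\<rho> \<in> rays \<Sigma>"
  obtains u m where "\<rho> = ray_cone u" "pairing m u = 1"
proof -
  from assms have \<rho>: "\<rho> \<in> \<Sigma>" "dim \<rho> = 1" by (auto simp: rays_def)
  note cc = cone_convex_cone[OF \<rho>(1)]
  obtain S where S: "finite S" "\<rho> = convex_cone hull (real_vec ` S)" using cone_generators[OF \<rho>(1)] .
  have "\<exists>s\<in>S. s \<noteq> 0"
  proof (rule ccontr)
    assume "\<not> ?thesis"
    then have "real_vec ` S \<subseteq> {0}" by (auto simp: real_vec_simps)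
    then have "\<rho> \<subseteq> {0}" unfolding S(2) by (rule hull_minimal) simp
    then have "dim \<rho> = 0" using dim_eq_0[of \<rho>] by simp
    then show False using \<rho>(2) by simp
  qed
  then obtain s where s: "s \<in> S" "s \<noteq> 0" by blast
  then have s\<rho>: "real_vec s \<in> \<rho>" unfolding S(2) by (auto intro: hull_inc)
  have "dim {real_vec s} = 1" using s by (simp add: dim_singleton real_vec_simps)
  then have "span {real_vec s} = span \<rho>" using s\<rho> \<rho>(2) by (intro dim_eq_span) auto
  then have "v \<in> range (\<lambda>k. k *\<^sub>R real_vec s)" if "v \<in> \<rho>" for v
    using that span_superset[of \<rho>] by (auto simp: span_singleton)
  moreover have "k \<ge> 0" if k: "k *\<^sub>R real_vec s \<in> \<rho>" for k
  proof (rule ccontr)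
    assume "\<not> k \<ge> 0"
    then have "- (k *\<^sub>R real_vec s) \<in> \<rho>" using convex_cone_scaleR[OF cc _ s\<rho>, of "- k"] by simp
    then have "k *\<^sub>R real_vec s = 0" using k cone_strongly_convex[OF \<rho>(1)] by (auto simp: strongly_convex_def)
    then show False using \<open>\<not> k \<ge> 0\<close> s by (auto simp: real_vec_simps)
  qed
  ultimately have \<rho>s: "\<rho> = ray_cone s"
    using convex_cone_scaleR[OF cc _ s\<rho>] by (fastforce simp: ray_cone_def)
  define G where "G = range (\<lambda>m. pairing m s)"
  have "\<exists>d\<in>G. G = range ((*) d)"
  proof (rule int_subgroup)
    show "0 \<in> G" unfolding G_def by (rule range_eqI[of _ _ 0]) (simp add: pairing_simps)
    show "a - b \<in> G" if "a \<in> G" "b \<in> G" for a b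
      using that unfolding G_def by (auto simp: pairing_simps(3)[symmetric])
  qed
  then obtain m0 where m0: "G = range ((*) (pairing m0 s))" by (auto simp: G_def)
  have axis: "pairing (axis i 1) s = s $ i" for i
    by (simp add: pairing_def axis_def if_distrib[of "\<lambda>x. x * _"] cong: if_cong)
  \<comment> \<open>The sign is chosen so that d is nonnegative and division by it does not leave
    the ray.\<close>
  define m where "m = (if pairing m0 s \<ge> 0 then m0 else - m0)"
  define d where "d = pairing m s"
  have d0: "d \<ge> 0" "d = pairing m0 s \<or> d = - pairing m0 s" by (auto simp: d_def m_def pairing_simps)
  have dvd: "d dvd s $ i" for i
  proof -
    have "s $ i \<in> G" unfolding G_def axis[symmetric] by blast
    then have "pairing m0 s dvd s $ i" unfolding m0 by auto
    then show ?thesis using d0(2) by auto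
  qed
  define u where "u = (\<chi> i. s $ i div d)"
  have su: "s = d *s u" using dvd by (simp add: u_def vec_eq_iff)
  then have d: "d > 0" using s(2) d0(1) by (cases "d = 0") auto
  have "d = d * pairing m u" using arg_cong[OF su, of "pairing m"] by (simp add: d_def[symmetric] pairing_simps)
  then have mu: "pairing m u = 1" using d by simp
  have "ray_cone s = ray_cone u"
  proof (intro equalityI subsetI)
    fix v assume "v \<in> ray_cone s"
    then obtain c where "c \<ge> 0" "v = c *\<^sub>R real_vec s" by (auto simp: ray_cone_def)
    then show "v \<in> ray_cone u" using d
      by (auto simp: ray_cone_def su real_vec_simps intro!: exI[of _ "c * of_int d"])
  next
    fix v assume "v \<in> ray_cone u"
    then obtain c where "c \<ge> 0" "v = c *\<^sub>R real_vec u" by (auto simp: ray_cone_def)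
    then show "v \<in> ray_cone s" using d
      by (auto simp: ray_cone_def su real_vec_simps intro!: exI[of _ "c / of_int d"])
  qed
  then show thesis using that[OF _ mu] \<rho>s by simp
qed

text \<open>\<open>v\<close> is a sum of nonnegative multiples of the \<open>w j\<close>, and a face
  that contains a sum of elements of the cone contains the summands; the multiple of
  \<open>w i\<close> is then rescaled.\<close>

lemma face_component:
  assumes \<tau>: "\<tau> \<in> \<Sigma>" and sf: "smooth_frame \<tau> I g w" and F: "F face_of \<tau>" and v: "v \<in> F"
    and nz: "real_vec (g i) \<bullet> v \<noteq> 0"
  shows "i \<in> I" "real_vec (w i) \<in> F"
proof -
  have v\<tau>: "v \<in> \<tau>" using F v face_of_imp_subset by blast
  then show iI: "i \<in> I" using nz sf by (auto simp: smooth_frame_def)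
  have db: "dual_bases g w" using sf by (simp add: smooth_frame_def)
  note cc = cone_convex_cone[OF \<tau>]
  have F\<Sigma>: "F \<in> \<Sigma>" using face_in_fan[OF \<tau> F] v by auto
  define c where "c = real_vec (g i) \<bullet> v"
  have c: "c > 0" using nz iI v\<tau> sf by (force simp: smooth_frame_def c_def)
  have tm: "(real_vec (g j) \<bullet> v) *\<^sub>R real_vec (w j) \<in> \<tau>" for j
    using v\<tau> sf smooth_frame_mem[OF sf, of j]
    by (cases "j \<in> I") (auto simp: smooth_frame_def[of \<tau>] intro: convex_cone_scaleR[OF cc] convex_cone_contains_0[OF cc])
  have "c *\<^sub>R real_vec (w i) \<in> F"
  proof (rule face_add[OF \<tau> F])
    show "c *\<^sub>R real_vec (w i) \<in> \<tau>" using tm[of i] by (simp add: c_def)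
    show "(\<Sum>j\<in>UNIV - {i}. (real_vec (g j) \<bullet> v) *\<^sub>R real_vec (w j)) \<in> \<tau>"
      by (intro convex_cone_sum[OF cc] tm)
    have "c *\<^sub>R real_vec (w i) + (\<Sum>j\<in>UNIV - {i}. (real_vec (g j) \<bullet> v) *\<^sub>R real_vec (w j))
        = (\<Sum>j\<in>UNIV. (real_vec (g j) \<bullet> v) *\<^sub>R real_vec (w j))"
      by (subst sum.remove[of UNIV i]) (auto simp: c_def)
    then show "c *\<^sub>R real_vec (w i) + (\<Sum>j\<in>UNIV - {i}. (real_vec (g j) \<bullet> v) *\<^sub>R real_vec (w j)) \<in> F"
      using v dual_bases_expand(2)[OF db, of v] by simp
  qed
  then have "(1 / c) *\<^sub>R (c *\<^sub>R real_vec (w i)) \<in> F"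
    using c by (intro convex_cone_scaleR[OF cone_convex_cone[OF F\<Sigma>] _ \<open>c *\<^sub>R real_vec (w i) \<in> F\<close>]) simp
  moreover have "(1 / c) *\<^sub>R (c *\<^sub>R real_vec (w i)) = real_vec (w i)" using c by simp
  ultimately show "real_vec (w i) \<in> F" by (simp only:)
qed

lemma smooth_frame_rays:
  assumes \<tau>: "\<tau> \<in> \<Sigma>" and sf: "smooth_frame \<tau> I g w" and \<rho>: "\<rho> \<in> rays_of_cone \<Sigma> \<tau>"
  shows "\<exists>i\<in>I. \<rho> = ray_cone (w i)"
proof -
  have db: "dual_bases g w" using sf by (simp add: smooth_frame_def)
  from \<rho> have r: "\<rho> \<in> rays \<Sigma>" "\<rho> face_of \<tau>" by (auto simp: rays_of_cone_def)
  obtain u m where u: "\<rho> = ray_cone u" "pairing m u = 1" using ray_structure[OF r(1)] .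
  have u\<rho>: "real_vec u \<in> \<rho>" by (auto simp: u ray_cone_def intro: exI[of _ 1])
  then have u\<tau>: "real_vec u \<in> \<tau>" using r(2) face_of_imp_subset by blast
  have expand: "real_vec u = (\<Sum>i\<in>UNIV. (real_vec (g i) \<bullet> real_vec u) *\<^sub>R real_vec (w i))"
    by (rule dual_bases_expand(2)[OF db])
  have "u \<noteq> 0" using u(2) by (auto simp: pairing_simps)
  have "\<exists>i. real_vec (g i) \<bullet> real_vec u \<noteq> 0"
  proof (rule ccontr)
    assume "\<not> ?thesis"
    then have "real_vec u = 0" using expand by simp
    then show False using \<open>u \<noteq> 0\<close> by (simp add: real_vec_simps)
  qed
  then obtain i where i: "real_vec (g i) \<bullet> real_vec u \<noteq> 0" by blast
  have iI: "i \<in> I" and wi: "real_vec (w i) \<in> \<rho>" using face_component[OF \<tau> sf r(2) u\<rho> i] .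
  obtain k where k: "k \<ge> 0" "real_vec (w i) = k *\<^sub>R real_vec u" using wi by (auto simp: u ray_cone_def)
  have "w i \<noteq> 0" using smooth_frame_pairing[OF sf, of i i] by (auto simp: pairing_simps)
  then have k0: "k > 0" using k by (cases "k = 0") (auto simp: real_vec_simps)
  have uw: "real_vec u = (1 / k) *\<^sub>R real_vec (w i)" using k k0 by simp
  have "ray_cone u = ray_cone (w i)"
  proof (intro equalityI subsetI)
    fix v assume "v \<in> ray_cone u"
    then obtain b where "b \<ge> 0" "v = b *\<^sub>R real_vec u" by (auto simp: ray_cone_def)
    then show "v \<in> ray_cone (w i)" using k0 unfolding ray_cone_def uw
      by (auto intro!: exI[of _ "b * (1 / k)"])
  next
    fix v assume "v \<in> ray_cone (w i)"
    then obtain b where "b \<ge> 0" "v = b *\<^sub>R real_vec (w i)" by (auto simp: ray_cone_def)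
    then show "v \<in> ray_cone u" using k0 unfolding ray_cone_def k(2)
      by (auto intro!: exI[of _ "b * k"])
  qed
  then show ?thesis using u(1) iI by blast
qed

lemma zero_smooth: "\<exists>g w. smooth_frame {0} {} g (w :: 'n \<Rightarrow> int^'n)"
proof -
  define g where "g i = (axis i 1 :: int^'n)" for i
  have "dual_bases g g"
    by (auto simp: dual_bases_def g_def pairing_def axis_def if_distrib[of "\<lambda>x. x * _"] cong: if_cong)
  moreover have "real_vec (g i) \<bullet> v = v $ i" for i v
    by (simp add: g_def real_vec_def inner_vec_def axis_def if_distrib[of "\<lambda>x. x * _"] if_distrib[of of_int] cong: if_cong)
  then have "{0} = {v. \<forall>i. real_vec (g i) \<bullet> v = 0}" by (auto simp: vec_eq_iff)
  ultimately show ?thesis by (auto simp: smooth_frame_def)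
qed

text \<open>A functional \<open>m1\<close> with value 1 on the primitive generator splits
  \<open>M\<close> into its multiples and the lattice u^\<bottom>. So every ray is generated by part
  of a lattice basis, whatever the rest of the fan.\<close>

lemma ray_smooth:
  assumes "\<rho> \<in> rays \<Sigma>"
  shows "\<exists>i g w. smooth_frame \<rho> {i} g (w :: 'n \<Rightarrow> int^'n)"
proof -
  obtain u m1 where u: "\<rho> = ray_cone u" "pairing m1 u = 1" using ray_structure[OF assms] .
  have \<rho>: "\<rho> \<in> \<Sigma>" using assms by (simp add: rays_def)
  have dual: "m \<in> dual_monoid \<rho> \<longleftrightarrow> pairing m u \<ge> 0" for m
  proof
    assume "m \<in> dual_monoid \<rho>"
    moreover have "real_vec u \<in> \<rho>" by (auto simp: u ray_cone_def intro: exI[of _ 1])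
    ultimately have "real_vec m \<bullet> real_vec u \<ge> 0" by (simp add: dual_monoid_def)
    then show "pairing m u \<ge> 0" by (simp add: real_vec_inner)
  qed (simp add: dual_monoid_def u ray_cone_def real_vec_inner, fastforce simp: real_vec_inner)
  have perp: "m \<in> perp_lattice \<rho> \<longleftrightarrow> pairing m u = 0" for m
    unfolding perp_lattice_dual dual by (auto simp: pairing_simps)
  have "\<exists>B v. finite B \<and> B \<subseteq> perp_lattice \<rho> \<and> perp_lattice \<rho> \<subseteq> zspan B \<and>
      (\<forall>b\<in>B. \<forall>b'\<in>B. cpair b' (v b) = (if b = b' then 1 else 0))"
    by (rule lattice_basis) (fact perp_lattice_closed)+
  then obtain B v where B: "finite B" "B \<subseteq> perp_lattice \<rho>" "perp_lattice \<rho> \<subseteq> zspan B"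
    and Bv: "\<forall>b\<in>B. \<forall>b'\<in>B. cpair b' (v b) = (if b = b' then 1 else 0)"
    by (elim exE conjE)
  have m1B: "m1 \<notin> B" using B(2) perp u(2) by auto
  \<comment> \<open>Dual system for \<open>m1\<close> and \<open>B\<close>: the generator itself
    vanishes on \<open>B\<close>, and the dual vectors of \<open>B\<close> are corrected to vanish
    at \<open>m1\<close>.\<close>
  define e where "e l = (if l = m1 then complex_vec u else v l - cpair m1 (v l) *s complex_vec u)" for l
  have "card ({m1} \<union> B) \<le> CARD('n)"
  proof (rule card_le_of_dual[where h = "\<lambda>k i. of_int (k $ i)" and e = "\<lambda>l i. e l $ i" and d = "\<lambda>_. 1"])
    fix k l assume kl: "k \<in> {m1} \<union> B" "l \<in> {m1} \<union> B"
    have Bu: "pairing b u = 0" if "b \<in> B" for b using that B(2) perp by auto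
    have "cpair k (e l) = (if k = l then 1 else 0)"
      using kl Bv m1B u(2) Bu by (auto simp: e_def cpair_simps)
    then show "(\<Sum>i\<in>UNIV. of_int (k $ i) * e l $ i) = (if k = l then 1 else 0)" by (simp add: cpair_def)
  qed (use B in auto)
  then have "\<exists>g w. smooth_frame \<rho> {i. g i \<in> {m1}} g (w :: 'n \<Rightarrow> int^'n) \<and> range g = {m1} \<union> B"
  proof (intro smooth_frame_of_generators[OF \<rho>] B)
    show "{m1} \<subseteq> dual_monoid \<rho> - perp_lattice \<rho>" using u(2) by (simp add: dual perp)
    fix m assume m: "m \<in> dual_monoid \<rho>"
    show "\<exists>c p. p \<in> perp_lattice \<rho> \<and> m = (\<Sum>a\<in>{m1}. int (c a) *s a) + p"
      using m u(2) by (intro exI[of _ "\<lambda>_. nat (pairing m u)"] exI[of _ "m - pairing m u *s m1"])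
        (auto simp: dual perp pairing_simps)
  qed auto
  then obtain g w where gw: "smooth_frame \<rho> {i. g i = m1} g (w :: 'n \<Rightarrow> int^'n)" "range g = {m1} \<union> B" by auto
  then obtain i where i: "g i = m1" by (metis UnI1 imageE singletonI)
  have ji: "j = i" if "g j = m1" for j
    using that i smooth_frame_pairing[OF gw(1), of i i] smooth_frame_pairing[OF gw(1), of j i] by (auto split: if_splits)
  have "{j. g j = m1} = {i}" by (intro equalityI subsetI) (simp_all add: i ji)
  then show ?thesis using gw(1) by auto
qed

end

subsection \<open>Vectors of Laurent polynomials\<close>

definition vcomp :: "'e \<Rightarrow> (int^'n \<Rightarrow>\<^sub>0 complex^'e) \<Rightarrow> (int^'n \<Rightarrow>\<^sub>0 complex)" where
  "vcomp i e = Poly_Mapping.map (\<lambda>v. v $ i) e"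

lemma lookup_vcomp [simp]: "lookup (vcomp i e) m = lookup e m $ i"
  by (simp add: vcomp_def Poly_Mapping.map.rep_eq when_def)

lemma keys_vcomp: "keys (vcomp i e) \<subseteq> keys e"
  by (auto simp: in_keys_iff)

lemma vcomp_eqI: "(\<And>i. vcomp i e = vcomp i e') \<Longrightarrow> e = e'"
  by (rule poly_mapping_eqI) (metis lookup_vcomp vec_eq_iff)

lemma vcomp_add: "vcomp i (e + e') = vcomp i e + vcomp i e'"
  by (rule poly_mapping_eqI) (simp add: lookup_add)

lemma vcomp_zero [simp]: "vcomp i 0 = 0"
  by (rule poly_mapping_eqI) simp

lemma vcomp_single [simp]: "vcomp i (single m v) = single m (v $ i)"
  by (rule poly_mapping_eqI) (simp add: lookup_single when_def)

lemma vcomp_sum: "vcomp i (\<Sum>j\<in>A. e j) = (\<Sum>j\<in>A. vcomp i (e j))"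
  by (induction A rule: infinite_finite_induct) (auto simp: vcomp_add)

lemma eval_vec_at_nth: "eval_vec_at e p $ i = eval_at (vcomp i e) p"
proof -
  have "eval_at (vcomp i e) p = (\<Sum>m\<in>keys e. lookup e m $ i * snd p m)"
    unfolding eval_at_lev by (subst lev_superset[OF _ keys_vcomp]) auto
  then show ?thesis by (simp add: eval_vec_at_def mult.commute)
qed

lemma eval_vec_at_add: "eval_vec_at (e + e') p = eval_vec_at e p + eval_vec_at e' p"
  by (simp add: vec_eq_iff eval_vec_at_nth vcomp_add)

text \<open>Scalar multiplication of \<complex>[M] on E \<otimes> \<complex>[M], written as a
  convolution because scalars and coefficients have different types.\<close>

definition vmult :: "(int^'n \<Rightarrow>\<^sub>0 complex) \<Rightarrow> (int^'n \<Rightarrow>\<^sub>0 complex^'e) \<Rightarrow> (int^'n \<Rightarrow>\<^sub>0 complex^'e)" where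
  "vmult b e = (\<Sum>m\<in>keys b. \<Sum>m'\<in>keys e. single (m + m') (lookup b m *s lookup e m'))"

lemma vcomp_vmult: "vcomp i (vmult b e) = b * vcomp i e"
proof -
  have "vcomp i e = (\<Sum>m\<in>keys e. single m (lookup e m $ i))"
    by (subst poly_mapping_expand[of e]) (simp add: vcomp_sum)
  then have "b * vcomp i e = (\<Sum>m\<in>keys b. single m (lookup b m)) * (\<Sum>m\<in>keys e. single m (lookup e m $ i))"
    using poly_mapping_expand[of b] by simp
  then show ?thesis
    by (simp add: vmult_def vcomp_sum sum_product mult_single)
qed

lemma lookup_vmult:
  "lookup (vmult b e) m =
    (\<Sum>m1\<in>keys b. \<Sum>m2\<in>keys e. if m1 + m2 = m then lookup b m1 *s lookup e m2 else 0)"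
  by (simp add: vmult_def lookup_sum lookup_single when_def)

context toric
begin

lemma eval_vec_at_vmult: "q \<in> T \<Longrightarrow> eval_vec_at (vmult b e) q = eval_at b q *s eval_vec_at e q"
  by (simp add: vec_eq_iff eval_vec_at_nth vcomp_vmult T_mult)

lemma laurent_vec_eq:
  assumes "\<And>q. q \<in> T \<Longrightarrow> eval_vec_at e q = eval_vec_at e' q"
  shows "e = e'"
proof (rule vcomp_eqI)
  fix i
  have "vcomp i e - vcomp i e' = 0"
    by (rule laurent_eq_0) (simp add: eval_vec_at_nth[symmetric] assms)
  then show "vcomp i e = vcomp i e'" by simp
qed

subsection \<open>Regular functions\<close>

text \<open>A local fraction whose denominator also cuts out the neighbourhood on which it is valid,
  so that the pair \<open>a\<close>, \<open>b\<close> contains all the data.\<close>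

definition rep :: "'n point set \<Rightarrow> ('n point \<Rightarrow> complex) \<Rightarrow> 'n point \<Rightarrow>
    (int^'n \<Rightarrow>\<^sub>0 complex) \<Rightarrow> (int^'n \<Rightarrow>\<^sub>0 complex) \<Rightarrow> bool" where
  "rep V f p a b \<longleftrightarrow> a \<in> R (fst p) \<and> b \<in> R (fst p) \<and> eval_at b p \<noteq> 0 \<and> D (fst p) b \<subseteq> V \<and>
     (\<forall>q\<in>D (fst p) b. f q = eval_at a q / eval_at b q)"

lemma open_subset: "openin (zariski \<Sigma>) V \<Longrightarrow> V \<subseteq> X"
  by (simp add: openin_zariski_iff)

lemma basic_open_self: "p \<in> X \<Longrightarrow> eval_at b p \<noteq> 0 \<Longrightarrow> p \<in> D (fst p) b"
  using self_chart by (simp add: basic_open_def)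

lemma basic_open_ring: "q \<in> D \<sigma> b \<Longrightarrow> a \<in> R \<sigma> \<Longrightarrow> a \<in> R (fst q)"
  using chart_coordinate_ring[of q \<Sigma> \<sigma>] by (auto simp: basic_open_def)

lemma basic_open_X: "q \<in> D \<sigma> b \<Longrightarrow> q \<in> X"
  by (simp add: basic_open_def chart_iff)

lemma basic_open_eval: "q \<in> D \<sigma> b \<Longrightarrow> eval_at b q \<noteq> 0"
  by (simp add: basic_open_def)

lemma basic_open_chart: "q \<in> D \<sigma> b \<Longrightarrow> q \<in> chart \<Sigma> \<sigma>"
  by (simp add: basic_open_def)

lemma D_mult: "q \<in> D \<sigma> b \<Longrightarrow> f \<in> R \<sigma> \<Longrightarrow> g \<in> R \<sigma> \<Longrightarrow> eval_at (f * g) q = eval_at f q * eval_at g q"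
  by (rule chart_eval_at_mult[OF basic_open_chart])

lemma D_nonzero: "q \<in> D \<sigma> b \<Longrightarrow> eval_at b q = 0 \<longleftrightarrow> False"
  by (simp add: basic_open_def)

lemma openin_D: "p \<in> X \<Longrightarrow> b \<in> R (fst p) \<Longrightarrow> openin (zariski \<Sigma>) (D (fst p) b)"
  by (intro openin_basic_open variety_cone)

lemma rep_mult:
  assumes "rep V f p a b" "c \<in> R (fst p)" "eval_at c p \<noteq> 0" "p \<in> X"
  shows "rep V f p (a * c) (b * c)"
  using assms
  by (auto simp: rep_def basic_open_mult coordinate_ring_mult eval_at_mult D_mult D_nonzero)

text \<open>Multiplying numerator and denominator by some \<open>c\<close> that cuts out a smaller
  neighbourhood moves the choice of neighbourhood into the denominator.\<close>

lemma regular_iff: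
  assumes V: "openin (zariski \<Sigma>) V"
  shows "f \<in> regular \<Sigma> V \<longleftrightarrow> f \<in> extensional V \<and> (\<forall>p\<in>V. \<exists>a b. rep V f p a b)"
proof (intro iffI conjI ballI)
  assume f: "f \<in> regular \<Sigma> V"
  then show "f \<in> extensional V" by (simp add: regular_def)
  fix p assume p: "p \<in> V"
  then have pX: "p \<in> X" using open_subset[OF V] by blast
  obtain \<sigma> W a b where *: "\<sigma> \<in> \<Sigma>" "W \<in> opens \<Sigma> (V \<inter> chart \<Sigma> \<sigma>)" "a \<in> R \<sigma>" "b \<in> R \<sigma>" "p \<in> W"
    "\<And>q. q \<in> W \<Longrightarrow> eval_at b q \<noteq> 0 \<and> f q = eval_at a q / eval_at b q"
    using f p unfolding regular_def by blast
  then have W: "openin (zariski \<Sigma>) W" "W \<subseteq> V" "W \<subseteq> chart \<Sigma> \<sigma>" by (auto simp: opens_def)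
  obtain c where c: "c \<in> R (fst p)" "eval_at c p \<noteq> 0" "D (fst p) c \<subseteq> W" using open_nbhd[OF W(1) *(5)] .
  have ab: "a \<in> R (fst p)" "b \<in> R (fst p)"
    using chart_coordinate_ring[of p \<Sigma> \<sigma>] * W by auto
  have "rep V f p (a * c) (b * c)"
    unfolding rep_def
  proof (intro conjI ballI)
    show "a * c \<in> R (fst p)" "b * c \<in> R (fst p)" using ab c by (auto intro: coordinate_ring_mult)
    show "eval_at (b * c) p \<noteq> 0" using *(5,6) ab c pX by (simp add: eval_at_mult)
    show "D (fst p) (b * c) \<subseteq> V" using c W ab by (auto simp: basic_open_mult)
    fix q assume q: "q \<in> D (fst p) (b * c)"
    then have "q \<in> D (fst p) c" using ab c by (simp add: basic_open_mult)
    moreover from this have "q \<in> W" using c by blast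
    ultimately show "f q = eval_at (a * c) q / eval_at (b * c) q"
      using * ab c basic_open_chart[OF q] by (simp add: chart_eval_at_mult basic_open_eval)
  qed
  then show "\<exists>a b. rep V f p a b" by blast
next
  assume f: "f \<in> extensional V \<and> (\<forall>p\<in>V. \<exists>a b. rep V f p a b)"
  show "f \<in> regular \<Sigma> V"
    unfolding regular_def
  proof (intro CollectI conjI ballI)
    show "f \<in> extensional V" using f by simp
    fix p assume p: "p \<in> V"
    then have pX: "p \<in> X" using open_subset[OF V] by blast
    obtain a b where "rep V f p a b" using f p by blast
    then have ab: "a \<in> R (fst p)" "b \<in> R (fst p)" "eval_at b p \<noteq> 0" "D (fst p) b \<subseteq> V"
      "\<And>q. q \<in> D (fst p) b \<Longrightarrow> f q = eval_at a q / eval_at b q" by (auto simp: rep_def)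
    show "\<exists>\<sigma>\<in>\<Sigma>. \<exists>W\<in>opens \<Sigma> (V \<inter> chart \<Sigma> \<sigma>). \<exists>a\<in>R \<sigma>. \<exists>b\<in>R \<sigma>. p \<in> W \<and>
        (\<forall>q\<in>W. eval_at b q \<noteq> 0 \<and> f q = eval_at a q / eval_at b q)"
    proof (rule bexI[of _ "fst p"], rule bexI[of _ "D (fst p) b"], rule bexI[of _ a], rule bexI[of _ b], intro conjI ballI)
      show "fst p \<in> \<Sigma>" using pX by (rule variety_cone)
      show "D (fst p) b \<in> opens \<Sigma> (V \<inter> chart \<Sigma> (fst p))"
        using ab openin_D[OF pX ab(2)] by (auto simp: opens_def basic_open_def)
      show "p \<in> D (fst p) b" using basic_open_self[OF pX ab(3)] .
    qed (use ab in \<open>auto simp: D_nonzero\<close>)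
  qed
qed

lemma regular_rep:
  assumes "openin (zariski \<Sigma>) V" "f \<in> regular \<Sigma> V" "p \<in> V"
  obtains a b where "rep V f p a b"
  using assms regular_iff by blast

lemma regular_ext: "f \<in> regular \<Sigma> V \<Longrightarrow> f \<in> extensional V"
  by (simp add: regular_def)

lemma rep_common:
  assumes V: "openin (zariski \<Sigma>) V" and p: "p \<in> V" and "finite K"
    and "\<And>k. k \<in> K \<Longrightarrow> f k \<in> regular \<Sigma> V"
  shows "\<exists>b a. b \<in> R (fst p) \<and> eval_at b p \<noteq> 0 \<and> D (fst p) b \<subseteq> V \<and> (\<forall>k\<in>K. rep V (f k) p (a k) b)"
  using assms(3,4)
proof (induction K)
  case empty
  obtain b where "b \<in> R (fst p)" "eval_at b p \<noteq> 0" "D (fst p) b \<subseteq> V" using open_nbhd[OF V p] .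
  then show ?case by auto
next
  case (insert x K)
  have pX: "p \<in> X" using open_subset[OF V] p by blast
  obtain b a where ba: "b \<in> R (fst p)" "eval_at b p \<noteq> 0" "D (fst p) b \<subseteq> V"
    "\<And>k. k \<in> K \<Longrightarrow> rep V (f k) p (a k) b" using insert by blast
  obtain a0 b0 where ab0: "rep V (f x) p a0 b0" using regular_rep[OF V insert.prems p, of x] by blast
  then have b0: "b0 \<in> R (fst p)" "eval_at b0 p \<noteq> 0" by (auto simp: rep_def)
  define a' where "a' k = (if k = x then a0 * b else a k * b0)" for k
  have "rep V (f k) p (a' k) (b * b0)" if "k \<in> insert x K" for k
  proof (cases "k = x")
    case True
    then show ?thesis using rep_mult[OF ab0 ba(1,2) pX] by (simp add: a'_def mult.commute)
  next
    case False
    then show ?thesis using rep_mult[OF ba(4) b0 pX] that by (simp add: a'_def)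
  qed
  moreover have "b * b0 \<in> R (fst p)" "eval_at (b * b0) p \<noteq> 0" "D (fst p) (b * b0) \<subseteq> V"
    using ba b0 pX by (auto simp: coordinate_ring_mult eval_at_mult basic_open_mult)
  ultimately show ?case by blast
qed

lemma regularI:
  assumes "openin (zariski \<Sigma>) V" "f \<in> extensional V" "\<And>p. p \<in> V \<Longrightarrow> \<exists>a b. rep V f p a b"
  shows "f \<in> regular \<Sigma> V"
  using assms regular_iff by blast

lemma regular_binop:
  assumes V: "openin (zariski \<Sigma>) V" and "f \<in> regular \<Sigma> V" "g \<in> regular \<Sigma> V"
  shows regular_add: "(\<lambda>q\<in>V. f q + g q) \<in> regular \<Sigma> V"
    and regular_mult: "(\<lambda>q\<in>V. f q * g q) \<in> regular \<Sigma> V"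
proof -
  have *: "\<exists>a c b. rep V f p a b \<and> rep V g p c b" if p: "p \<in> V" for p
  proof -
    have "\<exists>b a. b \<in> R (fst p) \<and> eval_at b p \<noteq> 0 \<and> D (fst p) b \<subseteq> V \<and>
        (\<forall>k\<in>UNIV. rep V (if k then f else g) p (a k) b)"
      by (rule rep_common[OF V p]) (use assms in auto)
    then obtain b a where "\<And>k :: bool. rep V (if k then f else g) p (a k) b" by blast
    from this[of True] this[of False] show ?thesis by auto
  qed
  have pX: "p \<in> X" if "p \<in> V" for p using open_subset[OF V] that by blast
  show "(\<lambda>q\<in>V. f q + g q) \<in> regular \<Sigma> V"
  proof (rule regularI[OF V])
    fix p assume p: "p \<in> V"
    obtain a c b where r: "rep V f p a b" "rep V g p c b" using *[OF p] by blast
    then have "rep V (\<lambda>q\<in>V. f q + g q) p (a + c) b"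
      by (auto simp: rep_def add_divide_distrib intro: coordinate_ring_add)
    then show "\<exists>a b. rep V (\<lambda>q\<in>V. f q + g q) p a b" by blast
  qed simp
  show "(\<lambda>q\<in>V. f q * g q) \<in> regular \<Sigma> V"
  proof (rule regularI[OF V])
    fix p assume p: "p \<in> V"
    obtain a c b where r: "rep V f p a b" "rep V g p c b" using *[OF p] by blast
    then have "rep V (\<lambda>q\<in>V. f q * g q) p (a * c) (b * b)"
      using pX[OF p] unfolding rep_def
      by (auto simp: coordinate_ring_mult eval_at_mult basic_open_mult D_mult)
    then show "\<exists>a b. rep V (\<lambda>q\<in>V. f q * g q) p a b" by blast
  qed simp
qed

lemma regular_eval:
  assumes V: "openin (zariski \<Sigma>) V" and "V \<subseteq> chart \<Sigma> \<sigma>" "f \<in> R \<sigma>"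
  shows "(\<lambda>q\<in>V. eval_at f q) \<in> regular \<Sigma> V"
proof (rule regularI[OF V])
  fix p assume p: "p \<in> V"
  then have f: "f \<in> R (fst p)" using chart_coordinate_ring[of p \<Sigma> \<sigma>] assms by blast
  obtain b where b: "b \<in> R (fst p)" "eval_at b p \<noteq> 0" "D (fst p) b \<subseteq> V" using open_nbhd[OF V p] .
  then have "rep V (\<lambda>q\<in>V. eval_at f q) p (f * b) b"
    using f by (auto simp: rep_def coordinate_ring_mult D_mult D_nonzero)
  then show "\<exists>a b. rep V (\<lambda>q\<in>V. eval_at f q) p a b" by blast
qed simp

lemma regular_const:
  assumes V: "openin (zariski \<Sigma>) V"
  shows "(\<lambda>q\<in>V. c) \<in> regular \<Sigma> V"
proof (rule regularI[OF V])
  fix p assume p: "p \<in> V"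
  obtain b where b: "b \<in> R (fst p)" "eval_at b p \<noteq> 0" "D (fst p) b \<subseteq> V" using open_nbhd[OF V p] .
  have "single 0 c * b \<in> R (fst p)" using b by (intro coordinate_ring_mult) (auto simp: dual_zero)
  moreover have "eval_at (single 0 c * b) q = c * eval_at b q" if "q \<in> D (fst p) b" for q
    using that b by (subst chart_eval_at_mult[of _ \<Sigma> "fst p"])
      (auto simp: dual_zero point_value_0[OF basic_open_X] dest: basic_open_chart)
  ultimately have "rep V (\<lambda>q\<in>V. c) p (single 0 c * b) b"
    using b by (auto simp: rep_def dest: basic_open_eval)
  then show "\<exists>a b. rep V (\<lambda>q\<in>V. c) p a b" by blast
qed simp

lemma regular_sum:
  assumes V: "openin (zariski \<Sigma>) V" and "\<And>i. i \<in> A \<Longrightarrow> f i \<in> regular \<Sigma> V"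
  shows "(\<lambda>q\<in>V. \<Sum>i\<in>A. f i q) \<in> regular \<Sigma> V"
  using assms(2)
proof (induction A rule: infinite_finite_induct)
  case (insert x A)
  then have "(\<lambda>q\<in>V. f x q + (\<lambda>q\<in>V. \<Sum>i\<in>A. f i q) q) \<in> regular \<Sigma> V" by (intro regular_add[OF V]) auto
  moreover have "(\<lambda>q\<in>V. f x q + (\<lambda>q\<in>V. \<Sum>i\<in>A. f i q) q) = (\<lambda>q\<in>V. \<Sum>i\<in>insert x A. f i q)"
    using insert by (auto simp: restrict_def)
  ultimately show ?case by (simp only:)
qed (use regular_const[OF V, of 0] in auto)

lemma regular_cmult:
  assumes V: "openin (zariski \<Sigma>) V" and f: "f \<in> regular \<Sigma> V"
  shows "(\<lambda>q\<in>V. c * f q) \<in> regular \<Sigma> V"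
proof -
  have "(\<lambda>q\<in>V. (\<lambda>q\<in>V. c) q * f q) \<in> regular \<Sigma> V" by (intro regular_mult[OF V] regular_const[OF V] f)
  moreover have "(\<lambda>q\<in>V. (\<lambda>q\<in>V. c) q * f q) = (\<lambda>q\<in>V. c * f q)" by auto
  ultimately show ?thesis by simp
qed

lemma regular_restrict:
  assumes V: "openin (zariski \<Sigma>) V" and W: "openin (zariski \<Sigma>) W" "W \<subseteq> V" and f: "f \<in> regular \<Sigma> V"
  shows "restrict f W \<in> regular \<Sigma> W"
proof (rule regularI[OF W(1)])
  fix p assume p: "p \<in> W"
  then have pX: "p \<in> X" using open_subset[OF W(1)] by blast
  obtain a b where ab: "rep V f p a b" using regular_rep[OF V f, of p] p W by blast
  obtain c where c: "c \<in> R (fst p)" "eval_at c p \<noteq> 0" "D (fst p) c \<subseteq> W" using open_nbhd[OF W(1) p] .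
  have "rep V f p (a * c) (b * c)" using rep_mult[OF ab c(1,2) pX] .
  moreover have "D (fst p) (b * c) \<subseteq> W" using ab c by (auto simp: rep_def basic_open_mult)
  ultimately have "rep W (restrict f W) p (a * c) (b * c)" by (auto simp: rep_def)
  then show "\<exists>a b. rep W (restrict f W) p a b" by blast
qed simp

text \<open>The factor b b' makes the cross-multiplied equation true also at torus points where a
  denominator vanishes. It thus becomes an identity of Laurent polynomials, which is evaluated at
  the possibly nontorus point \<open>q\<close>. The identity itself serves again for the quotient
  rule.\<close>

lemma fraction_unique:
  assumes q: "q \<in> X" and ab: "a \<in> R (fst q)" "b \<in> R (fst q)" "a' \<in> R (fst q)" "b' \<in> R (fst q)"
    and nz: "eval_at b q \<noteq> 0" "eval_at b' q \<noteq> 0"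
    and eq: "\<And>r. r \<in> T \<Longrightarrow> eval_at b r \<noteq> 0 \<Longrightarrow> eval_at b' r \<noteq> 0 \<Longrightarrow>
      eval_at a r / eval_at b r = eval_at a' r / eval_at b' r"
  shows "(a * b' - a' * b) * (b * b') = 0"
    and "eval_at a q / eval_at b q = eval_at a' q / eval_at b' q"
proof -
  show 0: "(a * b' - a' * b) * (b * b') = 0"
  proof (rule laurent_eq_0)
    fix r assume r: "r \<in> T"
    show "eval_at ((a * b' - a' * b) * (b * b')) r = 0"
      using eq[OF r] by (cases "eval_at b r = 0 \<or> eval_at b' r = 0") (auto simp: T_mult[OF r] field_simps)
  qed
  have "eval_at ((a * b' - a' * b) * (b * b')) q
      = (eval_at a q * eval_at b' q - eval_at a' q * eval_at b q) * (eval_at b q * eval_at b' q)"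
    using q ab by (simp add: eval_at_mult coordinate_ring_mult coordinate_ring_diff)
  then have "eval_at a q * eval_at b' q = eval_at a' q * eval_at b q" using 0 nz by simp
  then show "eval_at a q / eval_at b q = eval_at a' q / eval_at b' q" using nz by (simp add: field_simps)
qed

lemma basic_open_in_T: "\<sigma> \<in> \<Sigma> \<Longrightarrow> r \<in> T \<Longrightarrow> eval_at b r \<noteq> 0 \<Longrightarrow> r \<in> D \<sigma> b"
  using T_chart by (simp add: basic_open_def)

lemma regular_eqI:
  assumes V: "openin (zariski \<Sigma>) V" and f: "f \<in> regular \<Sigma> V" and g: "g \<in> regular \<Sigma> V"
    and eq: "\<And>q. q \<in> V \<Longrightarrow> q \<in> T \<Longrightarrow> f q = g q"
  shows "f = g"
proof (rule extensionalityI[of _ V])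
  fix p assume p: "p \<in> V"
  then have pX: "p \<in> X" using open_subset[OF V] by blast
  obtain a b where ab: "rep V f p a b" using regular_rep[OF V f p] .
  obtain a' b' where ab': "rep V g p a' b'" using regular_rep[OF V g p] .
  have "eval_at a p / eval_at b p = eval_at a' p / eval_at b' p"
  proof (rule fraction_unique(2)[OF pX])
    fix r assume r: "r \<in> T" "eval_at b r \<noteq> 0" "eval_at b' r \<noteq> 0"
    then have "r \<in> D (fst p) b" "r \<in> D (fst p) b'" using basic_open_in_T variety_cone[OF pX] by auto
    then show "eval_at a r / eval_at b r = eval_at a' r / eval_at b' r"
      using ab ab' eq[of r] r(1) by (auto simp: rep_def)
  qed (use ab ab' in \<open>auto simp: rep_def\<close>)
  then show "f p = g p" using ab ab' basic_open_self[OF pX] by (auto simp: rep_def)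
qed (use f g regular_ext in auto)

text \<open>The fraction is compared with \<open>h\<close> on torus points only, since
  \<open>h\<close> will be a function known just there, such as the derivative of a regular
  function.\<close>

definition locfrac :: "'n point set \<Rightarrow> ('n point \<Rightarrow> complex) \<Rightarrow> 'n point \<Rightarrow> bool" where
  "locfrac V h p \<longleftrightarrow> (\<exists>a\<in>R (fst p). \<exists>b\<in>R (fst p). eval_at b p \<noteq> 0 \<and> D (fst p) b \<subseteq> V \<and>
     (\<forall>q\<in>D (fst p) b \<inter> T. h q = eval_at a q / eval_at b q))"

definition ext :: "'n point set \<Rightarrow> ('n point \<Rightarrow> complex) \<Rightarrow> 'n point \<Rightarrow> complex" where
  "ext V h = (THE g. g \<in> regular \<Sigma> V \<and> (\<forall>q\<in>V \<inter> T. g q = h q))"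

lemma ext_eqI:
  assumes V: "openin (zariski \<Sigma>) V" and "g \<in> regular \<Sigma> V" "\<And>q. q \<in> V \<Longrightarrow> q \<in> T \<Longrightarrow> g q = h q"
  shows "ext V h = g"
  unfolding ext_def
proof (rule the_equality)
  fix g' assume "g' \<in> regular \<Sigma> V \<and> (\<forall>q\<in>V \<inter> T. g' q = h q)"
  then show "g' = g" using assms by (intro regular_eqI[OF V]) auto
qed (use assms in auto)

text \<open>Fractions chosen at different points agree on \<open>T\<close> and hence, by uniqueness
  of fractions, wherever both are defined; so they glue.\<close>

lemma ext_locfrac:
  assumes V: "openin (zariski \<Sigma>) V" and h: "\<And>p. p \<in> V \<Longrightarrow> locfrac V h p"
  shows "ext V h \<in> regular \<Sigma> V" "\<And>q. q \<in> V \<Longrightarrow> q \<in> T \<Longrightarrow> ext V h q = h q"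
proof -
  define fr where "fr p a b \<longleftrightarrow> a \<in> R (fst p) \<and> b \<in> R (fst p) \<and> eval_at b p \<noteq> 0 \<and> D (fst p) b \<subseteq> V \<and>
     (\<forall>q\<in>D (fst p) b \<inter> T. h q = eval_at a q / eval_at b q)" for p a b
  have "\<exists>a b. fr p a b" if "p \<in> V" for p using h[OF that] by (auto simp: locfrac_def fr_def)
  then obtain A B where AB: "\<And>p. p \<in> V \<Longrightarrow> fr p (A p) (B p)" by metis
  define g where "g = (\<lambda>p\<in>V. eval_at (A p) p / eval_at (B p) p)"
  have pX: "p \<in> X" if "p \<in> V" for p using open_subset[OF V] that by blast
  have g: "g q = eval_at (A p) q / eval_at (B p) q" if p: "p \<in> V" and q: "q \<in> D (fst p) (B p)" for p q
  proof -
    have qV: "q \<in> V" using AB[OF p] q by (auto simp: fr_def)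
    have "eval_at (A q) q / eval_at (B q) q = eval_at (A p) q / eval_at (B p) q"
    proof (rule fraction_unique(2)[OF pX[OF qV]])
      show "A p \<in> R (fst q)" "B p \<in> R (fst q)"
        using AB[OF p] basic_open_ring[OF q] by (auto simp: fr_def)
      show "eval_at (B p) q \<noteq> 0" using q by (rule basic_open_eval)
      fix r assume r: "r \<in> T" "eval_at (B q) r \<noteq> 0" "eval_at (B p) r \<noteq> 0"
      then have "r \<in> D (fst q) (B q)" "r \<in> D (fst p) (B p)"
        using basic_open_in_T[OF variety_cone[OF pX[OF p]]] basic_open_in_T[OF variety_cone[OF pX[OF qV]]] by blast+
      then have "h r = eval_at (A q) r / eval_at (B q) r" "h r = eval_at (A p) r / eval_at (B p) r"
        using AB[OF p] AB[OF qV] r(1) unfolding fr_def by blast+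
      then show "eval_at (A q) r / eval_at (B q) r = eval_at (A p) r / eval_at (B p) r" by simp
    qed (use AB[OF qV] in \<open>auto simp: fr_def\<close>)
    then show ?thesis using qV by (simp add: g_def)
  qed
  have "g \<in> regular \<Sigma> V"
  proof (rule regularI[OF V])
    fix p assume p: "p \<in> V"
    have "rep V g p (A p) (B p)" using AB[OF p] g[OF p] by (auto simp: fr_def rep_def)
    then show "\<exists>a b. rep V g p a b" by blast
  qed (simp add: g_def)
  moreover have gT: "g q = h q" if q: "q \<in> V" "q \<in> T" for q
  proof -
    have "q \<in> D (fst q) (B q)" using AB[OF q(1)] basic_open_self[OF pX[OF q(1)]] by (auto simp: fr_def)
    then show ?thesis using AB[OF q(1)] g[OF q(1)] q by (auto simp: fr_def)
  qed
  ultimately have "ext V h = g" by (intro ext_eqI[OF V])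
  then show "ext V h \<in> regular \<Sigma> V" "\<And>q. q \<in> V \<Longrightarrow> q \<in> T \<Longrightarrow> ext V h q = h q"
    using \<open>g \<in> regular \<Sigma> V\<close> gT by auto
qed

subsection \<open>Sections of the sheaf of a family of filtrations\<close>

definition vrep :: "((real^'n) set \<Rightarrow> int \<Rightarrow> (complex^'e) set) \<Rightarrow> 'n point set \<Rightarrow> ('n point \<Rightarrow> complex^'e) \<Rightarrow>
    'n point \<Rightarrow> (int^'n \<Rightarrow>\<^sub>0 complex^'e) \<Rightarrow> (int^'n \<Rightarrow>\<^sub>0 complex) \<Rightarrow> bool" where
  "vrep F V s p e b \<longleftrightarrow> e \<in> filtration_module \<Sigma> F (fst p) \<and> b \<in> R (fst p) \<and> eval_at b p \<noteq> 0 \<and>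
     D (fst p) b \<subseteq> V \<and> (\<forall>q\<in>D (fst p) b \<inter> T. s q = inverse (eval_at b q) *s eval_vec_at e q)"

lemma rays_of_face: "\<tau> face_of \<sigma> \<Longrightarrow> rays_of_cone \<Sigma> \<tau> \<subseteq> rays_of_cone \<Sigma> \<sigma>"
  using face_of_trans by (auto simp: rays_of_cone_def)

lemma filtration_module_face:
  "\<tau> face_of \<sigma> \<Longrightarrow> filtration_module \<Sigma> F \<sigma> \<subseteq> filtration_module \<Sigma> F \<tau>"
  using rays_of_face[of \<tau> \<sigma>] by (auto simp: filtration_module_def)

lemma ray_generator_mem:
  assumes "\<rho> \<in> rays \<Sigma>"
  shows "real_vec (ray_generator \<rho>) \<in> \<rho>"
proof -
  obtain u m where u: "\<rho> = ray_cone u" "pairing m u = 1" using ray_structure[OF assms] .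
  have "ray_generator \<rho> = u" unfolding u(1) by (rule ray_generator_ray_cone[OF u(2)])
  then show ?thesis by (auto simp: u(1) ray_cone_def intro: exI[of _ 1])
qed

lemma dual_ray_nonneg:
  assumes "m \<in> dual_monoid \<tau>" "\<rho> \<in> rays_of_cone \<Sigma> \<tau>"
  shows "pairing m (ray_generator \<rho>) \<ge> 0"
proof -
  have "real_vec (ray_generator \<rho>) \<in> \<tau>"
    using assms(2) ray_generator_mem face_of_imp_subset by (fastforce simp: rays_of_cone_def)
  then have "real_vec m \<bullet> real_vec (ray_generator \<rho>) \<ge> 0" using assms(1) by (simp add: dual_monoid_def)
  then show ?thesis by (simp add: real_vec_inner)
qed

text \<open>Multiplication by a character of the dual monoid does not lower any index <m, u_\<rho>>,
  and the filtrations increase.\<close>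

lemma filtration_module_vmult:
  assumes F: "family_of_filtrations \<Sigma> F" and b: "b \<in> R \<tau>" and e: "e \<in> filtration_module \<Sigma> F \<tau>"
  shows "vmult b e \<in> filtration_module \<Sigma> F \<tau>"
  unfolding filtration_module_def
proof (intro CollectI allI INT_I)
  fix m \<rho> assume \<rho>: "\<rho> \<in> rays_of_cone \<Sigma> \<tau>"
  then have \<rho>r: "\<rho> \<in> rays \<Sigma>" by (simp add: rays_of_cone_def)
  have sub: "vec.subspace (F \<rho> j)" and mono: "i \<le> j \<Longrightarrow> F \<rho> i \<subseteq> F \<rho> j" for i j
    using F \<rho>r by (auto simp: family_of_filtrations_def)
  let ?u = "ray_generator \<rho>"
  show "lookup (vmult b e) m \<in> F \<rho> (pairing m ?u)"
    unfolding lookup_vmult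
  proof (intro vec.subspace_sum[OF sub])
    fix m1 m2 assume m: "m1 \<in> keys b" "m2 \<in> keys e"
    have "pairing m1 ?u \<ge> 0" using m b \<rho> by (intro dual_ray_nonneg) (auto simp: coordinate_ring_def)
    then have "F \<rho> (pairing m2 ?u) \<subseteq> F \<rho> (pairing (m1 + m2) ?u)" by (intro mono) (simp add: pairing_simps)
    moreover have "lookup e m2 \<in> F \<rho> (pairing m2 ?u)" using e \<rho> by (auto simp: filtration_module_def)
    ultimately show "(if m1 + m2 = m then lookup b m1 *s lookup e m2 else 0) \<in> F \<rho> (pairing m ?u)"
      using vec.subspace_scale[OF sub] vec.subspace_0[OF sub] by auto
  qed
qed

lemma filtration_sections_iff:
  assumes F: "family_of_filtrations \<Sigma> F" and V: "openin (zariski \<Sigma>) V"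
  shows "s \<in> filtration_sections \<Sigma> F V \<longleftrightarrow>
    s \<in> extensional (V \<inter> T) \<and> (\<forall>p\<in>V. \<exists>e b. vrep F V s p e b)"
proof (intro iffI conjI ballI)
  assume s: "s \<in> filtration_sections \<Sigma> F V"
  then show "s \<in> extensional (V \<inter> T)" by (simp add: filtration_sections_def)
  fix p assume p: "p \<in> V"
  then have pX: "p \<in> X" using open_subset[OF V] by blast
  obtain \<sigma> W e b where *: "\<sigma> \<in> \<Sigma>" "W \<in> opens \<Sigma> (V \<inter> chart \<Sigma> \<sigma>)" "e \<in> filtration_module \<Sigma> F \<sigma>" "b \<in> R \<sigma>" "p \<in> W"
    "\<And>q. q \<in> W \<Longrightarrow> eval_at b q \<noteq> 0"
    "\<And>q. q \<in> W \<Longrightarrow> q \<in> T \<Longrightarrow> s q = inverse (eval_at b q) *s eval_vec_at e q"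
    using s p unfolding filtration_sections_def by blast
  then have W: "openin (zariski \<Sigma>) W" "W \<subseteq> V" "W \<subseteq> chart \<Sigma> \<sigma>" by (auto simp: opens_def)
  obtain c where c: "c \<in> R (fst p)" "eval_at c p \<noteq> 0" "D (fst p) c \<subseteq> W" using open_nbhd[OF W(1) *(5)] .
  have pc: "p \<in> chart \<Sigma> \<sigma>" using * W by blast
  have eb: "e \<in> filtration_module \<Sigma> F (fst p)" "b \<in> R (fst p)"
    using chart_coordinate_ring[OF pc] filtration_module_face[of "fst p" \<sigma> F] * pc by (auto simp: chart_iff)
  have "vrep F V s p (vmult c e) (b * c)"
    unfolding vrep_def
  proof (intro conjI ballI)
    show "vmult c e \<in> filtration_module \<Sigma> F (fst p)" using eb c F by (intro filtration_module_vmult) auto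
    show "b * c \<in> R (fst p)" using eb c by (auto intro: coordinate_ring_mult)
    show "eval_at (b * c) p \<noteq> 0" using *(5,6) eb c pX by (simp add: eval_at_mult)
    show "D (fst p) (b * c) \<subseteq> V" using c W eb by (auto simp: basic_open_mult)
    fix q assume q: "q \<in> D (fst p) (b * c) \<inter> T"
    then have qc: "q \<in> D (fst p) c" using eb c by (simp add: basic_open_mult)
    then have qW: "q \<in> W" using c by blast
    then show "s q = inverse (eval_at (b * c) q) *s eval_vec_at (vmult c e) q"
      using *(7)[OF qW] q basic_open_eval[OF qc] by (simp add: T_mult eval_vec_at_vmult)
  qed
  then show "\<exists>e b. vrep F V s p e b" by blast
next
  assume s: "s \<in> extensional (V \<inter> T) \<and> (\<forall>p\<in>V. \<exists>e b. vrep F V s p e b)"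
  show "s \<in> filtration_sections \<Sigma> F V"
    unfolding filtration_sections_def
  proof (intro CollectI conjI ballI)
    show "s \<in> extensional (V \<inter> T)" using s by simp
    fix p assume p: "p \<in> V"
    then have pX: "p \<in> X" using open_subset[OF V] by blast
    obtain e b where "vrep F V s p e b" using s p by blast
    then have eb: "e \<in> filtration_module \<Sigma> F (fst p)" "b \<in> R (fst p)" "eval_at b p \<noteq> 0" "D (fst p) b \<subseteq> V"
      "\<And>q. q \<in> D (fst p) b \<inter> T \<Longrightarrow> s q = inverse (eval_at b q) *s eval_vec_at e q" by (auto simp: vrep_def)
    show "\<exists>\<sigma>\<in>\<Sigma>. \<exists>W\<in>opens \<Sigma> (V \<inter> chart \<Sigma> \<sigma>). \<exists>e\<in>filtration_module \<Sigma> F \<sigma>. \<exists>b\<in>R \<sigma>. p \<in> W \<and>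
        (\<forall>q\<in>W. eval_at b q \<noteq> 0) \<and> (\<forall>q\<in>W \<inter> T. s q = inverse (eval_at b q) *s eval_vec_at e q)"
    proof (rule bexI[of _ "fst p"], rule bexI[of _ "D (fst p) b"], rule bexI[of _ e], rule bexI[of _ b], intro conjI ballI)
      show "fst p \<in> \<Sigma>" using pX by (rule variety_cone)
      show "D (fst p) b \<in> opens \<Sigma> (V \<inter> chart \<Sigma> (fst p))"
        using eb openin_D[OF pX eb(2)] by (auto simp: opens_def basic_open_def)
      show "p \<in> D (fst p) b" using basic_open_self[OF pX eb(3)] .
    qed (use eb in \<open>auto simp: D_nonzero\<close>)
  qed
qed

subsection \<open>Regular points lie in smooth orbits\<close>

text \<open>Let \<open>S\<close> be the dual monoid of the cone \<open>\<tau>\<close> of the point and \<open>P\<close> its group of units.  Each class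
  of irreducible elements of \<open>S\<close> modulo \<open>P\<close>, and each element of a basis of \<open>P\<close>, gives a derivation of
  the local ring into \<open>\<complex>\<close>, and these are independent.  When the maximal ideal has \<open>n\<close> generators there
  are hence at most \<open>n\<close> of them, so that these elements, which generate \<open>M\<close>, form a basis of \<open>M\<close>.\<close>

lemma local_coordinates_imp_smooth:
  assumes lc: "local_coordinates \<Sigma> p W z" and pX: "p \<in> X"
  shows "\<exists>I g w. smooth_frame (fst p) I g (w :: 'n \<Rightarrow> int^'n)"
proof -
  define \<tau> \<gamma> S P where "\<tau> = fst p" and "\<gamma> = snd p" and "S = dual_monoid \<tau>" and "P = perp_lattice \<tau>"
  have \<tau>: "\<tau> \<in> \<Sigma>" using variety_cone[OF pX] by (simp add: \<tau>_def)
  have Pc: "0 \<in> P" "\<And>m m'. m \<in> P \<Longrightarrow> m' \<in> P \<Longrightarrow> m + m' \<in> P" "\<And>m m'. m \<in> P \<Longrightarrow> m' \<in> P \<Longrightarrow> m - m' \<in> P"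
    "\<And>m. m \<in> P \<Longrightarrow> - m \<in> P"
    using perp_lattice_closed by (auto simp: P_def)
  have Psub: "P \<subseteq> S" using perp_dual by (auto simp: P_def S_def)
  have Sadd: "m + m' \<in> S" if "m \<in> S" "m' \<in> S" for m m' using dual_add that by (auto simp: S_def)
  have PS: "m + m' \<in> P \<longleftrightarrow> m \<in> P \<and> m' \<in> P" if "m \<in> S" "m' \<in> S" for m m'
    using perp_sum_iff that by (auto simp: S_def P_def)
  have \<gamma>: "\<gamma> 0 = 1" "\<And>m m'. m \<in> S \<Longrightarrow> m' \<in> S \<Longrightarrow> \<gamma> (m + m') = \<gamma> m * \<gamma> m'" "\<And>m. \<gamma> m = 0 \<longleftrightarrow> m \<notin> P"
    using point_value_0[OF pX] point_value_add[OF pX] point_value_eq_0[OF pX]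
    by (auto simp: \<gamma>_def S_def P_def \<tau>_def)
  \<comment> \<open>The tangent functionals at \<open>p\<close>: derivations of the chart ring into
    \<complex>, the latter a module through the homomorphism \<gamma>.\<close>
  define deriv where "deriv \<psi> \<longleftrightarrow> (\<forall>m\<in>S. \<forall>m'\<in>S. \<psi> (m + m') = \<gamma> m * \<psi> m' + \<psi> m * \<gamma> m')" for \<psi>
  have lev_mult': "lev \<psi> (f * g) = eval_at f p * lev \<psi> g + lev \<psi> f * eval_at g p"
    if "deriv \<psi>" "f \<in> R \<tau>" "g \<in> R \<tau>" for \<psi> f g
    unfolding eval_at_lev \<gamma>_def[symmetric] using that
    by (intro lev_derivation[of _ S]) (auto simp: deriv_def coordinate_ring_def S_def)
  have ev_mult: "eval_at (f * g) p = eval_at f p * eval_at g p" if "f \<in> R \<tau>" "g \<in> R \<tau>" for f g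
    using eval_at_mult[OF pX] that by (simp add: \<tau>_def)
  from lc have W: "openin (zariski \<Sigma>) W" "p \<in> W" "\<And>i. z i \<in> regular \<Sigma> W" "\<And>i. z i p = 0"
    by (auto simp: local_coordinates_def)
  have "\<exists>b a. b \<in> R (fst p) \<and> eval_at b p \<noteq> 0 \<and> D (fst p) b \<subseteq> W \<and> (\<forall>i\<in>UNIV. rep W (z i) p (a i) b)"
    by (rule rep_common[OF W(1,2)]) (use W in auto)
  then obtain \<beta> \<alpha> where \<beta>: "\<beta> \<in> R \<tau>" "eval_at \<beta> p \<noteq> 0" and \<alpha>: "\<And>i. rep W (z i) p (\<alpha> i) \<beta>"
    by (auto simp: \<tau>_def)
  have \<alpha>R: "\<alpha> i \<in> R \<tau>" for i using \<alpha>[of i] by (simp add: rep_def \<tau>_def)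
  have \<alpha>z: "z i q = eval_at (\<alpha> i) q / eval_at \<beta> q" if "q \<in> D \<tau> \<beta>" for i q
    using \<alpha>[of i] that by (simp add: rep_def \<tau>_def)
  have \<alpha>0: "eval_at (\<alpha> i) p = 0" for i
    using \<alpha>z[of p i] W(4)[of i] \<beta> basic_open_self[OF pX \<beta>(2)] by (simp add: \<tau>_def)
  \<comment> \<open>The n functions \<alpha>_i span the cotangent space: the differential of every
    \<open>f\<close> vanishing at \<open>p\<close> is a combination of theirs, with coefficients
    that do not depend on \<psi>.\<close>
  have cot: "\<exists>h. \<forall>\<psi>. deriv \<psi> \<longrightarrow> lev \<psi> f = (\<Sum>i\<in>UNIV. h i * lev \<psi> (\<alpha> i))"
    if f: "f \<in> R \<tau>" "eval_at f p = 0" for f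
  proof -
    define V where "V = W \<inter> chart \<Sigma> \<tau>"
    have V: "openin (zariski \<Sigma>) V" "V \<subseteq> W" "V \<subseteq> chart \<Sigma> \<tau>" "p \<in> V"
      using W openin_chart[OF \<tau>] self_chart[OF pX] by (auto simp: V_def \<tau>_def)
    have "(\<lambda>q\<in>V. eval_at f q) \<in> regular \<Sigma> V" by (rule regular_eval[OF V(1,3) f(1)])
    moreover have "V \<in> opens \<Sigma> W" using V by (simp add: opens_def)
    moreover have "\<forall>V\<in>opens \<Sigma> W. \<forall>g\<in>regular \<Sigma> V. p \<in> V \<and> g p = 0 \<longrightarrow>
        (\<exists>V'\<in>opens \<Sigma> V. \<exists>h. p \<in> V' \<and> (\<forall>i. h i \<in> regular \<Sigma> V') \<and>
           (\<forall>q\<in>V'. g q = (\<Sum>i\<in>UNIV. h i q * z i q)))"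
      using lc by (simp add: local_coordinates_def)
    moreover have "p \<in> V \<and> (\<lambda>q\<in>V. eval_at f q) p = 0" using f(2) V(4) by simp
    ultimately have "\<exists>V'\<in>opens \<Sigma> V. \<exists>h. p \<in> V' \<and> (\<forall>i. h i \<in> regular \<Sigma> V') \<and>
           (\<forall>q\<in>V'. (\<lambda>q\<in>V. eval_at f q) q = (\<Sum>i\<in>UNIV. h i q * z i q))" by blast
    then obtain V' h where h: "V' \<in> opens \<Sigma> V" "p \<in> V'" "\<And>i. h i \<in> regular \<Sigma> V'"
      "\<And>q. q \<in> V' \<Longrightarrow> (\<lambda>q\<in>V. eval_at f q) q = (\<Sum>i\<in>UNIV. h i q * z i q)" by blast
    have V': "openin (zariski \<Sigma>) V'" "V' \<subseteq> V" using h(1) by (auto simp: opens_def)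
    have "\<exists>b a. b \<in> R (fst p) \<and> eval_at b p \<noteq> 0 \<and> D (fst p) b \<subseteq> V' \<and> (\<forall>i\<in>UNIV. rep V' (h i) p (a i) b)"
      by (rule rep_common[OF V'(1) h(2)]) (use h in auto)
    then obtain b c where b: "b \<in> R \<tau>" "eval_at b p \<noteq> 0" "D \<tau> b \<subseteq> V'" and c: "\<And>i. rep V' (h i) p (c i) b"
      by (auto simp: \<tau>_def)
    have cR: "c i \<in> R \<tau>" for i using c[of i] by (simp add: rep_def \<tau>_def)
    have ch: "h i q = eval_at (c i) q / eval_at b q" if "q \<in> D \<tau> b" for i q
      using c[of i] that by (simp add: rep_def \<tau>_def)
    define Y where "Y = f * (\<beta> * b) - (\<Sum>i\<in>UNIV. c i * \<alpha> i)"
    \<comment> \<open>The equation f = \<Sum> h_i z_i with cleared denominators; the extra factor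
      \<beta> b covers torus points outside the neighbourhood.\<close>
    have Y0: "Y * (\<beta> * b) = 0"
    proof (rule laurent_eq_0)
      fix q assume q: "q \<in> T"
      show "eval_at (Y * (\<beta> * b)) q = 0"
      proof (cases "eval_at \<beta> q = 0 \<or> eval_at b q = 0")
        case False
        then have qD: "q \<in> D \<tau> \<beta>" "q \<in> D \<tau> b" using basic_open_in_T[OF \<tau> q] by auto
        then have "q \<in> V'" "q \<in> V" using b(3) V' by blast+
        then have "eval_at f q = (\<Sum>i\<in>UNIV. h i q * z i q)" using h(4)[of q] by simp
        also have "\<dots> = (\<Sum>i\<in>UNIV. eval_at (c i * \<alpha> i) q) / (eval_at \<beta> q * eval_at b q)"
          by (simp add: ch[OF qD(2)] \<alpha>z[OF qD(1)] T_mult[OF q] sum_divide_distrib mult.commute)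
        finally have "eval_at Y q = 0"
          using False by (simp add: Y_def T_mult[OF q] eval_at_sum)
        then show ?thesis by (simp add: T_mult[OF q])
      qed (auto simp: T_mult[OF q])
    qed
    have YR: "Y \<in> R \<tau>" "\<beta> * b \<in> R \<tau>"
      unfolding Y_def using f \<beta> b cR \<alpha>R
      by (auto intro!: coordinate_ring_diff coordinate_ring_sum coordinate_ring_mult)
    have \<beta>b: "eval_at (\<beta> * b) p \<noteq> 0" using \<beta> b by (simp add: ev_mult)
    have Yp: "eval_at Y p = 0"
      using f \<beta> b cR \<alpha>R YR by (simp add: Y_def ev_mult eval_at_sum \<alpha>0)
    have "lev \<psi> f = (\<Sum>i\<in>UNIV. (eval_at (c i) p / eval_at (\<beta> * b) p) * lev \<psi> (\<alpha> i))" if \<psi>: "deriv \<psi>" for \<psi>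
    proof -
      have "lev \<psi> Y * eval_at (\<beta> * b) p = 0"
        using lev_mult'[OF \<psi> YR] Y0 Yp by simp
      then have "lev \<psi> Y = 0" using \<beta>b by simp
      then have "lev \<psi> f * eval_at (\<beta> * b) p = (\<Sum>i\<in>UNIV. eval_at (c i) p * lev \<psi> (\<alpha> i))"
        using lev_mult'[OF \<psi> f(1) YR(2)] f(2) lev_mult'[OF \<psi> cR \<alpha>R] \<alpha>0
        by (simp add: Y_def lev_diff lev_sum)
      then have "lev \<psi> f = (\<Sum>i\<in>UNIV. eval_at (c i) p * lev \<psi> (\<alpha> i)) / eval_at (\<beta> * b) p"
        using \<beta>b by (simp add: nonzero_eq_divide_eq)
      then show ?thesis by (simp add: sum_divide_distrib)
    qed
    then show ?thesis by (intro exI[of _ "\<lambda>i. eval_at (c i) p / eval_at (\<beta> * b) p"] allI impI)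
  qed
  obtain S0 where S0: "finite S0" "\<tau> = convex_cone hull (real_vec ` S0)" using cone_generators[OF \<tau>] .
  \<comment> \<open>Pairing with a point of the relative interior of \<tau> is a degree on the dual
    monoid that vanishes exactly on the units.\<close>
  define w0 where "w0 = (\<Sum>s\<in>S0. s)"
  have deg: "pairing m w0 \<ge> 0" "pairing m w0 = 0 \<longleftrightarrow> m \<in> P" if m: "m \<in> S" for m
  proof -
    have nn: "pairing m s \<ge> 0" if "s \<in> S0" for s
      using m that by (simp add: S_def S0(2) dual_monoid_hull)
    show "pairing m w0 \<ge> 0" unfolding w0_def pairing_sum_right by (intro sum_nonneg nn)
    show "pairing m w0 = 0 \<longleftrightarrow> m \<in> P"
      unfolding w0_def pairing_sum_right P_def S0(2) perp_lattice_hull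
      using S0(1) nn by (subst sum_nonneg_eq_0_iff) auto
  qed
  define irr where "irr m \<longleftrightarrow> m \<in> S \<and> m \<notin> P \<and> (\<forall>a\<in>S. \<forall>b\<in>S. m = a + b \<longrightarrow> a \<in> P \<or> b \<in> P)" for m
  have "\<exists>B v. finite B \<and> B \<subseteq> P \<and> P \<subseteq> zspan B \<and>
      (\<forall>b\<in>B. \<forall>b'\<in>B. cpair b' (v b) = (if b = b' then 1 else 0))"
    by (rule lattice_basis) (fact Pc)+
  then obtain B v where B: "finite B" "B \<subseteq> P" "P \<subseteq> zspan B"
    and Bv: "\<forall>b\<in>B. \<forall>b'\<in>B. cpair b' (v b) = (if b = b' then 1 else 0)"
    by (elim exE conjE)
  define good where "good A \<longleftrightarrow> finite A \<and> (\<forall>a\<in>A. irr a) \<and> (\<forall>a\<in>A. \<forall>a'\<in>A. a \<noteq> a' \<longrightarrow> a - a' \<notin> P)" for A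
  have bound: "card (A \<union> B) \<le> CARD('n)" if A: "good A" for A
  proof -
    define f where "f k = single k 1 - single 0 (\<gamma> k)" for k
    have irrA: "a \<in> S" "a \<notin> P" if "a \<in> A" for a using A that by (auto simp: good_def irr_def)
    have KS: "k \<in> S" if "k \<in> A \<union> B" for k using that irrA B(2) Psub by auto
    have fR: "f k \<in> R \<tau>" if "k \<in> A \<union> B" for k
      unfolding f_def using KS[OF that] dual_zero[of \<tau>] by (intro coordinate_ring_diff) (auto simp: S_def)
    have f0: "eval_at (f k) p = 0" for k using \<gamma>(1) by (simp add: f_def \<gamma>_def)
    have "\<forall>k\<in>A \<union> B. \<exists>h. \<forall>\<psi>. deriv \<psi> \<longrightarrow> lev \<psi> (f k) = (\<Sum>i\<in>UNIV. h i * lev \<psi> (\<alpha> i))"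
      using cot[OF fR f0] by blast
    then obtain h where h: "\<And>k \<psi>. k \<in> A \<union> B \<Longrightarrow> deriv \<psi> \<Longrightarrow> lev \<psi> (f k) = (\<Sum>i\<in>UNIV. h k i * lev \<psi> (\<alpha> i))"
      by metis
    \<comment> \<open>For irreducible \<open>l\<close>: the function supported on the coset l + P,
      where it is the translate of \<gamma>. For \<open>l\<close> in the basis of \<open>P\<close>:
      the logarithmic derivation along the dual vector \<open>v l\<close>.\<close>
    define \<psi> where "\<psi> l = (\<lambda>m. if l \<in> A then (if m - l \<in> P then \<gamma> (m - l) else 0) else \<gamma> m * cpair m (v l))" for l
    have \<psi>A: "deriv (\<psi> l)" if l: "l \<in> A" for l
      unfolding deriv_def
    proof (intro ballI)
      fix m m' assume m: "m \<in> S" "m' \<in> S"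
      have irr: "a \<in> P \<or> b \<in> P" if "a \<in> S" "b \<in> S" "l = a + b" for a b
        using A l that by (auto simp: good_def irr_def)
      have lP: "l \<notin> P" using irrA l by auto
      have \<psi>l: "\<psi> l x = (if x - l \<in> P then \<gamma> (x - l) else 0)" for x using l by (simp add: \<psi>_def)
      consider "m \<in> P" | "m \<notin> P" "m' \<in> P" | "m \<notin> P" "m' \<notin> P" by blast
      then show "\<psi> l (m + m') = \<gamma> m * \<psi> l m' + \<psi> l m * \<gamma> m'"
      proof cases
        case 1
        have a: "m + m' - l \<in> P \<longleftrightarrow> m' - l \<in> P"
          using Pc(2)[OF 1, of "m' - l"] Pc(3)[of "m + m' - l" m] 1 by (auto simp: algebra_simps)
        have "\<psi> l m * \<gamma> m' = 0"
        proof (cases "m - l \<in> P")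
          case True
          then have "m - (m - l) \<in> P" using Pc(3)[OF 1] by blast
          then show ?thesis using lP by simp
        qed (simp add: \<psi>l)
        moreover have "\<psi> l (m + m') = \<gamma> m * \<psi> l m'"
        proof (cases "m' - l \<in> P")
          case True
          have "\<gamma> (m + (m' - l)) = \<gamma> m * \<gamma> (m' - l)" using 1 True Psub by (intro \<gamma>(2)) auto
          then show ?thesis using True a by (simp add: \<psi>l add_diff_eq)
        qed (simp add: \<psi>l a)
        ultimately show ?thesis by simp
      next
        case 2
        have a: "m + m' - l \<in> P \<longleftrightarrow> m - l \<in> P"
          using Pc(2)[OF 2(2), of "m - l"] Pc(3)[of "m + m' - l" m'] 2 by (auto simp: algebra_simps)
        have "\<gamma> m = 0" using 2 \<gamma>(3) by blast
        moreover have "\<psi> l (m + m') = \<psi> l m * \<gamma> m'"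
        proof (cases "m - l \<in> P")
          case True
          have "\<gamma> ((m - l) + m') = \<gamma> (m - l) * \<gamma> m'" using 2 True Psub by (intro \<gamma>(2)) auto
          moreover have "(m - l) + m' = m + m' - l" by simp
          ultimately show ?thesis using True a by (simp add: \<psi>l)
        qed (simp add: \<psi>l a)
        ultimately show ?thesis by simp
      next
        case 3
        have "\<gamma> m = 0" "\<gamma> m' = 0" using 3 \<gamma>(3) by auto
        \<comment> \<open>Otherwise \<open>l\<close> would be, up to a unit, the sum of the nonunits
          \<open>m\<close> and \<open>m'\<close>, against irreducibility.\<close>
        moreover have "m + m' - l \<notin> P"
        proof
          assume q: "m + m' - l \<in> P"
          have "- (m + m' - l) \<in> P" using Pc(4)[OF q] .
          then have "m' + - (m + m' - l) \<in> S" using m Psub by (intro Sadd) auto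
          then have "m \<in> P \<or> m' + - (m + m' - l) \<in> P" using irr[OF m(1)] by (simp add: algebra_simps)
          then have "m' + - (m + m' - l) \<in> P" using 3 by simp
          then have "m' \<in> P" using PS[of m' "- (m + m' - l)"] m Psub \<open>- (m + m' - l) \<in> P\<close> by auto
          then show False using 3 by simp
        qed
        ultimately show ?thesis by (simp add: \<psi>l)
      qed
    qed
    have \<psi>B: "deriv (\<psi> l)" if "l \<notin> A" for l
      using that \<gamma>(2) by (simp add: deriv_def \<psi>_def cpair_simps algebra_simps)
    have \<psi>d: "deriv (\<psi> l)" for l using \<psi>A \<psi>B by blast
    have disj: "a \<notin> A" if "a \<in> B" for a using that B(2) irrA by auto
    show ?thesis
    proof (rule card_le_of_dual[where h = h and e = "\<lambda>l i. lev (\<psi> l) (\<alpha> i)" and d = "\<lambda>l. if l \<in> A then 1 else \<gamma> l"])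
      show "finite (A \<union> B)" using A B by (simp add: good_def)
      show "(if l \<in> A then 1 else \<gamma> l) \<noteq> 0" if "l \<in> A \<union> B" for l using that B(2) \<gamma>(3) by auto
      fix k l assume k: "k \<in> A \<union> B" and l: "l \<in> A \<union> B"
      have "(\<Sum>i\<in>UNIV. h k i * lev (\<psi> l) (\<alpha> i)) = lev (\<psi> l) (f k)" using h[OF k \<psi>d] by simp
      also have "\<dots> = \<psi> l k - \<gamma> k * \<psi> l 0" by (simp add: f_def lev_diff)
      also have "\<psi> l 0 = 0"
      proof (cases "l \<in> A")
        case True
        then have "- l \<notin> P" using irrA(2) Pc(4)[of "- l"] by auto
        then show ?thesis using True by (simp add: \<psi>_def)
      qed (simp add: \<psi>_def cpair_simps)
      also have "\<psi> l k = (if k = l then if l \<in> A then 1 else \<gamma> l else 0)"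
      proof (cases "l \<in> A")
        case True
        have "k - l \<notin> P" if "k \<noteq> l"
        proof (cases "k \<in> A")
          case True
          then show ?thesis using A \<open>l \<in> A\<close> that by (auto simp: good_def)
        next
          case False
          then have "k \<in> P" using k B(2) by auto
          show ?thesis
          proof
            assume "k - l \<in> P"
            then have "k - (k - l) \<in> P" using Pc(3)[OF \<open>k \<in> P\<close>] by blast
            then show False using irrA(2)[OF \<open>l \<in> A\<close>] by simp
          qed
        qed
        then show ?thesis using True Pc(1) \<gamma>(1) by (auto simp: \<psi>_def)
      next
        case False
        then have lB: "l \<in> B" using l by simp
        show ?thesis
        proof (cases "k \<in> A")
          case True
          then have "\<gamma> k = 0" using irrA(2) \<gamma>(3) by blast
          then show ?thesis using False True by (auto simp: \<psi>_def)
        next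
          case kA: False
          then have "k \<in> B" using k by simp
          then have "cpair k (v l) = (if l = k then 1 else 0)" using Bv lB by blast
          then show ?thesis using False by (auto simp: \<psi>_def)
        qed
      qed
      finally show "(\<Sum>i\<in>UNIV. h k i * lev (\<psi> l) (\<alpha> i)) = (if k = l then if l \<in> A then 1 else \<gamma> l else 0)"
        by simp
    qed
  qed
  have bound': "card A \<le> CARD('n)" if "good A" for A
    using bound[OF that] that B(1) card_mono[of "A \<union> B" A] by (auto simp: good_def)
  have "good {}" by (simp add: good_def)
  \<comment> \<open>The bound by n provides a largest system of pairwise inequivalent irreducibles,
    which then represents every class.\<close>
  then have "\<exists>A. good A \<and> (\<forall>A'. good A' \<longrightarrow> card A' \<le> card A)"
    by (rule ex_has_greatest_nat[of good "{}" card "Suc CARD('n)"]) (use bound' in \<open>simp add: less_Suc_eq_le\<close>)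
  then obtain A where A: "good A" and Amax: "\<And>A'. good A' \<Longrightarrow> card A' \<le> card A" by blast
  have finA: "finite A" using A by (simp add: good_def)
  have repA: "\<exists>a\<in>A. m - a \<in> P" if m: "irr m" for m
  proof (rule ccontr)
    assume no: "\<not> ?thesis"
    have no': "a - m \<notin> P" if "a \<in> A" for a
    proof
      assume "a - m \<in> P"
      then have "- (a - m) \<in> P" by (rule Pc(4))
      then show False using no that by auto
    qed
    have mA: "m \<notin> A" using no Pc(1) by force
    have "good (insert m A)" using A m no no' by (auto simp: good_def)
    from Amax[OF this] show False using finA mA by simp
  qed
  \<comment> \<open>Decomposition into irreducibles terminates because nonunits have positive
    degree.\<close>
  have gen: "\<exists>c p. p \<in> P \<and> m = (\<Sum>a\<in>A. int (c a) *s a) + p" if "m \<in> S" for m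
    using that
  proof (induction "nat (pairing m w0)" arbitrary: m rule: less_induct)
    case less
    consider "m \<in> P" | "irr m" | "m \<notin> P" "\<not> irr m" by blast
    then show ?case
    proof cases
      case 1
      then show ?thesis by (intro exI[of _ "\<lambda>_. 0"] exI[of _ m]) simp
    next
      case 2
      then obtain a where a: "a \<in> A" "m - a \<in> P" using repA by blast
      have "(\<Sum>x\<in>A. int (if x = a then 1 else 0) *s x) = (\<Sum>x\<in>A. if x = a then x else 0)"
        by (intro sum.cong) auto
      also have "\<dots> = a" using a(1) finA by simp
      finally show ?thesis using a(2)
        by (intro exI[of _ "\<lambda>x. if x = a then 1 else 0"] exI[of _ "m - a"]) simp
    next
      case 3
      then obtain a b where ab: "a \<in> S" "b \<in> S" "m = a + b" "a \<notin> P" "b \<notin> P"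
        using less.prems by (auto simp: irr_def)
      have "pairing a w0 > 0" "pairing b w0 > 0" using deg ab by (metis order_le_less)+
      then have lt: "nat (pairing a w0) < nat (pairing m w0)" "nat (pairing b w0) < nat (pairing m w0)"
        by (auto simp: ab(3) pairing_simps)
      obtain c p where cp: "p \<in> P" "a = (\<Sum>a\<in>A. int (c a) *s a) + p" using less.hyps[OF lt(1) ab(1)] by blast
      obtain c' p' where cp': "p' \<in> P" "b = (\<Sum>a\<in>A. int (c' a) *s a) + p'" using less.hyps[OF lt(2) ab(2)] by blast
      have "m = (\<Sum>a\<in>A. int (c a + c' a) *s a) + (p + p')"
        unfolding ab(3) by (subst cp(2), subst cp'(2)) (simp add: vector_sadd_rdistrib sum.distrib)
      moreover have "p + p' \<in> P" using cp cp' by (intro Pc(2))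
      ultimately show ?thesis by (intro exI[of _ "\<lambda>a. c a + c' a"] exI[of _ "p + p'"] conjI)
    qed
  qed
  have "\<exists>g w. smooth_frame \<tau> {i. g i \<in> A} g (w :: 'n \<Rightarrow> int^'n) \<and> range g = A \<union> B"
  proof (rule smooth_frame_of_generators[OF \<tau> finA B(1) bound[OF A]])
    show "A \<subseteq> dual_monoid \<tau> - perp_lattice \<tau>" using A by (auto simp: good_def irr_def S_def P_def)
    show "B \<subseteq> perp_lattice \<tau>" "perp_lattice \<tau> \<subseteq> zspan B" using B by (simp_all add: P_def)
    show "\<exists>c p. p \<in> perp_lattice \<tau> \<and> m = (\<Sum>a\<in>A. int (c a) *s a) + p" if "m \<in> dual_monoid \<tau>" for m
      using gen[of m] that by (simp add: S_def P_def)
  qed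
  then show ?thesis unfolding \<tau>_def by blast
qed

end

section \<open>Invariant derivations and the filtration of the theorem\<close>

text \<open>The value at \<open>q\<close> of the derivative of a Laurent polynomial along the
  invariant field of \<open>v\<close>, under which each monomial is an eigenvector.\<close>

definition ld :: "complex^'n \<Rightarrow> 'n point \<Rightarrow> (int^'n \<Rightarrow>\<^sub>0 complex) \<Rightarrow> complex" where
  "ld v q f = lev (\<lambda>m. snd q m * cpair m v) f"

lemma ld_simps:
  "ld v q (f + g) = ld v q f + ld v q g"
  "ld v q (f - g) = ld v q f - ld v q g"
  "ld v q (single m c) = c * (snd q m * cpair m v)"
  "ld (v + v') q f = ld v q f + ld v' q f"
  "ld (c *s v) q f = c * ld v q f"
  "ld 0 q f = 0"
  "ld v q 0 = 0"
  unfolding ld_def lev_add lev_diff lev_single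
  by (simp_all add: cpair_simps lev_def sum.distrib sum_distrib_left algebra_simps)

lemma ld_sum: "ld (\<Sum>i\<in>A. v i) q f = (\<Sum>i\<in>A. ld (v i) q f)"
  by (induction A rule: infinite_finite_induct) (auto simp: ld_simps)

text \<open>The derivative of \<open>a\<close> along the field with Laurent polynomial coefficients
  \<open>e\<close>, kept as a Laurent polynomial so that membership in the ring of a chart can be
  read off from exponents.\<close>

definition dirp :: "(int^'n \<Rightarrow>\<^sub>0 complex^'n) \<Rightarrow> (int^'n \<Rightarrow>\<^sub>0 complex) \<Rightarrow> (int^'n \<Rightarrow>\<^sub>0 complex)" where
  "dirp e a = (\<Sum>m\<in>keys e. \<Sum>m'\<in>keys a. single (m + m') (lookup a m' * cpair m' (lookup e m)))"

text \<open>The filtration of the theorem with \<Delta> as a parameter. For empty \<Delta> it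
  belongs to the full tangent sheaf and is the largest of them, so fields are first constructed for
  that case.\<close>

definition logfilt :: "(real^'n) set set \<Rightarrow> (real^'n) set \<Rightarrow> int \<Rightarrow> (complex^'n) set" where
  "logfilt \<Delta> = (\<lambda>\<rho> j.
     if \<rho> \<in> \<Delta> then (if j \<le> -1 then {0} else UNIV)
     else (if j \<le> -2 then {0} else if j = -1 then vec.span {complex_vec (ray_generator \<rho>)} else UNIV))"

lemma logfilt_family:
  fixes \<Sigma> :: "(real^'n) set set"
  shows "family_of_filtrations \<Sigma> (logfilt \<Delta>)"
  unfolding family_of_filtrations_def
proof (intro ballI conjI allI impI)
  fix \<rho> :: "(real^'n) set"
  show "vec.subspace (logfilt \<Delta> \<rho> j)" for j
    by (auto simp: logfilt_def vec.subspace_span vec.subspace_UNIV)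
  show "logfilt \<Delta> \<rho> i \<subseteq> logfilt \<Delta> \<rho> j" if "i \<le> j" for i j
    using that vec.span_zero by (auto simp: logfilt_def split: if_splits)
  show "\<exists>i. \<forall>j\<le>i. logfilt \<Delta> \<rho> j = {0}" by (intro exI[of _ "-2"]) (auto simp: logfilt_def)
  show "\<exists>j. logfilt \<Delta> \<rho> j = UNIV" by (intro exI[of _ 0]) (auto simp: logfilt_def)
qed

lemma logfilt_subset: "logfilt \<Delta> \<rho> j \<subseteq> logfilt {} \<rho> j"
  by (auto simp: logfilt_def vec.span_zero)

lemma logfilt_nonneg: "j \<ge> 0 \<Longrightarrow> logfilt \<Delta> \<rho> j = UNIV"
  by (simp add: logfilt_def)

lemma filtration_module_logfilt_subset:
  "filtration_module \<Sigma> (logfilt \<Delta>) \<sigma> \<subseteq> filtration_module \<Sigma> (logfilt {}) \<sigma>"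
  using logfilt_subset by (fastforce simp: filtration_module_def)

text \<open>Hom(M, \<complex>) is N \<otimes> \<complex>: an additive function is determined by its
  values on the unit vectors.\<close>

lemma additive_int_vec:
  fixes h :: "int^'n \<Rightarrow> complex"
  assumes add: "\<And>m m'. h (m + m') = h m + h m'"
  shows "h m = cpair m (\<chi> i. h (axis i 1))"
proof -
  have h0: "h 0 = 0" using add[of 0 0] by simp
  have neg: "h (- m) = - h m" for m using add[of m "- m"] h0 by (simp add: eq_neg_iff_add_eq_0 add.commute)
  have nat: "h (int k *s m) = of_nat k * h m" for k m
    by (induction k) (simp_all add: h0 add algebra_simps vector_sadd_rdistrib)
  have int: "h (k *s m) = of_int k * h m" for k m
  proof (cases "k \<ge> 0")
    case True
    then show ?thesis using nat[of "nat k" m] by simp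
  next
    case False
    then have "h (- (k *s m)) = - of_int k * h m"
      using nat[of "nat (- k)" m] by (simp add: vector_smult_lneg)
    then show ?thesis using neg[of "k *s m"] by simp
  qed
  have "h (\<Sum>i\<in>A. m $ i *s axis i 1) = (\<Sum>i\<in>A. of_int (m $ i) * h (axis i 1))" for A
    by (induction A rule: infinite_finite_induct) (auto simp: h0 add int)
  from this[of UNIV] have "h (\<Sum>i\<in>UNIV. m $ i *s axis i 1) = cpair m (\<chi> i. h (axis i 1))"
    by (simp add: cpair_def)
  moreover have "(\<Sum>i\<in>UNIV. m $ i *s axis i 1) = m"
    by (simp add: vec_eq_iff axis_def if_distrib[of "\<lambda>x. _ * x"] cong: if_cong)
  ultimately show ?thesis by (simp only:)
qed

context toric
begin

lemma ld_mult:
  assumes "q \<in> T"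
  shows "ld v q (f * g) = eval_at f q * ld v q g + ld v q f * eval_at g q"
  unfolding ld_def eval_at_lev
  by (rule lev_derivation[of _ UNIV]) (auto simp: T_value_add[OF assms] cpair_simps algebra_simps)

lemma eval_dirp:
  assumes q: "q \<in> T"
  shows "eval_at (dirp e a) q = ld (eval_vec_at e q) q a"
proof -
  have "eval_at (dirp e a) q
      = (\<Sum>m\<in>keys e. \<Sum>m'\<in>keys a. snd q m * (lookup a m' * (snd q m' * cpair m' (lookup e m))))"
    by (simp add: dirp_def eval_at_sum T_value_add[OF q] algebra_simps)
  also have "\<dots> = (\<Sum>m\<in>keys e. snd q m * ld (lookup e m) q a)"
    by (simp add: ld_def lev_def sum_distrib_left)
  also have "\<dots> = ld (eval_vec_at e q) q a" by (simp add: eval_vec_at_def ld_sum ld_simps)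
  finally show ?thesis .
qed

subsection \<open>Derivatives of regular functions along invariant vector fields\<close>

definition trep :: "('n point \<Rightarrow> complex) \<Rightarrow> 'n point \<Rightarrow> (int^'n \<Rightarrow>\<^sub>0 complex) \<Rightarrow> (int^'n \<Rightarrow>\<^sub>0 complex) \<Rightarrow> bool" where
  "trep f q a b \<longleftrightarrow> q \<in> T \<and> eval_at b q \<noteq> 0 \<and> (\<forall>r\<in>T. eval_at b r \<noteq> 0 \<longrightarrow> f r = eval_at a r / eval_at b r)"

text \<open>The quotient rule for a fraction a / b. Fractions for \<open>f\<close> are not unique,
  hence the description by \<open>THE\<close>; independence of the choice is shown next.\<close>

definition logder :: "complex^'n \<Rightarrow> ('n point \<Rightarrow> complex) \<Rightarrow> 'n point \<Rightarrow> complex" where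
  "logder v f q = (THE c. \<exists>a b. trep f q a b \<and> c = (ld v q a - f q * ld v q b) / eval_at b q)"

text \<open>For two fractions the cross difference Y vanishes at \<open>q\<close> and satisfies Y b
  b' = 0. Differentiating this product leaves (b b')(q) times the derivative of Y, which is
  therefore 0; that is the equality of the two quotient rules.\<close>

lemma logder_eq:
  assumes ab: "trep f q a b"
  shows "logder v f q = (ld v q a - f q * ld v q b) / eval_at b q"
  unfolding logder_def
proof (rule the_equality)
  show "\<exists>a' b'. trep f q a' b' \<and>
      (ld v q a - f q * ld v q b) / eval_at b q = (ld v q a' - f q * ld v q b') / eval_at b' q"
    using ab by blast
  fix c assume "\<exists>a b. trep f q a b \<and> c = (ld v q a - f q * ld v q b) / eval_at b q"
  then obtain a' b' where ab': "trep f q a' b'" and c: "c = (ld v q a' - f q * ld v q b') / eval_at b' q" by blast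
  from ab ab' have q: "q \<in> T" and nz: "eval_at b q \<noteq> 0" "eval_at b' q \<noteq> 0" by (auto simp: trep_def)
  have R: "x \<in> R (fst q)" for x using q by (simp add: T_iff)
  have fa: "eval_at a q = f q * eval_at b q" using ab by (simp add: trep_def)
  have fa': "eval_at a' q = f q * eval_at b' q" using ab' by (simp add: trep_def)
  note fa = fa fa'
  define Y where "Y = a * b' - a' * b"
  have "Y * (b * b') = 0"
    unfolding Y_def by (rule fraction_unique(1)[of q]) (use ab ab' R q in \<open>auto simp: trep_def T_iff\<close>)
  then have "ld v q (Y * (b * b')) = 0" by (simp add: ld_simps)
  moreover have "eval_at Y q = 0" by (simp add: Y_def T_mult[OF q] fa)
  ultimately have "ld v q Y = 0" using nz by (simp add: ld_mult[OF q] T_mult[OF q])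
  then have "(ld v q a - f q * ld v q b) * eval_at b' q = (ld v q a' - f q * ld v q b') * eval_at b q"
    by (simp add: Y_def ld_simps ld_mult[OF q] fa algebra_simps)
  then show "c = (ld v q a - f q * ld v q b) / eval_at b q" using nz c by (simp add: frac_eq_eq)
qed

lemma rep_trep:
  assumes "rep V f p a b" "p \<in> X" "q \<in> T" "eval_at b q \<noteq> 0"
  shows "trep f q a b"
  using assms basic_open_in_T[OF variety_cone[OF assms(2)]] by (auto simp: rep_def trep_def)

lemma T_X: "q \<in> T \<Longrightarrow> q \<in> X"
  by (simp add: T_iff)

lemma regular_trep:
  assumes V: "openin (zariski \<Sigma>) V" and f: "f \<in> regular \<Sigma> V" and q: "q \<in> V" "q \<in> T"
  obtains a b where "trep f q a b"
proof -
  obtain a b where ab: "rep V f q a b" using regular_rep[OF V f q(1)] .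
  then have "trep f q a b" using rep_trep[OF ab T_X[OF q(2)] q(2)] by (auto simp: rep_def)
  then show thesis using that by blast
qed

lemma logder_rules:
  assumes V: "openin (zariski \<Sigma>) V" and f: "f \<in> regular \<Sigma> V" and g: "g \<in> regular \<Sigma> V"
    and q: "q \<in> V" "q \<in> T"
  shows logder_add: "logder v (\<lambda>r\<in>V. f r + g r) q = logder v f q + logder v g q"
    and logder_mult: "logder v (\<lambda>r\<in>V. f r * g r) q = f q * logder v g q + g q * logder v f q"
proof -
  have "\<exists>b a. b \<in> R (fst q) \<and> eval_at b q \<noteq> 0 \<and> D (fst q) b \<subseteq> V \<and>
      (\<forall>k\<in>UNIV. rep V (if k then f else g) q (a k) b)"
    by (rule rep_common[OF V q(1)]) (use f g in auto)
  then obtain b a where *: "\<And>k :: bool. rep V (if k then f else g) q (a k) b" by blast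
  define c d where "c = a True" and "d = a False"
  have c: "rep V f q c b" and d: "rep V g q d b" using *[of True] *[of False] by (simp_all add: c_def d_def)
  have b0: "eval_at b q \<noteq> 0" using c by (simp add: rep_def)
  have tc: "trep f q c b" and td: "trep g q d b"
    using rep_trep[OF c T_X[OF q(2)] q(2)] rep_trep[OF d T_X[OF q(2)] q(2)] b0 by auto
  have inV: "r \<in> V" if "r \<in> T" "eval_at b r \<noteq> 0" for r
    using basic_open_in_T[OF variety_cone[OF T_X[OF q(2)]] that] c by (auto simp: rep_def)
  have "trep (\<lambda>r\<in>V. f r + g r) q (c + d) b"
    using tc td inV by (simp add: trep_def add_divide_distrib)
  from logder_eq[OF this] show "logder v (\<lambda>r\<in>V. f r + g r) q = logder v f q + logder v g q"
    using q b0 by (simp add: logder_eq[OF tc] logder_eq[OF td] ld_simps algebra_simps add_divide_distrib diff_divide_distrib)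
  have "trep (\<lambda>r\<in>V. f r * g r) q (c * d) (b * b)"
    using tc td inV by (auto simp: trep_def T_mult)
  moreover have "eval_at c q = f q * eval_at b q" "eval_at d q = g q * eval_at b q"
    using tc td by (auto simp: trep_def)
  ultimately show "logder v (\<lambda>r\<in>V. f r * g r) q = f q * logder v g q + g q * logder v f q"
    using q b0 by (simp add: logder_eq logder_eq[OF tc] logder_eq[OF td] ld_mult[OF q(2)] T_mult[OF q(2)] field_simps)
qed

lemma logder_restrict:
  assumes V: "openin (zariski \<Sigma>) V" and W: "openin (zariski \<Sigma>) W" "W \<subseteq> V"
    and f: "f \<in> regular \<Sigma> V" and q: "q \<in> W" "q \<in> T"
  shows "logder v (restrict f W) q = logder v f q"
proof -
  have "restrict f W \<in> regular \<Sigma> W" by (rule regular_restrict[OF V W f])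
  then obtain a b where ab: "rep W (restrict f W) q a b" using regular_rep[OF W(1) _ q(1)] by blast
  then have b0: "eval_at b q \<noteq> 0" by (simp add: rep_def)
  have t: "trep (restrict f W) q a b" using rep_trep[OF ab T_X[OF q(2)] q(2) b0] .
  have "r \<in> W" if "r \<in> T" "eval_at b r \<noteq> 0" for r
    using basic_open_in_T[OF variety_cone[OF T_X[OF q(2)]] that] ab by (auto simp: rep_def)
  then have "trep f q a b" using t by (auto simp: trep_def)
  from logder_eq[OF this, of v] logder_eq[OF t, of v] q show ?thesis by simp
qed

lemma logder_eval:
  assumes V: "openin (zariski \<Sigma>) V" and q: "q \<in> V" "q \<in> T"
  shows "logder v (\<lambda>r\<in>V. eval_at f r) q = ld v q f"
proof -
  obtain b where b: "b \<in> R (fst q)" "eval_at b q \<noteq> 0" "D (fst q) b \<subseteq> V" using open_nbhd[OF V q(1)] .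
  have "r \<in> V" if "r \<in> T" "eval_at b r \<noteq> 0" for r
    using basic_open_in_T[OF variety_cone[OF T_X[OF q(2)]] that] b by auto
  then have "trep (\<lambda>r\<in>V. eval_at f r) q (f * b) b" using q b by (auto simp: trep_def T_mult)
  from logder_eq[OF this, of v] show ?thesis using q b by (simp add: ld_mult[OF q(2)])
qed

lemma logder_const:
  assumes V: "openin (zariski \<Sigma>) V" and q: "q \<in> V" "q \<in> T"
  shows "logder v (\<lambda>r\<in>V. c) q = 0"
proof -
  have "(\<lambda>r\<in>V. c) = (\<lambda>r\<in>V. eval_at (single 0 c) r)"
    using open_subset[OF V] by (intro restrict_ext) (simp add: point_value_0[OF subsetD[OF open_subset[OF V]]])
  then show ?thesis using logder_eval[OF V q, of v "single 0 c"] by (simp add: ld_simps cpair_simps)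
qed

lemma logder_cmult:
  assumes V: "openin (zariski \<Sigma>) V" and f: "f \<in> regular \<Sigma> V" and q: "q \<in> V" "q \<in> T"
  shows "logder v (\<lambda>r\<in>V. c * f r) q = c * logder v f q"
proof -
  have "(\<lambda>r\<in>V. c * f r) = (\<lambda>r\<in>V. (\<lambda>r\<in>V. c) r * f r)" by auto
  then show ?thesis
    using logder_mult[OF V regular_const[OF V] f q, of v c] logder_const[OF V q, of v c] q by simp
qed

lemma logder_linear:
  assumes V: "openin (zariski \<Sigma>) V" and f: "f \<in> regular \<Sigma> V" and q: "q \<in> V" "q \<in> T"
  shows "logder (\<Sum>i\<in>A. c i *s v i) f q = (\<Sum>i\<in>A. c i * logder (v i) f q)"
    and "logder (v1 + v2) f q = logder v1 f q + logder v2 f q"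
    and "logder (k *s v1) f q = k * logder v1 f q"
proof -
  obtain a b where ab: "trep f q a b" using regular_trep[OF V f q] .
  show "logder (\<Sum>i\<in>A. c i *s v i) f q = (\<Sum>i\<in>A. c i * logder (v i) f q)"
    by (simp add: logder_eq[OF ab] ld_sum ld_simps sum_distrib_left sum_subtractf[symmetric]
        sum_divide_distrib algebra_simps)
  show "logder (v1 + v2) f q = logder v1 f q + logder v2 f q"
    by (simp add: logder_eq[OF ab] ld_simps algebra_simps add_divide_distrib diff_divide_distrib)
  show "logder (k *s v1) f q = k * logder v1 f q"
    by (simp add: logder_eq[OF ab] ld_simps algebra_simps)
qed

subsection \<open>From sections of the filtration sheaf to vector fields\<close>

definition smooth :: "(real^'n) set \<Rightarrow> bool" where
  "smooth \<tau> \<longleftrightarrow> (\<exists>I g w. smooth_frame \<tau> I g (w :: 'n \<Rightarrow> int^'n))"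

lemma smooth_frame_module:
  assumes \<tau>: "\<tau> \<in> \<Sigma>" and sf: "smooth_frame \<tau> I g w"
  shows "e \<in> filtration_module \<Sigma> F \<tau> \<longleftrightarrow> (\<forall>m. \<forall>i\<in>I. lookup e m \<in> F (ray_cone (w i)) (pairing m (w i)))"
proof
  assume "e \<in> filtration_module \<Sigma> F \<tau>"
  then show "\<forall>m. \<forall>i\<in>I. lookup e m \<in> F (ray_cone (w i)) (pairing m (w i))"
    using smooth_frame_ray[OF \<tau> sf] by (fastforce simp: filtration_module_def)
next
  assume *: "\<forall>m. \<forall>i\<in>I. lookup e m \<in> F (ray_cone (w i)) (pairing m (w i))"
  show "e \<in> filtration_module \<Sigma> F \<tau>"
    unfolding filtration_module_def
  proof (intro CollectI allI INT_I)
    fix m \<rho> assume "\<rho> \<in> rays_of_cone \<Sigma> \<tau>"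
    then obtain i where "i \<in> I" "\<rho> = ray_cone (w i)" using smooth_frame_rays[OF \<tau> sf] by blast
    then show "lookup e m \<in> F \<rho> (pairing m (ray_generator \<rho>))"
      using * smooth_frame_ray(2)[OF \<tau> sf] by simp
  qed
qed

text \<open>In degree -1 along a ray outside \<Delta> the coefficient is a multiple of
  \<open>w i\<close>, and such a vector differentiates the character of m' nontrivially only if <m',
  w i> is nonzero.\<close>

lemma logfilt_coefficient:
  assumes \<tau>: "\<tau> \<in> \<Sigma>" and sf: "smooth_frame \<tau> I g w" and e: "e \<in> filtration_module \<Sigma> (logfilt \<Delta>) \<tau>"
    and i: "i \<in> I" and nz: "cpair m' (lookup e m) \<noteq> 0"
  shows "pairing m (w i) \<ge> 0 \<or>
    (ray_cone (w i) \<notin> \<Delta> \<and> pairing m (w i) = -1 \<and> pairing m' (w i) \<noteq> 0)"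
proof (rule ccontr)
  assume neg: "\<not> ?thesis"
  have mem: "lookup e m \<in> logfilt \<Delta> (ray_cone (w i)) (pairing m (w i))"
    using e i smooth_frame_module[OF \<tau> sf] by blast
  have "lookup e m \<noteq> 0" using nz by (auto simp: cpair_simps)
  with mem neg have "ray_cone (w i) \<notin> \<Delta>" "pairing m (w i) = -1"
    "lookup e m \<in> vec.span {complex_vec (w i)}"
    by (auto simp: logfilt_def smooth_frame_ray(2)[OF \<tau> sf i] split: if_splits)
  then show False using nz neg by (auto simp: vec.span_singleton cpair_simps)
qed

text \<open>The pole is compensated: where a coefficient has degree -1 along \<open>w i\<close>, the
  exponent m' has degree at least 1 there, unless the term is 0.\<close>

lemma dirp_ring:
  assumes \<tau>: "\<tau> \<in> \<Sigma>" and sf: "smooth_frame \<tau> I g w" and e: "e \<in> filtration_module \<Sigma> (logfilt {}) \<tau>"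
    and a: "a \<in> R \<tau>"
  shows "dirp e a \<in> R \<tau>"
  unfolding dirp_def
proof (intro coordinate_ring_sum)
  fix m m' assume m: "m \<in> keys e" "m' \<in> keys a"
  have m'd: "m' \<in> dual_monoid \<tau>" using m a by (auto simp: coordinate_ring_def)
  show "single (m + m') (lookup a m' * cpair m' (lookup e m)) \<in> R \<tau>"
  proof (cases "cpair m' (lookup e m) = 0")
    case False
    have "pairing (m + m') (w i) \<ge> 0" if i: "i \<in> I" for i
      using logfilt_coefficient[OF \<tau> sf e i False] m'd i smooth_frame_dual[OF sf]
      by (auto simp: pairing_simps)
    then show ?thesis by (simp add: smooth_frame_dual[OF sf])
  qed simp
qed

text \<open>On torus points the derivation is \<open>logder\<close>; its values at the boundary come
  from unique regular extension, and \<open>restrict\<close> gives the canonical undefined values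
  elsewhere.\<close>

definition vfield :: "'n point set \<Rightarrow> ('n point \<Rightarrow> complex^'n) \<Rightarrow> 'n vector_field" where
  "vfield U s = (\<lambda>V\<in>opens \<Sigma> U. \<lambda>f\<in>regular \<Sigma> V. ext V (\<lambda>q. logder (s q) f q))"

text \<open>Only the germ at each point matters, so the ambient set \<open>V\<close> is left free;
  smoothness is included because \<open>dirp_ring\<close> works in a lattice frame.\<close>

definition filtered_on :: "'n point set \<Rightarrow> ('n point \<Rightarrow> complex^'n) \<Rightarrow> bool" where
  "filtered_on U s \<longleftrightarrow> (\<forall>p\<in>U. smooth (fst p) \<and> (\<exists>V e b. vrep (logfilt {}) V s p e b))"

text \<open>With f = a / c and s = e / b the quotient rule gives (e(a) c - a e(c)) / (b c^2), where
  e(a) denotes \<open>dirp e a\<close>; the numerator lies in the ring of the chart by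
  \<open>dirp_ring\<close>.\<close>

lemma logder_locfrac:
  assumes V: "openin (zariski \<Sigma>) V" and f: "f \<in> regular \<Sigma> V" and p: "p \<in> V"
    and s: "smooth (fst p)" "vrep (logfilt {}) V' s p e b"
  shows "locfrac V (\<lambda>q. logder (s q) f q) p"
proof -
  define \<tau> where "\<tau> = fst p"
  have pX: "p \<in> X" using open_subset[OF V] p by blast
  then have \<tau>: "\<tau> \<in> \<Sigma>" using variety_cone \<tau>_def by blast
  obtain I g w where sf: "smooth_frame \<tau> I g (w :: 'n \<Rightarrow> int^'n)" using s(1) by (auto simp: smooth_def \<tau>_def)
  obtain a c where ac: "rep V f p a c" using regular_rep[OF V f p] .
  from ac have acR: "a \<in> R \<tau>" "c \<in> R \<tau>" "eval_at c p \<noteq> 0" "D \<tau> c \<subseteq> V"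
    "\<And>q. q \<in> D \<tau> c \<Longrightarrow> f q = eval_at a q / eval_at c q" by (auto simp: rep_def \<tau>_def)
  from s(2) have eb: "e \<in> filtration_module \<Sigma> (logfilt {}) \<tau>" "b \<in> R \<tau>" "eval_at b p \<noteq> 0"
    "\<And>q. q \<in> D \<tau> b \<Longrightarrow> q \<in> T \<Longrightarrow> s q = inverse (eval_at b q) *s eval_vec_at e q"
    by (auto simp: vrep_def \<tau>_def)
  note dR = dirp_ring[OF \<tau> sf eb(1)]
  have field: "(inverse b * x - (a / c) * (inverse b * y)) / c = (x * c - a * y) / (b * (c * c))"
    if "b \<noteq> 0" "c \<noteq> 0" for a b c x y :: complex
    using that by (simp add: field_simps)
  show ?thesis
    unfolding locfrac_def \<tau>_def[symmetric]
  proof (rule bexI[of _ "dirp e a * c - a * dirp e c"], rule bexI[of _ "b * (c * c)"], intro conjI ballI)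
    show "dirp e a * c - a * dirp e c \<in> R \<tau>" using dR acR by (auto intro: coordinate_ring_diff coordinate_ring_mult)
    show bcc: "b * (c * c) \<in> R \<tau>" using eb acR by (auto intro: coordinate_ring_mult)
    show "eval_at (b * (c * c)) p \<noteq> 0"
      using eb acR pX by (simp add: eval_at_mult coordinate_ring_mult \<tau>_def)
    show "D \<tau> (b * (c * c)) \<subseteq> V" using eb acR by (auto simp: basic_open_mult coordinate_ring_mult)
    fix q assume q: "q \<in> D \<tau> (b * (c * c)) \<inter> T"
    then have qT: "q \<in> T" and nz: "eval_at b q \<noteq> 0" "eval_at c q \<noteq> 0"
      using D_nonzero[of q \<tau> "b * (c * c)"] by (auto simp: T_mult)
    then have qD: "q \<in> D \<tau> b" "q \<in> D \<tau> c" using basic_open_in_T[OF \<tau> qT] by auto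
    have "logder (s q) f q = (ld (s q) q a - f q * ld (s q) q c) / eval_at c q"
      by (rule logder_eq[OF rep_trep[OF ac pX qT nz(2)]])
    also have "\<dots> = eval_at (dirp e a * c - a * dirp e c) q / eval_at (b * (c * c)) q"
      using field[OF nz] by (simp add: eb(4)[OF qD(1) qT] acR(5)[OF qD(2)] ld_simps T_mult[OF qT] eval_dirp[OF qT])
    finally show "logder (s q) f q = eval_at (dirp e a * c - a * dirp e c) q / eval_at (b * (c * c)) q" .
  qed
qed

lemma vfield_apply:
  assumes s: "filtered_on U s" and V: "V \<in> opens \<Sigma> U" and f: "f \<in> regular \<Sigma> V"
  shows "vfield U s V f \<in> regular \<Sigma> V"
    and "\<And>q. q \<in> V \<Longrightarrow> q \<in> T \<Longrightarrow> vfield U s V f q = logder (s q) f q"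
proof -
  have Vo: "openin (zariski \<Sigma>) V" "V \<subseteq> U" using V by (auto simp: opens_def)
  have lf: "locfrac V (\<lambda>q. logder (s q) f q) p" if "p \<in> V" for p
  proof -
    have "p \<in> U" using that Vo by blast
    then have "smooth (fst p) \<and> (\<exists>V e b. vrep (logfilt {}) V s p e b)" using s by (simp add: filtered_on_def)
    then show ?thesis using logder_locfrac[OF Vo(1) f that] by blast
  qed
  have "vfield U s V f = ext V (\<lambda>q. logder (s q) f q)" using V f by (simp add: vfield_def)
  then show "vfield U s V f \<in> regular \<Sigma> V" "\<And>q. q \<in> V \<Longrightarrow> q \<in> T \<Longrightarrow> vfield U s V f q = logder (s q) f q"
    using ext_locfrac[OF Vo(1) lf] by auto
qed

lemma vfield_eqI:
  assumes V: "V \<in> opens \<Sigma> U" and f: "f \<in> regular \<Sigma> V" and g: "g \<in> regular \<Sigma> V"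
    and "\<And>q. q \<in> V \<Longrightarrow> q \<in> T \<Longrightarrow> g q = logder (s q) f q"
  shows "vfield U s V f = g"
  using ext_eqI[OF _ g] assms by (simp add: vfield_def opens_def)

lemma vfield_tangent:
  assumes s: "filtered_on U s"
  shows "vfield U s \<in> tangent_sections \<Sigma> U"
  unfolding tangent_sections_def
proof (intro CollectI conjI ballI allI)
  show "vfield U s \<in> (\<Pi>\<^sub>E V\<in>opens \<Sigma> U. regular \<Sigma> V \<rightarrow>\<^sub>E regular \<Sigma> V)"
    using vfield_apply(1)[OF s] by (auto simp: vfield_def PiE_def extensional_def Pi_def)
  fix V assume V: "V \<in> opens \<Sigma> U"
  then have Vo: "openin (zariski \<Sigma>) V" by (simp add: opens_def)
  fix f assume f: "f \<in> regular \<Sigma> V"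
  note vf = vfield_apply[OF s V f]
  show "vfield U s V' (restrict f V') = restrict (vfield U s V f) V'" if V': "V' \<in> opens \<Sigma> V" for V'
  proof -
    have V'o: "openin (zariski \<Sigma>) V'" "V' \<subseteq> V" using V' by (auto simp: opens_def)
    show ?thesis
    proof (rule vfield_eqI)
      show "V' \<in> opens \<Sigma> U" using V V' by (auto simp: opens_def)
      show "restrict f V' \<in> regular \<Sigma> V'" by (rule regular_restrict[OF Vo V'o f])
      show "restrict (vfield U s V f) V' \<in> regular \<Sigma> V'" by (rule regular_restrict[OF Vo V'o vf(1)])
      fix q assume q: "q \<in> V'" "q \<in> T"
      then show "restrict (vfield U s V f) V' q = logder (s q) (restrict f V') q"
        using vf(2)[of q] V'o logder_restrict[OF Vo V'o f q] by auto
    qed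
  qed
  fix g c p assume g: "g \<in> regular \<Sigma> V" and p: "p \<in> V"
  note vg = vfield_apply[OF s V g]
  have "vfield U s V (\<lambda>q\<in>V. f q + g q) = (\<lambda>q\<in>V. vfield U s V f q + vfield U s V g q)"
    by (rule vfield_eqI[OF V]) (auto simp: regular_add[OF Vo] f g vf vg logder_add[OF Vo f g])
  then show "vfield U s V (\<lambda>q\<in>V. f q + g q) p = vfield U s V f p + vfield U s V g p" using p by simp
  have "vfield U s V (\<lambda>q\<in>V. c * f q) = (\<lambda>q\<in>V. c * vfield U s V f q)"
    by (rule vfield_eqI[OF V]) (auto simp: regular_cmult[OF Vo] f vf logder_cmult[OF Vo f])
  then show "vfield U s V (\<lambda>q\<in>V. c * f q) p = c * vfield U s V f p" using p by simp
  have "vfield U s V (\<lambda>q\<in>V. f q * g q) = (\<lambda>q\<in>V. (\<lambda>q\<in>V. f q * vfield U s V g q) q + (\<lambda>q\<in>V. g q * vfield U s V f q) q)"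
  proof (rule vfield_eqI[OF V])
    show "(\<lambda>q\<in>V. f q * g q) \<in> regular \<Sigma> V" by (rule regular_mult[OF Vo f g])
    show "(\<lambda>q\<in>V. (\<lambda>q\<in>V. f q * vfield U s V g q) q + (\<lambda>q\<in>V. g q * vfield U s V f q) q) \<in> regular \<Sigma> V"
      by (rule regular_add[OF Vo regular_mult[OF Vo f vg(1)] regular_mult[OF Vo g vf(1)]])
  qed (simp add: vf vg logder_mult[OF Vo f g])
  then show "vfield U s V (\<lambda>q\<in>V. f q * g q) p = f p * vfield U s V g p + g p * vfield U s V f p" using p by simp
qed

subsection \<open>Vector fields on the torus\<close>

lemma tangent_sectionsD:
  assumes "\<delta> \<in> tangent_sections \<Sigma> U" and V: "V \<in> opens \<Sigma> U" and f: "f \<in> regular \<Sigma> V"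
  shows "\<delta> V f \<in> regular \<Sigma> V"
    and "g \<in> regular \<Sigma> V \<Longrightarrow> p \<in> V \<Longrightarrow> \<delta> V (\<lambda>q\<in>V. f q + g q) p = \<delta> V f p + \<delta> V g p"
    and "p \<in> V \<Longrightarrow> \<delta> V (\<lambda>q\<in>V. c * f q) p = c * \<delta> V f p"
    and "g \<in> regular \<Sigma> V \<Longrightarrow> p \<in> V \<Longrightarrow> \<delta> V (\<lambda>q\<in>V. f q * g q) p = f p * \<delta> V g p + g p * \<delta> V f p"
    and "V' \<in> opens \<Sigma> V \<Longrightarrow> \<delta> V' (restrict f V') = restrict (\<delta> V f) V'"
proof -
  from assms(1) have 1: "\<delta> \<in> (\<Pi>\<^sub>E V\<in>opens \<Sigma> U. regular \<Sigma> V \<rightarrow>\<^sub>E regular \<Sigma> V)"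
    and 2: "\<forall>V\<in>opens \<Sigma> U. \<forall>f\<in>regular \<Sigma> V. \<forall>g\<in>regular \<Sigma> V. \<forall>c. \<forall>p\<in>V.
        \<delta> V (\<lambda>q\<in>V. f q + g q) p = \<delta> V f p + \<delta> V g p \<and>
        \<delta> V (\<lambda>q\<in>V. c * f q) p = c * \<delta> V f p \<and>
        \<delta> V (\<lambda>q\<in>V. f q * g q) p = f p * \<delta> V g p + g p * \<delta> V f p"
    and 3: "\<forall>V\<in>opens \<Sigma> U. \<forall>V'\<in>opens \<Sigma> V. \<forall>f\<in>regular \<Sigma> V. \<delta> V' (restrict f V') = restrict (\<delta> V f) V'"
    by (simp_all add: tangent_sections_def)
  have "\<delta> V \<in> regular \<Sigma> V \<rightarrow>\<^sub>E regular \<Sigma> V" using 1 V by (rule PiE_mem)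
  then show "\<delta> V f \<in> regular \<Sigma> V" using f by (rule PiE_mem)
  show "g \<in> regular \<Sigma> V \<Longrightarrow> p \<in> V \<Longrightarrow> \<delta> V (\<lambda>q\<in>V. f q + g q) p = \<delta> V f p + \<delta> V g p"
    "g \<in> regular \<Sigma> V \<Longrightarrow> p \<in> V \<Longrightarrow> \<delta> V (\<lambda>q\<in>V. f q * g q) p = f p * \<delta> V g p + g p * \<delta> V f p"
    using 2 V f by simp_all
  show "p \<in> V \<Longrightarrow> \<delta> V (\<lambda>q\<in>V. c * f q) p = c * \<delta> V f p" using 2 V f by simp
  show "V' \<in> opens \<Sigma> V \<Longrightarrow> \<delta> V' (restrict f V') = restrict (\<delta> V f) V'" using 3 V f by simp
qed

definition log_vector :: "'n point set \<Rightarrow> 'n vector_field \<Rightarrow> 'n point \<Rightarrow> complex^'n" where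
  "log_vector W \<delta> q = (\<chi> i. \<delta> W (\<lambda>r\<in>W. eval_at (single (axis i 1) 1) r) q / snd q (axis i 1))"

text \<open>The Leibniz rule makes \<delta>(\<chi>^m) / \<chi>^m additive in \<open>m\<close>, hence
  a pairing with a vector of N \<otimes> \<complex>. Linearity extends this to Laurent polynomials,
  and the Leibniz rule for a = b f extends it to fractions.\<close>

lemma tangent_on_torus:
  assumes \<delta>: "\<delta> \<in> tangent_sections \<Sigma> U" and W0: "W0 \<in> opens \<Sigma> U" "U \<inter> T \<subseteq> W0"
    and V: "V \<in> opens \<Sigma> U" and f: "f \<in> regular \<Sigma> V" and q: "q \<in> V" "q \<in> T" and W0T: "W0 \<subseteq> T"
  shows "\<delta> V f q = logder (log_vector W0 \<delta> q) f q"
proof -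
  have Vo: "openin (zariski \<Sigma>) V" "V \<subseteq> U" using V by (auto simp: opens_def)
  have W0o: "openin (zariski \<Sigma>) W0" "W0 \<subseteq> U" using W0 by (auto simp: opens_def)
  have qX: "q \<in> X" using T_X[OF q(2)] .
  obtain a b where ab: "rep V f q a b" using regular_rep[OF Vo(1) f q(1)] .
  define W where "W = D (fst q) b"
  have bR: "b \<in> R (fst q)" "eval_at b q \<noteq> 0" and WV: "W \<subseteq> V"
    and fW: "\<And>r. r \<in> W \<Longrightarrow> f r = eval_at a r / eval_at b r" using ab by (auto simp: rep_def W_def)
  have W: "openin (zariski \<Sigma>) W" "q \<in> W" unfolding W_def using openin_D[OF qX bR(1)] basic_open_self[OF qX bR(2)] by auto
  have fq: "fst q = {0}" using q(2) by (simp add: T_iff)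
  have WT: "W \<subseteq> T" unfolding W_def fq using basic_open_chart chart_zero by blast
  have WU: "W \<in> opens \<Sigma> U" "W \<in> opens \<Sigma> V" "W \<in> opens \<Sigma> W0"
    using W WV Vo W0(2) WT by (auto simp: opens_def)
  define E where "E x = (\<lambda>r\<in>W. eval_at x r)" for x
  have Ereg: "E x \<in> regular \<Sigma> W" for x
    unfolding E_def using WT by (intro regular_eval[OF W(1), of "{0}"]) (auto simp: chart_zero)
  note t = tangent_sectionsD[OF \<delta> WU(1)]
  have E_add: "E (x + y) = (\<lambda>r\<in>W. E x r + E y r)" for x y by (auto simp: E_def)
  have E_mult: "E (x * y) = (\<lambda>r\<in>W. E x r * E y r)" for x y
    using WT T_mult by (auto simp: E_def restrict_def fun_eq_iff)
  have \<delta>_add: "\<delta> W (E (x + y)) q = \<delta> W (E x) q + \<delta> W (E y) q" for x y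
    unfolding E_add by (rule t(2)[OF Ereg Ereg W(2)])
  have \<delta>_mult: "\<delta> W (E (x * y)) q = eval_at x q * \<delta> W (E y) q + eval_at y q * \<delta> W (E x) q" for x y
    unfolding E_mult using t(4)[OF Ereg Ereg W(2), of x y] W(2) by (simp add: E_def)
  define mono where "mono m = (single m 1 :: int^'n \<Rightarrow>\<^sub>0 complex)" for m
  define h where "h m = \<delta> W (E (mono m)) q / snd q m" for m
  have nz: "snd q m \<noteq> 0" for m using T_value_nonzero[OF q(2)] .
  have hadd: "h (m + m') = h m + h m'" for m m'
  proof -
    have "mono (m + m') = mono m * mono m'" by (simp add: mono_def mult_single)
    then show ?thesis using \<delta>_mult[of "mono m" "mono m'"] nz[of m] nz[of m']
      by (simp add: h_def T_value_add[OF q(2)] mono_def add_divide_distrib)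
  qed
  have lv: "log_vector W0 \<delta> q = (\<chi> i. h (axis i 1))"
  proof -
    have "\<delta> W0 (\<lambda>r\<in>W0. eval_at (mono m) r) q = \<delta> W (E (mono m)) q" for m
    proof -
      have r: "(\<lambda>r\<in>W0. eval_at (mono m) r) \<in> regular \<Sigma> W0"
        using W0T by (intro regular_eval[OF W0o(1), of "{0}"]) (auto simp: chart_zero)
      have "W \<subseteq> W0" using WU(3) by (simp add: opens_def)
      then have "restrict (\<lambda>r\<in>W0. eval_at (mono m) r) W = E (mono m)"
        by (auto simp: E_def restrict_def fun_eq_iff)
      then have "\<delta> W (E (mono m)) = restrict (\<delta> W0 (\<lambda>r\<in>W0. eval_at (mono m) r)) W"
        using tangent_sectionsD(5)[OF \<delta> W0(1) r WU(3)] by simp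
      then show ?thesis using W(2) by simp
    qed
    then show ?thesis by (simp add: log_vector_def h_def mono_def vec_eq_iff)
  qed
  define s where "s = log_vector W0 \<delta> q"
  have hs: "h m = cpair m s" for m unfolding s_def lv by (rule additive_int_vec[OF hadd])
  have pol: "\<delta> W (E x) q = ld s q x" for x
  proof -
    have "keys x \<subseteq> UNIV" by simp
    then show ?thesis
    proof (induction x rule: poly_mapping_keys_induct)
      case zero
      have "\<delta> W (E (0 + 0)) q = \<delta> W (E 0) q + \<delta> W (E 0) q" by (rule \<delta>_add)
      then show ?case by (simp add: ld_simps)
    next
      case (add m c x)
      have "E (single m c) = (\<lambda>r\<in>W. c * E (mono m) r)" by (auto simp: E_def mono_def)
      then have "\<delta> W (E (single m c)) q = c * \<delta> W (E (mono m)) q" using t(3)[OF Ereg W(2)] by simp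
      also have "\<delta> W (E (mono m)) q = snd q m * cpair m s" using hs[of m] nz[of m] by (simp add: h_def field_simps)
      finally show ?case using add by (simp add: \<delta>_add ld_simps)
    qed
  qed
  have rf: "restrict f W \<in> regular \<Sigma> W" by (rule regular_restrict[OF Vo(1) W(1) WV f])
  have "E a = (\<lambda>r\<in>W. E b r * restrict f W r)"
    using fW by (auto simp: E_def restrict_def fun_eq_iff W_def D_nonzero)
  then have "\<delta> W (E a) q = E b q * \<delta> W (restrict f W) q + restrict f W q * \<delta> W (E b) q"
    using t(4)[OF Ereg rf W(2), of b] by simp
  then have "ld s q a = eval_at b q * \<delta> W (restrict f W) q + f q * ld s q b"
    using W(2) by (simp add: pol) (simp add: E_def)
  moreover have "\<delta> W (restrict f W) q = \<delta> V f q"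
    using tangent_sectionsD(5)[OF \<delta> V f WU(2)] W(2) by simp
  ultimately have "\<delta> V f q = (ld s q a - f q * ld s q b) / eval_at b q" using bR by (simp add: field_simps)
  also have "\<dots> = logder s f q" using logder_eq[OF rep_trep[OF ab qX q(2) bR(2)]] by simp
  finally show ?thesis by (simp add: s_def)
qed

end

context toric
begin

subsection \<open>Local coordinates at points of smooth orbits\<close>

text \<open>A face is generated by the frame vectors that it contains, with the same dual
  basis.\<close>

lemma smooth_face:
  assumes \<tau>: "\<tau> \<in> \<Sigma>" and sm: "smooth \<tau>" and F: "F face_of \<tau>" "F \<noteq> {}"
  shows "smooth F"
proof -
  obtain I g w where sf: "smooth_frame \<tau> I g (w :: 'n \<Rightarrow> int^'n)" using sm by (auto simp: smooth_def)
  have db: "dual_bases g w" using sf by (simp add: smooth_frame_def)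
  note cF = cone_convex_cone[OF face_in_fan[OF \<tau> F]]
  define I' where "I' = {i\<in>I. real_vec (w i) \<in> F}"
  have "F = {v. (\<forall>i\<in>I'. real_vec (g i) \<bullet> v \<ge> 0) \<and> (\<forall>i. i \<notin> I' \<longrightarrow> real_vec (g i) \<bullet> v = 0)}"
  proof (intro equalityI subsetI)
    fix v assume v: "v \<in> F"
    then have "v \<in> \<tau>" using F face_of_imp_subset by blast
    then have "\<forall>i\<in>I'. real_vec (g i) \<bullet> v \<ge> 0" using sf by (auto simp: smooth_frame_def I'_def)
    moreover have "\<forall>i. i \<notin> I' \<longrightarrow> real_vec (g i) \<bullet> v = 0"
      using face_component[OF \<tau> sf F(1) v] by (auto simp: I'_def)
    ultimately show "v \<in> {v. (\<forall>i\<in>I'. real_vec (g i) \<bullet> v \<ge> 0) \<and> (\<forall>i. i \<notin> I' \<longrightarrow> real_vec (g i) \<bullet> v = 0)}" by simp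
  next
    fix v assume v: "v \<in> {v. (\<forall>i\<in>I'. real_vec (g i) \<bullet> v \<ge> 0) \<and> (\<forall>i. i \<notin> I' \<longrightarrow> real_vec (g i) \<bullet> v = 0)}"
    have "(\<Sum>i\<in>UNIV. (real_vec (g i) \<bullet> v) *\<^sub>R real_vec (w i)) \<in> F"
    proof (rule convex_cone_sum[OF cF])
      fix i
      show "(real_vec (g i) \<bullet> v) *\<^sub>R real_vec (w i) \<in> F"
      proof (cases "i \<in> I'")
        case True
        then show ?thesis using v by (intro convex_cone_scaleR[OF cF]) (auto simp: I'_def)
      next
        case False
        then show ?thesis using v convex_cone_contains_0[OF cF] by auto
      qed
    qed
    then show "v \<in> F" using dual_bases_expand(2)[OF db, of v] by simp
  qed
  then have "smooth_frame F I' g w" using db by (simp add: smooth_frame_def)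
  then show ?thesis by (auto simp: smooth_def)
qed

lemma smooth_chart: "\<tau> \<in> \<Sigma> \<Longrightarrow> smooth \<tau> \<Longrightarrow> q \<in> chart \<Sigma> \<tau> \<Longrightarrow> smooth (fst q)"
  using smooth_face[of \<tau> "fst q"] convex_cone_nonempty[OF cone_convex_cone[OF variety_cone]]
  by (simp add: chart_iff)

lemma regular_fraction:
  assumes \<sigma>: "\<sigma> \<in> \<Sigma>" and V: "openin (zariski \<Sigma>) V" "V \<subseteq> D \<sigma> b" and cb: "c \<in> R \<sigma>" "b \<in> R \<sigma>"
  shows "(\<lambda>q\<in>V. eval_at c q / eval_at b q) \<in> regular \<Sigma> V"
proof (rule regularI[OF V(1)])
  fix q assume q: "q \<in> V"
  then have qD: "q \<in> D \<sigma> b" using V by blast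
  obtain d where d: "d \<in> R (fst q)" "eval_at d q \<noteq> 0" "D (fst q) d \<subseteq> V" using open_nbhd[OF V(1) q] .
  have cbq: "c \<in> R (fst q)" "b \<in> R (fst q)" using basic_open_ring[OF qD] cb by auto
  have "rep V (\<lambda>q\<in>V. eval_at c q / eval_at b q) q (c * d) (b * d)"
    using d cbq basic_open_X[OF qD] D_nonzero[OF qD]
    by (auto simp: rep_def coordinate_ring_mult eval_at_mult basic_open_mult D_mult D_nonzero)
  then show "\<exists>x y. rep V (\<lambda>q\<in>V. eval_at c q / eval_at b q) q x y" by blast
qed simp

text \<open>For \<open>i\<close> in \<open>I\<close> the character of \<open>g i\<close> vanishes on
  the orbit of \<open>p\<close> and is itself a coordinate; for the other \<open>i\<close> it is a
  unit, and its value at \<open>p\<close> is subtracted.\<close>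

definition coord_poly :: "'n point \<Rightarrow> 'n set \<Rightarrow> ('n \<Rightarrow> int^'n) \<Rightarrow> 'n \<Rightarrow> (int^'n \<Rightarrow>\<^sub>0 complex)" where
  "coord_poly p I g i = single (g i) 1 - (if i \<in> I then 0 else single 0 (snd p (g i)))"

lemma frame_dual_mem:
  assumes "smooth_frame \<tau> I g w"
  shows "g i \<in> dual_monoid \<tau>" "g i \<in> perp_lattice \<tau> \<longleftrightarrow> i \<notin> I"
  by (auto simp: smooth_frame_dual[OF assms] smooth_frame_perp[OF assms] smooth_frame_pairing[OF assms])

lemma coord_poly_ring:
  assumes "smooth_frame \<tau> I g w"
  shows "coord_poly p I g i \<in> R \<tau>"
  unfolding coord_poly_def
  by (intro coordinate_ring_diff) (auto simp: frame_dual_mem[OF assms] dual_zero)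

lemma coord_poly_value:
  assumes "q \<in> X"
  shows "eval_at (coord_poly p I g i) q = snd q (g i) - (if i \<in> I then 0 else snd p (g i))"
  using point_value_0[OF assms] by (simp add: coord_poly_def)

text \<open>The units \<open>m\<close> for which \<chi>^m - \<gamma>(m) lies in the generated ideal
  form a subgroup that contains the \<open>g i\<close> with \<open>i\<close> outside
  \<open>I\<close>, hence all units. A nonunit monomial is divisible by some \<chi>^(g i) with
  \<open>i\<close> in \<open>I\<close>. Linearity does the rest.\<close>

lemma maximal_ideal_generators:
  assumes pX: "p \<in> X" and sf: "smooth_frame (fst p) I g w" and a: "a \<in> R (fst p)" "eval_at a p = 0"
  shows "\<exists>c. (\<forall>i. c i \<in> R (fst p)) \<and> a = (\<Sum>i\<in>UNIV. c i * coord_poly p I g i)"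
proof -
  define \<tau> \<gamma> where "\<tau> = fst p" and "\<gamma> = snd p"
  have sf: "smooth_frame \<tau> I g w" using sf by (simp add: \<tau>_def)
  define Id where "Id = {a. \<exists>c. (\<forall>i. c i \<in> R \<tau>) \<and> a = (\<Sum>i\<in>UNIV. c i * coord_poly p I g i)}"
  have IdI: "(\<Sum>i\<in>UNIV. c i * coord_poly p I g i) \<in> Id" if "\<And>i. c i \<in> R \<tau>" for c
    unfolding Id_def using that by blast
  have Id_add: "x + y \<in> Id" if xy: "x \<in> Id" "y \<in> Id" for x y
  proof -
    obtain c d where cd: "\<And>i. c i \<in> R \<tau>" "x = (\<Sum>i\<in>UNIV. c i * coord_poly p I g i)"
      "\<And>i. d i \<in> R \<tau>" "y = (\<Sum>i\<in>UNIV. d i * coord_poly p I g i)" using xy by (auto simp: Id_def)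
    have "x + y = (\<Sum>i\<in>UNIV. (c i + d i) * coord_poly p I g i)"
      by (simp add: cd(2,4) sum.distrib distrib_right)
    moreover have "c i + d i \<in> R \<tau>" for i using cd by (intro coordinate_ring_add)
    ultimately show ?thesis using IdI[of "\<lambda>i. c i + d i"] by (simp only:)
  qed
  have Id_mult: "b * x \<in> Id" if b: "b \<in> R \<tau>" and x: "x \<in> Id" for b x
  proof -
    obtain c where c: "\<And>i. c i \<in> R \<tau>" "x = (\<Sum>i\<in>UNIV. c i * coord_poly p I g i)"
      using x by (auto simp: Id_def)
    have "b * x = (\<Sum>i\<in>UNIV. (b * c i) * coord_poly p I g i)"
      by (simp add: c(2) sum_distrib_left mult.assoc)
    moreover have "b * c i \<in> R \<tau>" for i using b c by (intro coordinate_ring_mult)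
    ultimately show ?thesis using IdI[of "\<lambda>i. b * c i"] by (simp only:)
  qed
  have Id_gen: "coord_poly p I g i \<in> Id" for i
  proof -
    have "coord_poly p I g i = (\<Sum>j\<in>UNIV. (if j = i then 1 else 0) * coord_poly p I g j)"
      by (simp add: if_distrib[of "\<lambda>x. x * _"] cong: if_cong)
    moreover have "(if j = i then 1 else 0) \<in> R \<tau>" for j by (auto intro: coordinate_ring_one)
    ultimately show ?thesis using IdI[of "\<lambda>j. if j = i then 1 else 0"] by (simp only:)
  qed
  have Id_0: "0 \<in> Id" using Id_mult[OF _ Id_gen, of 0] by simp
  have \<gamma>0: "\<gamma> 0 = 1" using point_value_0[OF pX] by (simp add: \<gamma>_def)
  have \<gamma>add: "\<gamma> (m + m') = \<gamma> m * \<gamma> m'" if "m \<in> dual_monoid \<tau>" "m' \<in> dual_monoid \<tau>" for m m'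
    using point_value_add[OF pX] that by (simp add: \<gamma>_def \<tau>_def)
  have \<gamma>z: "\<gamma> m = 0 \<longleftrightarrow> m \<notin> perp_lattice \<tau>" for m
    using point_value_eq_0[OF pX] by (simp add: \<gamma>_def \<tau>_def)
  have Rs: "single m c \<in> R \<tau>" if "m \<in> dual_monoid \<tau>" for m c using that by simp
  define H where "H = {m \<in> perp_lattice \<tau>. single m 1 - single 0 (\<gamma> m) \<in> Id}"
  have H0: "0 \<in> H" using Id_0 by (simp add: H_def perp_lattice_closed \<gamma>0)
  have Hdiff: "m - m' \<in> H" if m: "m \<in> H" "m' \<in> H" for m m'
  proof -
    have P: "m \<in> perp_lattice \<tau>" "m' \<in> perp_lattice \<tau>" "m - m' \<in> perp_lattice \<tau>"
      using m perp_lattice_closed by (auto simp: H_def)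
    then have d: "m - m' \<in> dual_monoid \<tau>" "m' \<in> dual_monoid \<tau>" by (auto intro: perp_dual)
    have 1: "\<gamma> m = \<gamma> (m - m') * \<gamma> m'" using \<gamma>add[OF d] by simp
    have 2: "\<gamma> m' \<noteq> 0" using \<gamma>z P by blast
    let ?c = "inverse (\<gamma> m')"
    have cancel: "\<gamma> m' * (?c * x) = x" for x using 2 by simp
    have "single (m - m') 1 - single 0 (\<gamma> (m - m'))
        = single 0 ?c * (single m 1 - single 0 (\<gamma> m)) + single (m - m') (- ?c) * (single m' 1 - single 0 (\<gamma> m'))"
      using 2 by (simp add: algebra_simps mult_single 1 single_uminus cancel)
    moreover have "\<dots> \<in> Id"
      using m d by (intro Id_add Id_mult Rs) (auto simp: H_def dual_zero)
    ultimately show ?thesis using P(3) by (simp add: H_def)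
  qed
  have Hg: "g i \<in> H" if "i \<notin> I" for i
    using that Id_gen[of i] frame_dual_mem(2)[OF sf, of i] by (simp add: H_def coord_poly_def \<gamma>_def)
  have perpH: "m \<in> H" if m: "m \<in> perp_lattice \<tau>" for m
  proof -
    have db: "dual_bases g w" using sf by (simp add: smooth_frame_def)
    have "(\<Sum>i\<in>UNIV. pairing m (w i) *s g i) \<in> H"
    proof (rule subgroup_sum[OF H0 Hdiff])
      fix i
      show "pairing m (w i) *s g i \<in> H"
      proof (cases "i \<in> I")
        case True
        then have "pairing m (w i) = 0" using m smooth_frame_perp[OF sf] by blast
        then show ?thesis using H0 by simp
      next
        case False
        then show ?thesis by (intro subgroup_smult[OF H0 Hdiff] Hg)
      qed
    qed
    then show ?thesis using dual_bases_expand(1)[OF db, of m] by simp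
  qed
  have mono: "single m 1 - single 0 (\<gamma> m) \<in> Id" if m: "m \<in> dual_monoid \<tau>" for m
  proof (cases "m \<in> perp_lattice \<tau>")
    case True
    then show ?thesis using perpH by (simp add: H_def)
  next
    case False
    then obtain i where i: "i \<in> I" "pairing m (w i) \<noteq> 0" using smooth_frame_perp[OF sf] by blast
    then have "pairing m (w i) \<ge> 1" using m smooth_frame_dual[OF sf] by force
    then have "m - g i \<in> dual_monoid \<tau>"
      using m by (auto simp: smooth_frame_dual[OF sf] pairing_simps smooth_frame_pairing[OF sf])
    then have "single (m - g i) 1 * coord_poly p I g i \<in> Id" by (intro Id_mult Rs Id_gen)
    then show ?thesis using i False \<gamma>z[of m] by (simp add: coord_poly_def mult_single)
  qed
  have "keys a \<subseteq> dual_monoid \<tau>" using a by (simp add: coordinate_ring_def \<tau>_def)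
  then have "a - single 0 (eval_at a p) \<in> Id"
  proof (induction a rule: poly_mapping_keys_induct)
    case zero
    then show ?case using Id_0 by simp
  next
    case (add m c f)
    have "single m c + f - single 0 (eval_at (single m c + f) p)
        = single 0 c * (single m 1 - single 0 (\<gamma> m)) + (f - single 0 (eval_at f p))"
      by (simp add: algebra_simps mult_single single_add \<gamma>_def)
    moreover have "\<dots> \<in> Id" using add by (intro Id_add Id_mult Rs mono) (auto simp: dual_zero)
    ultimately show ?case by (simp only:)
  qed
  then show ?thesis using a(2) by (simp add: Id_def \<tau>_def)
qed

lemma smooth_local_coordinates:
  assumes pX: "p \<in> X" and sf: "smooth_frame (fst p) I g w"
    and W: "openin (zariski \<Sigma>) W" "p \<in> W" "W \<subseteq> chart \<Sigma> (fst p)"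
  shows "local_coordinates \<Sigma> p W (\<lambda>i. \<lambda>q\<in>W. eval_at (coord_poly p I g i) q)"
  unfolding local_coordinates_def
proof (intro conjI allI ballI impI)
  show "openin (zariski \<Sigma>) W" "p \<in> W" by fact+
  fix i
  show "(\<lambda>q\<in>W. eval_at (coord_poly p I g i) q) \<in> regular \<Sigma> W"
    by (rule regular_eval[OF W(1,3) coord_poly_ring[OF sf]])
  show "(\<lambda>q\<in>W. eval_at (coord_poly p I g i) q) p = 0"
    using W(2) point_value_eq_0[OF pX] frame_dual_mem(2)[OF sf] by (simp add: coord_poly_value[OF pX])
next
  fix V G assume V: "V \<in> opens \<Sigma> W" and G: "G \<in> regular \<Sigma> V" and pV: "p \<in> V \<and> G p = 0"
  have Vo: "openin (zariski \<Sigma>) V" "V \<subseteq> W" using V by (auto simp: opens_def)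
  obtain a b where ab: "rep V G p a b" using regular_rep[OF Vo(1) G] pV by blast
  then have R: "a \<in> R (fst p)" "b \<in> R (fst p)" "eval_at b p \<noteq> 0" "D (fst p) b \<subseteq> V"
    and Gq: "\<And>q. q \<in> D (fst p) b \<Longrightarrow> G q = eval_at a q / eval_at b q" by (auto simp: rep_def)
  have pD: "p \<in> D (fst p) b" using basic_open_self[OF pX R(3)] .
  have "eval_at a p = 0" using Gq[OF pD] pV R(3) by simp
  then obtain c where c: "\<And>i. c i \<in> R (fst p)" "a = (\<Sum>i\<in>UNIV. c i * coord_poly p I g i)"
    using maximal_ideal_generators[OF pX sf R(1)] by blast
  have Do: "openin (zariski \<Sigma>) (D (fst p) b)" using openin_D[OF pX R(2)] .
  show "\<exists>V'\<in>opens \<Sigma> V. \<exists>h. p \<in> V' \<and> (\<forall>i. h i \<in> regular \<Sigma> V') \<and>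
      (\<forall>q\<in>V'. G q = (\<Sum>i\<in>UNIV. h i q * (\<lambda>q\<in>W. eval_at (coord_poly p I g i) q) q))"
  proof (intro bexI[of _ "D (fst p) b"] exI[of _ "\<lambda>i. \<lambda>q\<in>D (fst p) b. eval_at (c i) q / eval_at b q"] conjI allI ballI)
    show "p \<in> D (fst p) b" by (rule pD)
    show "(\<lambda>q\<in>D (fst p) b. eval_at (c i) q / eval_at b q) \<in> regular \<Sigma> (D (fst p) b)" for i
      by (rule regular_fraction[OF variety_cone[OF pX] Do order_refl c(1) R(2)])
    show "D (fst p) b \<in> opens \<Sigma> V" using Do R(4) by (simp add: opens_def)
    fix q assume q: "q \<in> D (fst p) b"
    then have "q \<in> W" using R(4) Vo(2) by blast
    moreover have "eval_at a q = (\<Sum>i\<in>UNIV. eval_at (c i) q * eval_at (coord_poly p I g i) q)"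
      by (simp add: c(2) eval_at_sum D_mult[OF q c(1) coord_poly_ring[OF sf]])
    ultimately show "G q = (\<Sum>i\<in>UNIV. (\<lambda>q\<in>D (fst p) b. eval_at (c i) q / eval_at b q) q
        * (\<lambda>q\<in>W. eval_at (coord_poly p I g i) q) q)"
      using q by (simp add: Gq[OF q] sum_divide_distrib)
  qed
qed

text \<open>A ray of the frame is a face of \<open>fst q\<close> exactly when the dual coordinate
  \<open>g i\<close> is not identically 0 on \<open>fst q\<close>, that is, when the character of
  \<open>g i\<close> vanishes at \<open>q\<close>. The point \<open>p\<close> is free, since the
  coordinates with \<open>i\<close> in \<open>I\<close> do not depend on it.\<close>

lemma snc_divisor:
  assumes \<Delta>: "\<Delta> \<subseteq> rays \<Sigma>" and \<tau>: "\<tau> \<in> \<Sigma>" and sf: "smooth_frame \<tau> I g w" and q: "q \<in> chart \<Sigma> \<tau>"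
  shows "q \<in> (\<Union>\<rho>\<in>\<Delta>. toric_divisor \<Sigma> \<rho>) \<longleftrightarrow>
    (\<Prod>i\<in>{i\<in>I. ray_cone (w i) \<in> \<Delta>}. eval_at (coord_poly p I g i) q) = 0"
proof -
  have qX: "q \<in> X" and F: "fst q face_of \<tau>" using q by (auto simp: chart_iff)
  have "q \<in> toric_divisor \<Sigma> \<rho> \<longleftrightarrow> \<rho> face_of fst q" if "\<rho> \<in> \<Delta>" for \<rho>
    using toric_divisor_iff[of \<rho> q] \<Delta> that qX by (auto simp: rays_def)
  then have "q \<in> (\<Union>\<rho>\<in>\<Delta>. toric_divisor \<Sigma> \<rho>) \<longleftrightarrow> (\<exists>\<rho>\<in>\<Delta>. \<rho> face_of fst q)" by simp
  also have "\<dots> \<longleftrightarrow> (\<exists>i\<in>I. ray_cone (w i) \<in> \<Delta> \<and> g i \<notin> perp_lattice (fst q))"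
  proof
    assume "\<exists>\<rho>\<in>\<Delta>. \<rho> face_of fst q"
    then obtain \<rho> where \<rho>: "\<rho> \<in> \<Delta>" "\<rho> face_of fst q" by blast
    then have "\<rho> \<in> rays_of_cone \<Sigma> \<tau>" using \<Delta> face_of_trans[OF \<rho>(2) F] by (auto simp: rays_of_cone_def)
    then obtain i where i: "i \<in> I" "\<rho> = ray_cone (w i)" using smooth_frame_rays[OF \<tau> sf] by blast
    have "real_vec (w i) \<in> \<rho>" by (auto simp: i ray_cone_def intro: exI[of _ 1])
    then have "real_vec (w i) \<in> fst q" using \<rho>(2) face_of_imp_subset by blast
    moreover have "real_vec (g i) \<bullet> real_vec (w i) \<noteq> 0"
      by (simp add: real_vec_inner smooth_frame_pairing[OF sf])
    ultimately have "g i \<notin> perp_lattice (fst q)" by (auto simp: perp_lattice_def)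
    then show "\<exists>i\<in>I. ray_cone (w i) \<in> \<Delta> \<and> g i \<notin> perp_lattice (fst q)" using i \<rho>(1) by blast
  next
    assume "\<exists>i\<in>I. ray_cone (w i) \<in> \<Delta> \<and> g i \<notin> perp_lattice (fst q)"
    then obtain i v where i: "i \<in> I" "ray_cone (w i) \<in> \<Delta>" and v: "v \<in> fst q" "real_vec (g i) \<bullet> v \<noteq> 0"
      by (auto simp: perp_lattice_def)
    have "real_vec (w i) \<in> fst q" using face_component[OF \<tau> sf F v] by blast
    then have "ray_cone (w i) \<subseteq> fst q"
      using convex_cone_scaleR[OF cone_convex_cone[OF variety_cone[OF qX]]] by (auto simp: ray_cone_def)
    moreover have "ray_cone (w i) face_of \<tau>" using smooth_frame_ray(1)[OF \<tau> sf i(1)] by (simp add: rays_of_cone_def)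
    ultimately have "ray_cone (w i) face_of fst q"
      using F face_of_imp_subset[OF F] by (auto intro: face_of_subset)
    then show "\<exists>\<rho>\<in>\<Delta>. \<rho> face_of fst q" using i(2) by blast
  qed
  also have "\<dots> \<longleftrightarrow> (\<Prod>i\<in>{i\<in>I. ray_cone (w i) \<in> \<Delta>}. eval_at (coord_poly p I g i) q) = 0"
    by (auto simp: coord_poly_value[OF qX] point_value_eq_0[OF qX])
  finally show ?thesis .
qed

lemma smooth_snc_coordinates:
  assumes \<Delta>: "\<Delta> \<subseteq> rays \<Sigma>" and pX: "p \<in> X" and sf: "smooth_frame (fst p) I g w"
    and W: "openin (zariski \<Sigma>) W" "p \<in> W" "W \<subseteq> chart \<Sigma> (fst p)"
  shows "snc_coordinates \<Sigma> (\<Union>\<rho>\<in>\<Delta>. toric_divisor \<Sigma> \<rho>) p W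
    (\<lambda>i. \<lambda>q\<in>W. eval_at (coord_poly p I g i) q) {i\<in>I. ray_cone (w i) \<in> \<Delta>}"
proof -
  have "(\<Union>\<rho>\<in>\<Delta>. toric_divisor \<Sigma> \<rho>) \<inter> W =
      {q\<in>W. (\<Prod>i\<in>{i\<in>I. ray_cone (w i) \<in> \<Delta>}. (\<lambda>q\<in>W. eval_at (coord_poly p I g i) q) q) = 0}"
  proof (intro set_eqI)
    fix q
    show "q \<in> (\<Union>\<rho>\<in>\<Delta>. toric_divisor \<Sigma> \<rho>) \<inter> W \<longleftrightarrow>
      q \<in> {q\<in>W. (\<Prod>i\<in>{i\<in>I. ray_cone (w i) \<in> \<Delta>}. (\<lambda>q\<in>W. eval_at (coord_poly p I g i) q) q) = 0}"
    proof (cases "q \<in> W")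
      case True
      then have "q \<in> chart \<Sigma> (fst p)" using W(3) by blast
      from snc_divisor[OF \<Delta> variety_cone[OF pX] sf this, of p] True show ?thesis by simp
    qed simp
  qed
  then show ?thesis using smooth_local_coordinates[OF pX sf W] by (simp add: snc_coordinates_def)
qed

text \<open>The locus is the regular locus of X for every choice of \<Delta>: in monomial
  coordinates at a point of a smooth orbit all invariant divisors are coordinate
  hyperplanes.\<close>

lemma snc_locus_eq:
  assumes \<Delta>: "\<Delta> \<subseteq> rays \<Sigma>"
  shows "snc_locus \<Sigma> (\<Union>\<rho>\<in>\<Delta>. toric_divisor \<Sigma> \<rho>) = {p \<in> X. smooth (fst p)}"
proof (intro equalityI subsetI)
  fix p assume "p \<in> snc_locus \<Sigma> (\<Union>\<rho>\<in>\<Delta>. toric_divisor \<Sigma> \<rho>)"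
  then have "p \<in> X" "\<exists>W z. local_coordinates \<Sigma> p W z" by (auto simp: snc_locus_def snc_coordinates_def)
  then show "p \<in> {p \<in> X. smooth (fst p)}"
    using local_coordinates_imp_smooth unfolding smooth_def by blast
next
  fix p assume "p \<in> {p \<in> X. smooth (fst p)}"
  then obtain I g w where pX: "p \<in> X" and sf: "smooth_frame (fst p) I g (w :: 'n \<Rightarrow> int^'n)"
    by (auto simp: smooth_def)
  have "snc_coordinates \<Sigma> (\<Union>\<rho>\<in>\<Delta>. toric_divisor \<Sigma> \<rho>) p (chart \<Sigma> (fst p))
    (\<lambda>i. \<lambda>q\<in>chart \<Sigma> (fst p). eval_at (coord_poly p I g i) q) {i\<in>I. ray_cone (w i) \<in> \<Delta>}"
    by (rule smooth_snc_coordinates[OF \<Delta> pX sf openin_chart[OF variety_cone[OF pX]] self_chart[OF pX] order_refl])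
  then show "p \<in> snc_locus \<Sigma> (\<Union>\<rho>\<in>\<Delta>. toric_divisor \<Sigma> \<rho>)" using pX unfolding snc_locus_def by blast
qed

subsection \<open>Vector fields of filtered sections are logarithmic\<close>

text \<open>This is the partial derivative for the coordinate \<chi>^(g i). Its degree -(g i) pairs
  to -1 with \<open>w i\<close> and to 0 with the other frame vectors, and its coefficient is
  \<open>w i\<close>, just as the filtration for empty \<Delta> permits.\<close>

lemma frame_field_filtered:
  assumes \<tau>: "\<tau> \<in> \<Sigma>" and sf: "smooth_frame \<tau> I g w" and W: "W \<subseteq> chart \<Sigma> \<tau>"
  shows "filtered_on W (\<lambda>q. snd q (- g i) *s complex_vec (w i))"
  unfolding filtered_on_def
proof (intro ballI conjI)
  fix q assume q: "q \<in> W"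
  then have qc: "q \<in> chart \<Sigma> \<tau>" using W by blast
  then have qX: "q \<in> X" and F: "fst q face_of \<tau>" by (auto simp: chart_iff)
  show "smooth (fst q)" using smooth_chart[OF \<tau> _ qc] sf by (auto simp: smooth_def)
  define e where "e = (single (- g i) (complex_vec (w i)) :: int^'n \<Rightarrow>\<^sub>0 complex^'n)"
  have "e \<in> filtration_module \<Sigma> (logfilt {}) \<tau>"
    unfolding smooth_frame_module[OF \<tau> sf]
  proof (intro allI ballI)
    fix m j assume j: "j \<in> I"
    have sub: "vec.subspace (logfilt {} (ray_cone (w j)) k :: (complex^'n) set)" for k
      by (auto simp: logfilt_def vec.subspace_span vec.subspace_UNIV)
    show "lookup e m \<in> logfilt {} (ray_cone (w j)) (pairing m (w j))"
    proof (cases "m = - g i")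
      case True
      then have "pairing m (w j) = (if i = j then -1 else 0)"
        by (simp add: pairing_simps smooth_frame_pairing[OF sf])
      then show ?thesis using True
        by (auto simp: e_def logfilt_def smooth_frame_ray(2)[OF \<tau> sf j] intro: vec.span_base)
    next
      case False
      then show ?thesis using vec.subspace_0[OF sub] by (simp add: e_def lookup_single when_def)
    qed
  qed
  then have e: "e \<in> filtration_module \<Sigma> (logfilt {}) (fst q)" using filtration_module_face[OF F] by blast
  have er: "eval_vec_at e r = snd r (- g i) *s complex_vec (w i)" for r
    by (simp add: vec_eq_iff eval_vec_at_nth e_def)
  have "vrep (logfilt {}) X (\<lambda>q. snd q (- g i) *s complex_vec (w i)) q e 1"
    unfolding vrep_def
  proof (intro conjI ballI)
    show "eval_at 1 q \<noteq> 0" using eval_at_one[OF qX] by simp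
    show "D (fst q) 1 \<subseteq> X" using basic_open_X by blast
    fix r assume "r \<in> D (fst q) 1 \<inter> T"
    then show "snd r (- g i) *s complex_vec (w i) = inverse (eval_at 1 r) *s eval_vec_at e r"
      using eval_at_one[OF T_X] er[of r] by simp
  qed (use e coordinate_ring_one in auto)
  then show "\<exists>V e b. vrep (logfilt {}) V (\<lambda>q. snd q (- g i) *s complex_vec (w i)) q e b" by blast
qed

lemma T_value_neg: "q \<in> T \<Longrightarrow> snd q m * snd q (- m) = 1"
  using T_value_add[of q m "- m"] point_value_0[OF T_X] by simp

text \<open>On the torus s = \<Sum> <g i, s> w i, and the invariant field of \<open>w i\<close> is
  \<chi>^(g i) \<partial>_i. For \<open>i\<close> in \<open>K\<close> the factor \<chi>^(g i) is the
  coordinate \<open>z i\<close> that a logarithmic field must carry.\<close>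

lemma section_log_form:
  assumes \<Delta>: "\<Delta> \<subseteq> rays \<Sigma>" and pX: "p \<in> X" and sm: "smooth (fst p)"
    and s: "filtered_on U s" and vr: "vrep (logfilt \<Delta>) U' s p e b" and U: "U' \<inter> chart \<Sigma> (fst p) \<subseteq> U"
  shows "\<exists>W\<in>opens \<Sigma> U. \<exists>z K d a. snc_coordinates \<Sigma> (\<Union>\<rho>\<in>\<Delta>. toric_divisor \<Sigma> \<rho>) p W z K \<and>
    coordinate_fields \<Sigma> W z d \<and> (\<forall>i. a i \<in> regular \<Sigma> W) \<and>
    (\<forall>V\<in>opens \<Sigma> W. \<forall>f\<in>regular \<Sigma> V. \<forall>q\<in>V.
      vfield U s V f q = (\<Sum>i\<in>UNIV. a i q * ((if i \<in> K then z i q else 1) * d i V f q)))"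
proof -
  define \<tau> where "\<tau> = fst p"
  have \<tau>: "\<tau> \<in> \<Sigma>" using variety_cone[OF pX] by (simp add: \<tau>_def)
  obtain I g w where sf: "smooth_frame \<tau> I g (w :: 'n \<Rightarrow> int^'n)" using sm by (auto simp: smooth_def \<tau>_def)
  have db: "dual_bases g w" using sf by (simp add: smooth_frame_def)
  from vr have e: "e \<in> filtration_module \<Sigma> (logfilt \<Delta>) \<tau>" and b: "b \<in> R \<tau>" "eval_at b p \<noteq> 0" "D \<tau> b \<subseteq> U'"
    and sq: "\<And>q. q \<in> D \<tau> b \<Longrightarrow> q \<in> T \<Longrightarrow> s q = inverse (eval_at b q) *s eval_vec_at e q"
    by (auto simp: vrep_def \<tau>_def)
  define W where "W = D \<tau> b"
  have W: "openin (zariski \<Sigma>) W" "p \<in> W" "W \<subseteq> chart \<Sigma> \<tau>" "W \<subseteq> U"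
    using openin_basic_open[OF \<tau> b(1)] basic_open_self[OF pX b(2)] b(3) U basic_open_chart
    by (auto simp: W_def \<tau>_def)
  define K where "K = {i\<in>I. ray_cone (w i) \<in> \<Delta>}"
  define z where "z i = (\<lambda>q\<in>W. eval_at (coord_poly p I g i) q)" for i
  define d where "d i = vfield W (\<lambda>q. snd q (- g i) *s complex_vec (w i))" for i
  \<comment> \<open>Numerators of the coefficients: for \<open>i\<close> in \<open>K\<close> the
    component of \<open>s\<close> has no pole and is taken as it is; for other \<open>i\<close> the
    factor \<chi>^(g i) is absorbed and cancels a possible simple pole.\<close>
  define A where "A i = (\<Sum>m\<in>keys e. single (m + (if i \<in> K then 0 else g i)) (cpair (g i) (lookup e m)))" for i
  define a where "a i = (\<lambda>q\<in>W. eval_at (A i) q / eval_at b q)" for i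
  have dfil: "filtered_on W (\<lambda>q. snd q (- g i) *s complex_vec (w i))" for i
    by (rule frame_field_filtered[OF \<tau> sf W(3)])
  have AR: "A i \<in> R \<tau>" for i
    unfolding A_def
  proof (rule coordinate_ring_sum)
    fix m
    show "single (m + (if i \<in> K then 0 else g i)) (cpair (g i) (lookup e m)) \<in> R \<tau>"
    proof (cases "cpair (g i) (lookup e m) = 0")
      case False
      have "pairing (m + (if i \<in> K then 0 else g i)) (w l) \<ge> 0" if l: "l \<in> I" for l
        using logfilt_coefficient[OF \<tau> sf e l False] smooth_frame_pairing[OF sf, of i l] l
        by (auto simp: K_def pairing_simps split: if_splits)
      then show ?thesis by (simp add: smooth_frame_dual[OF sf])
    qed simp
  qed
  have areg: "a i \<in> regular \<Sigma> W" for i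
    unfolding a_def by (rule regular_fraction[OF \<tau> W(1) _ AR b(1)]) (simp add: W_def)
  have zreg: "z i \<in> regular \<Sigma> W" for i
    unfolding z_def by (rule regular_eval[OF W(1,3) coord_poly_ring[OF sf]])
  have "coordinate_fields \<Sigma> W z d"
    unfolding coordinate_fields_def
  proof (intro allI conjI ballI)
    fix i
    show "d i \<in> tangent_sections \<Sigma> W" unfolding d_def by (rule vfield_tangent[OF dfil])
    fix j q assume q: "q \<in> W"
    have "d i W (z j) = (\<lambda>q\<in>W. if i = j then 1 else 0)"
      unfolding d_def
    proof (rule vfield_eqI)
      show "W \<in> opens \<Sigma> W" using W by (simp add: opens_def)
      show "z j \<in> regular \<Sigma> W" by (rule zreg)
      show "(\<lambda>q\<in>W. if i = j then 1 else 0) \<in> regular \<Sigma> W" by (rule regular_const[OF W(1)])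
      fix q assume q: "q \<in> W" "q \<in> T"
      have "logder (snd q (- g i) *s complex_vec (w i)) (z j) q = ld (snd q (- g i) *s complex_vec (w i)) q (coord_poly p I g j)"
        unfolding z_def by (rule logder_eval[OF W(1) q])
      also have "\<dots> = snd q (- g i) * (snd q (g j) * of_int (pairing (g j) (w i)))"
        by (simp add: coord_poly_def ld_simps cpair_simps pairing_simps)
      also have "\<dots> = (if i = j then 1 else 0)"
        using T_value_neg[OF q(2), of "g i"] by (auto simp: smooth_frame_pairing[OF sf] mult.commute)
      finally show "(\<lambda>q\<in>W. if i = j then 1 else 0) q = logder (snd q (- g i) *s complex_vec (w i)) (z j) q"
        using q by simp
    qed
    then show "d i W (z j) q = (if i = j then 1 else 0)" using q by simp
  qed
  moreover have "vfield U s V f q = (\<Sum>i\<in>UNIV. a i q * ((if i \<in> K then z i q else 1) * d i V f q))"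
    if V: "V \<in> opens \<Sigma> W" and f: "f \<in> regular \<Sigma> V" and q: "q \<in> V" for V f q
  proof -
    have Vo: "openin (zariski \<Sigma>) V" "V \<subseteq> W" using V by (auto simp: opens_def)
    note dV = vfield_apply[OF dfil V f, folded d_def]
    define zz where "zz i = (if i \<in> K then restrict (z i) V else (\<lambda>q\<in>V. 1))" for i
    have zz: "zz i \<in> regular \<Sigma> V" for i
      using regular_restrict[OF W(1) Vo zreg] regular_const[OF Vo(1)] by (simp add: zz_def)
    have "vfield U s V f = (\<lambda>q\<in>V. \<Sum>i\<in>UNIV. (\<lambda>q\<in>V. restrict (a i) V q * (\<lambda>q\<in>V. zz i q * d i V f q) q) q)"
    proof (rule vfield_eqI)
      show "V \<in> opens \<Sigma> U" using Vo W(4) by (auto simp: opens_def)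
      show "f \<in> regular \<Sigma> V" by (rule f)
      show "(\<lambda>q\<in>V. \<Sum>i\<in>UNIV. (\<lambda>q\<in>V. restrict (a i) V q * (\<lambda>q\<in>V. zz i q * d i V f q) q) q) \<in> regular \<Sigma> V"
        by (intro regular_sum[OF Vo(1)] regular_mult[OF Vo(1)] regular_restrict[OF W(1) Vo] areg zz dV(1))
      fix q assume q: "q \<in> V" "q \<in> T"
      then have qW: "q \<in> W" using Vo by blast
      then have bq: "eval_at b q \<noteq> 0" by (simp add: W_def D_nonzero)
      define k where "k = eval_vec_at e q"
      have Aq: "eval_at (A i) q = snd q (if i \<in> K then 0 else g i) * cpair (g i) k" for i
        by (simp add: A_def k_def eval_at_sum eval_vec_at_def cpair_sum cpair_simps sum_distrib_left T_value_add[OF q(2)] algebra_simps)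
      have q0: "snd q 0 = 1" using point_value_0[OF T_X[OF q(2)]] .
      have tm: "a i q * (zz i q * d i V f q)
          = inverse (eval_at b q) * (cpair (g i) k * logder (complex_vec (w i)) f q)" for i
      proof -
        have di: "d i V f q = snd q (- g i) * logder (complex_vec (w i)) f q"
          using dV(2)[OF q, of i] logder_linear(3)[OF Vo(1) f q] by simp
        have zi: "zz i q = (if i \<in> K then snd q (g i) else 1)"
          using q qW coord_poly_value[OF T_X[OF q(2)], of p I g i] by (auto simp: zz_def z_def K_def)
        have "snd q (if i \<in> K then 0 else g i) * (zz i q * snd q (- g i)) = 1"
          using T_value_neg[OF q(2), of "g i"] q0 by (simp add: zi)
        moreover have "a i q * (zz i q * d i V f q) = (snd q (if i \<in> K then 0 else g i) * (zz i q * snd q (- g i)))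
            * (cpair (g i) k * logder (complex_vec (w i)) f q / eval_at b q)"
          using qW by (simp add: a_def Aq di)
        ultimately show ?thesis by (simp add: divide_inverse mult.commute)
      qed
      have "s q = inverse (eval_at b q) *s k" using sq qW q(2) by (simp add: W_def k_def)
      also have "k = (\<Sum>i\<in>UNIV. cpair (g i) k *s complex_vec (w i))" by (rule dual_bases_expand(3)[OF db])
      finally have "logder (s q) f q = inverse (eval_at b q) * (\<Sum>i\<in>UNIV. cpair (g i) k * logder (complex_vec (w i)) f q)"
        by (simp only: logder_linear[OF Vo(1) f q])
      then show "(\<lambda>q\<in>V. \<Sum>i\<in>UNIV. (\<lambda>q\<in>V. restrict (a i) V q * (\<lambda>q\<in>V. zz i q * d i V f q) q) q) q = logder (s q) f q"
        using q by (simp add: tm sum_distrib_left)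
    qed
    moreover have "zz i q = (if i \<in> K then z i q else 1)" for i using q by (simp add: zz_def)
    ultimately show ?thesis using q by simp
  qed
  moreover have "snc_coordinates \<Sigma> (\<Union>\<rho>\<in>\<Delta>. toric_divisor \<Sigma> \<rho>) p W z K"
    unfolding z_def K_def using W sf by (intro smooth_snc_coordinates[OF \<Delta> pX]) (auto simp: \<tau>_def)
  moreover have "W \<in> opens \<Sigma> U" using W by (simp add: opens_def)
  ultimately show ?thesis using areg
    by (intro bexI[of _ W] exI[of _ z] exI[of _ K] exI[of _ d] exI[of _ a]) simp_all
qed

subsection \<open>Extension over codimension two\<close>

text \<open>Realizes a homomorphism on the chart ring of {0} or of a ray as a point in normal form:
  if \<gamma> kills the equation \<open>g i\<close> of the divisor, the point lies on the orbit of
  \<tau>, and otherwise \<gamma> extends to all of \<open>M\<close>.\<close>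

lemma point_of_homomorphism:
  assumes \<tau>: "\<tau> \<in> \<Sigma>" and sf: "smooth_frame \<tau> I g w" and I: "I \<subseteq> {i}"
    and \<gamma>0: "\<gamma> 0 = 1"
    and \<gamma>add: "\<And>m m'. m \<in> dual_monoid \<tau> \<Longrightarrow> m' \<in> dual_monoid \<tau> \<Longrightarrow> \<gamma> (m + m') = \<gamma> m * \<gamma> m'"
  shows "\<exists>q\<in>X. (fst q = \<tau> \<or> fst q = {0}) \<and> (\<forall>m\<in>dual_monoid \<tau>. snd q m = \<gamma> m)"
proof -
  have perp_nz: "\<gamma> m \<noteq> 0" if m: "m \<in> perp_lattice \<tau>" for m
  proof -
    have "m \<in> dual_monoid \<tau>" "- m \<in> dual_monoid \<tau>" using m by (auto simp: perp_lattice_dual)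
    then have "\<gamma> m * \<gamma> (- m) = 1" using \<gamma>add[of m "- m"] \<gamma>0 by simp
    then show ?thesis by auto
  qed
  define Z where "Z \<longleftrightarrow> I = {} \<or> \<gamma> (g i) = 0"
  show ?thesis
  proof (cases Z)
    case True
    define q where "q = (\<tau>, \<lambda>m. if m \<in> perp_lattice \<tau> then \<gamma> m else 0)"
    have "q \<in> X"
      using \<tau> \<gamma>0 perp_nz by (auto simp: q_def toric_variety_def perp_lattice_closed perp_sum_iff \<gamma>add)
    moreover have "snd q m = \<gamma> m" if m: "m \<in> dual_monoid \<tau>" for m
    proof (cases "m \<in> perp_lattice \<tau>")
      case False
      then obtain j where j: "j \<in> I" "pairing m (w j) \<noteq> 0" using smooth_frame_perp[OF sf] by blast
      then have ji: "I = {i}" "j = i" using I by auto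
      then have "pairing m (w i) \<ge> 1" using m j smooth_frame_dual[OF sf] by force
      then have "m - g i \<in> dual_monoid \<tau>"
        using ji by (simp add: smooth_frame_dual[OF sf] pairing_simps smooth_frame_pairing[OF sf])
      then have "\<gamma> m = \<gamma> (m - g i) * \<gamma> (g i)" using \<gamma>add[OF _ frame_dual_mem(1)[OF sf], of "m - g i" i] by simp
      then show ?thesis using True ji False by (simp add: Z_def q_def)
    qed (simp add: q_def)
    ultimately show ?thesis by (intro bexI[of _ q]) (auto simp: q_def)
  next
    case False
    then have Ii: "I = {i}" and nz: "\<gamma> (g i) \<noteq> 0" using I by (auto simp: Z_def)
    define k where "k m = pairing m (w i)" for m
    have kadd: "k (m + m') = k m + k m'" for m m' by (simp add: k_def pairing_simps)
    \<comment> \<open>\<open>M\<close> is the sum of the units and the multiples of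
      \<open>g i\<close>; negative multiples make sense because \<gamma> (g i) is nonzero.\<close>
    define q where "q = ({0 :: real^'n}, \<lambda>m. \<gamma> (m - k m *s g i) * \<gamma> (g i) powi k m)"
    have P: "m - k m *s g i \<in> perp_lattice \<tau>" for m
      by (simp add: smooth_frame_perp[OF sf] Ii pairing_simps smooth_frame_pairing[OF sf] k_def)
    have "\<gamma> (m + m' - k (m + m') *s g i) = \<gamma> (m - k m *s g i) * \<gamma> (m' - k m' *s g i)" for m m'
    proof -
      have "m + m' - k (m + m') *s g i = (m - k m *s g i) + (m' - k m' *s g i)"
        by (simp add: kadd vector_sadd_rdistrib)
      then show ?thesis using \<gamma>add[OF perp_dual[OF P[of m]] perp_dual[OF P[of m']]] by (simp only:)
    qed
    then have "q \<in> X"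
      using zero_in_fan \<gamma>0 nz perp_nz[OF P]
      by (auto simp: q_def toric_variety_def power_int_add kadd k_def[of 0] pairing_simps)
    moreover have "snd q m = \<gamma> m" if m: "m \<in> dual_monoid \<tau>" for m
    proof -
      have gd: "g i \<in> dual_monoid \<tau>" by (rule frame_dual_mem(1)[OF sf])
      have pw: "int n *s g i \<in> dual_monoid \<tau> \<and> \<gamma> (int n *s g i) = \<gamma> (g i) ^ n" for n
      proof (induction n)
        case (Suc n)
        have "int (Suc n) *s g i = g i + int n *s g i" by (simp add: vector_sadd_rdistrib)
        then show ?case using Suc dual_add[OF gd] \<gamma>add[OF gd] by simp
      qed (simp add: dual_zero \<gamma>0)
      have k0: "k m \<ge> 0" using m Ii smooth_frame_dual[OF sf] by (simp add: k_def)
      have "\<gamma> ((m - k m *s g i) + int (nat (k m)) *s g i) = \<gamma> (m - k m *s g i) * \<gamma> (g i) ^ nat (k m)"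
        using \<gamma>add[OF perp_dual[OF P[of m]] pw[THEN conjunct1], of "nat (k m)"] by (simp only: pw)
      then show ?thesis using k0 by (simp add: q_def power_int_def)
    qed
    ultimately show ?thesis by (intro bexI[of _ q]) (auto simp: q_def)
  qed
qed

lemma filtration_module_0: "0 \<in> filtration_module \<Sigma> (logfilt \<Delta>) \<tau>"
  by (auto simp: filtration_module_def logfilt_def vec.span_zero)

lemma logfilt_subspace: "vec.subspace (logfilt \<Delta> \<rho> j :: (complex^'n) set)"
  by (auto simp: logfilt_def vec.subspace_span vec.subspace_UNIV)

lemma filtration_module_add:
  assumes "e \<in> filtration_module \<Sigma> (logfilt \<Delta>) \<tau>" "e' \<in> filtration_module \<Sigma> (logfilt \<Delta>) \<tau>"
  shows "e + e' \<in> filtration_module \<Sigma> (logfilt \<Delta>) \<tau>"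
  using assms vec.subspace_add[OF logfilt_subspace] by (auto simp: filtration_module_def lookup_add)

lemma filtration_module_sum:
  "(\<And>i. i \<in> A \<Longrightarrow> e i \<in> filtration_module \<Sigma> (logfilt \<Delta>) \<tau>) \<Longrightarrow>
    (\<Sum>i\<in>A. e i) \<in> filtration_module \<Sigma> (logfilt \<Delta>) \<tau>"
  by (induction A rule: infinite_finite_induct) (auto intro: filtration_module_add filtration_module_0)

lemma eval_vec_at_sum: "eval_vec_at (\<Sum>i\<in>A. e i) p = (\<Sum>i\<in>A. eval_vec_at (e i) p)"
  by (simp add: vec_eq_iff eval_vec_at_nth vcomp_sum eval_at_sum)

text \<open>A common form for the zero cone and the rays, so that both are treated at once;
  \<open>i\<close> is arbitrary when \<open>I\<close> is empty.\<close>

lemma small_frame: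
  assumes "\<tau> = {0} \<or> \<tau> \<in> rays \<Sigma>"
  shows "\<exists>I i g w. smooth_frame \<tau> I g (w :: 'n \<Rightarrow> int^'n) \<and> I \<subseteq> {i}"
  using assms zero_smooth ray_smooth[of \<tau>] by (metis empty_subsetI order_refl)

text \<open>The module of \<open>\<sigma>\<close> is the intersection of the modules of \<open>{0}\<close> and of the rays of \<open>\<sigma>\<close>.  So a function
  extends over all of \<open>D \<sigma> b\<close> as soon as a power of \<open>b\<close> clears its denominators on the charts of these
  cones, which follows from the Nullstellensatz there.\<close>

lemma denominator_power:
  fixes s :: "'n point \<Rightarrow> complex^'n"
  assumes \<sigma>: "\<sigma> \<in> \<Sigma>" and b: "b \<in> R \<sigma>" "D \<sigma> b \<subseteq> U"
    and \<tau>: "\<tau> = {0} \<or> \<tau> \<in> rays \<Sigma>" "\<tau> face_of \<sigma>"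
    and s: "\<And>q. q \<in> U \<Longrightarrow> fst q = {0} \<or> fst q \<in> rays \<Sigma> \<Longrightarrow> \<exists>V e b. vrep (logfilt \<Delta>) V s q e b"
  shows "\<exists>k. \<exists>e\<in>filtration_module \<Sigma> (logfilt \<Delta>) \<tau>.
    \<forall>r\<in>T. eval_at b r \<noteq> 0 \<longrightarrow> eval_at b r ^ k *s s r = eval_vec_at e r"
proof -
  have \<tau>\<Sigma>: "\<tau> \<in> \<Sigma>" using \<tau>(1) zero_in_fan by (auto simp: rays_def)
  obtain I i g w where sf: "smooth_frame \<tau> I g (w :: 'n \<Rightarrow> int^'n)" and Ii: "I \<subseteq> {i}"
    using small_frame[OF \<tau>(1)] by blast
  let ?M = "filtration_module \<Sigma> (logfilt \<Delta>) \<tau>"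
  \<comment> \<open>The ideal of possible denominators of \<open>s\<close> on the chart of \<tau>,
    tested on the part of the torus where \<open>b\<close> is nonzero.\<close>
  define J where "J = {f\<in>R \<tau>. \<exists>e\<in>?M. \<forall>r\<in>T. eval_at b r \<noteq> 0 \<longrightarrow> eval_at f r *s s r = eval_vec_at e r}"
  have b\<tau>: "b \<in> R \<tau>" using coordinate_ring_mono[OF face_of_imp_subset[OF \<tau>(2)]] b by blast
  have "\<exists>k. b ^ k \<in> J"
  proof (rule ccontr)
    assume no: "\<not> ?thesis"
    have "submonoid.ideal (dual_monoid \<tau>) J"
      unfolding submonoid.ideal_def[OF dual_monoid_submonoid]
    proof (intro conjI ballI)
      show "J \<subseteq> semigroup_algebra (dual_monoid \<tau>)" by (auto simp: J_def coordinate_ring_eq)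
      show "0 \<in> J" unfolding J_def using filtration_module_0
        by (auto intro!: bexI[of _ 0] simp: eval_vec_at_def)
      fix f assume "f \<in> J"
      then obtain e where f: "f \<in> R \<tau>" "e \<in> ?M"
        "\<And>r. r \<in> T \<Longrightarrow> eval_at b r \<noteq> 0 \<Longrightarrow> eval_at f r *s s r = eval_vec_at e r" by (auto simp: J_def)
      show "f + f' \<in> J" if "f' \<in> J" for f'
      proof -
        from that obtain e' where f': "f' \<in> R \<tau>" "e' \<in> ?M"
          "\<And>r. r \<in> T \<Longrightarrow> eval_at b r \<noteq> 0 \<Longrightarrow> eval_at f' r *s s r = eval_vec_at e' r" by (auto simp: J_def)
        have "f + f' \<in> R \<tau>" using f f' by (intro coordinate_ring_add)
        moreover have "e + e' \<in> ?M" using f f' by (intro filtration_module_add)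
        moreover have "eval_at (f + f') r *s s r = eval_vec_at (e + e') r" if "r \<in> T" "eval_at b r \<noteq> 0" for r
          using f(3)[OF that] f'(3)[OF that] by (simp add: eval_vec_at_add vector_sadd_rdistrib)
        ultimately show ?thesis by (auto simp: J_def)
      qed
      show "h * f \<in> J" if "h \<in> semigroup_algebra (dual_monoid \<tau>)" for h
      proof -
        have h: "h \<in> R \<tau>" using that by (simp add: coordinate_ring_eq)
        have "h * f \<in> R \<tau>" using f h by (intro coordinate_ring_mult)
        moreover have "vmult h e \<in> ?M" using f h by (intro filtration_module_vmult[OF logfilt_family])
        moreover have "eval_at (h * f) r *s s r = eval_vec_at (vmult h e) r" if "r \<in> T" "eval_at b r \<noteq> 0" for r
          using f(3)[OF that] by (simp add: eval_vec_at_vmult[OF that(1)] T_mult[OF that(1)] flip: vector_smult_assoc)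
        ultimately show ?thesis by (auto simp: J_def)
      qed
    qed
    from submonoid.nullstellensatz[OF dual_monoid_submonoid countableI_type this b\<tau>[unfolded coordinate_ring_eq]] no
    obtain \<gamma> where \<gamma>: "\<gamma> 0 = 1" "\<And>m m'. m \<in> dual_monoid \<tau> \<Longrightarrow> m' \<in> dual_monoid \<tau> \<Longrightarrow> \<gamma> (m + m') = \<gamma> m * \<gamma> m'"
      "\<And>f. f \<in> J \<Longrightarrow> lev \<gamma> f = 0" "lev \<gamma> b \<noteq> 0" by auto
    obtain q where q: "q \<in> X" "fst q = \<tau> \<or> fst q = {0}" "\<And>m. m \<in> dual_monoid \<tau> \<Longrightarrow> snd q m = \<gamma> m"
      using point_of_homomorphism[OF \<tau>\<Sigma> sf Ii \<gamma>(1,2)] by blast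
    have ev: "eval_at f q = lev \<gamma> f" if "f \<in> R \<tau>" for f
      unfolding eval_at_lev by (rule lev_cong) (use that q(3) in \<open>auto simp: coordinate_ring_def\<close>)
    have "fst q face_of \<sigma>" using q(2) \<tau>(2) zero_face[OF \<sigma>] by (elim disjE) simp_all
    then have "q \<in> D \<sigma> b" using q(1) ev[OF b\<tau>] \<gamma>(4) by (simp add: basic_open_def chart_iff)
    then have qU: "q \<in> U" using b by blast
    moreover have "fst q = {0} \<or> fst q \<in> rays \<Sigma>" using q(2) \<tau>(1) by auto
    ultimately obtain V e c where "vrep (logfilt \<Delta>) V s q e c" using s by blast
    then have ec: "e \<in> filtration_module \<Sigma> (logfilt \<Delta>) (fst q)" "c \<in> R (fst q)" "eval_at c q \<noteq> 0"
      "\<And>r. r \<in> D (fst q) c \<Longrightarrow> r \<in> T \<Longrightarrow> s r = inverse (eval_at c r) *s eval_vec_at e r"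
      by (auto simp: vrep_def)
    \<comment> \<open>With c c in place of \<open>c\<close> both sides contain the factor
      \<open>c\<close>, so the equation holds also at torus points where \<open>c\<close> vanishes
      and nothing is known about \<open>s\<close>.\<close>
    have cc: "eval_at (c * c) r *s s r = eval_vec_at (vmult c e) r" if r: "r \<in> T" for r
    proof (cases "eval_at c r = 0")
      case False
      then have "s r = inverse (eval_at c r) *s eval_vec_at e r"
        using ec(4)[OF basic_open_in_T[OF variety_cone[OF q(1)] r] r] by blast
      then show ?thesis using False by (simp add: T_mult[OF r] eval_vec_at_vmult[OF r])
    qed (simp add: T_mult[OF r] eval_vec_at_vmult[OF r])
    have ccq: "eval_at (c * c) q \<noteq> 0" using ec by (simp add: eval_at_mult[OF q(1)])
    show False
    proof (cases "fst q = \<tau>")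
      case True
      have "c * c \<in> R \<tau>" using ec True by (auto intro: coordinate_ring_mult)
      moreover have "vmult c e \<in> ?M" using ec True by (auto intro: filtration_module_vmult[OF logfilt_family])
      ultimately have "c * c \<in> J" using cc by (auto simp: J_def)
      then show False using \<gamma>(3) ev[OF \<open>c * c \<in> R \<tau>\<close>] ccq by simp
    next
      case False
      then have q0: "fst q = {0}" using q(2) by simp
      then have qT: "q \<in> T" using q(1) by (simp add: T_iff)
      \<comment> \<open>At a torus point the local numerator lies only in the module of {0}.
        Multiplication by the N-th power of \<chi>^(g i) moves all occurring exponents to
        nonnegative degrees, where the filtration is everything, without introducing a zero at
        \<open>q\<close>.\<close>
      define N where "N = (\<Sum>m\<in>keys (c * c) \<union> keys (vmult c e). \<bar>pairing m (w i)\<bar>)"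
      have N: "pairing (N *s g i + m) (w j) \<ge> 0" if "m \<in> keys (c * c) \<union> keys (vmult c e)" "j \<in> I" for m j
      proof -
        have "\<bar>pairing m (w i)\<bar> \<le> N" unfolding N_def using that by (intro member_le_sum) auto
        then show ?thesis using that(2) Ii by (auto simp: pairing_simps smooth_frame_pairing[OF sf])
      qed
      define x where "x = (single (N *s g i) 1 :: int^'n \<Rightarrow>\<^sub>0 complex)"
      have "keys (x * (c * c)) \<subseteq> dual_monoid \<tau>"
        using keys_mult[of x "c * c"] N by (fastforce simp: x_def smooth_frame_dual[OF sf])
      then have xR: "x * (c * c) \<in> R \<tau>" by (simp add: coordinate_ring_def)
      have "vmult x (vmult c e) \<in> ?M"
        unfolding smooth_frame_module[OF \<tau>\<Sigma> sf]
      proof (intro allI ballI)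
        fix m j assume j: "j \<in> I"
        have "lookup (vmult x (vmult c e)) m = (\<Sum>m2\<in>keys (vmult c e). if N *s g i + m2 = m then lookup (vmult c e) m2 else 0)"
        proof -
          have 1: "keys x = {N *s g i}" and 2: "lookup x (N *s g i) = 1" by (simp_all add: x_def)
          show ?thesis unfolding lookup_vmult[of x] 1 by (simp add: 2 cong: if_cong)
        qed
        also have "\<dots> \<in> logfilt \<Delta> (ray_cone (w j)) (pairing m (w j))"
        proof (rule vec.subspace_sum[OF logfilt_subspace])
          fix m2 assume "m2 \<in> keys (vmult c e)"
          then show "(if N *s g i + m2 = m then lookup (vmult c e) m2 else 0) \<in> logfilt \<Delta> (ray_cone (w j)) (pairing m (w j))"
            using N[of m2 j] j vec.subspace_0[OF logfilt_subspace] by (auto simp: logfilt_nonneg)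
        qed
        finally show "lookup (vmult x (vmult c e)) m \<in> logfilt \<Delta> (ray_cone (w j)) (pairing m (w j))" .
      qed
      moreover have "eval_at (x * (c * c)) r *s s r = eval_vec_at (vmult x (vmult c e)) r" if r: "r \<in> T" for r
        using cc[OF r] by (simp only: T_mult[OF r, of x] eval_vec_at_vmult[OF r, of x] vector_smult_assoc[symmetric])
      ultimately have "x * (c * c) \<in> J" using xR by (auto simp: J_def)
      then have "eval_at (x * (c * c)) q = 0" using \<gamma>(3) ev[OF xR] by simp
      then have "eval_at x q * eval_at (c * c) q = 0" by (simp only: T_mult[OF qT, of x])
      then show False using ccq T_value_nonzero[OF qT] by (simp add: x_def)
    qed
  qed
  then obtain k where "b ^ k \<in> J" by blast
  then show ?thesis by (auto simp: J_def T_power)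
qed

text \<open>For {0} and each ray of the cone, a power of \<open>b\<close> times \<open>s\<close> has
  a numerator in the respective module. With a common exponent these numerators agree on the torus,
  hence are one and the same element, which satisfies the conditions of all rays
  simultaneously.\<close>

lemma filtered_extension:
  fixes s :: "'n point \<Rightarrow> complex^'n"
  assumes U: "openin (zariski \<Sigma>) U" and p: "p \<in> U"
    and s: "\<And>q. q \<in> U \<Longrightarrow> fst q = {0} \<or> fst q \<in> rays \<Sigma> \<Longrightarrow> \<exists>V e b. vrep (logfilt \<Delta>) V s q e b"
  shows "\<exists>e b. vrep (logfilt \<Delta>) U s p e b"
proof -
  define \<sigma> where "\<sigma> = fst p"
  have pX: "p \<in> X" using open_subset[OF U] p by blast
  then have \<sigma>: "\<sigma> \<in> \<Sigma>" using variety_cone \<sigma>_def by blast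
  obtain b where b: "b \<in> R \<sigma>" "eval_at b p \<noteq> 0" "D \<sigma> b \<subseteq> U" using open_nbhd[OF U p] by (auto simp: \<sigma>_def)
  define A where "A = insert {0} (rays_of_cone \<Sigma> \<sigma>)"
  have A: "\<tau> = {0} \<or> \<tau> \<in> rays \<Sigma>" "\<tau> face_of \<sigma>" if "\<tau> \<in> A" for \<tau>
    using that zero_face[OF \<sigma>] by (auto simp: A_def rays_of_cone_def)
  have "finite \<Sigma>" using fan by (simp add: fan_def)
  then have finA: "finite A" by (simp add: A_def rays_of_cone_def rays_def)
  have "\<forall>\<tau>\<in>A. \<exists>k. \<exists>e\<in>filtration_module \<Sigma> (logfilt \<Delta>) \<tau>.
      \<forall>r\<in>T. eval_at b r \<noteq> 0 \<longrightarrow> eval_at b r ^ k *s s r = eval_vec_at e r"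
    using denominator_power[OF \<sigma> b(1,3) A s] by blast
  from bchoice[OF this] obtain k where "\<forall>\<tau>\<in>A. \<exists>e\<in>filtration_module \<Sigma> (logfilt \<Delta>) \<tau>.
      \<forall>r\<in>T. eval_at b r \<noteq> 0 \<longrightarrow> eval_at b r ^ k \<tau> *s s r = eval_vec_at e r" by blast
  then have "\<forall>\<tau>\<in>A. \<exists>e. e \<in> filtration_module \<Sigma> (logfilt \<Delta>) \<tau> \<and>
      (\<forall>r\<in>T. eval_at b r \<noteq> 0 \<longrightarrow> eval_at b r ^ k \<tau> *s s r = eval_vec_at e r)" by blast
  from bchoice[OF this] obtain e where e: "\<And>\<tau>. \<tau> \<in> A \<Longrightarrow> e \<tau> \<in> filtration_module \<Sigma> (logfilt \<Delta>) \<tau>"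
    "\<And>\<tau> r. \<tau> \<in> A \<Longrightarrow> r \<in> T \<Longrightarrow> eval_at b r \<noteq> 0 \<Longrightarrow> eval_at b r ^ k \<tau> *s s r = eval_vec_at (e \<tau>) r" by blast
  \<comment> \<open>Strictly larger than every \<open>k \<tau>\<close>, so that each
    \<open>e' \<tau>\<close> keeps a factor \<open>b\<close> and is 0 where \<open>b\<close> is 0;
    the numerators then agree on all of \<open>T\<close>, not just where \<open>b\<close> is
    nonzero.\<close>
  define K where "K = Suc (\<Sum>\<tau>\<in>A. k \<tau>)"
  have kK: "k \<tau> < K" if "\<tau> \<in> A" for \<tau>
    unfolding K_def using finA that by (simp add: less_Suc_eq_le member_le_sum)
  define e' where "e' \<tau> = vmult (b ^ (K - k \<tau>)) (e \<tau>)" for \<tau>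
  have e'M: "e' \<tau> \<in> filtration_module \<Sigma> (logfilt \<Delta>) \<tau>" if \<tau>: "\<tau> \<in> A" for \<tau>
  proof -
    have "b \<in> R \<tau>" using coordinate_ring_mono[OF face_of_imp_subset[OF A(2)[OF \<tau>]]] b(1) by blast
    then show ?thesis unfolding e'_def by (intro filtration_module_vmult[OF logfilt_family] coordinate_ring_power e(1)[OF \<tau>])
  qed
  have e'v: "eval_vec_at (e' \<tau>) r = (if eval_at b r = 0 then 0 else eval_at b r ^ K *s s r)"
    if \<tau>: "\<tau> \<in> A" and r: "r \<in> T" for \<tau> r
  proof -
    have "eval_vec_at (e' \<tau>) r = eval_at b r ^ (K - k \<tau>) *s eval_vec_at (e \<tau>) r"
      by (simp add: e'_def eval_vec_at_vmult[OF r] T_power[OF r])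
    moreover have "eval_at b r ^ (K - k \<tau>) *s (eval_at b r ^ k \<tau> *s s r) = eval_at b r ^ K *s s r"
      using kK[OF \<tau>] by (simp flip: power_add)
    ultimately show ?thesis using kK[OF \<tau>] by (cases "eval_at b r = 0") (simp_all add: e(2)[OF \<tau> r, symmetric] del: vector_smult_assoc)
  qed
  have zA: "{0} \<in> A" by (simp add: A_def)
  define x where "x = e' {0}"
  have eq: "e' \<tau> = x" if "\<tau> \<in> A" for \<tau>
    unfolding x_def by (rule laurent_vec_eq) (simp add: e'v that zA)
  have xM: "x \<in> filtration_module \<Sigma> (logfilt \<Delta>) \<sigma>"
    unfolding filtration_module_def
  proof (intro CollectI allI INT_I)
    fix m \<rho> assume \<rho>: "\<rho> \<in> rays_of_cone \<Sigma> \<sigma>"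
    then have "\<rho> \<in> A" "\<rho> \<in> \<Sigma>" "\<rho> \<in> rays \<Sigma>" by (auto simp: A_def rays_of_cone_def rays_def)
    then have "x \<in> filtration_module \<Sigma> (logfilt \<Delta>) \<rho>" "\<rho> \<in> rays_of_cone \<Sigma> \<rho>"
      using e'M[of \<rho>] eq[of \<rho>] face_refl by (auto simp: rays_of_cone_def)
    then show "lookup x m \<in> logfilt \<Delta> \<rho> (pairing m (ray_generator \<rho>))" by (auto simp: filtration_module_def)
  qed
  have "vrep (logfilt \<Delta>) U s p x (b ^ K)"
    unfolding vrep_def \<sigma>_def[symmetric]
  proof (intro conjI ballI)
    show "x \<in> filtration_module \<Sigma> (logfilt \<Delta>) \<sigma>" by (rule xM)
    show "b ^ K \<in> R \<sigma>" using b by (intro coordinate_ring_power)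
    show "eval_at (b ^ K) p \<noteq> 0" using b by (simp add: eval_at_power[OF pX] \<sigma>_def)
    have nz: "eval_at b q \<noteq> 0" if "q \<in> D \<sigma> (b ^ K)" for q
      using D_nonzero[OF that] chart_eval_at_power[OF basic_open_chart[OF that] b(1), of K] kK[OF zA] by auto
    then show "D \<sigma> (b ^ K) \<subseteq> U" using b(3) by (auto simp: basic_open_def)
    fix q assume q: "q \<in> D \<sigma> (b ^ K) \<inter> T"
    then have "eval_at b q \<noteq> 0" "q \<in> T" using nz by auto
    then show "s q = inverse (eval_at (b ^ K) q) *s eval_vec_at x q"
      using e'v[OF zA] by (simp add: x_def T_power)
  qed
  then show ?thesis by blast
qed

subsection \<open>Logarithmic vector fields near divisors\<close>

text \<open>On the orbit every function is a Laurent polynomial in \<open>t\<close>, so the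
  irreducibility of the torus applies. The extra factor \<open>h\<close> absorbs one factor of the
  product in each induction step.\<close>

lemma orbit_irreducible:
  assumes \<tau>: "\<tau> \<in> \<Sigma>" and K: "finite K" "\<And>k. k \<in> K \<Longrightarrow> f k \<in> R \<tau>" and h: "h \<in> R \<tau>"
    and 0: "\<And>t. t \<in> torus \<Longrightarrow> (\<Prod>k\<in>K. eval_at (f k) (pt \<tau> t)) * eval_at h (pt \<tau> t) = 0"
  shows "(\<exists>k\<in>K. \<forall>t\<in>torus. eval_at (f k) (pt \<tau> t) = 0) \<or> (\<forall>t\<in>torus. eval_at h (pt \<tau> t) = 0)"
  using K h 0
proof (induction K arbitrary: h)
  case (insert k K)
  have X: "pt \<tau> t \<in> X" "fst (pt \<tau> t) = \<tau>" if "t \<in> torus" for t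
    using pt_in_variety[OF \<tau> that] by (auto simp: pt_def)
  define f' where "f' = f k * h"
  have f': "f' \<in> R \<tau>" using insert.prems by (auto simp: f'_def intro: coordinate_ring_mult)
  have ev: "eval_at f' (pt \<tau> t) = eval_at (f k) (pt \<tau> t) * eval_at h (pt \<tau> t)" if "t \<in> torus" for t
    unfolding f'_def using X[OF that] insert.prems by (intro eval_at_mult) auto
  have "(\<exists>k\<in>K. \<forall>t\<in>torus. eval_at (f k) (pt \<tau> t) = 0) \<or> (\<forall>t\<in>torus. eval_at f' (pt \<tau> t) = 0)"
  proof (rule insert.IH)
    show "(\<Prod>k\<in>K. eval_at (f k) (pt \<tau> t)) * eval_at f' (pt \<tau> t) = 0" if "t \<in> torus" for t
      using insert.prems(3)[OF that] insert.hyps by (auto simp: ev[OF that])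
  qed (use insert.prems f' in auto)
  moreover have "(\<forall>t\<in>torus. eval_at (f k) (pt \<tau> t) = 0) \<or> (\<forall>t\<in>torus. eval_at h (pt \<tau> t) = 0)"
    if "\<forall>t\<in>torus. eval_at f' (pt \<tau> t) = 0"
  proof -
    have "eval_at (f k) (pt \<tau> t) * eval_at h (pt \<tau> t) = 0" if "t \<in> torus" for t
      using \<open>\<forall>t\<in>torus. eval_at f' (pt \<tau> t) = 0\<close> that ev[OF that] by simp
    then show ?thesis unfolding eval_pt by (intro torus_irreducible) auto
  qed
  ultimately show ?case by blast
qed auto

lemma locfrac_common:
  assumes V: "openin (zariski \<Sigma>) V" and p: "p \<in> V" and "finite K" and "\<And>k. k \<in> K \<Longrightarrow> locfrac V (h k) p"
  shows "\<exists>b a. b \<in> R (fst p) \<and> eval_at b p \<noteq> 0 \<and> D (fst p) b \<subseteq> V \<and>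
    (\<forall>k\<in>K. a k \<in> R (fst p) \<and> (\<forall>q\<in>D (fst p) b \<inter> T. h k q = eval_at (a k) q / eval_at b q))"
  using assms(3,4)
proof (induction K)
  case empty
  obtain b where "b \<in> R (fst p)" "eval_at b p \<noteq> 0" "D (fst p) b \<subseteq> V" using open_nbhd[OF V p] .
  then show ?case by auto
next
  case (insert x K)
  have pX: "p \<in> X" using open_subset[OF V] p by blast
  from insert have "\<exists>b a. b \<in> R (fst p) \<and> eval_at b p \<noteq> 0 \<and> D (fst p) b \<subseteq> V \<and>
    (\<forall>k\<in>K. a k \<in> R (fst p) \<and> (\<forall>q\<in>D (fst p) b \<inter> T. h k q = eval_at (a k) q / eval_at b q))" by simp
  then obtain b a where b: "b \<in> R (fst p)" "eval_at b p \<noteq> 0" "D (fst p) b \<subseteq> V"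
    and a': "\<forall>k\<in>K. a k \<in> R (fst p) \<and> (\<forall>q\<in>D (fst p) b \<inter> T. h k q = eval_at (a k) q / eval_at b q)"
    by (elim exE conjE)
  have a: "a k \<in> R (fst p)" "q \<in> D (fst p) b \<Longrightarrow> q \<in> T \<Longrightarrow> h k q = eval_at (a k) q / eval_at b q"
    if "k \<in> K" for k q using a' that by simp_all
  obtain a0 b0 where ab0: "a0 \<in> R (fst p)" "b0 \<in> R (fst p)" "eval_at b0 p \<noteq> 0"
    "\<And>q. q \<in> D (fst p) b0 \<Longrightarrow> q \<in> T \<Longrightarrow> h x q = eval_at a0 q / eval_at b0 q"
    using insert.prems[of x] by (auto simp: locfrac_def)
  define a' where "a' k = (if k = x then a0 * b else a k * b0)" for k
  have "a' k \<in> R (fst p) \<and> (\<forall>q\<in>D (fst p) (b * b0) \<inter> T. h k q = eval_at (a' k) q / eval_at (b * b0) q)"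
    if k: "k \<in> insert x K" for k
  proof (intro conjI ballI)
    show "a' k \<in> R (fst p)" using k a ab0 b by (auto simp: a'_def intro: coordinate_ring_mult)
    fix q assume q: "q \<in> D (fst p) (b * b0) \<inter> T"
    then have qT: "q \<in> T" and qD: "q \<in> D (fst p) b" "q \<in> D (fst p) b0" using b ab0 by (auto simp: basic_open_mult)
    then show "h k q = eval_at (a' k) q / eval_at (b * b0) q"
      using k a(2)[OF _ qD(1) qT] ab0(4)[OF qD(2) qT] D_nonzero[OF qD(1)] D_nonzero[OF qD(2)]
      by (auto simp: a'_def T_mult[OF qT])
  qed
  moreover have "b * b0 \<in> R (fst p)" "eval_at (b * b0) p \<noteq> 0" "D (fst p) (b * b0) \<subseteq> V"
    using b ab0 pX by (auto simp: coordinate_ring_mult eval_at_mult basic_open_mult)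
  ultimately show ?case by blast
qed

lemma rep_locfrac:
  "rep V f p a b \<Longrightarrow> (\<And>q. q \<in> V \<Longrightarrow> q \<in> T \<Longrightarrow> f q = h q) \<Longrightarrow> locfrac V h p"
  unfolding locfrac_def
proof (rule bexI[of _ a], rule bexI[of _ b], intro conjI ballI)
  fix q assume r: "rep V f p a b" and h: "\<And>q. q \<in> V \<Longrightarrow> q \<in> T \<Longrightarrow> f q = h q" and q: "q \<in> D (fst p) b \<inter> T"
  have "q \<in> V" "f q = eval_at a q / eval_at b q" using r q by (auto simp: rep_def)
  then show "h q = eval_at a q / eval_at b q" using h[of q] q by simp
qed (simp_all add: rep_def)

lemma regular_locfrac:
  assumes "openin (zariski \<Sigma>) V" "f \<in> regular \<Sigma> V" "p \<in> V" "\<And>q. q \<in> V \<Longrightarrow> q \<in> T \<Longrightarrow> f q = h q"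
  shows "locfrac V h p"
  using regular_rep[OF assms(1-3)] rep_locfrac assms(4) by metis

text \<open>Near the generic points of a component \<open>x = 0\<close> of the divisor, some coordinate
  \<open>z\<^sub>k\<close> with \<open>k \<in> K\<close> vanishes on this component, so that \<open>z\<^sub>k = x y\<close>; then \<open>\<partial>\<^sub>k z\<^sub>k = 1\<close> forces \<open>y\<close> to be
  a unit, and \<open>\<delta> z\<^sub>k \<in> (z\<^sub>k)\<close> gives \<open>\<delta> x \<in> (x)\<close>.\<close>

lemma log_field_divisible:
  assumes \<Delta>: "\<Delta> \<subseteq> rays \<Sigma>" and \<delta>: "\<delta> \<in> log_tangent_sections \<Sigma> (\<Union>\<rho>\<in>\<Delta>. toric_divisor \<Sigma> \<rho>) U"
    and p: "p \<in> U" "p \<in> X" and \<rho>: "fst p \<in> \<Delta>" and sf: "smooth_frame (fst p) {i} g w"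
    and V: "openin (zariski \<Sigma>) V" "p \<in> V" "U \<inter> chart \<Sigma> (fst p) \<subseteq> V"
    and on_T: "\<And>W f q. W \<in> opens \<Sigma> U \<Longrightarrow> f \<in> regular \<Sigma> W \<Longrightarrow> q \<in> W \<Longrightarrow> q \<in> T \<Longrightarrow> \<delta> W f q = logder (s q) f q"
  shows "locfrac V (\<lambda>q. cpair (g i) (s q)) p"
proof -
  define \<tau> where "\<tau> = fst p"
  have \<tau>: "\<tau> \<in> \<Sigma>" "\<tau> \<in> \<Delta>" using variety_cone[OF p(2)] \<rho> by (auto simp: \<tau>_def)
  have sf: "smooth_frame \<tau> {i} g w" using sf by (simp add: \<tau>_def)
  let ?Dv = "\<Union>\<rho>\<in>\<Delta>. toric_divisor \<Sigma> \<rho>"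
  have \<delta>t: "\<delta> \<in> tangent_sections \<Sigma> U" using \<delta> by (simp add: log_tangent_sections_def)
  have "\<exists>W\<in>opens \<Sigma> U. \<exists>z K d a. snc_coordinates \<Sigma> ?Dv p W z K \<and> coordinate_fields \<Sigma> W z d \<and>
       (\<forall>i. a i \<in> regular \<Sigma> W) \<and>
       (\<forall>V\<in>opens \<Sigma> W. \<forall>f\<in>regular \<Sigma> V. \<forall>q\<in>V.
          \<delta> V f q = (\<Sum>i\<in>UNIV. a i q * ((if i \<in> K then z i q else 1) * d i V f q)))"
    using \<delta> p(1) by (simp add: log_tangent_sections_def)
  then obtain W z K d a where W: "W \<in> opens \<Sigma> U" and snc: "snc_coordinates \<Sigma> ?Dv p W z K"
    and cf: "coordinate_fields \<Sigma> W z d" and areg': "\<forall>i. a i \<in> regular \<Sigma> W"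
    and form': "\<forall>V\<in>opens \<Sigma> W. \<forall>f\<in>regular \<Sigma> V. \<forall>q\<in>V.
      \<delta> V f q = (\<Sum>i\<in>UNIV. a i q * ((if i \<in> K then z i q else 1) * d i V f q))"
    by (elim bexE exE conjE)
  have areg: "a l \<in> regular \<Sigma> W" for l using areg' by simp
  have form: "\<delta> V f q = (\<Sum>i\<in>UNIV. a i q * ((if i \<in> K then z i q else 1) * d i V f q))"
    if "V \<in> opens \<Sigma> W" "f \<in> regular \<Sigma> V" "q \<in> V" for V f q using form' that by simp
  have Wo: "openin (zariski \<Sigma>) W" "W \<subseteq> U" using W by (auto simp: opens_def)
  have pW: "p \<in> W" and zreg: "\<And>i. z i \<in> regular \<Sigma> W" and DW: "?Dv \<inter> W = {q\<in>W. (\<Prod>i\<in>K. z i q) = 0}"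
    using snc by (auto simp: snc_coordinates_def local_coordinates_def)
  have dt: "d l \<in> tangent_sections \<Sigma> W" and dz: "q \<in> W \<Longrightarrow> d l W (z j) q = (if l = j then 1 else 0)" for l j q
    using cf by (auto simp: coordinate_fields_def)
  have "\<exists>b a. b \<in> R (fst p) \<and> eval_at b p \<noteq> 0 \<and> D (fst p) b \<subseteq> W \<and> (\<forall>i\<in>UNIV. rep W (z i) p (a i) b)"
    by (rule rep_common[OF Wo(1) pW]) (use zreg in auto)
  then obtain \<beta> \<alpha> where \<beta>: "\<beta> \<in> R \<tau>" "eval_at \<beta> p \<noteq> 0" "D \<tau> \<beta> \<subseteq> W" and \<alpha>: "\<And>i. rep W (z i) p (\<alpha> i) \<beta>"
    by (auto simp: \<tau>_def)
  have \<alpha>R: "\<alpha> i \<in> R \<tau>" for i using \<alpha>[of i] by (simp add: rep_def \<tau>_def)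
  have \<alpha>z: "z i q = eval_at (\<alpha> i) q / eval_at \<beta> q" if "q \<in> D \<tau> \<beta>" for i q
    using \<alpha>[of i] that by (simp add: rep_def \<tau>_def)
  \<comment> \<open>The divisor contains the whole orbit, so the product of the coordinates in
    \<open>K\<close> vanishes on it wherever \<beta> does not; by irreducibility a single coordinate
    does.\<close>
  have irr: "(\<exists>k\<in>K. \<forall>t\<in>torus. eval_at (\<alpha> k) (pt \<tau> t) = 0) \<or> (\<forall>t\<in>torus. eval_at \<beta> (pt \<tau> t) = 0)"
  proof (rule orbit_irreducible[OF \<tau>(1) _ \<alpha>R \<beta>(1)])
    show "finite K" by simp
    fix t :: "complex^'n" assume t: "t \<in> torus"
    show "(\<Prod>k\<in>K. eval_at (\<alpha> k) (pt \<tau> t)) * eval_at \<beta> (pt \<tau> t) = 0"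
    proof (cases "eval_at \<beta> (pt \<tau> t) = 0")
      case False
      have ptX: "pt \<tau> t \<in> X" "fst (pt \<tau> t) = \<tau>" using pt_in_variety[OF \<tau>(1) t] by (auto simp: pt_def)
      then have D: "pt \<tau> t \<in> D \<tau> \<beta>" using basic_open_self[OF ptX(1) False] by simp
      then have "pt \<tau> t \<in> ?Dv \<inter> W"
        using ptX \<tau> \<beta>(3) toric_divisor_iff[OF \<tau>(1), of "pt \<tau> t"] face_refl[OF \<tau>(1)] by auto
      then have "(\<Prod>k\<in>K. z k (pt \<tau> t)) = 0" using DW by blast
      then obtain k where "k \<in> K" "z k (pt \<tau> t) = 0" by auto
      then have "eval_at (\<alpha> k) (pt \<tau> t) = 0" using \<alpha>z[OF D] False by simp
      then show ?thesis using \<open>k \<in> K\<close> by auto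
    qed simp
  qed
  have "\<not> (\<forall>t\<in>torus. eval_at \<beta> (pt \<tau> t) = 0)"
  proof
    assume "\<forall>t\<in>torus. eval_at \<beta> (pt \<tau> t) = 0"
    then have "keys \<beta> \<inter> perp_lattice \<tau> = {}" by (intro vanishing_on_orbit) auto
    then have "eval_at \<beta> p = 0"
      unfolding eval_at_def \<tau>_def by (intro sum.neutral) (auto simp: point_value_eq_0[OF p(2)])
    then show False using \<beta>(2) by simp
  qed
  with irr obtain k where k: "k \<in> K" "\<And>t. t \<in> torus \<Longrightarrow> eval_at (\<alpha> k) (pt \<tau> t) = 0" by blast
  \<comment> \<open>No exponent of \<alpha>_k is a unit, so \<alpha>_k is divisible by the character
    of \<open>g i\<close>.\<close>
  have keys1: "pairing m (w i) \<ge> 1" if "m \<in> keys (\<alpha> k)" for m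
  proof -
    have "m \<notin> perp_lattice \<tau>" using vanishing_on_orbit[OF k(2)] that by blast
    moreover have "m \<in> dual_monoid \<tau>" using \<alpha>R[of k] that by (auto simp: coordinate_ring_def)
    ultimately show ?thesis by (simp add: smooth_frame_perp[OF sf] smooth_frame_dual[OF sf])
  qed
  define \<alpha>' where "\<alpha>' = single (- g i) 1 * \<alpha> k"
  have "keys \<alpha>' \<subseteq> dual_monoid \<tau>"
  proof
    fix m assume "m \<in> keys \<alpha>'"
    then obtain m' where m': "m' \<in> keys (\<alpha> k)" "m = - g i + m'"
      unfolding \<alpha>'_def using keys_mult[of "single (- g i) (1::complex)" "\<alpha> k"] by auto
    then show "m \<in> dual_monoid \<tau>"
      using keys1[OF m'(1)] by (simp add: m'(2) smooth_frame_dual[OF sf] pairing_simps smooth_frame_pairing[OF sf])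
  qed
  then have \<alpha>'R: "\<alpha>' \<in> R \<tau>" by (simp add: coordinate_ring_def)
  have gR: "single (g i) 1 \<in> R \<tau>" using frame_dual_mem(1)[OF sf] by simp
  have \<alpha>k: "\<alpha> k = single (g i) 1 * \<alpha>'" by (simp add: \<alpha>'_def mult.assoc[symmetric] mult_single)
  define V1 where "V1 = D \<tau> \<beta>"
  have V1: "openin (zariski \<Sigma>) V1" "p \<in> V1" "V1 \<subseteq> W" "V1 \<subseteq> chart \<Sigma> \<tau>" "V1 \<in> opens \<Sigma> W" "V1 \<in> opens \<Sigma> U"
    using openin_basic_open[OF \<tau>(1) \<beta>(1)] basic_open_self[OF p(2) \<beta>(2)] \<beta>(3) basic_open_chart Wo(2)
    by (auto simp: V1_def \<tau>_def opens_def)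
  define x y zk where "x = (\<lambda>q\<in>V1. eval_at (single (g i) 1) q)"
    and "y = (\<lambda>q\<in>V1. eval_at \<alpha>' q / eval_at \<beta> q)" and "zk = restrict (z k) V1"
  have xr: "x \<in> regular \<Sigma> V1" unfolding x_def by (rule regular_eval[OF V1(1,4) gR])
  have yr: "y \<in> regular \<Sigma> V1"
    unfolding y_def by (rule regular_fraction[OF \<tau>(1) V1(1) _ \<alpha>'R \<beta>(1)]) (simp add: V1_def)
  have zkr: "zk \<in> regular \<Sigma> V1" unfolding zk_def by (rule regular_restrict[OF Wo(1) V1(1,3) zreg])
  have zxy: "zk = (\<lambda>q\<in>V1. x q * y q)"
    unfolding zk_def
  proof (rule restrict_ext)
    fix q assume q: "q \<in> V1"
    then show "z k q = x q * y q"
      using D_mult[OF q[unfolded V1_def] gR \<alpha>'R] \<alpha>z[OF q[unfolded V1_def]] by (simp add: x_def y_def \<alpha>k)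
  qed
  have dzk: "d l V1 zk q = (if l = k then 1 else 0)" if "q \<in> V1" for l q
  proof -
    have "W \<in> opens \<Sigma> W" using Wo by (simp add: opens_def)
    then have "d l V1 zk = restrict (d l W (z k)) V1"
      unfolding zk_def using tangent_sectionsD(5)[OF dt _ zreg V1(5)] by blast
    then show ?thesis using that V1(3) dz[of q l k] by auto
  qed
  have "d k V1 zk p = x p * d k V1 y p + y p * d k V1 x p"
    unfolding zxy by (rule tangent_sectionsD(4)[OF dt V1(5) xr yr V1(2)])
  moreover have "x p = 0"
    using V1(2) point_value_eq_0[OF p(2)] frame_dual_mem(2)[OF sf, of i] by (simp add: x_def \<tau>_def)
  ultimately have yp: "y p \<noteq> 0" using dzk[OF V1(2), of k] by auto
  then have \<alpha>'p: "eval_at \<alpha>' p \<noteq> 0" using V1(2) by (simp add: y_def)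
  \<comment> \<open>The intended value of y <g i, s>. Comparing \<delta> z_k = a_k x y with \<delta>
    (x y) = x \<delta> y + y x <g i, s> and cancelling x, which has no zero on the torus, gives y <g
    i, s> = a_k y - \<delta> y.\<close>
  define n where "n = (\<lambda>q\<in>V1. (\<lambda>q\<in>V1. restrict (a k) V1 q * y q) q + (\<lambda>q\<in>V1. (-1) * \<delta> V1 y q) q)"
  have \<delta>y: "\<delta> V1 y \<in> regular \<Sigma> V1" by (rule tangent_sectionsD(1)[OF \<delta>t V1(6) yr])
  have nreg: "n \<in> regular \<Sigma> V1"
    unfolding n_def
    by (intro regular_add[OF V1(1)] regular_mult[OF V1(1)] regular_cmult[OF V1(1)] yr \<delta>y regular_restrict[OF Wo(1) V1(1,3) areg])
  have key: "y q * cpair (g i) (s q) = n q" if q: "q \<in> V1" "q \<in> T" for q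
  proof -
    have "\<delta> V1 zk q = (\<Sum>l\<in>UNIV. a l q * ((if l \<in> K then z l q else 1) * (if l = k then 1 else 0)))"
      using form[OF V1(5) zkr q(1)] by (simp add: dzk[OF q(1)])
    also have "\<dots> = (\<Sum>l\<in>UNIV. if l = k then a l q * (if l \<in> K then z l q else 1) else 0)"
      by (intro sum.cong) auto
    also have "\<dots> = a k q * z k q" using k(1) by simp
    also have "z k q = x q * y q" using fun_cong[OF zxy, of q] q by (simp add: zk_def)
    finally have 1: "\<delta> V1 zk q = a k q * (x q * y q)" .
    have 2: "\<delta> V1 zk q = x q * \<delta> V1 y q + y q * \<delta> V1 x q"
      unfolding zxy by (rule tangent_sectionsD(4)[OF \<delta>t V1(6) xr yr q(1)])
    have "\<delta> V1 x q = logder (s q) x q" by (rule on_T[OF V1(6) xr q])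
    also have "\<dots> = snd q (g i) * cpair (g i) (s q)"
      unfolding x_def using logder_eval[OF V1(1) q] by (simp add: ld_simps)
    also have "snd q (g i) = x q" using q by (simp add: x_def)
    finally have "x q * (y q * cpair (g i) (s q)) = x q * (a k q * y q - \<delta> V1 y q)"
      using 1 2 by (simp add: algebra_simps)
    moreover have "x q \<noteq> 0" using T_value_nonzero[OF q(2)] q by (simp add: x_def)
    ultimately show ?thesis using q by (simp add: n_def)
  qed
  obtain A B where AB: "rep V1 n p A B" using regular_rep[OF V1(1) nreg V1(2)] .
  then have ABR: "A \<in> R \<tau>" "B \<in> R \<tau>" "eval_at B p \<noteq> 0" "D \<tau> B \<subseteq> V1"
    "\<And>q. q \<in> D \<tau> B \<Longrightarrow> n q = eval_at A q / eval_at B q" by (auto simp: rep_def \<tau>_def)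
  show ?thesis
    unfolding locfrac_def \<tau>_def[symmetric]
  proof (rule bexI[of _ "A * \<beta>"], rule bexI[of _ "B * \<alpha>'"], intro conjI ballI)
    show "A * \<beta> \<in> R \<tau>" "B * \<alpha>' \<in> R \<tau>" using ABR \<beta> \<alpha>'R by (auto intro: coordinate_ring_mult)
    show "eval_at (B * \<alpha>') p \<noteq> 0" using ABR \<alpha>'R \<alpha>'p by (simp add: eval_at_mult[OF p(2)] \<tau>_def)
    have sub: "D \<tau> (B * \<alpha>') \<subseteq> V1" using ABR \<alpha>'R by (auto simp: basic_open_mult)
    then show "D \<tau> (B * \<alpha>') \<subseteq> V" using V1(3,4) Wo(2) V(3)[folded \<tau>_def] by blast
    fix q assume q: "q \<in> D \<tau> (B * \<alpha>') \<inter> T"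
    then have qT: "q \<in> T" and q1: "q \<in> V1" and qB: "q \<in> D \<tau> B" and qa: "eval_at \<alpha>' q \<noteq> 0"
      using sub ABR \<alpha>'R by (auto simp: basic_open_mult D_nonzero)
    have nz: "eval_at \<beta> q \<noteq> 0" "eval_at B q \<noteq> 0" using q1 D_nonzero[OF qB] by (auto simp: V1_def D_nonzero)
    have "eval_at \<alpha>' q / eval_at \<beta> q * cpair (g i) (s q) = eval_at A q / eval_at B q"
      using key[OF q1 qT] ABR(5)[OF qB] q1 by (simp add: y_def)
    then show "cpair (g i) (s q) = eval_at (A * \<beta>) q / eval_at (B * \<alpha>') q"
      using nz qa by (simp add: T_mult[OF qT] field_simps)
  qed
qed

text \<open>For a ray outside \<Delta> the transversal component is controlled by applying \<delta>
  to \<chi>^(g j); for the remaining components this character is a unit and can be divided out.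
  Only a ray in \<Delta> requires the logarithmic condition.\<close>

lemma log_field_filtered:
  assumes \<Delta>: "\<Delta> \<subseteq> rays \<Sigma>" and \<delta>: "\<delta> \<in> log_tangent_sections \<Sigma> (\<Union>\<rho>\<in>\<Delta>. toric_divisor \<Sigma> \<rho>) U'"
    and U: "openin (zariski \<Sigma>) U" "U' = U \<inter> {p \<in> X. smooth (fst p)}"
    and p: "p \<in> U" and fp: "fst p = {0} \<or> fst p \<in> rays \<Sigma>"
    and on_T: "\<And>W f q. W \<in> opens \<Sigma> U' \<Longrightarrow> f \<in> regular \<Sigma> W \<Longrightarrow> q \<in> W \<Longrightarrow> q \<in> T \<Longrightarrow> \<delta> W f q = logder (s q) f q"
  shows "\<exists>V e b. vrep (logfilt \<Delta>) V s p e b"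
proof -
  have pX: "p \<in> X" using open_subset[OF U(1)] p by blast
  define \<tau> where "\<tau> = fst p"
  have \<tau>: "\<tau> \<in> \<Sigma>" using variety_cone[OF pX] by (simp add: \<tau>_def)
  obtain I i g w where sf: "smooth_frame \<tau> I g (w :: 'n \<Rightarrow> int^'n)" and Ii: "I \<subseteq> {i}"
    using small_frame[OF fp] by (auto simp: \<tau>_def)
  have db: "dual_bases g w" using sf by (simp add: smooth_frame_def)
  have sm: "smooth \<tau>" using sf by (auto simp: smooth_def)
  define V where "V = U \<inter> chart \<Sigma> \<tau>"
  have V: "openin (zariski \<Sigma>) V" "p \<in> V" "V \<subseteq> chart \<Sigma> \<tau>" "V \<subseteq> U"
    using U openin_chart[OF \<tau>] p self_chart[OF pX] by (auto simp: V_def \<tau>_def)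
  have "V \<subseteq> U'" using smooth_chart[OF \<tau> sm] by (auto simp: V_def U(2) chart_iff)
  then have VU': "V \<in> opens \<Sigma> U'" using V by (simp add: opens_def)
  have \<delta>t: "\<delta> \<in> tangent_sections \<Sigma> U'" using \<delta> by (simp add: log_tangent_sections_def)
  \<comment> \<open>The exponent that clears the permitted simple pole; it is 0 where no pole is
    permitted.\<close>
  define x where "x j = (if j \<in> I \<and> ray_cone (w j) \<notin> \<Delta> then g j else 0)" for j
  define h where "h j q = snd q (x j) * cpair (g j) (s q)" for j q
  define G where "G j = \<delta> V (\<lambda>q\<in>V. eval_at (single (g j) 1) q)" for j
  have mreg: "(\<lambda>q\<in>V. eval_at (single m 1) q) \<in> regular \<Sigma> V" if "m \<in> dual_monoid \<tau>" for m
    by (rule regular_eval[OF V(1,3)]) (use that in simp)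
  note gd = frame_dual_mem[OF sf]
  have G: "G j \<in> regular \<Sigma> V" for j
    unfolding G_def by (rule tangent_sectionsD(1)[OF \<delta>t VU' mreg[OF gd(1)]])
  have GT: "G j q = snd q (g j) * cpair (g j) (s q)" if q: "q \<in> V" "q \<in> T" for j q
    unfolding G_def on_T[OF VU' mreg[OF gd(1)] q, of j] logder_eval[OF V(1) q] by (simp add: ld_simps)
  have lf: "locfrac V (h j) p" for j
  proof -
    consider "j \<in> I" "ray_cone (w j) \<notin> \<Delta>" | "j \<notin> I" | "j \<in> I" "ray_cone (w j) \<in> \<Delta>" by blast
    then show ?thesis
    proof cases
      case 1
      then show ?thesis using GT by (intro regular_locfrac[OF V(1) G[of j] V(2)]) (simp add: h_def x_def)
    next
      case 2
      have "- g j \<in> dual_monoid \<tau>" using gd(2)[of j] 2 by (simp add: perp_lattice_dual)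
      then have r: "(\<lambda>q\<in>V. (\<lambda>q\<in>V. eval_at (single (- g j) 1) q) q * G j q) \<in> regular \<Sigma> V"
        by (intro regular_mult[OF V(1)] mreg G)
      show ?thesis
      proof (rule regular_locfrac[OF V(1) r V(2)])
        fix q assume q: "q \<in> V" "q \<in> T"
        then show "(\<lambda>q\<in>V. (\<lambda>q\<in>V. eval_at (single (- g j) 1) q) q * G j q) q = h j q"
          using 2 T_value_neg[OF q(2), of "g j"] point_value_0[OF T_X[OF q(2)]]
          by (simp add: h_def x_def GT[OF q] mult.assoc[symmetric] mult.commute)
      qed
    next
      case 3
      then have I: "I = {j}" using Ii by auto
      have "\<tau> \<noteq> {0}"
      proof
        assume "\<tau> = {0}"
        then have "real_vec (w j) = 0" using smooth_frame_mem[OF sf 3(1)] by simp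
        then show False using smooth_frame_pairing[OF sf, of j j] by (simp add: real_vec_simps pairing_simps)
      qed
      then have "\<tau> \<in> rays \<Sigma>" using fp by (simp add: \<tau>_def)
      then have "\<tau> \<in> rays_of_cone \<Sigma> \<tau>" using face_refl[OF \<tau>] by (simp add: rays_of_cone_def)
      then have "\<tau> = ray_cone (w j)" using smooth_frame_rays[OF \<tau> sf] I by auto
      then have \<rho>: "fst p \<in> \<Delta>" using 3 by (simp add: \<tau>_def)
      have "locfrac V (\<lambda>q. cpair (g j) (s q)) p"
      proof (rule log_field_divisible[OF \<Delta> \<delta> _ pX \<rho> _ V(1,2) _ on_T])
        show "p \<in> U'" using V(2) \<open>V \<subseteq> U'\<close> by blast
        show "smooth_frame (fst p) {j} g w" using sf I by (simp add: \<tau>_def)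
        show "U' \<inter> chart \<Sigma> (fst p) \<subseteq> V" by (auto simp: V_def U(2) \<tau>_def)
      qed
      then obtain a b where ab: "a \<in> R \<tau>" "b \<in> R \<tau>" "eval_at b p \<noteq> 0" "D \<tau> b \<subseteq> V"
        "\<And>q. q \<in> D \<tau> b \<inter> T \<Longrightarrow> cpair (g j) (s q) = eval_at a q / eval_at b q" by (auto simp: locfrac_def \<tau>_def)
      have hj: "h j q = cpair (g j) (s q)" if "q \<in> T" for q
        using 3 point_value_0[OF T_X[OF that]] by (simp add: h_def x_def)
      show ?thesis unfolding locfrac_def \<tau>_def[symmetric]
        by (rule bexI[of _ a], rule bexI[of _ b]) (auto simp: ab hj)
    qed
  qed
  have "\<exists>b a. b \<in> R (fst p) \<and> eval_at b p \<noteq> 0 \<and> D (fst p) b \<subseteq> V \<and>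
      (\<forall>j\<in>UNIV. a j \<in> R (fst p) \<and> (\<forall>q\<in>D (fst p) b \<inter> T. h j q = eval_at (a j) q / eval_at b q))"
    by (rule locfrac_common[OF V(1,2)]) (use lf in auto)
  then obtain b a where b: "b \<in> R \<tau>" "eval_at b p \<noteq> 0" "D \<tau> b \<subseteq> V"
    and a': "\<forall>j\<in>UNIV. a j \<in> R \<tau> \<and> (\<forall>q\<in>D \<tau> b \<inter> T. h j q = eval_at (a j) q / eval_at b q)"
    unfolding \<tau>_def by (elim exE conjE)
  have a: "a j \<in> R \<tau>" "q \<in> D \<tau> b \<Longrightarrow> q \<in> T \<Longrightarrow> h j q = eval_at (a j) q / eval_at b q" for j q
    using a' by simp_all
  define y where "y j = (single (- x j) (complex_vec (w j)) :: int^'n \<Rightarrow>\<^sub>0 complex^'n)" for j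
  define e where "e = (\<Sum>j\<in>UNIV. vmult (a j) (y j))"
  have "y j \<in> filtration_module \<Sigma> (logfilt \<Delta>) \<tau>" for j
    unfolding smooth_frame_module[OF \<tau> sf]
  proof (intro allI ballI)
    fix m l assume l: "l \<in> I"
    show "lookup (y j) m \<in> logfilt \<Delta> (ray_cone (w l)) (pairing m (w l))"
    proof (cases "m = - x j")
      case True
      show ?thesis
      proof (cases "j \<in> I \<and> ray_cone (w j) \<notin> \<Delta> \<and> l = j")
        case True
        then show ?thesis using \<open>m = - x j\<close>
          by (auto simp: y_def x_def logfilt_def smooth_frame_ray(2)[OF \<tau> sf] pairing_simps
              smooth_frame_pairing[OF sf] intro: vec.span_base)
      next
        case False
        then have "pairing m (w l) = 0"
          using \<open>m = - x j\<close> by (auto simp: x_def pairing_simps smooth_frame_pairing[OF sf])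
        then show ?thesis by (simp add: logfilt_nonneg)
      qed
    next
      case False
      then have "lookup (y j) m = 0" by (simp add: y_def lookup_single when_def)
      then show ?thesis using vec.subspace_0[OF logfilt_subspace] by simp
    qed
  qed
  then have eM: "e \<in> filtration_module \<Sigma> (logfilt \<Delta>) \<tau>"
    unfolding e_def by (intro filtration_module_sum filtration_module_vmult[OF logfilt_family] a(1))
  have "vrep (logfilt \<Delta>) V s p e b"
    unfolding vrep_def \<tau>_def[symmetric]
  proof (intro conjI ballI)
    fix q assume q: "q \<in> D \<tau> b \<inter> T"
    then have qT: "q \<in> T" and qD: "q \<in> D \<tau> b" by auto
    have yq: "eval_vec_at (y j) q = snd q (- x j) *s complex_vec (w j)" for j
      by (simp add: vec_eq_iff eval_vec_at_nth y_def)
    have "inverse (eval_at b q) *s eval_vec_at e q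
        = (\<Sum>j\<in>UNIV. (eval_at (a j) q / eval_at b q * snd q (- x j)) *s complex_vec (w j))"
      by (simp add: e_def eval_vec_at_sum eval_vec_at_vmult[OF qT] yq vec_eq_iff sum_distrib_left divide_inverse mult.assoc mult.commute mult.left_commute)
    also have "\<dots> = (\<Sum>j\<in>UNIV. cpair (g j) (s q) *s complex_vec (w j))"
    proof (intro sum.cong refl)
      fix j
      have "eval_at (a j) q / eval_at b q * snd q (- x j) = (snd q (x j) * snd q (- x j)) * cpair (g j) (s q)"
        unfolding a(2)[OF qD qT, of j, symmetric] h_def by (simp only: mult_ac)
      then show "(eval_at (a j) q / eval_at b q * snd q (- x j)) *s complex_vec (w j)
          = cpair (g j) (s q) *s complex_vec (w j)" using T_value_neg[OF qT, of "x j"] by simp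
    qed
    also have "\<dots> = s q" by (rule dual_bases_expand(3)[OF db, symmetric])
    finally show "s q = inverse (eval_at b q) *s eval_vec_at e q" by simp
  qed (use b eM in auto)
  then show ?thesis by blast
qed

subsection \<open>The torus action\<close>

lemma act_X: "t \<in> torus \<Longrightarrow> p \<in> X \<Longrightarrow> act t p \<in> X"
  using character_nonzero[of t] by (auto simp: act_def toric_variety_def character_add)

lemma fst_act [simp]: "fst (act t p) = fst p"
  by (simp add: act_def)

lemma act_inverse:
  assumes "t \<in> torus"
  shows "act t (act (torus_inv t) p) = p" "act (torus_inv t) (act t p) = p"
  using character_nonzero[OF assms] by (simp_all add: act_def character_torus_inv mult.assoc[symmetric])

lemma act_image_iff:
  assumes "t \<in> torus"
  shows "q \<in> act t ` V \<longleftrightarrow> act (torus_inv t) q \<in> V"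
proof
  assume "act (torus_inv t) q \<in> V"
  then show "q \<in> act t ` V" using act_inverse(1)[OF assms, of q] by (intro image_eqI[of q _ "act (torus_inv t) q"]) simp_all
qed (auto simp: act_inverse[OF assms])

lemma act_inv_image: "t \<in> torus \<Longrightarrow> act t ` (act (torus_inv t) ` V) = V"
  by (simp add: image_image act_inverse)

lemma act_T: "t \<in> torus \<Longrightarrow> q \<in> T \<Longrightarrow> act t q \<in> T"
  by (simp add: T_iff act_X)

lemma act_chart: "t \<in> torus \<Longrightarrow> q \<in> chart \<Sigma> \<sigma> \<Longrightarrow> act t q \<in> chart \<Sigma> \<sigma>"
  by (simp add: chart_iff act_X)

text \<open>The pullback of a Laurent polynomial under the action of \<open>t\<close>. It keeps the
  support within that of \<open>f\<close>, so it preserves the chart rings.\<close>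

definition tpoly :: "complex^'n \<Rightarrow> (int^'n \<Rightarrow>\<^sub>0 complex) \<Rightarrow> (int^'n \<Rightarrow>\<^sub>0 complex)" where
  "tpoly t f = Poly_Mapping.mapp (\<lambda>m c. character m t * c) f"

lemma lev_tpoly: "lev \<psi> (tpoly t f) = lev (\<lambda>m. character m t * \<psi> m) f"
proof -
  have "keys (tpoly t f) \<subseteq> keys f" by (simp add: tpoly_def keys_mapp_subset)
  then have "lev \<psi> (tpoly t f) = (\<Sum>m\<in>keys f. lookup (tpoly t f) m * \<psi> m)"
    by (intro lev_superset) auto
  also have "\<dots> = lev (\<lambda>m. character m t * \<psi> m) f"
    unfolding lev_def by (intro sum.cong) (auto simp: tpoly_def lookup_mapp)
  finally show ?thesis .
qed

lemma eval_tpoly: "eval_at (tpoly t f) p = eval_at f (act t p)"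
  by (simp add: eval_at_lev lev_tpoly act_def)

lemma tpoly_ring: "f \<in> R \<sigma> \<Longrightarrow> tpoly t f \<in> R \<sigma>"
  using keys_mapp_subset[of "\<lambda>m c. character m t * c" f] by (auto simp: coordinate_ring_def tpoly_def)

lemma ld_tpoly: "ld v q (tpoly t f) = ld v (act t q) f"
  by (simp add: ld_def lev_tpoly act_def mult.assoc)

lemma basic_open_tpoly: "t \<in> torus \<Longrightarrow> q \<in> D \<sigma> (tpoly t b) \<Longrightarrow> act t q \<in> D \<sigma> b"
  by (simp add: basic_open_def eval_tpoly act_chart)

lemma openin_act:
  assumes t: "t \<in> torus" and V: "openin (zariski \<Sigma>) V"
  shows "openin (zariski \<Sigma>) (act t ` V)"
  unfolding openin_zariski_iff
proof (intro conjI ballI)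
  show "act t ` V \<subseteq> X" using act_X[OF t] open_subset[OF V] by auto
  fix p assume "p \<in> act t ` V"
  then have p: "act (torus_inv t) p \<in> V" by (simp add: act_image_iff[OF t])
  obtain b where b: "b \<in> R (fst p)" "eval_at b (act (torus_inv t) p) \<noteq> 0" "D (fst p) b \<subseteq> V"
    using open_nbhd[OF V p] by auto
  show "\<exists>b\<in>R (fst p). eval_at b p \<noteq> 0 \<and> D (fst p) b \<subseteq> act t ` V"
  proof (intro bexI[of _ "tpoly (torus_inv t) b"] conjI subsetI)
    show "eval_at (tpoly (torus_inv t) b) p \<noteq> 0" using b by (simp add: eval_tpoly)
    fix q assume "q \<in> D (fst p) (tpoly (torus_inv t) b)"
    then have "act (torus_inv t) q \<in> V"
      using subsetD[OF b(3) basic_open_tpoly[OF torus_inv_torus[OF t]]] by blast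
    then show "q \<in> act t ` V" by (simp add: act_image_iff[OF t])
  qed (use b tpoly_ring in auto)
qed

lemma translate_apply: "t \<in> torus \<Longrightarrow> q \<in> act t ` V \<Longrightarrow> translate t V f q = f (act (torus_inv t) q)"
  by (simp add: translate_def)

lemma regular_translate:
  assumes t: "t \<in> torus" and V: "openin (zariski \<Sigma>) V" and f: "f \<in> regular \<Sigma> V"
  shows "translate t V f \<in> regular \<Sigma> (act t ` V)"
proof (rule regularI[OF openin_act[OF t V]])
  show "translate t V f \<in> extensional (act t ` V)" by (simp add: translate_def)
  fix p assume "p \<in> act t ` V"
  then have p: "act (torus_inv t) p \<in> V" by (simp add: act_image_iff[OF t])
  obtain a b where "rep V f (act (torus_inv t) p) a b" using regular_rep[OF V f p] .
  then have ab: "a \<in> R (fst p)" "b \<in> R (fst p)" "eval_at b (act (torus_inv t) p) \<noteq> 0" "D (fst p) b \<subseteq> V"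
    "\<And>q. q \<in> D (fst p) b \<Longrightarrow> f q = eval_at a q / eval_at b q" by (auto simp: rep_def)
  have "rep (act t ` V) (translate t V f) p (tpoly (torus_inv t) a) (tpoly (torus_inv t) b)"
    unfolding rep_def
  proof (intro conjI ballI)
    show "eval_at (tpoly (torus_inv t) b) p \<noteq> 0" using ab by (simp add: eval_tpoly)
    have D: "act (torus_inv t) q \<in> D (fst p) b" if "q \<in> D (fst p) (tpoly (torus_inv t) b)" for q
      using basic_open_tpoly[OF torus_inv_torus[OF t] that] .
    show sub: "D (fst p) (tpoly (torus_inv t) b) \<subseteq> act t ` V"
    proof
      fix q assume "q \<in> D (fst p) (tpoly (torus_inv t) b)"
      from subsetD[OF ab(4) D[OF this]] show "q \<in> act t ` V" by (simp add: act_image_iff[OF t])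
    qed
    fix q assume q: "q \<in> D (fst p) (tpoly (torus_inv t) b)"
    then show "translate t V f q = eval_at (tpoly (torus_inv t) a) q / eval_at (tpoly (torus_inv t) b) q"
      using ab(5)[OF D[OF q]] translate_apply[OF t subsetD[OF sub q], of f] by (simp add: eval_tpoly)
  qed (use ab tpoly_ring in auto)
  then show "\<exists>a b. rep (act t ` V) (translate t V f) p a b" by blast
qed

text \<open>Pullback multiplies each monomial by a constant and therefore commutes with the
  derivation of \<open>v\<close>; hence \<open>s\<close> can be moved by \<open>t\<close> without a
  change of its values in N \<otimes> \<complex>.\<close>

lemma logder_translate:
  assumes t: "t \<in> torus" and V: "openin (zariski \<Sigma>) V" and f: "f \<in> regular \<Sigma> V" and q: "q \<in> V" "q \<in> T"
  shows "logder v (translate (torus_inv t) V f) (act (torus_inv t) q) = logder v f q"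
proof -
  note ti = torus_inv_torus[OF t]
  define f' q' where "f' = translate (torus_inv t) V f" and "q' = act (torus_inv t) q"
  obtain a b where ab: "rep V f q a b" using regular_rep[OF V f q(1)] .
  then have b0: "eval_at b q \<noteq> 0" by (simp add: rep_def)
  have tr: "trep f q a b" by (rule rep_trep[OF ab T_X[OF q(2)] q(2) b0])
  have aq: "act t q' = q" by (simp add: q'_def act_inverse[OF t])
  have f': "f' r = f (act t r)" if "act t r \<in> V" for r
    using translate_apply[OF ti, of r V f] that by (simp add: act_image_iff[OF ti] f'_def)
  have "trep f' q' (tpoly t a) (tpoly t b)"
    unfolding trep_def
  proof (intro conjI ballI impI)
    show "q' \<in> T" unfolding q'_def by (rule act_T[OF ti q(2)])
    show "eval_at (tpoly t b) q' \<noteq> 0" by (simp add: eval_tpoly aq b0)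
    fix r assume r: "r \<in> T" "eval_at (tpoly t b) r \<noteq> 0"
    then have r': "act t r \<in> T" "eval_at b (act t r) \<noteq> 0" using act_T[OF t] by (auto simp: eval_tpoly)
    then have "act t r \<in> D (fst q) b" using basic_open_in_T[OF variety_cone[OF T_X[OF q(2)]]] by blast
    then have "act t r \<in> V" using ab by (auto simp: rep_def)
    then show "f' r = eval_at (tpoly t a) r / eval_at (tpoly t b) r"
      using tr r' by (simp add: f' eval_tpoly trep_def)
  qed
  from logder_eq[OF this, of v] logder_eq[OF tr, of v] show ?thesis
    using f'[of q'] q by (simp add: f'_def[symmetric] q'_def[symmetric] ld_tpoly eval_tpoly aq)
qed

subsection \<open>The isomorphism\<close>

lemma T_smooth: "q \<in> T \<Longrightarrow> q \<in> X \<and> smooth (fst q)"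
  using zero_smooth by (auto simp: T_iff smooth_def)

lemma vrep_mono:
  assumes "vrep (logfilt \<Delta>) V s p e b"
  shows "vrep (logfilt {}) V s p e b"
  using assms filtration_module_logfilt_subset by (auto simp: vrep_def)

lemma section_filtered:
  assumes U: "openin (zariski \<Sigma>) U" and s: "s \<in> filtration_sections \<Sigma> (logfilt \<Delta>) U"
  shows "filtered_on (U \<inter> {p \<in> X. smooth (fst p)}) s"
  unfolding filtered_on_def
proof (intro ballI conjI)
  fix p assume p: "p \<in> U \<inter> {p \<in> X. smooth (fst p)}"
  then show "smooth (fst p)" by simp
  from p s obtain e b where "vrep (logfilt \<Delta>) U s p e b"
    using filtration_sections_iff[OF logfilt_family U] by blast
  then show "\<exists>V e b. vrep (logfilt {}) V s p e b" using vrep_mono by blast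
qed

lemma log_vector_vfield:
  assumes s: "filtered_on U s" and W: "W \<in> opens \<Sigma> U" "W \<subseteq> T" and q: "q \<in> W"
  shows "log_vector W (vfield U s) q = s q"
proof (subst vec_eq_iff, rule allI)
  fix i
  have Wo: "openin (zariski \<Sigma>) W" using W by (simp add: opens_def)
  let ?f = "\<lambda>r\<in>W. eval_at (single (axis i 1) 1) r"
  have f: "?f \<in> regular \<Sigma> W"
    using W(2) by (intro regular_eval[OF Wo, of "{0}"]) (auto simp: chart_zero)
  have qT: "q \<in> T" using q W(2) by blast
  have "vfield U s W ?f q = snd q (axis i 1) * cpair (axis i 1) (s q)"
    unfolding vfield_apply(2)[OF s W(1) f q qT] logder_eval[OF Wo q qT] by (simp add: ld_simps)
  also have "cpair (axis i 1) (s q) = s q $ i"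
    by (simp add: cpair_def axis_def if_distrib[of of_int] if_distrib[of "\<lambda>x. x * _"] cong: if_cong)
  finally have eq: "vfield U s W ?f q = snd q (axis i 1) * s q $ i" .
  show "log_vector W (vfield U s) q $ i = s q $ i"
    unfolding log_vector_def vec_lambda_beta eq using T_value_nonzero[OF qT] by simp
qed

lemma vector_field_ext:
  assumes "\<delta> \<in> extensional (opens \<Sigma> U)" "\<delta>' \<in> extensional (opens \<Sigma> U)"
    and "\<And>V. V \<in> opens \<Sigma> U \<Longrightarrow> \<delta> V \<in> extensional (regular \<Sigma> V)"
    and "\<And>V. V \<in> opens \<Sigma> U \<Longrightarrow> \<delta>' V \<in> extensional (regular \<Sigma> V)"
    and "\<And>V f. V \<in> opens \<Sigma> U \<Longrightarrow> f \<in> regular \<Sigma> V \<Longrightarrow> \<delta> V f = \<delta>' V f"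
  shows "\<delta> = \<delta>'"
proof (rule extensionalityI[OF assms(1,2)])
  fix V assume V: "V \<in> opens \<Sigma> U"
  show "\<delta> V = \<delta>' V" by (rule extensionalityI[OF assms(3)[OF V] assms(4)[OF V] assms(5)[OF V]])
qed

lemma vfield_extensional:
  "vfield U s \<in> extensional (opens \<Sigma> U)"
  "V \<in> opens \<Sigma> U \<Longrightarrow> vfield U s V \<in> extensional (regular \<Sigma> V)"
  by (simp_all add: vfield_def)

lemma opens_T:
  assumes "openin (zariski \<Sigma>) U"
  shows "U \<inter> T \<in> opens \<Sigma> (U \<inter> {p \<in> X. smooth (fst p)})"
  using openin_Int[OF assms openin_T] T_smooth by (auto simp: opens_def)

text \<open>The inverse reads the vector of a field on U \<inter> T. Surjectivity is where the two
  sides differ in domain: the field is given only at smooth points of \<open>U\<close>, and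
  \<open>filtered_extension\<close> produces fractions at the others.\<close>

lemma vfield_bij:
  assumes \<Delta>: "\<Delta> \<subseteq> rays \<Sigma>" and U: "openin (zariski \<Sigma>) U"
  shows "bij_betw (vfield (U \<inter> {p \<in> X. smooth (fst p)})) (filtration_sections \<Sigma> (logfilt \<Delta>) U)
    (log_tangent_sections \<Sigma> (\<Union>\<rho>\<in>\<Delta>. toric_divisor \<Sigma> \<rho>) (U \<inter> {p \<in> X. smooth (fst p)}))"
proof -
  define U0 where "U0 = U \<inter> {p \<in> X. smooth (fst p)}"
  let ?Dv = "\<Union>\<rho>\<in>\<Delta>. toric_divisor \<Sigma> \<rho>"
  note UT = opens_T[OF U, folded U0_def]
  define inv_f where "inv_f \<delta> = restrict (log_vector (U \<inter> T) \<delta>) (U \<inter> T)" for \<delta>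
  have "bij_betw (vfield U0) (filtration_sections \<Sigma> (logfilt \<Delta>) U) (log_tangent_sections \<Sigma> ?Dv U0)"
  proof (rule bij_betw_byWitness[where f' = inv_f])
    show "\<forall>s\<in>filtration_sections \<Sigma> (logfilt \<Delta>) U. inv_f (vfield U0 s) = s"
    proof
      fix s assume s: "s \<in> filtration_sections \<Sigma> (logfilt \<Delta>) U"
      show "inv_f (vfield U0 s) = s"
      proof (rule extensionalityI[of _ "U \<inter> T"])
        show "s \<in> extensional (U \<inter> T)" using s by (simp add: filtration_sections_def)
        fix q assume q: "q \<in> U \<inter> T"
        then show "inv_f (vfield U0 s) q = s q"
          using log_vector_vfield[OF section_filtered[OF U s, folded U0_def] UT _ q] by (simp add: inv_f_def)
      qed (simp add: inv_f_def)
    qed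
    have log: "inv_f \<delta> \<in> filtration_sections \<Sigma> (logfilt \<Delta>) U \<and> vfield U0 (inv_f \<delta>) = \<delta>"
      if \<delta>: "\<delta> \<in> log_tangent_sections \<Sigma> ?Dv U0" for \<delta>
    proof -
      have \<delta>t: "\<delta> \<in> tangent_sections \<Sigma> U0" using \<delta> by (simp add: log_tangent_sections_def)
      have on_T: "\<delta> W f q = logder (inv_f \<delta> q) f q"
        if "W \<in> opens \<Sigma> U0" "f \<in> regular \<Sigma> W" "q \<in> W" "q \<in> T" for W f q
      proof -
        have "q \<in> U \<inter> T" using that by (auto simp: opens_def U0_def)
        then show ?thesis
          using tangent_on_torus[OF \<delta>t UT _ that] by (auto simp: U0_def inv_f_def)
      qed
      have "inv_f \<delta> \<in> filtration_sections \<Sigma> (logfilt \<Delta>) U"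
        unfolding filtration_sections_iff[OF logfilt_family U]
      proof (intro conjI ballI)
        show "inv_f \<delta> \<in> extensional (U \<inter> T)" by (simp add: inv_f_def)
        fix p assume p: "p \<in> U"
        show "\<exists>e b. vrep (logfilt \<Delta>) U (inv_f \<delta>) p e b"
          by (rule filtered_extension[OF U p], rule log_field_filtered[OF \<Delta> \<delta> U U0_def]) (use on_T in auto)
      qed
      moreover have "vfield U0 (inv_f \<delta>) = \<delta>"
      proof (rule vector_field_ext[OF vfield_extensional(1) _ vfield_extensional(2)])
        have \<delta>P: "\<delta> \<in> (\<Pi>\<^sub>E V\<in>opens \<Sigma> U0. regular \<Sigma> V \<rightarrow>\<^sub>E regular \<Sigma> V)"
          using \<delta>t by (simp add: tangent_sections_def)
        then show "\<delta> \<in> extensional (opens \<Sigma> U0)" by (simp add: PiE_def)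
        fix V assume V: "V \<in> opens \<Sigma> U0"
        have "\<delta> V \<in> regular \<Sigma> V \<rightarrow>\<^sub>E regular \<Sigma> V" using \<delta>P V by (rule PiE_mem)
        then show "\<delta> V \<in> extensional (regular \<Sigma> V)" by (simp add: PiE_def)
        fix f assume f: "f \<in> regular \<Sigma> V"
        show "vfield U0 (inv_f \<delta>) V f = \<delta> V f"
          by (rule vfield_eqI[OF V f tangent_sectionsD(1)[OF \<delta>t V f] on_T[OF V f]])
      qed
      ultimately show ?thesis ..
    qed
    then show "\<forall>\<delta>\<in>log_tangent_sections \<Sigma> ?Dv U0. vfield U0 (inv_f \<delta>) = \<delta>"
      "inv_f ` log_tangent_sections \<Sigma> ?Dv U0 \<subseteq> filtration_sections \<Sigma> (logfilt \<Delta>) U" by auto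
    show "vfield U0 ` filtration_sections \<Sigma> (logfilt \<Delta>) U \<subseteq> log_tangent_sections \<Sigma> ?Dv U0"
    proof
      fix \<delta> assume "\<delta> \<in> vfield U0 ` filtration_sections \<Sigma> (logfilt \<Delta>) U"
      then obtain s where s: "s \<in> filtration_sections \<Sigma> (logfilt \<Delta>) U" and \<delta>: "\<delta> = vfield U0 s" by blast
      have fil: "filtered_on U0 s" unfolding U0_def by (rule section_filtered[OF U s])
      show "\<delta> \<in> log_tangent_sections \<Sigma> ?Dv U0"
        unfolding log_tangent_sections_def \<delta>
      proof (intro CollectI conjI ballI)
        show "vfield U0 s \<in> tangent_sections \<Sigma> U0" by (rule vfield_tangent[OF fil])
        fix p assume "p \<in> U0"
        then have p: "p \<in> U" "p \<in> X" "smooth (fst p)" by (auto simp: U0_def)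
        obtain e b where eb: "vrep (logfilt \<Delta>) U s p e b"
          using s p(1) filtration_sections_iff[OF logfilt_family U] by blast
        have "U \<inter> chart \<Sigma> (fst p) \<subseteq> U0"
          using smooth_chart[OF variety_cone[OF p(2)] p(3)] by (auto simp: U0_def chart_iff)
        then show "\<exists>W\<in>opens \<Sigma> U0. \<exists>z K d a. snc_coordinates \<Sigma> ?Dv p W z K \<and>
            coordinate_fields \<Sigma> W z d \<and> (\<forall>i. a i \<in> regular \<Sigma> W) \<and>
            (\<forall>V\<in>opens \<Sigma> W. \<forall>f\<in>regular \<Sigma> V. \<forall>q\<in>V.
              vfield U0 s V f q = (\<Sum>i\<in>UNIV. a i q * ((if i \<in> K then z i q else 1) * d i V f q)))"
          by (rule section_log_form[OF \<Delta> p(2,3) fil eb])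
      qed
    qed
  qed
  then show ?thesis by (simp only: U0_def)
qed

text \<open>Each compatibility is an equality of regular functions, hence can be tested on
  \<open>T\<close>, where it follows from the linearity of \<open>logder\<close> in the vector or
  from its invariance under translation.\<close>

lemma vfield_isomorphism:
  assumes \<Delta>: "\<Delta> \<subseteq> rays \<Sigma>"
  shows "equivariant_isomorphism \<Sigma> (filtration_sheaf \<Sigma> (logfilt \<Delta>))
    (log_tangent_sheaf \<Sigma> (\<Union>\<rho>\<in>\<Delta>. toric_divisor \<Sigma> \<rho>)) (\<lambda>U. vfield (U \<inter> {p \<in> X. smooth (fst p)}))"
  unfolding equivariant_isomorphism_def filtration_sheaf_def log_tangent_sheaf_def
    snc_locus_eq[OF \<Delta>] equivariant_sheaf.simps
proof (intro allI impI conjI ballI)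
  fix U assume U: "openin (zariski \<Sigma>) U"
  define X0 where "X0 = {p \<in> X. smooth (fst p)}"
  show "bij_betw (vfield (U \<inter> {p \<in> X. smooth (fst p)})) (filtration_sections \<Sigma> (logfilt \<Delta>) U)
    (log_tangent_sections \<Sigma> (\<Union>\<rho>\<in>\<Delta>. toric_divisor \<Sigma> \<rho>) (U \<inter> {p \<in> X. smooth (fst p)}))"
    by (rule vfield_bij[OF \<Delta> U])
  fix s assume s: "s \<in> filtration_sections \<Sigma> (logfilt \<Delta>) U"
  note fs = section_filtered[OF U s, folded X0_def]
  have in_UT: "q \<in> U \<inter> T" if "V \<in> opens \<Sigma> (U \<inter> X0)" "q \<in> V" "q \<in> T" for V q
    using that by (auto simp: opens_def)
  have op: "openin (zariski \<Sigma>) V" if "V \<in> opens \<Sigma> W" for V W using that by (simp add: opens_def)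
  show "vfield (U \<inter> X0) (\<lambda>p\<in>U \<inter> T. s p + s' p) = (\<lambda>V\<in>opens \<Sigma> (U \<inter> X0). \<lambda>f\<in>regular \<Sigma> V. \<lambda>p\<in>V.
      vfield (U \<inter> X0) s V f p + vfield (U \<inter> X0) s' V f p)"
    if s': "s' \<in> filtration_sections \<Sigma> (logfilt \<Delta>) U" for s'
  proof (rule vector_field_ext[OF vfield_extensional(1) _ vfield_extensional(2)])
    note fs' = section_filtered[OF U s', folded X0_def]
    fix V f assume V: "V \<in> opens \<Sigma> (U \<inter> X0)" and f: "f \<in> regular \<Sigma> V"
    have "vfield (U \<inter> X0) (\<lambda>p\<in>U \<inter> T. s p + s' p) V f = (\<lambda>p\<in>V. vfield (U \<inter> X0) s V f p + vfield (U \<inter> X0) s' V f p)"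
      by (rule vfield_eqI[OF V f regular_add[OF op[OF V] vfield_apply(1)[OF fs V f] vfield_apply(1)[OF fs' V f]]])
        (use in_UT[OF V] in \<open>auto simp: vfield_apply(2)[OF fs V f] vfield_apply(2)[OF fs' V f] logder_linear(2)[OF op[OF V] f]\<close>)
    then show "vfield (U \<inter> X0) (\<lambda>p\<in>U \<inter> T. s p + s' p) V f
        = (\<lambda>V\<in>opens \<Sigma> (U \<inter> X0). \<lambda>f\<in>regular \<Sigma> V. \<lambda>p\<in>V. vfield (U \<inter> X0) s V f p + vfield (U \<inter> X0) s' V f p) V f"
      using V f by simp
  qed simp_all
  show "vfield (U \<inter> X0) (\<lambda>p\<in>U \<inter> T. h p *s s p) = (\<lambda>V\<in>opens \<Sigma> (U \<inter> X0). \<lambda>f\<in>regular \<Sigma> V. \<lambda>p\<in>V.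
      h p * vfield (U \<inter> X0) s V f p)"
    if h: "h \<in> regular \<Sigma> U" for h
  proof (rule vector_field_ext[OF vfield_extensional(1) _ vfield_extensional(2)])
    fix V f assume V: "V \<in> opens \<Sigma> (U \<inter> X0)" and f: "f \<in> regular \<Sigma> V"
    have "V \<subseteq> U" using V by (auto simp: opens_def)
    then have hV: "restrict h V \<in> regular \<Sigma> V" by (rule regular_restrict[OF U op[OF V] _ h])
    have "vfield (U \<inter> X0) (\<lambda>p\<in>U \<inter> T. h p *s s p) V f = (\<lambda>p\<in>V. restrict h V p * vfield (U \<inter> X0) s V f p)"
      by (rule vfield_eqI[OF V f regular_mult[OF op[OF V] hV vfield_apply(1)[OF fs V f]]])
        (use in_UT[OF V] in \<open>auto simp: vfield_apply(2)[OF fs V f] logder_linear(3)[OF op[OF V] f]\<close>)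
    also have "\<dots> = (\<lambda>p\<in>V. h p * vfield (U \<inter> X0) s V f p)" by (intro restrict_ext) simp
    finally show "vfield (U \<inter> X0) (\<lambda>p\<in>U \<inter> T. h p *s s p) V f
        = (\<lambda>V\<in>opens \<Sigma> (U \<inter> X0). \<lambda>f\<in>regular \<Sigma> V. \<lambda>p\<in>V. h p * vfield (U \<inter> X0) s V f p) V f"
      using V f by simp
  qed simp_all
  show "vfield (V \<inter> X0) (restrict s (V \<inter> T)) = restrict (vfield (U \<inter> X0) s) (opens \<Sigma> (V \<inter> X0))"
    if V: "V \<in> opens \<Sigma> U" for V
  proof (rule vector_field_ext[OF vfield_extensional(1) _ vfield_extensional(2)])
    have sub: "W \<in> opens \<Sigma> (U \<inter> X0)" if "W \<in> opens \<Sigma> (V \<inter> X0)" for W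
      using that V by (auto simp: opens_def)
    show "restrict (vfield (U \<inter> X0) s) (opens \<Sigma> (V \<inter> X0)) W \<in> extensional (regular \<Sigma> W)"
      if "W \<in> opens \<Sigma> (V \<inter> X0)" for W
      using vfield_extensional(2)[OF sub[OF that]] that by simp
    fix W f assume W: "W \<in> opens \<Sigma> (V \<inter> X0)" and f: "f \<in> regular \<Sigma> W"
    have "vfield (V \<inter> X0) (restrict s (V \<inter> T)) W f = vfield (U \<inter> X0) s W f"
      by (rule vfield_eqI[OF W f vfield_apply(1)[OF fs sub[OF W] f]])
        (use W in \<open>auto simp: vfield_apply(2)[OF fs sub[OF W] f] opens_def\<close>)
    then show "vfield (V \<inter> X0) (restrict s (V \<inter> T)) W f = restrict (vfield (U \<inter> X0) s) (opens \<Sigma> (V \<inter> X0)) W f"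
      using W by simp
  qed simp_all
  show "vfield (act t ` U \<inter> X0) (translate t (U \<inter> T) s) = (\<lambda>V\<in>opens \<Sigma> (act t ` U \<inter> X0). \<lambda>f\<in>regular \<Sigma> V.
      let V' = act (torus_inv t) ` V
      in translate t V' (vfield (U \<inter> X0) s V' (translate (torus_inv t) V f)))"
    if t: "t \<in> torus" for t
  proof (rule vector_field_ext[OF vfield_extensional(1) _ vfield_extensional(2)])
    fix V f assume V: "V \<in> opens \<Sigma> (act t ` U \<inter> X0)" and f: "f \<in> regular \<Sigma> V"
    note ti = torus_inv_torus[OF t]
    \<comment> \<open>The derivation acts over the translate by t^(-1): a function is moved there,
      differentiated and moved back.\<close>
    define V' where "V' = act (torus_inv t) ` V"
    have V'o: "openin (zariski \<Sigma>) V'" unfolding V'_def by (rule openin_act[OF ti op[OF V]])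
    have mem: "act (torus_inv t) q \<in> U \<inter> X0" if "q \<in> V" for q
    proof -
      have "q \<in> act t ` U" "q \<in> X0" using that V by (auto simp: opens_def)
      then show ?thesis using act_X[OF ti] by (auto simp: act_image_iff[OF t] X0_def)
    qed
    then have V': "V' \<in> opens \<Sigma> (U \<inter> X0)" using V'o by (auto simp: V'_def opens_def)
    define f' where "f' = translate (torus_inv t) V f"
    have f': "f' \<in> regular \<Sigma> V'" unfolding f'_def V'_def by (rule regular_translate[OF ti op[OF V] f])
    have VV': "act t ` V' = V" unfolding V'_def by (rule act_inv_image[OF t])
    have g: "translate t V' (vfield (U \<inter> X0) s V' f') \<in> regular \<Sigma> V"
      using regular_translate[OF t V'o vfield_apply(1)[OF fs V' f']] by (simp only: VV')
    have "vfield (act t ` U \<inter> X0) (translate t (U \<inter> T) s) V f = translate t V' (vfield (U \<inter> X0) s V' f')"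
    proof (rule vfield_eqI[OF V f g])
      fix q assume q: "q \<in> V" "q \<in> T"
      have q': "act (torus_inv t) q \<in> V'" "act (torus_inv t) q \<in> T"
        using q act_T[OF ti] by (auto simp: V'_def)
      have "translate t V' (vfield (U \<inter> X0) s V' f') q = vfield (U \<inter> X0) s V' f' (act (torus_inv t) q)"
        using q by (intro translate_apply[OF t]) (simp add: VV')
      also have "\<dots> = logder (s (act (torus_inv t) q)) f' (act (torus_inv t) q)"
        by (rule vfield_apply(2)[OF fs V' f' q'])
      also have "\<dots> = logder (s (act (torus_inv t) q)) f q"
        unfolding f'_def by (rule logder_translate[OF t op[OF V] f q])
      also have "s (act (torus_inv t) q) = translate t (U \<inter> T) s q"
        using mem[OF q(1)] q'(2) by (intro translate_apply[OF t, symmetric]) (simp add: act_image_iff[OF t])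
      finally show "translate t V' (vfield (U \<inter> X0) s V' f') q = logder (translate t (U \<inter> T) s q) f q" .
    qed
    then show "vfield (act t ` U \<inter> X0) (translate t (U \<inter> T) s) V f =
       (\<lambda>V\<in>opens \<Sigma> (act t ` U \<inter> X0). \<lambda>f\<in>regular \<Sigma> V.
        let V' = act (torus_inv t) ` V in translate t V' (vfield (U \<inter> X0) s V' (translate (torus_inv t) V f))) V f"
      using V f by (simp add: V'_def f'_def)
  qed simp_all
qed

end

theorem theorem1p1:
  fixes \<Sigma> \<Delta> :: "(real^'n) set set"
  assumes "fan \<Sigma>" and "\<Delta> \<subseteq> rays \<Sigma>"
  shows "is_family_of_filtrations_of \<Sigma>
     (\<lambda>\<rho> j::int.
        if \<rho> \<in> \<Delta> then
          (if j \<le> -1 then {0} else UNIV)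
        else
          (if j \<le> -2 then {0}
           else if j = -1 then vec.span {complex_vec (ray_generator \<rho>)}
           else (UNIV :: (complex^'n) set)))
     (log_tangent_sheaf \<Sigma> (\<Union>\<rho>\<in>\<Delta>. toric_divisor \<Sigma> \<rho>))"
proof -
  interpret toric \<Sigma> by unfold_locales (fact assms(1))
  show ?thesis
    unfolding is_family_of_filtrations_of_def logfilt_def[symmetric]
    using logfilt_family vfield_isomorphism[OF assms(2)] by blast
qed

end
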